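(* Let $M$ be a smooth manifold and $\kappa\in\Omega^3(M)$ a closed 3-form. Let $\psi_\kappa:(T^*[2]T[1]M,Q_\kappa)\to(T^*[2]T[1]M,Q)$ be the $NQ$-morphism corresponding to the $N$-morphism $s\circ\omega^\flat_{T^*[1]M}\circ L:T^*[2]T[1]M\to T^*[1]M$ (see context). Then $\psi_\kappa$ is given by translation along the fibres of $q:T^*[2]T[1]M\to T[1]M$ by the degree-2 1-form $$\tfrac12\,\iota_{Q_{dR}}\iota_{Q_{dR}}q_M^*\kappa\in\Omega^1(T[1]M),$$ where $q_M:T[1]M\to M$ is the projection and $Q_{dR}$ is the de Rham vector field on $T[1]M$. In particular, $\psi_\kappa$ is a diffeomorphism.
   Context: An $N$-manifold is a supermanifold with an action of the multiplicative semigroup $\mathbb{R}$ such that $-1$ acts as the parity operator (so functions are non-negatively graded, with parity equal to degree mod 2). An $NQ$-manifold is an $N$-manifold with a homological vector field $Q$ of degree 1 (equivalently, a supermanifold with an action of the super-semigroup $\underline{\operatorname{End}}(\mathbb{R}^{0|1})$ such that $\theta\mapsto-\theta$ acts by parity). $N$-morphisms preserve degrees; $NQ$-morphisms also intertwine the homological vector fields. Let $x^a$ be local coordinates on $M$, $\xi^a=dx^a$ the degree 1 coordinates on $T[1]M$ (so $C^\infty(T[1]M)=\Omega^\bullet(M)$ and $Q_{dR}=d=\xi^a\partial_{x^a}$), and $p_a$ (degree 2), $\eta_a$ (degree 1) the momenta on $T^*[2]T[1]M$ conjugate to $x^a,\xi^a$. On $T^*[2]T[1]M$ let $\omega=dp_a\,dx^a+d\eta_a\,d\xi^a$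 be the canonical symplectic form, $Q=\xi^a\partial_{x^a}+p_a\partial_{\eta_a}$, with Poisson bracket $\{p_a,x^b\}=\delta^b_a$, $\{\eta_a,\xi^b\}=\delta_a^b$ (other brackets of coordinates zero). A closed 3-form $\kappa$ on $M$ is viewed as a degree 3 function on $T[1]M$, and $Q_\kappa:=Q+\{q^*\kappa,\cdot\}$; the triple $(T^*[2]T[1]M,Q_\kappa,\omega)$ is the exact Courant algebroid with background 3-form $\kappa$, and $\kappa=0$ gives the standard Courant algebroid. $L:T^*[2]T[1]M\to T^*[2]T^*[1]M$ is the Legendre transform, $\omega^\flat_{T^*[1]M}:T^*[2]T^*[1]M\to T[1]T^*[1]M$ is the diffeomorphism defined by the canonical symplectic structure on $T^*[1]M$, and $s:T[1]T^*[1]M\to T^*[1]M$ is the canonical projection. The composition $\omega^\flat_{T^*[1]M}\circ L$ is an isomorphism of $NQ$-manifolds from $(T^*[2]T[1]M,Q)$ to $T[1]T^*[1]M$ with its de Rham vector field. In coordinates $(x^a,\eta_a)$ on $T^*[1]M$, it is $(x,\xi,p,\eta)\mapsto(x,\eta,dx=\xi,d\eta=p)$, and $s\circ\omega^\flat_{T^*[1]M}\circ L$ is $(x,\xi,p,\eta)\mapsto(x,\eta)$. For an $NQ$-manifold $X$ and an $N$-manifold $Z$, composing with the projection $T[1]Z\to Z$ is a bijection between $NQ$-morphisms $X\to T[1]Z$ and $N$-morphisms $X\to Z$; the inverse sends $f$ to $T[1]f\circ Q_X$, where $Q_X:X\to T[1]X$ is the section given by the homological vector field. Thus $\psi_\kappa$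 is the unique $NQ$-morphism $(T^*[2]T[1]M,Q_\kappa)\to(T^*[2]T[1]M,Q)$ with $s\circ\omega^\flat_{T^*[1]M}\circ L\circ\psi_\kappa=s\circ\omega^\flat_{T^*[1]M}\circ L$. A degree-2 1-form on $T[1]M$ is a degree-preserving section of $q:T^*[2]T[1]M\to T[1]M$; translation by it is fibrewise addition. Here $\iota_{Q_{dR}}$ is contraction with the vector field $Q_{dR}$; e.g. for $\kappa=\kappa_{abc}\,dx^adx^bdx^c$ with $\kappa_{abc}$ totally antisymmetric, $\tfrac12\iota_{Q_{dR}}\iota_{Q_{dR}}q_M^*\kappa=3\kappa_{abc}\,\xi^b\xi^c\,dx^a$. *)

theory Defs
  imports "HOL-Analysis.Analysis"
begin

section \<open>Local graded functions\<close>

text \<open>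
  A graded domain has coordinates \<open>z_0, ..., z_{N-1}\<close>; \<open>z_0, ..., z_{n-1}\<close> have degree 0 and
  range over an open subset of \<^const>\<open>Euclidean_space\<close> \<open>n\<close>, the others have positive degree
  \<open>w i\<close>. A function is a sum \<open>\<Sum>\<mu>. f \<mu>(x) z^\<mu>\<close>, where \<open>f \<mu>\<close> is smooth and
  \<open>z^\<mu>\<close> is the monomial with exponents \<open>\<mu>\<close>, written with increasing indices.
  Coordinates of odd degree anticommute.
\<close>

type_synonym lfun = "(nat \<Rightarrow> nat) \<Rightarrow> (nat \<Rightarrow> real) \<Rightarrow> real"

definition pdiff :: "nat \<Rightarrow> ((nat \<Rightarrow> real) \<Rightarrow> real) \<Rightarrow> (nat \<Rightarrow> real) \<Rightarrow> real" where
  "pdiff i h = (\<lambda>v. deriv (\<lambda>t. h (v(i := t))) (v i))"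

definition smooth_fun :: "nat \<Rightarrow> (nat \<Rightarrow> real) set \<Rightarrow> ((nat \<Rightarrow> real) \<Rightarrow> real) \<Rightarrow> bool" where
  "smooth_fun n V h \<longleftrightarrow>
     (\<forall>is. set is \<subseteq> {..<n} \<longrightarrow>
        continuous_map (subtopology (Euclidean_space n) V) euclideanreal (foldr pdiff is h) \<and>
        (\<forall>v\<in>V. \<forall>i<n. (\<lambda>t. foldr pdiff is h (v(i := t))) differentiable (at (v i))))"

definition mono_ok :: "nat \<Rightarrow> nat \<Rightarrow> (nat \<Rightarrow> nat) \<Rightarrow> (nat \<Rightarrow> nat) \<Rightarrow> bool" where
  "mono_ok n N w \<mu> \<longleftrightarrow>
     (\<forall>i. \<mu> i \<noteq> 0 \<longrightarrow> n \<le> i \<and> i < N) \<and> (\<forall>i. odd (w i) \<longrightarrow> \<mu> i \<le> 1)"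

definition mono_deg :: "nat \<Rightarrow> (nat \<Rightarrow> nat) \<Rightarrow> (nat \<Rightarrow> nat) \<Rightarrow> nat" where
  "mono_deg N w \<mu> = (\<Sum>i<N. w i * \<mu> i)"

text \<open>Coefficients are extended by 0 outside the domain \<open>V\<close>.\<close>

definition local_funs :: "nat \<Rightarrow> nat \<Rightarrow> (nat \<Rightarrow> nat) \<Rightarrow> (nat \<Rightarrow> real) set \<Rightarrow> lfun set" where
  "local_funs n N w V =
     {f. (\<forall>\<mu> v. f \<mu> v \<noteq> 0 \<longrightarrow> mono_ok n N w \<mu> \<and> v \<in> V) \<and> (\<forall>\<mu>. smooth_fun n V (f \<mu>))}"

definition lrestrict :: "(nat \<Rightarrow> real) set \<Rightarrow> lfun \<Rightarrow> lfun" where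
  "lrestrict V f = (\<lambda>\<mu> v. if v \<in> V then f \<mu> v else 0)"

definition lvar :: "nat \<Rightarrow> nat \<Rightarrow> lfun" where
  "lvar n i = (\<lambda>\<mu> v. if i < n then (if \<mu> = (\<lambda>_. 0) then v i else 0)
                     else (if \<mu> = (\<lambda>_. 0)(i := 1) then 1 else 0))"

definition lone :: lfun where
  "lone = (\<lambda>\<mu> v. if \<mu> = (\<lambda>_. 0) then 1 else 0)"

definition ladd :: "lfun \<Rightarrow> lfun \<Rightarrow> lfun" where
  "ladd f g = (\<lambda>\<mu> v. f \<mu> v + g \<mu> v)"

definition lsum :: "(nat \<Rightarrow> lfun) \<Rightarrow> nat set \<Rightarrow> lfun" where
  "lsum F J = (\<lambda>\<mu> v. \<Sum>j\<in>J. F j \<mu> v)"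

text \<open>\<open>z^\<alpha> z^\<beta> = mono_sign w \<alpha> \<beta> z^(\<alpha>+\<beta>)\<close>, unless an odd coordinate is repeated.\<close>

definition mono_sign :: "(nat \<Rightarrow> nat) \<Rightarrow> (nat \<Rightarrow> nat) \<Rightarrow> (nat \<Rightarrow> nat) \<Rightarrow> real" where
  "mono_sign w \<alpha> \<beta> =
     (- 1) ^ card {(i, j). j < i \<and> odd (w i) \<and> odd (w j) \<and> \<alpha> i \<noteq> 0 \<and> \<beta> j \<noteq> 0}"

definition lmult :: "(nat \<Rightarrow> nat) \<Rightarrow> lfun \<Rightarrow> lfun \<Rightarrow> lfun" where
  "lmult w f g = (\<lambda>\<mu> v.
     if \<forall>i. odd (w i) \<longrightarrow> \<mu> i \<le> 1
     then \<Sum>\<alpha> | \<forall>i. \<alpha> i \<le> \<mu> i.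
            mono_sign w \<alpha> (\<lambda>i. \<mu> i - \<alpha> i) * f \<alpha> v * g (\<lambda>i. \<mu> i - \<alpha> i) v
     else 0)"

text \<open>Left and right partial derivatives: an odd \<open>z_i\<close> is first moved to the far left,
  respectively to the far right, of each monomial.\<close>

definition lpartial :: "nat \<Rightarrow> (nat \<Rightarrow> nat) \<Rightarrow> nat \<Rightarrow> lfun \<Rightarrow> lfun" where
  "lpartial n w i f =
     (if i < n then (\<lambda>\<mu>. pdiff i (f \<mu>))
      else (\<lambda>\<mu> v. (if odd (w i) then (- 1) ^ card {j. j < i \<and> odd (w j) \<and> \<mu> j \<noteq> 0} else 1) *
                   real (\<mu> i + 1) * f (\<mu>(i := \<mu> i + 1)) v))"

definition rpartial :: "nat \<Rightarrow> (nat \<Rightarrow> nat) \<Rightarrow> nat \<Rightarrow> lfun \<Rightarrow> lfun" where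
  "rpartial n w i f =
     (if i < n then (\<lambda>\<mu>. pdiff i (f \<mu>))
      else (\<lambda>\<mu> v. (if odd (w i) then (- 1) ^ card {j. i < j \<and> odd (w j) \<and> \<mu> j \<noteq> 0} else 1) *
                   real (\<mu> i + 1) * f (\<mu>(i := \<mu> i + 1)) v))"

text \<open>Substitution of \<open>y_i\<close> for the coordinates \<open>z_i\<close> of the target, which has \<open>N\<close> coordinates,
  \<open>n\<close> of them of degree 0; \<open>w\<close> are the degrees on the source. Degrees are preserved, so
  \<open>y_0, ..., y_{n-1}\<close> have degree 0 and give an ordinary map between the bases, with which the
  coefficients are composed.\<close>

definition base_subst :: "nat \<Rightarrow> (nat \<Rightarrow> lfun) \<Rightarrow> (nat \<Rightarrow> real) \<Rightarrow> (nat \<Rightarrow> real)" where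
  "base_subst n y v = (\<lambda>i. if i < n then y i (\<lambda>_. 0) v else 0)"

definition mono_subst :: "(nat \<Rightarrow> nat) \<Rightarrow> nat \<Rightarrow> nat \<Rightarrow> (nat \<Rightarrow> lfun) \<Rightarrow> (nat \<Rightarrow> nat) \<Rightarrow> lfun" where
  "mono_subst w n N y \<nu> = foldr (\<lambda>i. (lmult w (y i)) ^^ (\<nu> i)) [n..<N] lone"

definition lsubst :: "(nat \<Rightarrow> nat) \<Rightarrow> nat \<Rightarrow> nat \<Rightarrow> (nat \<Rightarrow> lfun) \<Rightarrow> lfun \<Rightarrow> lfun" where
  "lsubst w n N y f = (\<lambda>\<mu> v.
     \<Sum>\<nu> | f \<nu> (base_subst n y v) \<noteq> 0. f \<nu> (base_subst n y v) * mono_subst w n N y \<nu> \<mu> v)"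


section \<open>N-manifolds and their morphisms\<close>

text \<open>
  An N-manifold is presented as a space with a sheaf of non-negatively graded algebras (parity is
  degree mod 2), glued from graded domains: \<open>trans c d i\<close> is the \<open>i\<close>-th coordinate of the
  chart \<open>d\<close> expressed in the coordinates of the chart \<open>c\<close>. The action of a real number \<open>t\<close>
  multiplies functions of degree \<open>k\<close> by \<open>t^k\<close>.
\<close>

record ('m, 'c) nmfd =
  space_of :: "'m topology"
  bdim :: nat
  ncoord :: nat
  wt :: "nat \<Rightarrow> nat"
  charts :: "'c set"
  cdom :: "'c \<Rightarrow> 'm set"
  cmap :: "'c \<Rightarrow> 'm \<Rightarrow> nat \<Rightarrow> real"
  trans :: "'c \<Rightarrow> 'c \<Rightarrow> nat \<Rightarrow> lfun"

definition cimage :: "('m, 'c) nmfd \<Rightarrow> 'c \<Rightarrow> 'm set \<Rightarrow> (nat \<Rightarrow> real) set" where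
  "cimage X c W = cmap X c ` (cdom X c \<inter> W)"

text \<open>A function on an open set \<open>W\<close> is the family of its coordinate expressions.\<close>

type_synonym 'c sec = "'c \<Rightarrow> lfun"

definition sections :: "('m, 'c) nmfd \<Rightarrow> 'm set \<Rightarrow> 'c sec set" where
  "sections X W = {f.
     (\<forall>c. c \<notin> charts X \<longrightarrow> f c = (\<lambda>_ _. 0)) \<and>
     (\<forall>c\<in>charts X. f c \<in> local_funs (bdim X) (ncoord X) (wt X) (cimage X c W)) \<and>
     (\<forall>c\<in>charts X. \<forall>d\<in>charts X. \<forall>\<mu>. \<forall>v\<in>cimage X c (cdom X d \<inter> W).
        f c \<mu> v = lsubst (wt X) (bdim X) (ncoord X) (trans X c d) (f d) \<mu> v) \<and>
     (\<exists>K. \<forall>c \<mu> v. f c \<mu> v \<noteq> 0 \<longrightarrow> mono_deg (ncoord X) (wt X) \<mu> \<le> K)}"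

definition homogeneous :: "('m, 'c) nmfd \<Rightarrow> nat \<Rightarrow> 'c sec \<Rightarrow> bool" where
  "homogeneous X k f \<longleftrightarrow> (\<forall>c \<mu> v. f c \<mu> v \<noteq> 0 \<longrightarrow> mono_deg (ncoord X) (wt X) \<mu> = k)"

definition sec_one :: "('m, 'c) nmfd \<Rightarrow> 'm set \<Rightarrow> 'c sec" where
  "sec_one X W = (\<lambda>c. if c \<in> charts X then lrestrict (cimage X c W) lone else (\<lambda>_ _. 0))"

definition sec_add :: "'c sec \<Rightarrow> 'c sec \<Rightarrow> 'c sec" where
  "sec_add f g = (\<lambda>c. ladd (f c) (g c))"

definition sec_scale :: "real \<Rightarrow> 'c sec \<Rightarrow> 'c sec" where
  "sec_scale r f = (\<lambda>c \<mu> v. r * f c \<mu> v)"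

definition sec_mult :: "('m, 'c) nmfd \<Rightarrow> 'c sec \<Rightarrow> 'c sec \<Rightarrow> 'c sec" where
  "sec_mult X f g = (\<lambda>c. lmult (wt X) (f c) (g c))"

definition sec_restrict :: "('m, 'c) nmfd \<Rightarrow> 'm set \<Rightarrow> 'c sec \<Rightarrow> 'c sec" where
  "sec_restrict X W f = (\<lambda>c. lrestrict (cimage X c W) (f c))"

record ('m, 'c, 'k, 'd) nmor =
  base :: "'m \<Rightarrow> 'k"
  pull :: "'k set \<Rightarrow> 'd sec \<Rightarrow> 'c sec"

definition preim :: "('m, 'c) nmfd \<Rightarrow> ('m, 'c, 'k, 'd) nmor \<Rightarrow> 'k set \<Rightarrow> 'm set" where
  "preim X \<psi> W = {m \<in> topspace (space_of X). base \<psi> m \<in> W}"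

text \<open>Morphisms of locally ringed spaces that preserve degrees. The last condition is locality:
  the value of the pullback of \<open>f\<close> at \<open>m\<close> is the value of \<open>f\<close> at the image of \<open>m\<close>.\<close>

definition n_morphism ::
  "('m, 'c) nmfd \<Rightarrow> ('k, 'd) nmfd \<Rightarrow> ('m, 'c, 'k, 'd) nmor \<Rightarrow> bool" where
  "n_morphism X Y \<psi> \<longleftrightarrow>
     continuous_map (space_of X) (space_of Y) (base \<psi>) \<and>
     (\<forall>W. openin (space_of Y) W \<longrightarrow>
        (\<forall>f\<in>sections Y W. pull \<psi> W f \<in> sections X (preim X \<psi> W)) \<and>
        pull \<psi> W (sec_one Y W) = sec_one X (preim X \<psi> W) \<and>
        (\<forall>f\<in>sections Y W. \<forall>g\<in>sections Y W.
           pull \<psi> W (sec_add f g) = sec_add (pull \<psi> W f) (pull \<psi> W g) \<and>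
           pull \<psi> W (sec_mult Y f g) = sec_mult X (pull \<psi> W f) (pull \<psi> W g)) \<and>
        (\<forall>r. \<forall>f\<in>sections Y W. pull \<psi> W (sec_scale r f) = sec_scale r (pull \<psi> W f)) \<and>
        (\<forall>k. \<forall>f\<in>sections Y W. homogeneous Y k f \<longrightarrow> homogeneous X k (pull \<psi> W f)) \<and>
        (\<forall>W'. openin (space_of Y) W' \<and> W' \<subseteq> W \<longrightarrow>
           (\<forall>f\<in>sections Y W.
              pull \<psi> W' (sec_restrict Y W' f) = sec_restrict X (preim X \<psi> W') (pull \<psi> W f))) \<and>
        (\<forall>f\<in>sections Y W. \<forall>m\<in>preim X \<psi> W. \<forall>c\<in>charts X. \<forall>d\<in>charts Y.
           m \<in> cdom X c \<and> base \<psi> m \<in> cdom Y d \<longrightarrow>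
           pull \<psi> W f c (\<lambda>_. 0) (cmap X c m) = f d (\<lambda>_. 0) (cmap Y d (base \<psi> m))))"

definition mor_eq ::
  "('m, 'c) nmfd \<Rightarrow> ('k, 'd) nmfd \<Rightarrow> ('m, 'c, 'k, 'd) nmor \<Rightarrow> ('m, 'c, 'k, 'd) nmor \<Rightarrow> bool" where
  "mor_eq X Y \<psi> \<phi> \<longleftrightarrow>
     (\<forall>m\<in>topspace (space_of X). base \<psi> m = base \<phi> m) \<and>
     (\<forall>W. openin (space_of Y) W \<longrightarrow> (\<forall>f\<in>sections Y W. pull \<psi> W f = pull \<phi> W f))"

definition mor_id :: "('m, 'c, 'm, 'c) nmor" where
  "mor_id = \<lparr>base = (\<lambda>m. m), pull = (\<lambda>W f. f)\<rparr>"

text \<open>The composition \<open>\<phi> \<circ> \<psi>\<close> through \<open>Y\<close>.\<close>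

definition mor_comp ::
  "('k, 'd) nmfd \<Rightarrow> ('k, 'd, 'l, 'e) nmor \<Rightarrow> ('m, 'c, 'k, 'd) nmor \<Rightarrow> ('m, 'c, 'l, 'e) nmor" where
  "mor_comp Y \<phi> \<psi> =
     \<lparr>base = base \<phi> \<circ> base \<psi>, pull = (\<lambda>W f. pull \<psi> (preim Y \<phi> W) (pull \<phi> W f))\<rparr>"

definition n_diffeomorphism ::
  "('m, 'c) nmfd \<Rightarrow> ('k, 'd) nmfd \<Rightarrow> ('m, 'c, 'k, 'd) nmor \<Rightarrow> bool" where
  "n_diffeomorphism X Y \<psi> \<longleftrightarrow> n_morphism X Y \<psi> \<and>
     (\<exists>\<phi>. n_morphism Y X \<phi> \<and> mor_eq X X (mor_comp Y \<phi> \<psi>) mor_id \<and>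
          mor_eq Y Y (mor_comp X \<psi> \<phi>) mor_id)"

text \<open>For two N-manifolds over the same base with the same base charts: the map over the identity
  that pulls the \<open>i\<close>-th coordinate of \<open>Y\<close> in the chart \<open>c\<close> back to \<open>y c i\<close>.\<close>

definition coord_morphism ::
  "('m, 'c) nmfd \<Rightarrow> ('m, 'c) nmfd \<Rightarrow> ('c \<Rightarrow> nat \<Rightarrow> lfun) \<Rightarrow> ('m, 'c, 'm, 'c) nmor" where
  "coord_morphism X Y y =
     \<lparr>base = (\<lambda>m. m),
      pull = (\<lambda>W f c. if c \<in> charts X
                      then lrestrict (cimage X c W) (lsubst (wt X) (bdim Y) (ncoord Y) (y c) (f c))
                      else (\<lambda>_ _. 0))\<rparr>"


section \<open>Vector fields and NQ-morphisms\<close>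

text \<open>\<open>vf_apply X v W f\<close> is \<open>\<Sum>j. v^j \<partial>f/\<partial>z_j\<close> on \<open>W\<close>.\<close>

definition vf_apply ::
  "('m, 'c) nmfd \<Rightarrow> ('c \<Rightarrow> nat \<Rightarrow> lfun) \<Rightarrow> 'm set \<Rightarrow> 'c sec \<Rightarrow> 'c sec" where
  "vf_apply X v W f =
     (\<lambda>c. if c \<in> charts X
          then lrestrict (cimage X c W)
                 (lsum (\<lambda>j. lmult (wt X) (v c j) (lpartial (bdim X) (wt X) j (f c))) {..<ncoord X})
          else (\<lambda>_ _. 0))"

definition nq_morphism ::
  "('m, 'c) nmfd \<Rightarrow> ('m set \<Rightarrow> 'c sec \<Rightarrow> 'c sec) \<Rightarrow>
   ('k, 'd) nmfd \<Rightarrow> ('k set \<Rightarrow> 'd sec \<Rightarrow> 'd sec) \<Rightarrow> ('m, 'c, 'k, 'd) nmor \<Rightarrow> bool" where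
  "nq_morphism X Q\<^sub>X Y Q\<^sub>Y \<psi> \<longleftrightarrow> n_morphism X Y \<psi> \<and>
     (\<forall>W. openin (space_of Y) W \<longrightarrow>
        (\<forall>f\<in>sections Y W. pull \<psi> W (Q\<^sub>Y W f) = Q\<^sub>X (preim X \<psi> W) (pull \<psi> W f)))"


section \<open>Shifted tangent and cotangent bundles\<close>

text \<open>If \<open>X\<close> has \<open>N\<close> coordinates, the coordinate \<open>N + i\<close> is \<open>dz_i\<close> on \<open>T[1]X\<close> and the
  momentum \<open>p_i\<close> conjugate to \<open>z_i\<close> on \<open>T^*[k]X\<close>. In both cases the coordinates of \<open>X\<close> keep
  their index, so pulling functions back from \<open>X\<close> does not change their expression.\<close>

definition T1_wt :: "('m, 'c) nmfd \<Rightarrow> nat \<Rightarrow> nat" where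
  "T1_wt X = (\<lambda>i. if i < ncoord X then wt X i else wt X (i - ncoord X) + 1)"

text \<open>\<open>df = \<Sum>j. dz_j \<partial>f/\<partial>z_j\<close>\<close>

definition ldiff :: "('m, 'c) nmfd \<Rightarrow> lfun \<Rightarrow> lfun" where
  "ldiff X f =
     lsum (\<lambda>j. lmult (T1_wt X) (lvar (bdim X) (ncoord X + j)) (lpartial (bdim X) (wt X) j f))
       {..<ncoord X}"

definition T1 :: "('m, 'c) nmfd \<Rightarrow> ('m, 'c) nmfd" where
  "T1 X = X\<lparr>ncoord := 2 * ncoord X, wt := T1_wt X,
     trans := (\<lambda>c d i. if i < ncoord X then trans X c d i
                       else ldiff X (trans X c d (i - ncoord X)))\<rparr>"

definition Tstar_wt :: "nat \<Rightarrow> ('m, 'c) nmfd \<Rightarrow> nat \<Rightarrow> nat" where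
  "Tstar_wt k X = (\<lambda>i. if i < ncoord X then wt X i else k - wt X (i - ncoord X))"

text \<open>Momenta transform like \<open>\<partial>/\<partial>z'_i = \<Sum>j. (\<partial>z_j/\<partial>z'_i) \<partial>/\<partial>z_j\<close>. This needs
  all degrees on \<open>X\<close> to be smaller than \<open>k\<close>.\<close>

definition Tstar :: "nat \<Rightarrow> ('m, 'c) nmfd \<Rightarrow> ('m, 'c) nmfd" where
  "Tstar k X = X\<lparr>ncoord := 2 * ncoord X, wt := Tstar_wt k X,
     trans := (\<lambda>c d i. if i < ncoord X then trans X c d i
        else lsum (\<lambda>j. lmult (Tstar_wt k X)
                 (lsubst (wt X) (bdim X) (ncoord X) (trans X c d)
                    (lpartial (bdim X) (wt X) (i - ncoord X) (trans X d c j)))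
                 (lvar (bdim X) (ncoord X + j))) {..<ncoord X})\<rparr>"

text \<open>Coordinate expressions of the projections \<open>T[1]X \<rightarrow> X\<close> and \<open>T^*[k]X \<rightarrow> X\<close>.\<close>

definition proj_coords :: "('m, 'c) nmfd \<Rightarrow> 'c \<Rightarrow> nat \<Rightarrow> lfun" where
  "proj_coords X = (\<lambda>c i. lvar (bdim X) i)"

definition T1_proj :: "('m, 'c) nmfd \<Rightarrow> ('m, 'c, 'm, 'c) nmor" where
  "T1_proj X = coord_morphism (T1 X) X (proj_coords X)"

definition Tstar_proj :: "nat \<Rightarrow> ('m, 'c) nmfd \<Rightarrow> ('m, 'c, 'm, 'c) nmor" where
  "Tstar_proj k X = coord_morphism (Tstar k X) X (proj_coords X)"

definition deRham_vf :: "('m, 'c) nmfd \<Rightarrow> 'c \<Rightarrow> nat \<Rightarrow> lfun" where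
  "deRham_vf X = (\<lambda>c i. if i < ncoord X then lvar (bdim X) (ncoord X + i) else (\<lambda>_ _. 0))"

text \<open>\<open>diff_forms X p k\<close>: the \<open>p\<close>-forms of degree \<open>k\<close> on \<open>X\<close>. Forms are functions on \<open>T[1]X\<close>,
  on which \<open>dz_i\<close> has total degree \<open>wt X i + 1\<close>.\<close>

definition diff_forms :: "('m, 'c) nmfd \<Rightarrow> nat \<Rightarrow> nat \<Rightarrow> 'c sec set" where
  "diff_forms X p k = {\<alpha> \<in> sections (T1 X) (topspace (space_of X)).
     homogeneous (T1 X) (p + k) \<alpha> \<and>
     (\<forall>c \<mu> v. \<alpha> c \<mu> v \<noteq> 0 \<longrightarrow> (\<Sum>i\<in>{ncoord X..<2 * ncoord X}. \<mu> i) = p)}"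

definition closed_form :: "('m, 'c) nmfd \<Rightarrow> 'c sec \<Rightarrow> bool" where
  "closed_form X \<alpha> \<longleftrightarrow>
     vf_apply (T1 X) (deRham_vf X) (topspace (space_of X)) \<alpha> = (\<lambda>_ _ _. 0)"

text \<open>The pullback of forms along \<open>coord_morphism X Y y\<close>: it substitutes \<open>y_i\<close> for \<open>z_i\<close> and
  \<open>d y_i\<close> for \<open>dz_i\<close>.\<close>

definition form_pullback ::
  "('m, 'c) nmfd \<Rightarrow> ('m, 'c) nmfd \<Rightarrow> ('c \<Rightarrow> nat \<Rightarrow> lfun) \<Rightarrow> 'c sec \<Rightarrow> 'c sec" where
  "form_pullback X Y y =
     pull (coord_morphism (T1 X) (T1 Y)
             (\<lambda>c i. if i < ncoord Y then y c i else ldiff X (y c (i - ncoord Y))))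
       (topspace (space_of Y))"

text \<open>\<open>\<iota>_v = \<Sum>j. v^j \<partial>/\<partial>(dz_j)\<close>\<close>

definition contract :: "('m, 'c) nmfd \<Rightarrow> ('c \<Rightarrow> nat \<Rightarrow> lfun) \<Rightarrow> 'c sec \<Rightarrow> 'c sec" where
  "contract X v \<alpha> = (\<lambda>c.
     lsum (\<lambda>j. lmult (T1_wt X) (v c j) (lpartial (bdim X) (T1_wt X) (ncoord X + j) (\<alpha> c)))
       {..<ncoord X})"

text \<open>Fibrewise translation \<open>p_j \<mapsto> p_j + \<alpha>_j\<close> of \<open>T^*[k]X\<close> by a 1-form
  \<open>\<alpha> = \<Sum>j. dz_j \<alpha>_j\<close> of degree \<open>k\<close>. The index \<open>i = N + j\<close> denotes \<open>p_j\<close> on \<open>T^*[k]X\<close> and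
  \<open>dz_j\<close> on \<open>T[1]X\<close>.\<close>

definition translation :: "nat \<Rightarrow> ('m, 'c) nmfd \<Rightarrow> 'c sec \<Rightarrow> ('m, 'c, 'm, 'c) nmor" where
  "translation k X \<alpha> = coord_morphism (Tstar k X) (Tstar k X)
     (\<lambda>c i. if i < ncoord X then lvar (bdim X) i
            else ladd (lvar (bdim X) i) (lpartial (bdim X) (T1_wt X) i (\<alpha> c)))"

text \<open>
  The canonical Poisson bracket on \<open>T^*[2]X\<close>, of degree \<open>-2\<close>: the graded biderivation with
  \<open>{p_i, z_j} = \<delta>_ij\<close> and \<open>{z_i, z_j} = {p_i, p_j} = 0\<close>.
\<close>

definition poisson ::
  "('m, 'c) nmfd \<Rightarrow> 'm set \<Rightarrow> 'c sec \<Rightarrow> 'c sec \<Rightarrow> 'c sec" where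
  "poisson X W f g = (\<lambda>c.
     let n = bdim X; N = ncoord X; w = Tstar_wt 2 X in
     if c \<in> charts X
     then lrestrict (cimage X c W)
       (lsum (\<lambda>j \<mu> x.
            lmult w (rpartial n w (N + j) (f c)) (lpartial n w j (g c)) \<mu> x
            - (- 1) ^ wt X j * lmult w (rpartial n w j (f c)) (lpartial n w (N + j) (g c)) \<mu> x)
          {..<N})
     else (\<lambda>_ _. 0))"


section \<open>Smooth manifolds\<close>

text \<open>A smooth manifold is a Hausdorff second countable space with a smooth atlas of dimension
  \<open>n\<close>; charts are pairs of an open set and a coordinate map on it.\<close>

type_synonym 'm chart = "'m set \<times> ('m \<Rightarrow> nat \<Rightarrow> real)"

definition chart_trans :: "'m chart \<Rightarrow> 'm chart \<Rightarrow> (nat \<Rightarrow> real) \<Rightarrow> nat \<Rightarrow> real" where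
  "chart_trans c d v = snd d (inv_into (fst c) (snd c) v)"

definition smooth_manifold :: "'m topology \<Rightarrow> nat \<Rightarrow> 'm chart set \<Rightarrow> bool" where
  "smooth_manifold T n A \<longleftrightarrow>
     Hausdorff_space T \<and> second_countable T \<and>
     (\<Union>c\<in>A. fst c) = topspace T \<and>
     (\<forall>(U, \<phi>)\<in>A. openin T U \<and> openin (Euclidean_space n) (\<phi> ` U) \<and>
        homeomorphic_map (subtopology T U) (subtopology (Euclidean_space n) (\<phi> ` U)) \<phi>) \<and>
     (\<forall>c\<in>A. \<forall>d\<in>A. \<forall>i<n.
        smooth_fun n (snd c ` (fst c \<inter> fst d)) (\<lambda>v. chart_trans c d v i))"

definition manifold :: "'m topology \<Rightarrow> nat \<Rightarrow> 'm chart set \<Rightarrow> ('m, 'm chart) nmfd" where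
  "manifold T n A =
     \<lparr>space_of = T, bdim = n, ncoord = n, wt = (\<lambda>_. 0), charts = A, cdom = fst, cmap = snd,
      trans = (\<lambda>c d i \<mu> v. if \<mu> = (\<lambda>_. 0) then chart_trans c d v i else 0)\<rparr>"


section \<open>The exact Courant algebroid with a background 3-form\<close>

text \<open>
  For \<open>M\<close> of dimension \<open>n\<close> and \<open>a < n\<close>, the indices \<open>a, n + a, 2n + a, 3n + a\<close> denote
  \<open>x_a, \<xi>_a, p_a, \<eta>_a\<close> on \<open>T^*[2]T[1]M\<close>;
  \<open>x_a, \<eta>_a\<close> and their momenta on \<open>T^*[2]T^*[1]M\<close>;
  \<open>x_a, \<eta>_a, dx_a, d\<eta>_a\<close> on \<open>T[1]T^*[1]M\<close>.
\<close>

definition courant_mfd :: "('m, 'c) nmfd \<Rightarrow> ('m, 'c) nmfd" where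
  "courant_mfd M = Tstar 2 (T1 M)"

text \<open>\<open>Q = \<xi>_a \<partial>/\<partial>x_a + p_a \<partial>/\<partial>\<eta>_a\<close>\<close>

definition Q_std :: "('m, 'c) nmfd \<Rightarrow> 'm set \<Rightarrow> 'c sec \<Rightarrow> 'c sec" where
  "Q_std M = (let n = bdim M in
     vf_apply (courant_mfd M)
       (\<lambda>c i. if i < n then lvar n (n + i)
              else if 3 * n \<le> i \<and> i < 4 * n then lvar n (i - n)
              else (\<lambda>_ _. 0)))"

text \<open>\<open>Q_\<kappa> = Q + {q^*\<kappa>, _}\<close>\<close>

definition Q_twisted ::
  "('m, 'c) nmfd \<Rightarrow> 'c sec \<Rightarrow> 'm set \<Rightarrow> 'c sec \<Rightarrow> 'c sec" where
  "Q_twisted M \<kappa> W f = sec_add (Q_std M W f)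
     (poisson (T1 M) W (pull (Tstar_proj 2 (T1 M)) (topspace (space_of M)) \<kappa>) f)"

text \<open>The Legendre transform pulls the momenta of \<open>x_a\<close> and \<open>\<eta>_a\<close> on \<open>T^*[2]T^*[1]M\<close> back to
  \<open>p_a\<close> and \<open>\<xi>_a\<close>.\<close>

definition legendre :: "('m, 'c) nmfd \<Rightarrow> ('m, 'c, 'm, 'c) nmor" where
  "legendre M = (let n = bdim M in
     coord_morphism (courant_mfd M) (Tstar 2 (Tstar 1 M))
       (\<lambda>c i. if i < n then lvar n i
              else if i < 2 * n then lvar n (2 * n + i)
              else if i < 3 * n then lvar n i
              else lvar n (i - 2 * n)))"

text \<open>With \<open>\<omega> = d\<eta>_a dx_a\<close> on \<open>T^*[1]M\<close>, the map \<open>T^*[2]T^*[1]M \<rightarrow> T[1]T^*[1]M\<close> pulls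
  \<open>dx_a\<close> and \<open>d\<eta>_a\<close> back to the momenta of \<open>\<eta>_a\<close> and \<open>x_a\<close>.\<close>

definition omega_flat :: "('m, 'c) nmfd \<Rightarrow> ('m, 'c, 'm, 'c) nmor" where
  "omega_flat M = (let n = bdim M in
     coord_morphism (Tstar 2 (Tstar 1 M)) (T1 (Tstar 1 M))
       (\<lambda>c i. if i < 2 * n then lvar n i
              else if i < 3 * n then lvar n (n + i)
              else lvar n (i - n)))"

definition s_omega_L :: "('m, 'c) nmfd \<Rightarrow> ('m, 'c, 'm, 'c) nmor" where
  "s_omega_L M =
     mor_comp (T1 (Tstar 1 M)) (T1_proj (Tstar 1 M))
       (mor_comp (Tstar 2 (Tstar 1 M)) (omega_flat M) (legendre M))"

text \<open>The NQ-morphism corresponding to the N-morphism \<open>s \<circ> \<omega> \<circ> L\<close>, characterised by the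
  bijection between NQ-morphisms to \<open>T[1]T^*[1]M\<close> and N-morphisms to \<open>T^*[1]M\<close>.\<close>

definition is_psi :: "('m, 'c) nmfd \<Rightarrow> 'c sec \<Rightarrow> ('m, 'c, 'm, 'c) nmor \<Rightarrow> bool" where
  "is_psi M \<kappa> \<psi> \<longleftrightarrow>
     nq_morphism (courant_mfd M) (Q_twisted M \<kappa>) (courant_mfd M) (Q_std M) \<psi> \<and>
     mor_eq (courant_mfd M) (Tstar 1 M)
       (mor_comp (courant_mfd M) (s_omega_L M) \<psi>) (s_omega_L M)"

text \<open>\<open>(1/2) \<iota>_Q \<iota>_Q q_M^* \<kappa>\<close> with \<open>Q\<close> the de Rham vector field on \<open>T[1]M\<close>\<close>

definition shift_form :: "('m, 'c) nmfd \<Rightarrow> 'c sec \<Rightarrow> 'c sec" where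
  "shift_form M \<kappa> = sec_scale (1/2)
     (contract (T1 M) (deRham_vf M) (contract (T1 M) (deRham_vf M)
        (form_pullback (T1 M) M (proj_coords M) \<kappa>)))"

end

theory Submission
  imports Defs "HOL-Library.Function_Algebras"
begin

text \<open>
  In a chart, \<open>Q_\<kappa> = \<xi>_a \<partial>/\<partial>x_a + p_a \<partial>/\<partial>\<eta>_a - \<partial>\<kappa>/\<partial>x_a \<partial>/\<partial>p_a + \<partial>\<kappa>/\<partial>\<xi>_a \<partial>/\<partial>\<eta>_a\<close>. A morphism
  over the projection to \<open>T^*[1]M\<close> that intertwines \<open>Q_\<kappa>\<close> and \<open>Q\<close> fixes \<open>x_a\<close> and \<open>\<eta>_a\<close>, hence also
  \<open>\<xi>_a = Q x_a\<close>, and it sends \<open>p_a = Q \<eta>_a\<close> to \<open>Q_\<kappa> \<eta>_a = p_a + \<partial>\<kappa>/\<partial>\<xi>_a\<close>. Functions are determined by their values on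
  coordinates, so there is at most one such morphism. Conversely, this substitution is compatible
  with the coordinate changes because the \<open>\<partial>\<kappa>/\<partial>\<xi>_a\<close> transform like the \<open>p_a\<close> modulo the \<open>\<eta>_a\<close>, and it
  intertwines the vector fields because \<open>d\<kappa> = 0\<close> gives \<open>\<xi>_b \<partial>^2\<kappa>/\<partial>x_b \<partial>\<xi>_a = \<partial>\<kappa>/\<partial>x_a\<close>. The double
  contraction replaces two of the three factors \<open>dx\<close> of \<open>\<kappa>\<close> by \<open>\<xi>\<close>, in either order, so that half of it is
  \<open>\<Sum>a. dx_a \<partial>\<kappa>/\<partial>\<xi>_a\<close>. The inverse is the translation for \<open>-\<kappa>\<close>.
\<close>

text \<open>A graded function is a polynomial in the coordinates of positive degree with smooth
  coefficients. Positive weights and bounded degree make every expansion finite, so statements are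
  proved on monomials, built up from single coordinates with explicit Koszul signs, and extended
  linearly over base functions. Two facts carry the argument: substitution is an algebra
  homomorphism (\<open>lsubst_lmult\<close>), and a vector field obeys the chain rule for
  substitutions (\<open>vfield_lsubst\<close>). The latter gives both the equivariance and the
  transformation law of \<open>\<partial>\<kappa>/\<partial>\<xi>_a\<close>. Since
  \<open>smooth_fun\<close> speaks of iterated partial derivatives only, the ordinary chain rule and
  the symmetry of second derivatives are derived from the mean value theorem. Identities between
  local expressions hold only over a domain or an overlap and are stated with \<open>eqon\<close>.
  For uniqueness, a morphism is given on sections and not on coordinates: its effect on a smooth
  coefficient is fixed by locality, because the pullback of a function of degree 0 has degree 0 and
  is determined by its values at points.\<close>

definition osupp :: "(nat \<Rightarrow> nat) \<Rightarrow> (nat \<Rightarrow> nat) \<Rightarrow> nat set" where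
  "osupp w \<mu> = {i. odd (w i) \<and> \<mu> i \<noteq> 0}"

text \<open>The exponent of the Koszul sign: the number of transpositions that sort
  \<open>z_A z_B\<close>. It depends on the exponents only through the sets of odd factors.\<close>

definition inversions :: "nat set \<Rightarrow> nat set \<Rightarrow> nat" where
  "inversions A B = card {(i, j). j < i \<and> i \<in> A \<and> j \<in> B}"

definition fsupp :: "(nat \<Rightarrow> nat) \<Rightarrow> bool" where
  "fsupp \<mu> \<longleftrightarrow> finite {i. \<mu> i \<noteq> 0}"

definition odd_ok :: "(nat \<Rightarrow> nat) \<Rightarrow> (nat \<Rightarrow> nat) \<Rightarrow> bool" where
  "odd_ok w \<mu> \<longleftrightarrow> (\<forall>i. odd (w i) \<longrightarrow> \<mu> i \<le> 1)"

text \<open>Conditions that concern only the monomials occurring in a function (degree, parity,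
  absence of coordinates) are all of this form, so that their closure under sums and scaling is
  proved once.\<close>

definition lsupp :: "((nat \<Rightarrow> nat) \<Rightarrow> bool) \<Rightarrow> lfun \<Rightarrow> bool" where
  "lsupp P f \<longleftrightarrow> (\<forall>\<mu> v. f \<mu> v \<noteq> 0 \<longrightarrow> P \<mu>)"

abbreviation "lok w \<equiv> lsupp (\<lambda>\<mu>. fsupp \<mu> \<and> odd_ok w \<mu>)"

text \<open>Parity is read off from the number of odd factors, which makes sense before the
  coordinates are counted; \<open>mono_deg_parity\<close> links it to the degree.\<close>

abbreviation "lpar w p \<equiv> lsupp (\<lambda>\<mu>. fsupp \<mu> \<and> odd_ok w \<mu> \<and> (even (card (osupp w \<mu>)) \<longleftrightarrow> even (p :: nat)))"

text \<open>Multiplication by a base function. It passes through products and fibre derivatives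
  without a sign, so these are linear over base functions.\<close>

definition lscale :: "((nat \<Rightarrow> real) \<Rightarrow> real) \<Rightarrow> lfun \<Rightarrow> lfun" where
  "lscale h f = (\<lambda>\<mu> v. h v * f \<mu> v)"

lemma lsuppD: "lsupp P f \<Longrightarrow> f \<mu> v \<noteq> 0 \<Longrightarrow> P \<mu>"
  by (auto simp: lsupp_def)

lemma lsupp_mono: "lsupp P f \<Longrightarrow> (\<And>\<mu>. P \<mu> \<Longrightarrow> Q \<mu>) \<Longrightarrow> lsupp Q f"
  by (auto simp: lsupp_def)

lemma lsupp_add [intro]: "lsupp P f \<Longrightarrow> lsupp P g \<Longrightarrow> lsupp P (f + g)"
  by (auto simp: lsupp_def) (metis add_0)

lemma lsupp_zero [simp, intro]: "lsupp P 0"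
  by (auto simp: lsupp_def)

lemma lsupp_scale [intro]: "lsupp P f \<Longrightarrow> lsupp P (lscale h f)"
  by (auto simp: lsupp_def lscale_def)

lemma lsupp_sum [intro]: "(\<And>i. i \<in> I \<Longrightarrow> lsupp P (f i)) \<Longrightarrow> lsupp P (sum f I)" for f :: "'i \<Rightarrow> lfun"
  by (induction I rule: infinite_finite_induct) auto

lemma lsupp_lrestrict [intro]: "lsupp P f \<Longrightarrow> lsupp P (lrestrict V f)"
  by (auto simp: lsupp_def lrestrict_def)

lemma sum_lfun_apply: "sum f I \<mu> v = (\<Sum>i\<in>I. f i \<mu> v)" for f :: "'i \<Rightarrow> lfun"
  by (induction I rule: infinite_finite_induct) auto

lemma ladd_eq: "ladd f g = f + g"
  by (simp add: ladd_def fun_eq_iff)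

lemma lsum_eq: "lsum F J = sum F J"
  by (simp add: lsum_def sum_lfun_apply fun_eq_iff)

lemma zero_lfun: "(\<lambda>_ _. 0) = (0 :: lfun)"
  by (simp add: fun_eq_iff)

lemma lscale_add: "lscale h (f + g) = lscale h f + lscale h g"
  by (simp add: lscale_def fun_eq_iff algebra_simps)

lemma lscale_add_left: "lscale (\<lambda>v. h v + k v) f = lscale h f + lscale k f"
  by (simp add: lscale_def fun_eq_iff algebra_simps)

lemma lscale_zero [simp]: "lscale h 0 = 0"
  by (simp add: lscale_def fun_eq_iff)

lemma lscale_zero_left [simp]: "lscale (\<lambda>_. 0) f = 0"
  by (simp add: lscale_def fun_eq_iff)

lemma lscale_one [simp]: "lscale (\<lambda>_. 1) f = f"
  by (simp add: lscale_def fun_eq_iff)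

lemma lscale_lscale: "lscale h (lscale k f) = lscale (\<lambda>v. h v * k v) f"
  by (simp add: lscale_def fun_eq_iff)

lemma lscale_sum: "lscale h (sum f I) = (\<Sum>i\<in>I. lscale h (f i))" for f :: "'i \<Rightarrow> lfun"
  by (auto simp: fun_eq_iff sum_lfun_apply lscale_def sum_distrib_left)

lemma lscale_sum_left: "lscale (\<lambda>v. \<Sum>i\<in>I. h i v) f = (\<Sum>i\<in>I. lscale (h i) f)"
  by (auto simp: fun_eq_iff sum_lfun_apply lscale_def sum_distrib_right)

section \<open>The graded algebra of local functions\<close>

lemma lmult_add_left: "lmult w (f + g) h = lmult w f h + lmult w g h"
  by (auto simp: lmult_def fun_eq_iff algebra_simps sum.distrib)

lemma lmult_add_right: "lmult w h (f + g) = lmult w h f + lmult w h g"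
  by (auto simp: lmult_def fun_eq_iff algebra_simps sum.distrib)

lemma lmult_zero_left [simp]: "lmult w 0 g = 0"
  by (auto simp: lmult_def fun_eq_iff)

lemma lmult_zero_right [simp]: "lmult w g 0 = 0"
  by (auto simp: lmult_def fun_eq_iff)

lemma lmult_scale_left: "lmult w (lscale h f) g = lscale h (lmult w f g)"
  by (auto simp: lmult_def fun_eq_iff lscale_def sum_distrib_left algebra_simps)

lemma lmult_scale_right: "lmult w f (lscale h g) = lscale h (lmult w f g)"
  by (auto simp: lmult_def fun_eq_iff lscale_def sum_distrib_left algebra_simps)

lemma lmult_sum_left: "lmult w (sum f I) g = (\<Sum>i\<in>I. lmult w (f i) g)" for f :: "'i \<Rightarrow> lfun"
  using sum_comp_morphism[of "\<lambda>x. lmult w x g" f I] by (simp add: lmult_add_left o_def)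

lemma lmult_sum_right: "lmult w g (sum f I) = (\<Sum>i\<in>I. lmult w g (f i))" for f :: "'i \<Rightarrow> lfun"
  using sum_comp_morphism[of "lmult w g" f I] by (simp add: lmult_add_right o_def)

lemma lmult_restrict: "lrestrict V (lmult w f g) = lmult w (lrestrict V f) (lrestrict V g)"
  by (auto simp: lmult_def lrestrict_def fun_eq_iff)

lemma lmult_cong_at:
  assumes "\<And>\<mu>. f \<mu> v = f' \<mu> v" "\<And>\<mu>. g \<mu> v = g' \<mu> v"
  shows "lmult w f g \<mu> v = lmult w f' g' \<mu> v"
  using assms by (auto simp: lmult_def)

lemma fsupp_zero [simp]: "fsupp (\<lambda>_. 0)" and fsupp_upd [simp]: "fsupp (\<mu>(i := k)) \<longleftrightarrow> fsupp \<mu>"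
proof -
  have "finite {j. (\<mu>(i := k)) j \<noteq> 0}" if "finite {j. \<mu> j \<noteq> 0}"
    using that by (rule finite_subset[rotated, OF finite.insertI[of _ i]]) auto
  moreover have "finite {j. \<mu> j \<noteq> 0}" if "finite {j. (\<mu>(i := k)) j \<noteq> 0}"
    using that by (rule finite_subset[rotated, OF finite.insertI[of _ i]]) auto
  ultimately show "fsupp (\<mu>(i := k)) \<longleftrightarrow> fsupp \<mu>"
    unfolding fsupp_def by blast
qed (simp add: fsupp_def)

lemma fsupp_le: "fsupp \<mu> \<Longrightarrow> (\<And>i. \<alpha> i \<le> \<mu> i) \<Longrightarrow> fsupp \<alpha>"
  unfolding fsupp_def by (erule finite_subset[rotated]) (auto, metis le_zero_eq neq0_conv)

lemma odd_ok_le: "odd_ok w \<mu> \<Longrightarrow> (\<And>i. \<alpha> i \<le> \<mu> i) \<Longrightarrow> odd_ok w \<alpha>"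
  unfolding odd_ok_def using le_trans by blast

lemma finite_below: "fsupp \<mu> \<Longrightarrow> finite {\<alpha>. \<forall>i. \<alpha> i \<le> (\<mu> i :: nat)}"
proof -
  assume f: "fsupp \<mu>"
  let ?A = "{i. \<mu> i \<noteq> 0}"
  have "finite {\<alpha>. \<forall>i. (i \<in> ?A \<longrightarrow> \<alpha> i \<in> {..Max (\<mu> ` ?A)}) \<and> (i \<notin> ?A \<longrightarrow> \<alpha> i = 0)}"
    by (rule finite_set_of_finite_funs) (use f in \<open>auto simp: fsupp_def\<close>)
  moreover have "\<alpha> i \<in> {..Max (\<mu> ` ?A)}" if "\<forall>i. \<alpha> i \<le> \<mu> i" "i \<in> ?A" for \<alpha> i
  proof -
    have "\<mu> i \<le> Max (\<mu> ` ?A)"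
      using f that by (intro Max_ge) (auto simp: fsupp_def)
    then show ?thesis using that(1) le_trans by blast
  qed
  moreover have "\<alpha> i = 0" if "\<forall>i. \<alpha> i \<le> \<mu> i" "i \<notin> ?A" for \<alpha> i
    using that by (metis (mono_tags) le_zero_eq mem_Collect_eq)
  ultimately show ?thesis
    by (elim finite_subset[rotated]) blast
qed

lemma infinite_below: "\<not> fsupp \<mu> \<Longrightarrow> infinite {\<alpha>. \<forall>i. \<alpha> i \<le> (\<mu> i :: nat)}"
proof
  assume "\<not> fsupp \<mu>" and fin: "finite {\<alpha>. \<forall>i. \<alpha> i \<le> (\<mu> i :: nat)}"
  then have inf: "infinite {i. \<mu> i \<noteq> 0}" by (simp add: fsupp_def)
  let ?d = "\<lambda>i j. if j = i then 1 else 0 :: nat"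
  have "?d ` {i. \<mu> i \<noteq> 0} \<subseteq> {\<alpha>. \<forall>i. \<alpha> i \<le> (\<mu> i :: nat)}" by auto
  moreover have "inj_on ?d {i. \<mu> i \<noteq> 0}"
    by (rule inj_onI) (metis one_neq_zero)
  ultimately show False
    using fin inf finite_imageD finite_subset by blast
qed

text \<open>The sum in \<open>lmult\<close> then ranges over an infinite set and is 0 by convention,
  so products have coefficients at exponents of finite support only.\<close>

lemma lmult_not_fsupp: "\<not> fsupp \<mu> \<Longrightarrow> lmult w f g \<mu> v = 0"
  using infinite_below[of \<mu>] by (simp add: lmult_def)

lemma mono_sign_eq: "mono_sign w \<alpha> \<beta> = (- 1) ^ inversions (osupp w \<alpha>) (osupp w \<beta>)"
  unfolding mono_sign_def inversions_def osupp_def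
  by (rule arg_cong[where f = "\<lambda>x. (- 1) ^ card x"]) auto

lemma lmult_eq:
  "lmult w f g \<mu> v = (if fsupp \<mu> \<and> odd_ok w \<mu> then
     \<Sum>\<alpha> | \<forall>i. \<alpha> i \<le> \<mu> i.
            mono_sign w \<alpha> (\<lambda>i. \<mu> i - \<alpha> i) * f \<alpha> v * g (\<lambda>i. \<mu> i - \<alpha> i) v else 0)"
  by (cases "fsupp \<mu>") (auto simp: lmult_not_fsupp odd_ok_def, auto simp: lmult_def)

lemma lmult_notok: "\<not> (fsupp \<mu> \<and> odd_ok w \<mu>) \<Longrightarrow> lmult w f g \<mu> v = 0"
  unfolding lmult_eq by (rule if_not_P)

lemma lmult_lok: "lok w (lmult w f g)"
  by (auto simp: lsupp_def lmult_eq split: if_splits)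

lemma inversions_Un_left:
  "finite A \<Longrightarrow> finite B \<Longrightarrow> finite C \<Longrightarrow> A \<inter> B = {} \<Longrightarrow>
    inversions (A \<union> B) C = inversions A C + inversions B C"
proof -
  assume *: "finite A" "finite B" "finite C" "A \<inter> B = {}"
  have fin: "finite {(i, j). j < i \<and> i \<in> X \<and> j \<in> C}" if "finite X" for X
    by (rule finite_subset[of _ "X \<times> C"]) (use that * in auto)
  have "{(i, j). j < i \<and> i \<in> A \<union> B \<and> j \<in> C} =
        {(i, j). j < i \<and> i \<in> A \<and> j \<in> C} \<union> {(i, j). j < i \<and> i \<in> B \<and> j \<in> C}" by auto
  then show ?thesis
    unfolding inversions_def using * fin by (auto intro!: card_Un_disjoint)
qed

lemma inversions_Un_right:
  "finite A \<Longrightarrow> finite B \<Longrightarrow> finite C \<Longrightarrow> B \<inter> C = {} \<Longrightarrow>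
    inversions A (B \<union> C) = inversions A B + inversions A C"
proof -
  assume *: "finite A" "finite B" "finite C" "B \<inter> C = {}"
  have fin: "finite {(i, j). j < i \<and> i \<in> A \<and> j \<in> X}" if "finite X" for X
    by (rule finite_subset[of _ "A \<times> X"]) (use that * in auto)
  have "{(i, j). j < i \<and> i \<in> A \<and> j \<in> B \<union> C} =
        {(i, j). j < i \<and> i \<in> A \<and> j \<in> B} \<union> {(i, j). j < i \<and> i \<in> A \<and> j \<in> C}" by auto
  then show ?thesis
    unfolding inversions_def using * fin by (auto intro!: card_Un_disjoint)
qed

text \<open>As \<open>A\<close> and \<open>B\<close> are disjoint, each pair in
  \<open>A \<times> B\<close> is an inversion for exactly one of the two orders.\<close>

lemma inversions_swap:
  "finite A \<Longrightarrow> finite B \<Longrightarrow> A \<inter> B = {} \<Longrightarrow> inversions A B + inversions B A = card A * card B"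
proof -
  assume *: "finite A" "finite B" "A \<inter> B = {}"
  have "inversions B A = card (prod.swap ` {(i, j). j < i \<and> i \<in> B \<and> j \<in> A})"
    unfolding inversions_def by (rule card_image[symmetric]) auto
  also have "prod.swap ` {(i, j). j < i \<and> i \<in> B \<and> j \<in> A} = {(i, j). i < j \<and> i \<in> A \<and> j \<in> B}"
    by (auto simp: image_iff prod.swap_def)
  finally have "inversions A B + inversions B A =
      card ({(i, j). j < i \<and> i \<in> A \<and> j \<in> B} \<union> {(i, j). i < j \<and> i \<in> A \<and> j \<in> B})"
    unfolding inversions_def
    by (subst card_Un_disjoint) (auto intro: finite_subset[of _ "A \<times> B"] simp: *)
  also have "{(i, j). j < i \<and> i \<in> A \<and> j \<in> B} \<union> {(i, j). i < j \<and> i \<in> A \<and> j \<in> B} = A \<times> B"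
    using * by (auto dest: linorder_neqE_nat)
  finally show ?thesis by (simp add: card_cartesian_product)
qed

lemma finite_osupp: "fsupp \<mu> \<Longrightarrow> finite (osupp w \<mu>)"
  unfolding fsupp_def osupp_def by (erule finite_subset[rotated]) auto

lemma osupp_Un: "osupp w \<alpha> \<union> osupp w \<beta> = osupp w (\<lambda>i. \<alpha> i + \<beta> i)"
  by (auto simp: osupp_def)

lemma osupp_disjoint: "odd_ok w (\<lambda>i. \<alpha> i + \<beta> i) \<Longrightarrow> osupp w \<alpha> \<inter> osupp w \<beta> = {}"
  by (fastforce simp: osupp_def odd_ok_def)

text \<open>The cocycle identity of the Koszul sign: the odd supports are disjoint, so both
  exponents split into the same three pairwise inversion numbers.\<close>

lemma mono_sign_assoc:
  assumes "fsupp \<alpha>" "fsupp \<beta>" "fsupp \<gamma>" "odd_ok w (\<lambda>i. \<alpha> i + \<beta> i + \<gamma> i)"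
  shows "mono_sign w \<alpha> \<beta> * mono_sign w (\<lambda>i. \<alpha> i + \<beta> i) \<gamma> =
         mono_sign w \<alpha> (\<lambda>i. \<beta> i + \<gamma> i) * mono_sign w \<beta> \<gamma>"
proof -
  have "odd_ok w (\<lambda>i. \<alpha> i + \<beta> i)" "odd_ok w (\<lambda>i. \<beta> i + \<gamma> i)"
    using assms(4) by (auto elim!: odd_ok_le)
  then have "osupp w \<alpha> \<inter> osupp w \<beta> = {}" "osupp w \<beta> \<inter> osupp w \<gamma> = {}"
    by (auto dest: osupp_disjoint)
  then show ?thesis
    using assms finite_osupp
    by (simp add: mono_sign_eq osupp_Un[symmetric] inversions_Un_left inversions_Un_right power_add)
qed

lemma mono_sign_swap:
  assumes "fsupp \<alpha>" "fsupp \<beta>" "odd_ok w (\<lambda>i. \<alpha> i + \<beta> i)"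
  shows "mono_sign w \<alpha> \<beta> = (- 1) ^ (card (osupp w \<alpha>) * card (osupp w \<beta>)) * mono_sign w \<beta> \<alpha>"
proof -
  have "inversions (osupp w \<alpha>) (osupp w \<beta>) + inversions (osupp w \<beta>) (osupp w \<alpha>) =
     card (osupp w \<alpha>) * card (osupp w \<beta>)"
    using assms by (intro inversions_swap finite_osupp osupp_disjoint)
  then have "even (inversions (osupp w \<alpha>) (osupp w \<beta>)) \<longleftrightarrow>
    even (card (osupp w \<alpha>) * card (osupp w \<beta>) + inversions (osupp w \<beta>) (osupp w \<alpha>))"
    by (metis even_add)
  then show ?thesis
    unfolding mono_sign_eq power_add[symmetric] by (simp add: minus_one_power_iff)
qed

lemma lmult_assoc: "lmult w (lmult w f g) h = lmult w f (lmult w g h)"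
proof (intro ext)
  fix \<mu> v
  show "lmult w (lmult w f g) h \<mu> v = lmult w f (lmult w g h) \<mu> v"
  proof (cases "fsupp \<mu> \<and> odd_ok w \<mu>")
    case True
    let ?B = "\<lambda>\<mu>. {\<alpha>. \<forall>i. \<alpha> i \<le> (\<mu> i :: nat)}"
    let ?m = "\<lambda>\<mu> \<alpha> i. \<mu> i - (\<alpha> i :: nat)"
    have ok: "fsupp \<alpha>" "odd_ok w \<alpha>" if "\<And>i. \<alpha> i \<le> \<mu> i" for \<alpha>
      using True that fsupp_le odd_ok_le by blast+
    have "lmult w (lmult w f g) h \<mu> v = (\<Sum>\<delta>\<in>?B \<mu>. \<Sum>\<alpha>\<in>?B \<delta>.
        mono_sign w \<delta> (?m \<mu> \<delta>) * (mono_sign w \<alpha> (?m \<delta> \<alpha>) * f \<alpha> v * g (?m \<delta> \<alpha>) v) * h (?m \<mu> \<delta>) v)"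
      using True by (simp add: lmult_eq[of _ _ _ \<mu>] ok lmult_eq[of _ f] sum_distrib_left sum_distrib_right)
    also have "\<dots> = (\<Sum>(\<delta>, \<alpha>)\<in>Sigma (?B \<mu>) ?B.
        mono_sign w \<delta> (?m \<mu> \<delta>) * (mono_sign w \<alpha> (?m \<delta> \<alpha>) * f \<alpha> v * g (?m \<delta> \<alpha>) v) * h (?m \<mu> \<delta>) v)"
      using True ok by (intro sum.Sigma) (auto intro: finite_below)
    also have "\<dots> = (\<Sum>(\<alpha>, \<beta>)\<in>Sigma (?B \<mu>) (\<lambda>\<alpha>. ?B (?m \<mu> \<alpha>)).
        mono_sign w \<alpha> (?m \<mu> \<alpha>) * f \<alpha> v *
          (mono_sign w \<beta> (?m (?m \<mu> \<alpha>) \<beta>) * g \<beta> v * h (?m (?m \<mu> \<alpha>) \<beta>) v))"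
    \<comment> \<open>Both sides sum over the splittings of \<open>\<mu>\<close> into three parts:
      \<open>\<delta>\<close> is the sum of the first two parts,
      \<open>\<beta> = \<delta> - \<alpha>\<close> is the second.\<close>
    proof (rule sum.reindex_bij_witness[where i = "\<lambda>(\<alpha>, \<beta>). (\<lambda>i. \<alpha> i + \<beta> i, \<alpha>)"
          and j = "\<lambda>(\<delta>, \<alpha>). (\<alpha>, ?m \<delta> \<alpha>)"], goal_cases)
      case (5 a)
      obtain \<delta> \<alpha> where a: "a = (\<delta>, \<alpha>)" by force
      have le: "\<alpha> i \<le> \<delta> i" "\<delta> i \<le> \<mu> i" for i using 5 a by auto
      then have e: "?m (?m \<mu> \<alpha>) (?m \<delta> \<alpha>) = ?m \<mu> \<delta>" "(\<lambda>i. \<alpha> i + (\<delta> i - \<alpha> i)) = \<delta>"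
        "(\<lambda>i. \<delta> i - \<alpha> i + (\<mu> i - \<delta> i)) = ?m \<mu> \<alpha>" "(\<lambda>i. \<alpha> i + (\<delta> i - \<alpha> i) + (\<mu> i - \<delta> i)) = \<mu>"
        by (auto simp: fun_eq_iff le)
      have "mono_sign w \<alpha> (?m \<delta> \<alpha>) * mono_sign w (\<lambda>i. \<alpha> i + ?m \<delta> \<alpha> i) (?m \<mu> \<delta>) =
         mono_sign w \<alpha> (\<lambda>i. ?m \<delta> \<alpha> i + ?m \<mu> \<delta> i) * mono_sign w (?m \<delta> \<alpha>) (?m \<mu> \<delta>)"
        using le True e(4) by (intro mono_sign_assoc ok) (auto intro: le_trans diff_le_self order.trans[OF diff_le_self])
      then have "mono_sign w \<delta> (?m \<mu> \<delta>) * mono_sign w \<alpha> (?m \<delta> \<alpha>) =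
         mono_sign w \<alpha> (?m \<mu> \<alpha>) * mono_sign w (?m \<delta> \<alpha>) (?m \<mu> \<delta>)"
        using e by (simp add: mult.commute)
      from arg_cong[OF this, of "\<lambda>x. x * (f \<alpha> v * g (?m \<delta> \<alpha>) v * h (?m \<mu> \<delta>) v)"]
      have "mono_sign w \<delta> (?m \<mu> \<delta>) * (mono_sign w \<alpha> (?m \<delta> \<alpha>) * f \<alpha> v * g (?m \<delta> \<alpha>) v) * h (?m \<mu> \<delta>) v =
         mono_sign w \<alpha> (?m \<mu> \<alpha>) * f \<alpha> v * (mono_sign w (?m \<delta> \<alpha>) (?m \<mu> \<delta>) * g (?m \<delta> \<alpha>) v * h (?m \<mu> \<delta>) v)"
        by (simp only: mult_ac)
      then show ?case by (simp only: a case_prod_conv e)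
    qed (auto simp: fun_eq_iff, (metis le_trans diff_le_self add_leD1 diff_le_mono le_diff_conv2 add.commute)+)
    also have "\<dots> = (\<Sum>\<alpha>\<in>?B \<mu>. \<Sum>\<beta>\<in>?B (?m \<mu> \<alpha>).
        mono_sign w \<alpha> (?m \<mu> \<alpha>) * f \<alpha> v *
          (mono_sign w \<beta> (?m (?m \<mu> \<alpha>) \<beta>) * g \<beta> v * h (?m (?m \<mu> \<alpha>) \<beta>) v))"
      using True ok by (intro sum.Sigma[symmetric]) (auto intro!: finite_below)
    also have "\<dots> = lmult w f (lmult w g h) \<mu> v"
      using True by (simp add: lmult_eq[of _ _ _ \<mu>] ok lmult_eq[of _ g] sum_distrib_left)
    finally show ?thesis .
  next
    case False
    then show ?thesis by (metis lmult_notok)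
  qed
qed

lemma lpar_lok: "lpar w p f \<Longrightarrow> lok w f"
  by (erule lsupp_mono) auto

lemma lpar_lmult: "lpar w p f \<Longrightarrow> lpar w q g \<Longrightarrow> lpar w (p + q) (lmult w f g)"
  unfolding lsupp_def
proof (intro allI impI)
  fix \<mu> v
  assume f: "\<forall>\<mu> v. f \<mu> v \<noteq> 0 \<longrightarrow> fsupp \<mu> \<and> odd_ok w \<mu> \<and> even (card (osupp w \<mu>)) = even p"
    and g: "\<forall>\<mu> v. g \<mu> v \<noteq> 0 \<longrightarrow> fsupp \<mu> \<and> odd_ok w \<mu> \<and> even (card (osupp w \<mu>)) = even q"
    and nz: "lmult w f g \<mu> v \<noteq> 0"
  then have ok: "fsupp \<mu>" "odd_ok w \<mu>" by (auto simp: lmult_eq split: if_splits)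
  then have "(\<Sum>\<alpha> | \<forall>i. \<alpha> i \<le> \<mu> i.
      mono_sign w \<alpha> (\<lambda>i. \<mu> i - \<alpha> i) * f \<alpha> v * g (\<lambda>i. \<mu> i - \<alpha> i) v) \<noteq> 0"
    using nz by (simp add: lmult_eq)
  then obtain \<alpha> where \<alpha>: "\<forall>i. \<alpha> i \<le> \<mu> i" "f \<alpha> v \<noteq> 0" "g (\<lambda>i. \<mu> i - \<alpha> i) v \<noteq> 0"
    by (rule sum.not_neutral_contains_not_neutral) auto
  have e: "(\<lambda>i. \<alpha> i + (\<mu> i - \<alpha> i)) = \<mu>" using \<alpha>(1) by auto
  have "osupp w \<alpha> \<inter> osupp w (\<lambda>i. \<mu> i - \<alpha> i) = {}"
    by (rule osupp_disjoint) (simp add: e ok)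
  then have "card (osupp w \<mu>) = card (osupp w \<alpha>) + card (osupp w (\<lambda>i. \<mu> i - \<alpha> i))"
    using \<alpha> f g osupp_Un[of w \<alpha> "\<lambda>i. \<mu> i - \<alpha> i"] finite_osupp
    by (metis (no_types, lifting) card_Un_disjoint e)
  then show "fsupp \<mu> \<and> odd_ok w \<mu> \<and> even (card (osupp w \<mu>)) = even (p + q)"
    using ok f g \<alpha> by auto
qed

text \<open>Reversing each splitting of the exponent exchanges the factors. The sign from
  \<open>mono_sign_swap\<close> depends only on parities, hence is the same in all nonzero
  terms.\<close>

lemma lmult_commute:
  assumes f: "lpar w p f" and g: "lpar w q g"
  shows "lmult w f g = lscale (\<lambda>_. (- 1) ^ (p * q)) (lmult w g f)"
proof (intro ext)
  fix \<mu> v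
  show "lmult w f g \<mu> v = lscale (\<lambda>_. (- 1) ^ (p * q)) (lmult w g f) \<mu> v"
  proof (cases "fsupp \<mu> \<and> odd_ok w \<mu>")
    case True
    have "lmult w f g \<mu> v = (\<Sum>\<alpha> | \<forall>i. \<alpha> i \<le> \<mu> i.
            mono_sign w (\<lambda>i. \<mu> i - \<alpha> i) \<alpha> * f (\<lambda>i. \<mu> i - \<alpha> i) v * g \<alpha> v)"
      unfolding lmult_eq using True
      by simp (rule sum.reindex_bij_witness[where i = "\<lambda>\<alpha> i. \<mu> i - \<alpha> i" and j = "\<lambda>\<alpha> i. \<mu> i - \<alpha> i"]; auto)
    also have "\<dots> = (\<Sum>\<alpha> | \<forall>i. \<alpha> i \<le> \<mu> i. (- 1) ^ (p * q) *
            (mono_sign w \<alpha> (\<lambda>i. \<mu> i - \<alpha> i) * g \<alpha> v * f (\<lambda>i. \<mu> i - \<alpha> i) v))"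
    proof (rule sum.cong[OF refl])
      fix \<alpha> assume "\<alpha> \<in> {\<alpha>. \<forall>i. \<alpha> i \<le> \<mu> i}"
      then have le: "\<And>i. \<alpha> i \<le> \<mu> i" by auto
      then have e: "(\<lambda>i. \<mu> i - \<alpha> i + \<alpha> i) = \<mu>" by auto
      show "mono_sign w (\<lambda>i. \<mu> i - \<alpha> i) \<alpha> * f (\<lambda>i. \<mu> i - \<alpha> i) v * g \<alpha> v = (- 1) ^ (p * q) *
            (mono_sign w \<alpha> (\<lambda>i. \<mu> i - \<alpha> i) * g \<alpha> v * f (\<lambda>i. \<mu> i - \<alpha> i) v)"
      proof (cases "f (\<lambda>i. \<mu> i - \<alpha> i) v = 0 \<or> g \<alpha> v = 0")
        case False
        then have "even (card (osupp w (\<lambda>i. \<mu> i - \<alpha> i)) * card (osupp w \<alpha>)) \<longleftrightarrow> even (p * q)"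
          using lsuppD[OF f, of "\<lambda>i. \<mu> i - \<alpha> i" v] lsuppD[OF g, of \<alpha> v] by simp
        moreover have "mono_sign w (\<lambda>i. \<mu> i - \<alpha> i) \<alpha> =
            (- 1) ^ (card (osupp w (\<lambda>i. \<mu> i - \<alpha> i)) * card (osupp w \<alpha>)) * mono_sign w \<alpha> (\<lambda>i. \<mu> i - \<alpha> i)"
          using True le e by (intro mono_sign_swap) (auto intro: fsupp_le)
        ultimately show ?thesis by (simp add: minus_one_power_iff)
      qed auto
    qed
    finally show ?thesis using True by (simp add: lscale_def lmult_eq[of _ g] sum_distrib_left)
  next
    case False
    then show ?thesis unfolding lscale_def by (metis lmult_notok mult_zero_right)
  qed
qed

text \<open>The sign for bringing \<open>z_i\<close> from its place in \<open>z^\<mu>\<close> to the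
  far left, past the odd factors before it.\<close>

definition gsign :: "(nat \<Rightarrow> nat) \<Rightarrow> nat \<Rightarrow> (nat \<Rightarrow> nat) \<Rightarrow> real" where
  "gsign w i \<mu> = (if odd (w i) then (- 1) ^ card {j. j < i \<and> odd (w j) \<and> \<mu> j \<noteq> 0} else 1)"

lemma lmult_lone_left: "lok w f \<Longrightarrow> lmult w lone f = f"
proof (intro ext)
  fix \<mu> v assume f: "lok w f"
  show "lmult w lone f \<mu> v = f \<mu> v"
  proof (cases "fsupp \<mu> \<and> odd_ok w \<mu>")
    case True
    have "lmult w lone f \<mu> v = (\<Sum>\<alpha>\<in>{\<alpha>. \<forall>i. \<alpha> i \<le> \<mu> i}. if \<alpha> = (\<lambda>_. 0) then f \<mu> v else 0)"
      using True by (auto simp: lmult_eq lone_def mono_sign_eq inversions_def osupp_def intro!: sum.cong)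
    also have "\<dots> = f \<mu> v" using True by (subst sum.delta) (auto intro: finite_below)
    finally show ?thesis .
  qed (use f in \<open>auto simp: lsupp_def lmult_eq\<close>)
qed

lemma lone_lpar: "lpar w 0 lone"
  by (auto simp: lsupp_def lone_def osupp_def odd_ok_def)

lemma lmult_lone_right: "lok w f \<Longrightarrow> lmult w f lone = f"
proof (intro ext)
  fix \<mu> v assume f: "lok w f"
  show "lmult w f lone \<mu> v = f \<mu> v"
  proof (cases "fsupp \<mu> \<and> odd_ok w \<mu>")
    case True
    have *: "(\<lambda>i. \<mu> i - \<alpha> i) = (\<lambda>_. 0) \<longleftrightarrow> \<alpha> = \<mu>" if "\<forall>i. \<alpha> i \<le> \<mu> i" for \<alpha>
      using that by (auto simp: fun_eq_iff) (metis le_antisym)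
    have "lmult w f lone \<mu> v = (\<Sum>\<alpha>\<in>{\<alpha>. \<forall>i. \<alpha> i \<le> \<mu> i}. if \<alpha> = \<mu> then f \<mu> v else 0)"
      using True by (auto simp: lmult_eq lone_def * mono_sign_eq inversions_def osupp_def intro!: sum.cong)
    also have "\<dots> = f \<mu> v" using True by (subst sum.delta) (auto intro: finite_below)
    finally show ?thesis .
  qed (use f in \<open>auto simp: lsupp_def lmult_eq\<close>)
qed

text \<open>Left multiplication by a coordinate and its left derivative carry the same sign.\<close>

lemma lmult_lvar:
  assumes f: "lok w f" and i: "n \<le> i"
  shows "lmult w (lvar n i) f \<mu> v =
    (if odd_ok w \<mu> \<and> \<mu> i \<noteq> 0 then gsign w i \<mu> * f (\<mu>(i := \<mu> i - 1)) v else 0)"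
proof (cases "fsupp \<mu> \<and> odd_ok w \<mu>")
  case True
  let ?d = "(\<lambda>_. 0)(i := 1) :: nat \<Rightarrow> nat"
  have "lmult w (lvar n i) f \<mu> v = (\<Sum>\<alpha>\<in>{\<alpha>. \<forall>i. \<alpha> i \<le> \<mu> i}. if \<alpha> = ?d then
      mono_sign w ?d (\<lambda>j. \<mu> j - ?d j) * f (\<lambda>j. \<mu> j - ?d j) v else 0)"
    using True i by (auto simp: lmult_eq lvar_def intro!: sum.cong)
  also have "\<dots> = (if \<mu> i \<noteq> 0 then mono_sign w ?d (\<lambda>j. \<mu> j - ?d j) * f (\<lambda>j. \<mu> j - ?d j) v else 0)"
    using True by (subst sum.delta) (auto intro: finite_below)
  also have "(\<lambda>j. \<mu> j - ?d j) = \<mu>(i := \<mu> i - 1)" by auto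
  also have "mono_sign w ?d (\<mu>(i := \<mu> i - 1)) = gsign w i \<mu>"
  proof -
    have "{(k, j). j < k \<and> k \<in> osupp w ?d \<and> j \<in> osupp w (\<mu>(i := \<mu> i - 1))} =
      (if odd (w i) then Pair i ` {j. j < i \<and> odd (w j) \<and> \<mu> j \<noteq> 0} else {})"
      by (auto simp: osupp_def)
    then show ?thesis
      by (simp add: mono_sign_eq gsign_def inversions_def card_image inj_on_def)
  qed
  finally show ?thesis using True by simp
qed (use f in \<open>auto simp: lmult_eq lsupp_def\<close>)

text \<open>\<open>induction\<close> eta-expands its goals, and these rules would then unfold sums of functions.\<close>

declare plus_fun_apply [simp del] zero_fun_apply [simp del]

section \<open>Degrees and finite expansions\<close>

abbreviation "bmono n N w K \<equiv> (\<lambda>\<mu>. mono_ok n N w \<mu> \<and> mono_deg N w \<mu> \<le> K)"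
abbreviation "hdeg n N w k \<equiv> lsupp (\<lambda>\<mu>. mono_ok n N w \<mu> \<and> mono_deg N w \<mu> = k)"
abbreviation "bdeg n N w K \<equiv> lsupp (bmono n N w K)"

text \<open>Sections have bounded degree by definition. With positive weights this leaves finitely
  many monomials, so the sum in \<open>lsubst\<close> is a genuine finite sum.\<close>

definition gdeg :: "nat \<Rightarrow> nat \<Rightarrow> (nat \<Rightarrow> nat) \<Rightarrow> lfun \<Rightarrow> bool" where
  "gdeg n N w f \<longleftrightarrow> (\<exists>K. bdeg n N w K f)"

definition gpos :: "nat \<Rightarrow> nat \<Rightarrow> (nat \<Rightarrow> nat) \<Rightarrow> bool" where
  "gpos n N w \<longleftrightarrow> (\<forall>i. n \<le> i \<and> i < N \<longrightarrow> 0 < w i)"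

definition lmono :: "(nat \<Rightarrow> nat) \<Rightarrow> lfun" where
  "lmono \<nu> = (\<lambda>\<mu> v. if \<mu> = \<nu> then 1 else 0)"

lemma mono_okD: "mono_ok n N w \<mu> \<Longrightarrow> \<mu> i \<noteq> 0 \<Longrightarrow> n \<le> i \<and> i < N"
  by (auto simp: mono_ok_def)

lemma mono_ok_fsupp: "mono_ok n N w \<mu> \<Longrightarrow> fsupp \<mu>"
  unfolding fsupp_def by (rule finite_subset[of _ "{..<N}"]) (auto simp: mono_ok_def)

lemma mono_ok_odd_ok: "mono_ok n N w \<mu> \<Longrightarrow> odd_ok w \<mu>"
  by (auto simp: mono_ok_def odd_ok_def)

lemma mono_ok_add:
  "mono_ok n N w \<alpha> \<Longrightarrow> mono_ok n N w \<beta> \<Longrightarrow> odd_ok w (\<lambda>i. \<alpha> i + \<beta> i) \<Longrightarrow> mono_ok n N w (\<lambda>i. \<alpha> i + \<beta> i)"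
  by (auto simp: mono_ok_def odd_ok_def)

lemma mono_deg_add: "mono_deg N w (\<lambda>i. \<alpha> i + \<beta> i) = mono_deg N w \<alpha> + mono_deg N w \<beta>"
  by (simp add: mono_deg_def algebra_simps sum.distrib)

text \<open>Modulo 2 only the odd coordinates contribute to the degree, and each of them has
  exponent at most 1.\<close>

lemma mono_deg_parity:
  assumes "mono_ok n N w \<mu>"
  shows "even (card (osupp w \<mu>)) \<longleftrightarrow> even (mono_deg N w \<mu>)"
proof -
  have "osupp w \<mu> = {i \<in> {..<N}. odd (w i * \<mu> i)}"
  proof -
    have "odd (\<mu> i) \<longleftrightarrow> \<mu> i \<noteq> 0" if "odd (w i)" for i
      using assms that by (auto simp: mono_ok_def le_Suc_eq dest!: spec[of _ i])
    then show ?thesis using assms by (auto simp: osupp_def mono_ok_def)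
  qed
  then show ?thesis by (simp add: mono_deg_def even_sum_iff)
qed

lemma hdeg_lpar: "hdeg n N w k f \<Longrightarrow> lpar w k f"
  by (erule lsupp_mono) (auto simp: mono_ok_fsupp mono_ok_odd_ok mono_deg_parity)

lemma bdeg_lok: "bdeg n N w k f \<Longrightarrow> lok w f"
  by (erule lsupp_mono) (auto simp: mono_ok_fsupp mono_ok_odd_ok)

lemma gdeg_lok: "gdeg n N w f \<Longrightarrow> lok w f"
  using bdeg_lok by (auto simp: gdeg_def)

text \<open>A positive weight bounds each exponent by the degree of the monomial.\<close>

lemma finite_bmono:
  assumes "gpos n N w"
  shows "finite {\<mu>. bmono n N w K \<mu>}"
proof -
  have "finite {\<mu>. \<forall>i. (i \<in> {..<N} \<longrightarrow> \<mu> i \<in> {..K}) \<and> (i \<notin> {..<N} \<longrightarrow> \<mu> i = 0)}"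
    by (rule finite_set_of_finite_funs) auto
  moreover have "\<mu> i \<le> K" if "mono_ok n N w \<mu>" "mono_deg N w \<mu> \<le> K" "i < N" for \<mu> i
  proof (cases "\<mu> i = 0")
    case False
    then have "0 < w i" using assms that by (auto simp: gpos_def mono_ok_def)
    then have "\<mu> i \<le> w i * \<mu> i" by simp
    also have "\<dots> \<le> mono_deg N w \<mu>"
      unfolding mono_deg_def using that by (intro member_le_sum) auto
    finally show ?thesis using that by simp
  qed simp
  ultimately show ?thesis
    by (elim finite_subset[rotated]) (auto simp: mono_ok_def)
qed

text \<open>A nonzero coefficient of a product comes from a splitting of its exponent. The degree
  bounds for products that follow are instances.\<close>

lemma lsupp_lmult:
  assumes "lsupp P f" "lsupp Q g"
    and "\<And>\<alpha> \<beta>. P \<alpha> \<Longrightarrow> Q \<beta> \<Longrightarrow> odd_ok w (\<lambda>i. \<alpha> i + \<beta> i) \<Longrightarrow> R (\<lambda>i. \<alpha> i + \<beta> i)"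
  shows "lsupp R (lmult w f g)"
  unfolding lsupp_def
proof (intro allI impI)
  fix \<mu> v
  assume nz: "lmult w f g \<mu> v \<noteq> 0"
  then have ok: "fsupp \<mu>" "odd_ok w \<mu>" by (metis lmult_notok)+
  then have "(\<Sum>\<alpha> | \<forall>i. \<alpha> i \<le> \<mu> i.
      mono_sign w \<alpha> (\<lambda>i. \<mu> i - \<alpha> i) * f \<alpha> v * g (\<lambda>i. \<mu> i - \<alpha> i) v) \<noteq> 0"
    using nz by (simp add: lmult_eq)
  then obtain \<alpha> where \<alpha>: "\<forall>i. \<alpha> i \<le> \<mu> i" "f \<alpha> v \<noteq> 0" "g (\<lambda>i. \<mu> i - \<alpha> i) v \<noteq> 0"
    by (rule sum.not_neutral_contains_not_neutral) auto
  have e: "(\<lambda>i. \<alpha> i + (\<mu> i - \<alpha> i)) = \<mu>" using \<alpha>(1) by auto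
  show "R \<mu>" using assms(3)[of \<alpha> "\<lambda>i. \<mu> i - \<alpha> i"] \<alpha> ok assms(1,2) by (simp add: e lsupp_def) blast
qed

lemma hdeg_lmult: "hdeg n N w a f \<Longrightarrow> hdeg n N w b g \<Longrightarrow> hdeg n N w (a + b) (lmult w f g)"
  by (erule (1) lsupp_lmult) (auto simp: mono_ok_add mono_deg_add)

lemma bdeg_lmult: "bdeg n N w a f \<Longrightarrow> bdeg n N w b g \<Longrightarrow> bdeg n N w (a + b) (lmult w f g)"
  by (erule (1) lsupp_lmult) (auto simp: mono_ok_add mono_deg_add)

lemma gdeg_lmult: "gdeg n N w f \<Longrightarrow> gdeg n N w g \<Longrightarrow> gdeg n N w (lmult w f g)"
  unfolding gdeg_def using bdeg_lmult by blast

lemma bdeg_mono: "bdeg n N w K f \<Longrightarrow> K \<le> L \<Longrightarrow> bdeg n N w L f"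
  by (erule lsupp_mono) auto

lemma gdeg_add: "gdeg n N w f \<Longrightarrow> gdeg n N w g \<Longrightarrow> gdeg n N w (f + g)"
proof -
  assume "gdeg n N w f" "gdeg n N w g"
  then obtain K L where "bdeg n N w K f" "bdeg n N w L g" by (auto simp: gdeg_def)
  then have "bdeg n N w (max K L) (f + g)"
    by (intro lsupp_add) (erule bdeg_mono, simp)+
  then show ?thesis by (auto simp: gdeg_def)
qed

lemma gdeg_zero [simp]: "gdeg n N w 0"
  by (auto simp: gdeg_def)

lemma gdeg_scale: "gdeg n N w f \<Longrightarrow> gdeg n N w (lscale h f)"
  by (auto simp: gdeg_def)

lemma gdeg_sum:
  fixes f :: "'i \<Rightarrow> lfun"
  assumes "\<And>i. i \<in> I \<Longrightarrow> gdeg n N w (f i)"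
  shows "gdeg n N w (sum f I)"
  using assms
proof (induction I rule: infinite_finite_induct)
  case (infinite A)
  then show ?case by simp
next
  case empty
  show ?case by simp
next
  case (insert x F)
  then show ?case by (auto intro: gdeg_add)
qed

lemma bdeg_gdeg: "bdeg n N w K f \<Longrightarrow> gdeg n N w f"
  by (auto simp: gdeg_def)

lemma hdeg_bdeg: "hdeg n N w k f \<Longrightarrow> bdeg n N w k f"
  by (erule lsupp_mono) auto

lemma hdeg_gdeg: "hdeg n N w k f \<Longrightarrow> gdeg n N w f"
  by (intro bdeg_gdeg hdeg_bdeg)

lemma hdeg_lone: "hdeg n N w 0 lone"
  by (auto simp: lsupp_def lone_def mono_ok_def mono_deg_def)

lemma hdeg_lvar: "n \<le> i \<Longrightarrow> i < N \<Longrightarrow> hdeg n N w (w i) (lvar n i)"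
  by (auto simp: lsupp_def lvar_def mono_ok_def mono_deg_def split: if_splits)
    (subst sum.mono_neutral_right[of _ "{i}"]; auto)+

lemma hdeg_lvar0: "i < n \<Longrightarrow> hdeg n N w 0 (lvar n i)"
  by (auto simp: lsupp_def lvar_def mono_ok_def mono_deg_def split: if_splits)

lemma lmono_zero: "lmono (\<lambda>_. 0) = lone"
  by (simp add: lmono_def lone_def)

lemma lmono_hdeg: "mono_ok n N w \<nu> \<Longrightarrow> hdeg n N w (mono_deg N w \<nu>) (lmono \<nu>)"
  by (auto simp: lsupp_def lmono_def)

section \<open>Monomials and their images under substitution\<close>

lemma lmono_expand:
  assumes "finite S" "\<And>\<nu> v. f \<nu> v \<noteq> 0 \<Longrightarrow> \<nu> \<in> S"
  shows "f = (\<Sum>\<nu>\<in>S. lscale (f \<nu>) (lmono \<nu>))"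
proof (intro ext)
  fix \<mu> v
  have "(\<Sum>\<nu>\<in>S. lscale (f \<nu>) (lmono \<nu>)) \<mu> v = (\<Sum>\<nu>\<in>S. if \<mu> = \<nu> then f \<nu> v else 0)"
    unfolding sum_lfun_apply by (rule sum.cong) (auto simp: lscale_def lmono_def)
  also have "\<dots> = f \<mu> v"
    using assms by (subst sum.delta') auto
  finally show "f \<mu> v = (\<Sum>\<nu>\<in>S. lscale (f \<nu>) (lmono \<nu>)) \<mu> v" by simp
qed

text \<open>The tail of \<open>mono_subst\<close> from coordinate \<open>k\<close> on, which makes
  \<open>mono_subst\<close> accessible to downward induction on \<open>k\<close>.\<close>

definition mpart :: "(nat \<Rightarrow> nat) \<Rightarrow> nat \<Rightarrow> (nat \<Rightarrow> lfun) \<Rightarrow> nat \<Rightarrow> (nat \<Rightarrow> nat) \<Rightarrow> lfun" where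
  "mpart w N y k \<nu> = foldr (\<lambda>i. (lmult w (y i)) ^^ (\<nu> i)) [k..<N] lone"

lemma mono_subst_mpart: "mono_subst w n N y \<nu> = mpart w N y n \<nu>"
  by (simp add: mono_subst_def mpart_def)

lemma mpart_end: "N \<le> k \<Longrightarrow> mpart w N y k \<nu> = lone"
  by (simp add: mpart_def)

lemma mpart_step: "k < N \<Longrightarrow> mpart w N y k \<nu> = ((lmult w (y k)) ^^ (\<nu> k)) (mpart w N y (Suc k) \<nu>)"
  by (simp add: mpart_def upt_conv_Cons)

lemma mpart_cong:
  "(\<And>i. k \<le> i \<Longrightarrow> i < N \<Longrightarrow> \<nu> i = \<nu>' i) \<Longrightarrow> (\<And>i. k \<le> i \<Longrightarrow> i < N \<Longrightarrow> \<nu> i \<noteq> 0 \<Longrightarrow> y i = y' i) \<Longrightarrow>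
    mpart w N y k \<nu> = mpart w N y' k \<nu>'"
proof -
  assume a: "\<And>i. k \<le> i \<Longrightarrow> i < N \<Longrightarrow> \<nu> i = \<nu>' i" "\<And>i. k \<le> i \<Longrightarrow> i < N \<Longrightarrow> \<nu> i \<noteq> 0 \<Longrightarrow> y i = y' i"
  have "(lmult w (y i) ^^ \<nu> i) = (lmult w (y' i) ^^ \<nu>' i)" if "i \<in> set [k..<N]" for i
    using a[of i] that by (cases "\<nu> i = 0") auto
  then show ?thesis unfolding mpart_def by (intro foldr_cong) auto
qed

lemma lok_lone: "lok w lone"
  using lone_lpar lpar_lok by blast

lemma lok_power: "lok w f \<Longrightarrow> lok w ((lmult w g ^^ m) f)"
  by (cases m) (auto simp: lmult_lok)

lemma lok_mpart: "lok w (mpart w N y k \<nu>)"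
proof (cases "k \<le> N")
  case True
  then show ?thesis
    by (induction rule: inc_induct) (auto simp: mpart_end mpart_step lok_lone lok_power)
qed (simp add: mpart_end lok_lone)

lemma hdeg_power:
  "hdeg n N w a g \<Longrightarrow> hdeg n N w b f \<Longrightarrow> hdeg n N w (m * a + b) ((lmult w g ^^ m) f)"
proof (induction m)
  case (Suc m)
  then show ?case using hdeg_lmult[of n N w a g "m * a + b"] by (simp add: add.assoc)
qed simp

lemma hdeg_mpart:
  assumes "\<And>i. k \<le> i \<Longrightarrow> i < N' \<Longrightarrow> hdeg n N w (w' i) (y i)"
  shows "hdeg n N w (\<Sum>i\<in>{k..<N'}. w' i * \<nu> i) (mpart w N' y k \<nu>)"
proof (cases "k \<le> N'")
  case True
  then show ?thesis using assms
  proof (induction rule: inc_induct)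
    case (step k)
    have "hdeg n N w (\<nu> k * w' k + (\<Sum>i\<in>{Suc k..<N'}. w' i * \<nu> i)) (mpart w N' y k \<nu>)"
      unfolding mpart_step[OF step(2)] using step by (intro hdeg_power) auto
    then show ?case using step(2) by (simp add: sum.atLeast_Suc_lessThan algebra_simps)
  qed (simp add: mpart_end hdeg_lone)
qed (simp add: mpart_end hdeg_lone)

lemma hdeg_mono_subst:
  assumes "\<And>i. n' \<le> i \<Longrightarrow> i < N' \<Longrightarrow> hdeg n N w (w' i) (y i)" "mono_ok n' N' w' \<nu>"
  shows "hdeg n N w (mono_deg N' w' \<nu>) (mono_subst w n' N' y \<nu>)"
proof -
  have "(\<Sum>i\<in>{n'..<N'}. w' i * \<nu> i) = mono_deg N' w' \<nu>"
    unfolding mono_deg_def using assms(2) by (intro sum.mono_neutral_left) (auto simp: mono_ok_def not_le)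
  then show ?thesis using hdeg_mpart[of n' N' n N w w' y \<nu>] assms by (simp add: mono_subst_mpart)
qed

lemma lscale_power: "(lmult w g ^^ m) (lscale h f) = lscale h ((lmult w g ^^ m) f)"
  by (induction m) (auto simp: lmult_scale_right)

lemma power_zero: "(lmult w g ^^ m) 0 = 0"
  by (induction m) auto

lemma lpar_swap_power:
  assumes "lpar w a f" "lpar w b g"
  shows "lmult w f ((lmult w g ^^ m) h) = lscale (\<lambda>_. (- 1) ^ (m * (a * b))) ((lmult w g ^^ m) (lmult w f h))"
proof (induction m)
  case (Suc m)
  have "lmult w f ((lmult w g ^^ Suc m) h) = lmult w (lmult w f g) ((lmult w g ^^ m) h)"
    by (simp add: lmult_assoc)
  also have "\<dots> = lscale (\<lambda>_. (- 1) ^ (a * b)) (lmult w g (lmult w f ((lmult w g ^^ m) h)))"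
    by (subst lmult_commute[OF assms]) (simp add: lmult_assoc lmult_scale_left)
  also have "\<dots> = lscale (\<lambda>_. (- 1) ^ (Suc m * (a * b))) ((lmult w g ^^ Suc m) (lmult w f h))"
    by (simp add: Suc lmult_scale_right lscale_lscale power_add)
  finally show ?case .
qed simp

text \<open>Supercommutativity gives \<open>f f = - f f\<close>.\<close>

lemma lpar_odd_square:
  assumes "lpar w a f" "odd a"
  shows "lmult w f f = 0"
proof -
  have "lmult w f f = lscale (\<lambda>_. (- 1) ^ (a * a)) (lmult w f f)"
    by (rule lmult_commute[OF assms(1) assms(1)])
  then have "lmult w f f \<mu> v = - lmult w f f \<mu> v" for \<mu> v
    using assms(2) by (metis (no_types) even_mult_iff lscale_def mult_minus_left mult_1 uminus_power_if power_one)
  then show ?thesis by (simp add: fun_eq_iff zero_fun_apply)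
qed

text \<open>The analogue of \<open>gsign\<close> for the tail \<open>mpart\<close>: only the factors
  from \<open>k\<close> on have to be passed.\<close>

definition gsign_from :: "nat \<Rightarrow> (nat \<Rightarrow> nat) \<Rightarrow> nat \<Rightarrow> (nat \<Rightarrow> nat) \<Rightarrow> real" where
  "gsign_from k w i \<mu> = (if odd (w i) then (- 1) ^ card {j. k \<le> j \<and> j < i \<and> odd (w j) \<and> \<mu> j \<noteq> 0} else 1)"

lemma gsign_from_self: "gsign_from k w k \<mu> = 1"
proof -
  have "{j. k \<le> j \<and> j < k \<and> odd (w j) \<and> \<mu> j \<noteq> 0} = {}" by auto
  then show ?thesis unfolding gsign_from_def by (simp only: card.empty power_0 if_cancel)
qed

lemma gsign_from_Suc:
  assumes "k < i" "odd (w k) \<longrightarrow> \<mu> k \<le> 1"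
  shows "gsign_from k w i \<mu> = (- 1) ^ (\<mu> k * (w i * w k)) * gsign_from (Suc k) w i \<mu>"
proof -
  let ?B = "{j. Suc k \<le> j \<and> j < i \<and> odd (w j) \<and> \<mu> j \<noteq> 0}"
  have "{j. k \<le> j \<and> j < i \<and> odd (w j) \<and> \<mu> j \<noteq> 0} = (if odd (w k) \<and> \<mu> k \<noteq> 0 then insert k ?B else ?B)"
    using assms(1) by (auto simp: le_Suc_eq Suc_le_eq le_less)
  moreover have "finite ?B" "k \<notin> ?B" by auto
  ultimately have c: "card {j. k \<le> j \<and> j < i \<and> odd (w j) \<and> \<mu> j \<noteq> 0} =
      (if odd (w k) \<and> \<mu> k \<noteq> 0 then Suc (card ?B) else card ?B)"
    by simp
  show ?thesis
  proof (cases "odd (w k) \<and> \<mu> k \<noteq> 0")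
    case True
    then have "\<mu> k = 1" using assms(2) by auto
    then show ?thesis using True unfolding gsign_from_def c by (simp add: minus_one_power_iff)
  next
    case False
    then have "even (\<mu> k * (w i * w k))" by auto
    then show ?thesis using False unfolding gsign_from_def c by (simp only: minus_one_power_iff if_False if_True mult_1)
  qed
qed

lemma gsign_from_mono_ok: "mono_ok n N w \<mu> \<Longrightarrow> gsign_from n w i \<mu> = gsign w i \<mu>"
proof -
  assume "mono_ok n N w \<mu>"
  then have "{j. n \<le> j \<and> j < i \<and> odd (w j) \<and> \<mu> j \<noteq> 0} = {j. j < i \<and> odd (w j) \<and> \<mu> j \<noteq> 0}"
    by (auto simp: mono_ok_def)
  then show ?thesis by (simp add: gsign_def gsign_from_def)
qed

text \<open>Moving \<open>y_i\<close> past the factors \<open>k, ..., i - 1\<close> to its place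
  produces the sign; an odd factor that is already there squares to 0.\<close>

lemma lmult_mpart:
  assumes "k \<le> i" "i < N" "\<And>i. k \<le> i \<Longrightarrow> i < N \<Longrightarrow> lpar w (w' i) (y i)" "odd_ok w' \<nu>"
  shows "lmult w (y i) (mpart w N y k \<nu>) =
    (if odd (w' i) \<and> \<nu> i \<noteq> 0 then 0
     else lscale (\<lambda>_. gsign_from k w' i \<nu>) (mpart w N y k (\<nu>(i := \<nu> i + 1))))"
proof -
  have "k \<le> N" using assms by simp
  then show ?thesis using assms(1-3)
  proof (induction rule: inc_induct)
    case (step k)
    have ok: "odd (w' k) \<longrightarrow> \<nu> k \<le> 1" using assms(4) by (auto simp: odd_ok_def)
    show ?case
    proof (cases "i = k")
      case True
      have e: "mpart w N y (Suc k) (\<nu>(i := \<nu> i + 1)) = mpart w N y (Suc k) \<nu>"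
        by (rule mpart_cong) (auto simp: True)
      have l: "lmult w (y i) (mpart w N y k \<nu>) = mpart w N y k (\<nu>(i := \<nu> i + 1))"
        using step(2) e by (simp add: mpart_step True)
      show ?thesis
      proof (cases "odd (w' i) \<and> \<nu> i \<noteq> 0")
        case T: True
        then have "\<nu> k = 1" using ok True by auto
        then have "lmult w (y i) (mpart w N y k \<nu>) = lmult w (lmult w (y k) (y k)) (mpart w N y (Suc k) \<nu>)"
          using step(2) True by (simp add: mpart_step lmult_assoc)
        also have "lmult w (y k) (y k) = 0"
          using step(2) T True by (intro lpar_odd_square[OF step.prems(3)]) auto
        finally show ?thesis using T by simp
      next
        case False
        show ?thesis unfolding if_not_P[OF False] l by (simp add: True gsign_from_self)
      qed
    next
      case False
      then have ki: "k < i" using step.prems by simp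
      have IH: "lmult w (y i) (mpart w N y (Suc k) \<nu>) = (if odd (w' i) \<and> \<nu> i \<noteq> 0 then 0
        else lscale (\<lambda>_. gsign_from (Suc k) w' i \<nu>) (mpart w N y (Suc k) (\<nu>(i := \<nu> i + 1))))"
        using step ki by auto
      have "lmult w (y i) (mpart w N y k \<nu>) = lscale (\<lambda>_. (- 1) ^ (\<nu> k * (w' i * w' k)))
         ((lmult w (y k) ^^ \<nu> k) (lmult w (y i) (mpart w N y (Suc k) \<nu>)))"
        unfolding mpart_step[OF step(2)] using step ki by (intro lpar_swap_power) auto
      then show ?thesis
        unfolding IH using ki step(2) False ok
        by (simp add: power_zero lscale_power lscale_lscale mpart_step gsign_from_Suc)
    qed
  qed simp
qed

lemma lmult_mono_subst:
  assumes "n \<le> i" "i < N" "\<And>i. n \<le> i \<Longrightarrow> i < N \<Longrightarrow> lpar w (w' i) (y i)" "mono_ok n N w' \<nu>"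
  shows "lmult w (y i) (mono_subst w n N y \<nu>) =
    (if odd (w' i) \<and> \<nu> i \<noteq> 0 then 0
     else lscale (\<lambda>_. gsign w' i \<nu>) (mono_subst w n N y (\<nu>(i := \<nu> i + 1))))"
  using lmult_mpart[OF assms(1-3) mono_ok_odd_ok[OF assms(4)]] assms(4)
  by (simp add: mono_subst_mpart gsign_from_mono_ok)

section \<open>Linearity of substitution and its dependence on the data\<close>

lemma lsubst_eq:
  assumes "finite S" "\<And>\<nu>. f \<nu> (base_subst n y v) \<noteq> 0 \<Longrightarrow> \<nu> \<in> S"
  shows "lsubst w n N y f \<mu> v = (\<Sum>\<nu>\<in>S. f \<nu> (base_subst n y v) * mono_subst w n N y \<nu> \<mu> v)"
  unfolding lsubst_def using assms by (intro sum.mono_neutral_left) auto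

lemma lsubst_expand:
  assumes "finite S" "\<And>\<nu> v. f \<nu> v \<noteq> 0 \<Longrightarrow> \<nu> \<in> S"
  shows "lsubst w n N y f = (\<Sum>\<nu>\<in>S. lscale (\<lambda>v. f \<nu> (base_subst n y v)) (mono_subst w n N y \<nu>))"
  using assms by (intro ext) (auto simp: lsubst_eq[of S] sum_lfun_apply lscale_def)

lemma gdeg_finite:
  assumes "gpos n N w" "gdeg n N w f"
  obtains S where "finite S" "\<forall>\<nu> v. f \<nu> v \<noteq> 0 \<longrightarrow> \<nu> \<in> S" "\<forall>\<nu>\<in>S. mono_ok n N w \<nu>"
proof -
  obtain K where K: "bdeg n N w K f" using assms by (auto simp: gdeg_def)
  show thesis
    by (rule that[OF finite_bmono[OF assms(1), of K]]) (use K in \<open>auto simp: lsupp_def\<close>)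
qed

text \<open>The index set of the sum in \<open>lsubst\<close> depends on the function. Bounded
  degree provides a finite set that serves \<open>f\<close>, \<open>g\<close> and
  \<open>f + g\<close> at once.\<close>

lemma lsubst_add:
  assumes "gpos n N wY" "gdeg n N wY f" "gdeg n N wY g"
  shows "lsubst w n N y (f + g) = lsubst w n N y f + lsubst w n N y g"
proof -
  obtain S where "finite S" "\<forall>\<nu> v. f \<nu> v \<noteq> 0 \<longrightarrow> \<nu> \<in> S" "\<forall>\<nu>\<in>S. mono_ok n N wY \<nu>"
    by (rule gdeg_finite[OF assms(1,2)])
  note S = this(1) this(2,3)[rule_format]
  obtain T where "finite T" "\<forall>\<nu> v. g \<nu> v \<noteq> 0 \<longrightarrow> \<nu> \<in> T" "\<forall>\<nu>\<in>T. mono_ok n N wY \<nu>"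
    by (rule gdeg_finite[OF assms(1,3)])
  note T = this(1) this(2,3)[rule_format]
  have "(f + g) \<nu> v \<noteq> 0 \<Longrightarrow> \<nu> \<in> S \<union> T" for \<nu> v
    using S T by (auto simp: plus_fun_apply) (metis add_0)
  then have "lsubst w n N y (f + g) \<mu> v =
      (\<Sum>\<nu>\<in>S \<union> T. (f + g) \<nu> (base_subst n y v) * mono_subst w n N y \<nu> \<mu> v)" for \<mu> v
    using S T by (intro lsubst_eq) auto
  moreover have "lsubst w n N y f \<mu> v =
      (\<Sum>\<nu>\<in>S \<union> T. f \<nu> (base_subst n y v) * mono_subst w n N y \<nu> \<mu> v)" for \<mu> v
    using S T by (intro lsubst_eq) auto
  moreover have "lsubst w n N y g \<mu> v =
      (\<Sum>\<nu>\<in>S \<union> T. g \<nu> (base_subst n y v) * mono_subst w n N y \<nu> \<mu> v)" for \<mu> v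
    using S T by (intro lsubst_eq) auto
  ultimately show ?thesis
    by (simp add: fun_eq_iff plus_fun_apply algebra_simps sum.distrib)
qed

lemma lsubst_zero [simp]: "lsubst w n N y 0 = 0"
  by (simp add: lsubst_def fun_eq_iff zero_fun_apply)

text \<open>Where \<open>h\<close> is nonzero the index set of the sum is unchanged; where it is 0
  both sides vanish.\<close>

lemma lsubst_scale:
  "lsubst w n N y (lscale h f) = lscale (\<lambda>v. h (base_subst n y v)) (lsubst w n N y f)"
proof (intro ext)
  fix \<mu> v
  show "lsubst w n N y (lscale h f) \<mu> v = lscale (\<lambda>v. h (base_subst n y v)) (lsubst w n N y f) \<mu> v"
  proof (cases "h (base_subst n y v) = 0")
    case False
    then show ?thesis by (simp add: lsubst_def lscale_def sum_distrib_left mult.assoc)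
  qed (simp add: lsubst_def lscale_def)
qed

lemma lsubst_sum:
  assumes "gpos n N wY" "\<And>i. i \<in> I \<Longrightarrow> gdeg n N wY (f i)"
  shows "lsubst w n N y (sum f I) = (\<Sum>i\<in>I. lsubst w n N y (f i))"
  using assms(2)
proof (induction I rule: infinite_finite_induct)
  case (insert x F)
  then have "lsubst w n N y (f x + sum f F) = lsubst w n N y (f x) + lsubst w n N y (sum f F)"
    by (intro lsubst_add[OF assms(1)] gdeg_sum) auto
  then show ?case using insert by simp
qed simp_all

lemma lsubst_lmono: "lsubst w n N y (lmono \<nu>) = mono_subst w n N y \<nu>"
proof (intro ext)
  fix \<mu> v
  show "lsubst w n N y (lmono \<nu>) \<mu> v = mono_subst w n N y \<nu> \<mu> v"
    by (subst lsubst_eq[of "{\<nu>}"]) (auto simp: lmono_def split: if_splits)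
qed

lemma lsubst_lone [simp]: "lsubst w n N y lone = lone"
proof -
  have "foldr (\<lambda>i. lmult w (y i) ^^ 0) xs lone = lone" for xs :: "nat list"
    by (induction xs) auto
  then show ?thesis
    using lsubst_lmono[of w n N y "\<lambda>_. 0"] by (simp add: mono_subst_def lmono_zero)
qed

text \<open>Products are formed pointwise in the base point, so the value at \<open>v\<close> uses
  only the values of the \<open>y_i\<close> at \<open>v\<close>, and of the fibre coordinates only
  those that occur in \<open>f\<close> there.\<close>

lemma lsubst_cong_at:
  assumes "\<And>\<nu>. f \<nu> (base_subst n y v) = f' \<nu> (base_subst n y v)"
    and b: "\<And>i. i < n \<Longrightarrow> y i (\<lambda>_. 0) v = y' i (\<lambda>_. 0) v"
    and "\<And>i \<nu>. n \<le> i \<Longrightarrow> i < N \<Longrightarrow> f \<nu> (base_subst n y v) \<noteq> 0 \<Longrightarrow> \<nu> i \<noteq> 0 \<Longrightarrow> (\<forall>\<mu>. y i \<mu> v = y' i \<mu> v)"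
  shows "lsubst w n N y f \<mu> v = lsubst w n N y' f' \<mu> v"
proof -
  have bs: "base_subst n y v = base_subst n y' v"
    using b by (auto simp: base_subst_def)
  have pw: "((lmult w (y i) ^^ m) g) \<mu> v = ((lmult w (y' i) ^^ m) g') \<mu> v"
    if "m = 0 \<or> (\<forall>\<mu>. y i \<mu> v = y' i \<mu> v)" "\<And>\<mu>. g \<mu> v = g' \<mu> v" for i m g g' \<mu>
    using that(1)
  proof (induction m arbitrary: \<mu>)
    case (Suc m)
    then show ?case by (auto intro!: lmult_cong_at)
  qed (simp add: that)
  have fr: "foldr (\<lambda>i. lmult w (y i) ^^ \<nu> i) xs lone \<mu> v = foldr (\<lambda>i. lmult w (y' i) ^^ \<nu> i) xs lone \<mu> v"
    if "\<And>i. i \<in> set xs \<Longrightarrow> \<nu> i = 0 \<or> (\<forall>\<mu>. y i \<mu> v = y' i \<mu> v)" for xs \<mu> \<nu>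
    using that
  proof (induction xs arbitrary: \<mu>)
    case (Cons a xs)
    have "(lmult w (y a) ^^ \<nu> a) (foldr (\<lambda>i. lmult w (y i) ^^ \<nu> i) xs lone) \<mu> v =
      (lmult w (y' a) ^^ \<nu> a) (foldr (\<lambda>i. lmult w (y' i) ^^ \<nu> i) xs lone) \<mu> v"
      using Cons.prems[of a] by (intro pw Cons) (auto intro: Cons)
    then show ?case by simp
  qed simp
  have "mono_subst w n N y \<nu> \<mu> v = mono_subst w n N y' \<nu> \<mu> v" if "f \<nu> (base_subst n y v) \<noteq> 0" for \<nu>
    unfolding mono_subst_def using assms(3)[OF _ _ that] by (intro fr) auto
  then show ?thesis unfolding lsubst_def using assms(1) by (intro sum.cong) (auto simp: bs)
qed

subsection \<open>Substitution is multiplicative\<close>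

text \<open>Signs see only the parities of the \<open>y_i\<close>, hence \<open>lpar\<close> and not
  \<open>hdeg\<close>. Substitutions that preserve degrees are described by
  \<open>csub\<close>.\<close>

definition good_subst :: "nat \<Rightarrow> nat \<Rightarrow> (nat \<Rightarrow> nat) \<Rightarrow> (nat \<Rightarrow> nat) \<Rightarrow> (nat \<Rightarrow> lfun) \<Rightarrow> bool" where
  "good_subst n N wY w y \<longleftrightarrow> gpos n N wY \<and> (\<forall>i. n \<le> i \<and> i < N \<longrightarrow> lpar w (wY i) (y i))"

lemma good_substD:
  assumes "good_subst n N wY w y"
  shows "gpos n N wY" "n \<le> i \<Longrightarrow> i < N \<Longrightarrow> lpar w (wY i) (y i)"
  using assms by (auto simp: good_subst_def)

lemma lok_mono_subst: "lok w (mono_subst w n N y \<nu>)"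
  by (simp add: mono_subst_mpart lok_mpart)

lemma lok_lsubst: "lok w (lsubst w n N y f)"
  unfolding lsupp_def
proof (intro allI impI)
  fix \<mu> v assume "lsubst w n N y f \<mu> v \<noteq> 0"
  then obtain \<nu> where "mono_subst w n N y \<nu> \<mu> v \<noteq> 0"
    unfolding lsubst_def by (metis (mono_tags, lifting) mult_zero_right sum.not_neutral_contains_not_neutral)
  then show "fsupp \<mu> \<and> odd_ok w \<mu>" using lok_mono_subst lsuppD by blast
qed

lemma lmult_lvar_lmono:
  assumes "n \<le> i" "mono_ok n N w \<nu>"
  shows "lmult w (lvar n i) (lmono \<nu>) =
    (if odd (w i) \<and> \<nu> i \<noteq> 0 then 0 else lscale (\<lambda>_. gsign w i \<nu>) (lmono (\<nu>(i := \<nu> i + 1))))"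
proof (intro ext)
  fix \<mu> v
  have l: "lok w (lmono \<nu>)" using assms by (auto simp: lsupp_def lmono_def mono_ok_fsupp mono_ok_odd_ok)
  have e: "\<mu>(i := \<mu> i - 1) = \<nu> \<and> \<mu> i \<noteq> 0 \<longleftrightarrow> \<mu> = \<nu>(i := \<nu> i + 1)" by (auto simp: fun_upd_def)
  have o: "odd_ok w (\<nu>(i := \<nu> i + 1)) \<longleftrightarrow> \<not> (odd (w i) \<and> \<nu> i \<noteq> 0)"
    using mono_ok_odd_ok[OF assms(2)] by (auto simp: odd_ok_def)
  have g: "gsign w i (\<nu>(i := \<nu> i + 1)) = gsign w i \<nu>"
    unfolding gsign_def by (rule if_cong[OF refl _ refl], rule arg_cong[of _ _ "\<lambda>S. (- 1) ^ card S"]) auto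
  show "lmult w (lvar n i) (lmono \<nu>) \<mu> v =
    (if odd (w i) \<and> \<nu> i \<noteq> 0 then 0 else lscale (\<lambda>_. gsign w i \<nu>) (lmono (\<nu>(i := \<nu> i + 1)))) \<mu> v"
  proof (cases "\<mu> = \<nu>(i := \<nu> i + 1)")
    case True
    show ?thesis
      unfolding lmult_lvar[OF l assms(1)] True o
      by (auto simp: lmono_def lscale_def g[simplified] zero_fun_apply)
  next
    case False
    then have "\<mu> i = 0 \<or> \<mu>(i := \<mu> i - 1) \<noteq> \<nu>" using e by blast
    then show ?thesis
      unfolding lmult_lvar[OF l assms(1)] using False by (auto simp: lmono_def lscale_def zero_fun_apply)
  qed
qed

text \<open>On a monomial both sides carry the same sign \<open>gsign\<close>, or vanish together if
  an odd coordinate is repeated. Linearity over base functions does the rest.\<close>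

lemma lsubst_lmult_lvar:
  assumes g: "good_subst n N wY w y" and f: "gdeg n N wY f" and i: "n \<le> i" "i < N"
  shows "lsubst w n N y (lmult wY (lvar n i) f) = lmult w (y i) (lsubst w n N y f)"
proof -
  note pos = good_substD(1)[OF g]
  obtain S where "finite S" "\<forall>\<nu> v. f \<nu> v \<noteq> 0 \<longrightarrow> \<nu> \<in> S" "\<forall>\<nu>\<in>S. mono_ok n N wY \<nu>"
    by (rule gdeg_finite[OF pos f])
  note S = this(1) this(2,3)[rule_format]
  have *: "lsubst w n N y (lmult wY (lvar n i) (lmono \<nu>)) = lmult w (y i) (mono_subst w n N y \<nu>)"
    if "mono_ok n N wY \<nu>" for \<nu>
    using lmult_mono_subst[OF i good_substD(2)[OF g] that] i that
    by (simp add: lmult_lvar_lmono lsubst_scale lsubst_lmono)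
  have e: "f = (\<Sum>\<nu>\<in>S. lscale (f \<nu>) (lmono \<nu>))" by (rule lmono_expand) (use S in auto)
  have gm: "gdeg n N wY (lmono \<nu>)" if "\<nu> \<in> S" for \<nu>
    using lmono_hdeg[OF S(3)[OF that]] by (rule hdeg_gdeg)
  have gv: "gdeg n N wY (lvar n i)" using hdeg_lvar[OF i] by (rule hdeg_gdeg)
  have "lsubst w n N y (lmult wY (lvar n i) f) =
    lsubst w n N y (\<Sum>\<nu>\<in>S. lscale (f \<nu>) (lmult wY (lvar n i) (lmono \<nu>)))"
    by (subst e) (simp add: lmult_sum_right lmult_scale_right)
  also have "\<dots> = (\<Sum>\<nu>\<in>S. lscale (\<lambda>v. f \<nu> (base_subst n y v)) (lmult w (y i) (mono_subst w n N y \<nu>)))"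
    using gm gv S(3) by (subst lsubst_sum[OF pos]) (auto intro!: gdeg_scale gdeg_lmult simp: lsubst_scale *)
  also have "\<dots> = lmult w (y i) (lsubst w n N y f)"
    using S by (subst lsubst_expand[of S]) (auto simp: lmult_sum_right lmult_scale_right)
  finally show ?thesis .
qed

text \<open>The coordinates are multiplied on from the left in decreasing order, so none has to pass
  an odd one and all signs are 1.\<close>

lemma mpart_lvar:
  assumes "odd_ok w \<nu>" "n \<le> k" "k \<le> N"
  shows "mpart w N (lvar n) k \<nu> = lmono (\<lambda>i. if k \<le> i \<and> i < N then \<nu> i else 0)"
  using assms(3,2)
proof (induction rule: inc_induct)
  case base
  then show ?case by (auto simp: mpart_end lmono_zero[symmetric] intro!: arg_cong[of _ _ lmono])
next
  case (step k)
  let ?r = "\<lambda>m i. if i = k then m else if Suc k \<le> i \<and> i < N then \<nu> i else 0 :: nat"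
  have "(lmult w (lvar n k) ^^ m) (lmono (?r 0)) = lmono (?r m)" if "m \<le> \<nu> k" for m
    using that
  proof (induction m)
    case (Suc m)
    have ok: "mono_ok n N w (?r m)"
      using Suc.prems step assms(1) by (auto simp: mono_ok_def odd_ok_def)
    have g: "gsign w k (?r m) = 1"
    proof -
      have "{j. j < k \<and> odd (w j) \<and> ?r m j \<noteq> 0} = {}" by auto
      then show ?thesis unfolding gsign_def by (simp only: card.empty power_0 if_cancel)
    qed
    have "\<not> (odd (w k) \<and> ?r m k \<noteq> 0)"
      using Suc.prems spec[OF assms(1)[unfolded odd_ok_def], of k] by auto
    then have "lmult w (lvar n k) (lmono (?r m)) = lmono ((?r m)(k := ?r m k + 1))"
      using lmult_lvar_lmono[OF _ ok, of k] step g by auto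
    also have "(?r m)(k := ?r m k + 1) = ?r (Suc m)" by auto
    finally show ?case using Suc by simp
  qed simp
  moreover have "?r 0 = (\<lambda>i. if Suc k \<le> i \<and> i < N then \<nu> i else 0)"
    "?r (\<nu> k) = (\<lambda>i. if k \<le> i \<and> i < N then \<nu> i else 0)"
    using step(2) by (auto simp: fun_eq_iff)
  ultimately show ?case
    using step by (simp add: mpart_step)
qed

lemma mono_subst_lvar:
  assumes "mono_ok n N w \<nu>" "n \<le> N"
  shows "mono_subst w n N (lvar n) \<nu> = lmono \<nu>"
proof -
  have "(\<lambda>i. if n \<le> i \<and> i < N then \<nu> i else 0) = \<nu>"
    using mono_okD[OF assms(1)] by (intro ext) (metis gr_zeroI)
  then show ?thesis
    using mpart_lvar[OF mono_ok_odd_ok[OF assms(1)] order.refl assms(2)] by (simp add: mono_subst_mpart)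
qed

text \<open>By associativity, multiplication by a monomial is repeated multiplication by
  coordinates, where \<open>lsubst_lmult_lvar\<close> applies.\<close>

lemma lsubst_mpart_lmult:
  assumes g: "good_subst n N wY w y" and f: "gdeg n N wY f" and k: "n \<le> k" "k \<le> N"
  shows "lsubst w n N y (lmult wY (mpart wY N (lvar n) k \<nu>) f) = lmult w (mpart w N y k \<nu>) (lsubst w n N y f)"
  using k(2,1)
proof (induction rule: inc_induct)
  case base
  then show ?case using f by (simp add: mpart_end lmult_lone_left gdeg_lok lok_lsubst)
next
  case (step k)
  have gm: "gdeg n N wY (mpart wY N (lvar n) j \<nu>)" if "n \<le> j" for j
    by (rule hdeg_gdeg, rule hdeg_mpart[where w' = wY]) (use that in \<open>auto intro: hdeg_lvar\<close>)
  have "lsubst w n N y (lmult wY ((lmult wY (lvar n k) ^^ m) (mpart wY N (lvar n) (Suc k) \<nu>)) f)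
     = lmult w ((lmult w (y k) ^^ m) (mpart w N y (Suc k) \<nu>)) (lsubst w n N y f)
     \<and> gdeg n N wY ((lmult wY (lvar n k) ^^ m) (mpart wY N (lvar n) (Suc k) \<nu>))" for m
  proof (induction m)
    case 0
    then show ?case using step gm by auto
  next
    case (Suc m)
    let ?X = "(lmult wY (lvar n k) ^^ m) (mpart wY N (lvar n) (Suc k) \<nu>)"
    have "gdeg n N wY (lmult wY ?X f)" using Suc f by (auto intro: gdeg_lmult)
    from lsubst_lmult_lvar[OF g this, of k] show ?case
      using Suc step by (auto simp: lmult_assoc intro!: gdeg_lmult hdeg_gdeg[OF hdeg_lvar])
  qed
  then show ?case using step by (simp add: mpart_step)
qed

theorem lsubst_lmult:
  assumes g: "good_subst n N wY w y" and f: "gdeg n N wY f" and h: "gdeg n N wY h" and nN: "n \<le> N"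
  shows "lsubst w n N y (lmult wY f h) = lmult w (lsubst w n N y f) (lsubst w n N y h)"
proof -
  note pos = good_substD(1)[OF g]
  obtain S where "finite S" "\<forall>\<nu> v. f \<nu> v \<noteq> 0 \<longrightarrow> \<nu> \<in> S" "\<forall>\<nu>\<in>S. mono_ok n N wY \<nu>"
    by (rule gdeg_finite[OF pos f])
  note S = this(1) this(2,3)[rule_format]
  have e: "f = (\<Sum>\<nu>\<in>S. lscale (f \<nu>) (lmono \<nu>))" by (rule lmono_expand) (use S in auto)
  have gm: "gdeg n N wY (lmono \<nu>)" if "\<nu> \<in> S" for \<nu>
    using lmono_hdeg[OF S(3)[OF that]] by (rule hdeg_gdeg)
  have *: "lsubst w n N y (lmult wY (lmono \<nu>) h) = lmult w (mono_subst w n N y \<nu>) (lsubst w n N y h)" if "\<nu> \<in> S" for \<nu>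
    using lsubst_mpart_lmult[OF g h, of n \<nu>] nN mono_subst_lvar[OF S(3)[OF that]] by (simp add: mono_subst_mpart)
  have "lsubst w n N y (lmult wY f h) =
    lsubst w n N y (\<Sum>\<nu>\<in>S. lscale (f \<nu>) (lmult wY (lmono \<nu>) h))"
    by (subst e) (simp add: lmult_sum_left lmult_scale_left)
  also have "\<dots> = (\<Sum>\<nu>\<in>S. lscale (\<lambda>v. f \<nu> (base_subst n y v)) (lmult w (mono_subst w n N y \<nu>) (lsubst w n N y h)))"
    using gm h by (subst lsubst_sum[OF pos]) (auto intro!: gdeg_scale gdeg_lmult simp: lsubst_scale *)
  also have "\<dots> = lmult w (lsubst w n N y f) (lsubst w n N y h)"
    using S by (subst lsubst_expand[of S f]) (auto simp: lmult_sum_left lmult_scale_left)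
  finally show ?thesis .
qed

lemma lsubst_mono_subst:
  assumes g: "good_subst n N wY w y" and nN: "n \<le> N"
    and z: "\<And>i. n \<le> i \<Longrightarrow> i < N' \<Longrightarrow> gdeg n N wY (z i)"
  shows "lsubst w n N y (mono_subst wY n N' z \<nu>) = mono_subst w n N' (\<lambda>i. lsubst w n N y (z i)) \<nu>
    \<and> gdeg n N wY (mono_subst wY n N' z \<nu>)"
proof -
  have "lsubst w n N y (mpart wY N' z k \<nu>) = mpart w N' (\<lambda>i. lsubst w n N y (z i)) k \<nu>
      \<and> gdeg n N wY (mpart wY N' z k \<nu>)" if "k \<le> N'" "n \<le> k" for k
    using that
  proof (induction rule: inc_induct)
    case base
    then show ?case using hdeg_gdeg[OF hdeg_lone] by (simp add: mpart_end)
  next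
    case (step k)
    have "lsubst w n N y ((lmult wY (z k) ^^ m) f) = (lmult w (lsubst w n N y (z k)) ^^ m) (lsubst w n N y f)
        \<and> gdeg n N wY ((lmult wY (z k) ^^ m) f)" if "gdeg n N wY f" for m f
      by (induction m) (use that z[of k] step in \<open>auto simp: lsubst_lmult[OF g _ _ nN] intro: gdeg_lmult\<close>)
    then show ?case using step by (simp add: mpart_step)
  qed
  moreover have "mono_subst wY n N' z \<nu> = lone \<and> mono_subst w n N' (\<lambda>i. lsubst w n N y (z i)) \<nu> = lone" if "N' < n"
    using that by (simp add: mono_subst_mpart mpart_end)
  ultimately show ?thesis
    using hdeg_gdeg[OF hdeg_lone] by (cases "n \<le> N'") (auto simp: mono_subst_mpart)
qed

text \<open>With positive weights only the empty monomial has degree 0, so a function of degree 0 is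
  an ordinary function on the base.\<close>

lemma hdeg_0_eq:
  assumes "hdeg n N w 0 f" "gpos n N w"
  shows "f = lscale (f (\<lambda>_. 0)) lone"
proof (intro ext)
  fix \<mu> v
  show "f \<mu> v = lscale (f (\<lambda>_. 0)) lone \<mu> v"
  proof (cases "\<mu> = (\<lambda>_. 0)")
    case False
    then obtain i where i: "\<mu> i \<noteq> 0" by auto
    have "f \<mu> v = 0"
    proof (rule ccontr)
      assume "f \<mu> v \<noteq> 0"
      then have *: "mono_ok n N w \<mu>" "mono_deg N w \<mu> = 0" using lsuppD[OF assms(1)] by auto
      then have "n \<le> i" "i < N" using i by (auto simp: mono_ok_def)
      then have "w i * \<mu> i = 0" using *(2) by (auto simp: mono_deg_def)
      then show False using \<open>n \<le> i\<close> \<open>i < N\<close> assms(2) i by (auto simp: gpos_def)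
    qed
    then show ?thesis using False by (simp add: lscale_def lone_def)
  qed (simp add: lscale_def lone_def)
qed

lemma base_subst_comp:
  assumes "\<And>i. i < n \<Longrightarrow> hdeg n N wY 0 (z i)" "gpos n N wY" "i < n"
  shows "lsubst w n N y (z i) = lscale (\<lambda>v. base_subst n z (base_subst n y v) i) lone"
  by (subst hdeg_0_eq[OF assms(1)[OF assms(3)] assms(2)])
    (simp add: lsubst_scale, simp add: base_subst_def assms(3))

text \<open>Functoriality. Coefficients are composed with the base maps, which compose because the
  components \<open>z_i\<close> with \<open>i < n\<close> have degree 0; monomials are handled by
  multiplicativity.\<close>

theorem lsubst_lsubst:
  assumes g: "good_subst n N wY w y" and nN: "n \<le> N"
    and z: "\<And>i. n \<le> i \<Longrightarrow> i < N' \<Longrightarrow> gdeg n N wY (z i)" and z0: "\<And>i. i < n \<Longrightarrow> hdeg n N wY 0 (z i)"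
    and f: "gdeg n N' wZ f" "gpos n N' wZ"
  shows "lsubst w n N y (lsubst wY n N' z f) = lsubst w n N' (\<lambda>i. lsubst w n N y (z i)) f"
proof -
  note pos = good_substD(1)[OF g]
  obtain S where "finite S" "\<forall>\<nu> v. f \<nu> v \<noteq> 0 \<longrightarrow> \<nu> \<in> S" "\<forall>\<nu>\<in>S. mono_ok n N' wZ \<nu>"
    by (rule gdeg_finite[OF f(2,1)])
  note S = this(1) this(2,3)[rule_format]
  have b: "base_subst n (\<lambda>i. lsubst w n N y (z i)) v = base_subst n z (base_subst n y v)" for v
  proof
    fix i
    show "base_subst n (\<lambda>i. lsubst w n N y (z i)) v i = base_subst n z (base_subst n y v) i"
    proof (cases "i < n")
      case True
      have "lsubst w n N y (z i) (\<lambda>_. 0) v = base_subst n z (base_subst n y v) i"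
        by (subst base_subst_comp[OF z0 pos True]) (simp_all add: lscale_def lone_def)
      then show ?thesis using True by (simp add: base_subst_def)
    qed (simp add: base_subst_def)
  qed
  have "lsubst w n N y (lsubst wY n N' z f) =
    (\<Sum>\<nu>\<in>S. lsubst w n N y (lscale (\<lambda>v. f \<nu> (base_subst n z v)) (mono_subst wY n N' z \<nu>)))"
    using S lsubst_mono_subst[OF g nN z]
    by (subst lsubst_expand[of S f]) (auto simp: lsubst_sum[OF pos] gdeg_scale)
  also have "\<dots> = (\<Sum>\<nu>\<in>S. lscale (\<lambda>v. f \<nu> (base_subst n z (base_subst n y v)))
      (mono_subst w n N' (\<lambda>i. lsubst w n N y (z i)) \<nu>))"
    using lsubst_mono_subst[OF g nN z] by (simp add: lsubst_scale)
  also have "\<dots> = lsubst w n N' (\<lambda>i. lsubst w n N y (z i)) f"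
    using S by (subst lsubst_expand[of S f]) (auto simp: b)
  finally show ?thesis .
qed

lemma lsubst_lvar:
  assumes "n \<le> i" "i < N" "lok w (y i)"
  shows "lsubst w n N y (lvar n i) = y i"
proof -
  have "lvar n i = lmono ((\<lambda>_. 0)(i := 1))" using assms by (simp add: lvar_def lmono_def)
  moreover have "foldr (\<lambda>j. lmult w (y j) ^^ ((\<lambda>_. 0)(i := 1)) j) xs lone = (if i \<in> set xs then y i else lone)"
    if "distinct xs" for xs
    using that by (induction xs) (auto simp: lmult_lone_right assms)
  ultimately show ?thesis using assms by (simp add: lsubst_lmono mono_subst_def)
qed

lemma lvar_base: "i < n \<Longrightarrow> lvar n i = lscale (\<lambda>v. v i) lone"
  by (auto simp: lvar_def lscale_def lone_def fun_eq_iff)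

lemma lsubst_lvar_base:
  assumes "i < n"
  shows "lsubst w n N y (lvar n i) = lscale (y i (\<lambda>_. 0)) lone"
  by (simp add: lvar_base[OF assms] lsubst_scale) (simp add: base_subst_def assms)

text \<open>\<open>base_subst\<close> puts 0 at the indices from \<open>n\<close> on, so the
  identity substitution fixes exactly the points whose entries vanish there; points of charts
  do.\<close>

lemma lsubst_lvar_id:
  assumes "gdeg n N w f" "gpos n N w" "n \<le> N" "N \<le> N'" "\<And>i. i \<ge> n \<Longrightarrow> v i = 0"
  shows "lsubst w n N' (lvar n) f \<mu> v = f \<mu> v"
proof -
  obtain S where "finite S" "\<forall>\<nu> v. f \<nu> v \<noteq> 0 \<longrightarrow> \<nu> \<in> S" "\<forall>\<nu>\<in>S. mono_ok n N w \<nu>"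
    by (rule gdeg_finite[OF assms(2,1)])
  note S = this(1) this(2,3)[rule_format]
  have b: "base_subst n (lvar n) v = v" using assms by (auto simp: base_subst_def lvar_def)
  have m: "mono_ok n N' w \<nu>" if "mono_ok n N w \<nu>" for \<nu>
    using that assms(4) by (auto simp: mono_ok_def) (meson order_less_le_trans)
  have "lsubst w n N' (lvar n) f \<mu> v = (\<Sum>\<nu>\<in>S. f \<nu> v * lmono \<nu> \<mu> v)"
    using S b m assms by (subst lsubst_eq[of S]) (auto simp: mono_subst_lvar)
  also have "\<dots> = (\<Sum>\<nu>\<in>S. lscale (f \<nu>) (lmono \<nu>)) \<mu> v" by (simp add: sum_lfun_apply lscale_def)
  also have "\<dots> = f \<mu> v" using lmono_expand[of S f] S by metis
  finally show ?thesis .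
qed

lemma mono_subst_trunc:
  assumes "\<And>i. N \<le> i \<Longrightarrow> \<nu> i = 0" "n \<le> N" "N \<le> N'"
  shows "mono_subst w n N' y \<nu> = mono_subst w n N y \<nu>"
proof -
  have "[n..<N'] = [n..<N] @ [N..<N']" using assms by (metis le_Suc_ex upt_add_eq_append)
  moreover have "foldr (\<lambda>i. lmult w (y i) ^^ \<nu> i) [N..<N'] lone = lone"
  proof -
    have "foldr (\<lambda>i. lmult w (y i) ^^ \<nu> i) xs lone = lone" if "\<forall>i\<in>set xs. \<nu> i = 0" for xs
      using that by (induct xs) auto
    then show ?thesis using assms(1) by simp
  qed
  ultimately show ?thesis by (simp add: mono_subst_def)
qed

lemma lsubst_trunc:
  assumes f: "gdeg n N w' f" and N: "n \<le> N" "N \<le> N'"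
  shows "lsubst w n N' y f = lsubst w n N y f"
proof -
  obtain K where K: "bdeg n N w' K f" using f unfolding gdeg_def by (rule exE)
  have "mono_subst w n N' y \<nu> = mono_subst w n N y \<nu>" if "f \<nu> v \<noteq> 0" for \<nu> v
  proof (rule mono_subst_trunc[OF _ N])
    fix i assume "N \<le> i"
    have "mono_ok n N w' \<nu>" using lsuppD[OF K that] by (rule conjunct1)
    then show "\<nu> i = 0" using \<open>N \<le> i\<close> mono_okD leD by blast
  qed
  then show ?thesis
    unfolding lsubst_def by (intro ext sum.cong refl) simp
qed

subsection \<open>Smooth functions on open subsets of Euclidean space\<close>

text \<open>Entries from \<open>n\<close> on vanish throughout the space, so only finitely many
  coordinates constrain a point and a cube fits into each neighbourhood.\<close>

lemma openin_box:
  assumes "openin (Euclidean_space n) V" "v \<in> V"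
  obtains e where "e > 0" "\<And>u. (\<forall>i\<ge>n. u i = 0) \<Longrightarrow> (\<forall>i<n. \<bar>u i - v i\<bar> < e) \<Longrightarrow> u \<in> V"
proof -
  obtain T where T: "openin (powertop_real UNIV) T" "V = T \<inter> {x. \<forall>i\<ge>n. x i = 0}"
    using assms(1) unfolding Euclidean_space_def openin_subtopology by blast
  then obtain U where U: "finite {i. U i \<noteq> UNIV}" "\<And>i. open (U i)" "v \<in> Pi\<^sub>E UNIV U" "Pi\<^sub>E UNIV U \<subseteq> T"
    using assms(2) unfolding openin_product_topology_alt by force
  have "\<exists>e>0. \<forall>x. \<bar>x - v i\<bar> < e \<longrightarrow> x \<in> U i" for i
    using U(2)[of i] U(3) by (auto simp: open_dist dist_real_def)
  then obtain d where d: "\<And>i. d i > 0" "\<And>i x. \<bar>x - v i\<bar> < d i \<Longrightarrow> x \<in> U i" by metis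
  define e where "e = Min (insert 1 (d ` {..<n}))"
  have e: "e > 0" "\<And>i. i < n \<Longrightarrow> e \<le> d i"
    unfolding e_def by (auto simp: d)
  show thesis
  proof (rule that[OF e(1)])
    fix u :: "nat \<Rightarrow> real"
    assume u: "\<forall>i\<ge>n. u i = 0" "\<forall>i<n. \<bar>u i - v i\<bar> < e"
    have "u i \<in> U i" for i
    proof (cases "i < n")
      case True
      then show ?thesis using u(2) e(2)[of i] d(2)[of "u i" i] by auto
    next
      case False
      then have "u i = v i" using u(1) assms(2) T(2) by auto
      then show ?thesis using d by simp
    qed
    then show "u \<in> V" using U(4) T(2) u(1) by auto
  qed
qed

lemma open_zero: "openin (Euclidean_space n) V \<Longrightarrow> v \<in> V \<Longrightarrow> i \<ge> n \<Longrightarrow> v i = 0"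
  using openin_subset topspace_Euclidean_space by fastforce

lemma openin_line:
  assumes "openin (Euclidean_space n) V" "v \<in> V" "i < n"
  shows "\<forall>\<^sub>F t in nhds (v i). v(i := t) \<in> V"
proof -
  obtain e where e: "e > 0" "\<And>u. (\<forall>i\<ge>n. u i = 0) \<Longrightarrow> (\<forall>i<n. \<bar>u i - v i\<bar> < e) \<Longrightarrow> u \<in> V"
    using openin_box[OF assms(1,2)] by metis
  have "v(i := t) \<in> V" if "dist t (v i) < e" for t
    using that assms open_zero[OF assms(1,2)] e(1) by (intro e(2)) (auto simp: dist_real_def)
  then show ?thesis
    using e(1) by (auto simp: eventually_nhds_metric)
qed

lemma pdiff_cong:
  assumes "openin (Euclidean_space n) V" "v \<in> V" "i < n" "\<And>u. u \<in> V \<Longrightarrow> h u = k u"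
  shows "pdiff i h v = pdiff i k v"
  unfolding pdiff_def
  by (rule deriv_cong_ev) (use openin_line[OF assms(1-3)] assms(4) in \<open>auto elim!: eventually_mono\<close>)

abbreviation differentiable_along :: "nat \<Rightarrow> ((nat \<Rightarrow> real) \<Rightarrow> real) \<Rightarrow> (nat \<Rightarrow> real) \<Rightarrow> bool" where
  "differentiable_along i h v \<equiv> (\<lambda>t. h (v(i := t))) differentiable (at (v i))"

lemma differentiable_along_cong:
  assumes "openin (Euclidean_space n) V" "v \<in> V" "i < n" "\<And>u. u \<in> V \<Longrightarrow> h u = k u"
    and "differentiable_along i h v"
  shows "differentiable_along i k v"
proof -
  obtain D where "((\<lambda>t. h (v(i := t))) has_real_derivative D) (at (v i))"
    using assms(5) by (auto simp: real_differentiable_def)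
  moreover have "\<forall>\<^sub>F t in nhds (v i). h (v(i := t)) = k (v(i := t))"
    using openin_line[OF assms(1-3)] assms(4) by (auto elim!: eventually_mono)
  ultimately have "((\<lambda>t. k (v(i := t))) has_real_derivative D) (at (v i))"
    by (subst DERIV_cong_ev[OF refl _ refl, symmetric])
  then show ?thesis by (auto simp: real_differentiable_def)
qed

lemma DERIV_pdiff:
  "differentiable_along i h v \<Longrightarrow> ((\<lambda>t. h (v(i := t))) has_real_derivative pdiff i h v) (at (v i))"
  unfolding pdiff_def using DERIV_deriv_iff_real_differentiable by blast

lemma pdiff_eqI: "((\<lambda>t. h (v(i := t))) has_real_derivative D) (at (v i)) \<Longrightarrow> pdiff i h v = D"
  unfolding pdiff_def by (rule DERIV_imp_deriv)

lemma pdiff_const: "pdiff i (\<lambda>_. c) = (\<lambda>_. 0)"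
  by (auto intro!: pdiff_eqI derivative_eq_intros)

lemma smooth_funD:
  assumes "smooth_fun n V h"
  shows "continuous_map (subtopology (Euclidean_space n) V) euclideanreal h"
    and "v \<in> V \<Longrightarrow> i < n \<Longrightarrow> differentiable_along i h v"
    and "i < n \<Longrightarrow> smooth_fun n V (pdiff i h)"
proof -
  show "continuous_map (subtopology (Euclidean_space n) V) euclideanreal h"
    using assms unfolding smooth_fun_def by (metis empty_iff empty_set foldr_Nil id_apply subsetI)
  show "v \<in> V \<Longrightarrow> i < n \<Longrightarrow> differentiable_along i h v"
    using assms unfolding smooth_fun_def by (metis empty_iff empty_set foldr_Nil id_apply subsetI)
  assume "i < n"
  then show "smooth_fun n V (pdiff i h)"
    unfolding smooth_fun_def
  proof (intro allI impI)
    fix js assume "set js \<subseteq> {..<n}"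
    then have "set (js @ [i]) \<subseteq> {..<n}" using \<open>i < n\<close> by simp
    from assms[unfolded smooth_fun_def, rule_format, OF this]
    show "continuous_map (subtopology (Euclidean_space n) V) euclideanreal (foldr pdiff js (pdiff i h)) \<and>
        (\<forall>v\<in>V. \<forall>ia<n. differentiable_along ia (foldr pdiff js (pdiff i h)) v)"
      by simp
  qed
qed

text \<open>Coinduction for the quantifier over iterated derivatives. A derivative has to agree with
  a member of \<open>P\<close> on \<open>V\<close> only, because outside \<open>V\<close>
  \<open>pdiff\<close> may return arbitrary values.\<close>

lemma smooth_fun_coinduct:
  assumes V: "openin (Euclidean_space n) V" and "P h"
    and c: "\<And>h. P h \<Longrightarrow> continuous_map (subtopology (Euclidean_space n) V) euclideanreal h"
    and d: "\<And>h v i. P h \<Longrightarrow> v \<in> V \<Longrightarrow> i < n \<Longrightarrow> differentiable_along i h v"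
    and s: "\<And>h i. P h \<Longrightarrow> i < n \<Longrightarrow> \<exists>h'. P h' \<and> (\<forall>v\<in>V. h' v = pdiff i h v)"
  shows "smooth_fun n V h"
  unfolding smooth_fun_def
proof (intro allI impI)
  fix js assume js: "set js \<subseteq> {..<n}"
  have "\<exists>k. P k \<and> (\<forall>v\<in>V. k v = foldr pdiff js h v)"
    using js
  proof (induction js)
    case Nil
    then show ?case using assms(2) by auto
  next
    case (Cons i js)
    then obtain k where k: "P k" "\<forall>v\<in>V. k v = foldr pdiff js h v" by auto
    obtain k' where k': "P k'" "\<forall>v\<in>V. k' v = pdiff i k v" using s[OF k(1), of i] Cons by auto
    have "pdiff i k v = pdiff i (foldr pdiff js h) v" if "v \<in> V" for v
      using Cons k by (intro pdiff_cong[OF V that]) auto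
    then show ?case using k' by auto
  qed
  then obtain k where k: "P k" "\<forall>v\<in>V. k v = foldr pdiff js h v" by auto
  have "continuous_map (subtopology (Euclidean_space n) V) euclideanreal (foldr pdiff js h)"
    by (rule continuous_map_eq[OF c[OF k(1)]]) (use k in \<open>auto simp: topspace_subtopology\<close>)
  moreover have "differentiable_along i (foldr pdiff js h) v" if "v \<in> V" "i < n" for v i
    using k that by (intro differentiable_along_cong[OF V that _ d[OF k(1) that]]) auto
  ultimately show "continuous_map (subtopology (Euclidean_space n) V) euclideanreal (foldr pdiff js h) \<and>
        (\<forall>v\<in>V. \<forall>i<n. differentiable_along i (foldr pdiff js h) v)" by blast
qed

subsection \<open>The chain rule\<close>

lemma continuous_box:
  assumes "openin (Euclidean_space n) V" "v \<in> V" "e > 0"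
    and "continuous_map (subtopology (Euclidean_space n) V) euclideanreal h"
  obtains d where "d > 0" "\<And>u. (\<forall>i\<ge>n. u i = 0) \<Longrightarrow> (\<forall>i<n. \<bar>u i - v i\<bar> < d) \<Longrightarrow> u \<in> V \<and> \<bar>h u - h v\<bar> < e"
proof -
  have "openin (subtopology (Euclidean_space n) V)
     {u \<in> topspace (subtopology (Euclidean_space n) V). h u \<in> ball (h v) e}"
    by (rule openin_continuous_map_preimage[OF assms(4)]) simp
  then have o: "openin (Euclidean_space n) {u \<in> V. \<bar>h u - h v\<bar> < e}"
    using assms(1) openin_subset[OF assms(1)]
    by (simp add: openin_open_subtopology dist_real_def abs_minus_commute topspace_subtopology)
       (metis (no_types, lifting) Collect_cong inf.absorb_iff2 Int_iff)
  have "v \<in> {u \<in> V. \<bar>h u - h v\<bar> < e}" using assms by simp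
  from openin_box[OF o this] show thesis using that by (metis (no_types, lifting) mem_Collect_eq)
qed

lemma mvt_along:
  assumes "\<And>t. min a b \<le> t \<Longrightarrow> t \<le> max a b \<Longrightarrow> (g has_real_derivative g' t) (at t)"
  obtains z where "min a b \<le> z" "z \<le> max a b" "g b - g a = g' z * (b - a)"
proof (cases "a = b")
  case True
  then show thesis using that[of a] by simp
next
  case False
  then consider "a < b" | "b < a" by linarith
  then show thesis
  proof cases
    case 1
    obtain z where "z > a" "z < b" "g b - g a = (b - a) * g' z"
      using MVT2[of a b g g'] 1 assms by auto
    then show thesis using that[of z] 1 by (simp add: mult.commute)
  next
    case 2
    obtain z where "z > b" "z < a" "g a - g b = (a - b) * g' z"
      using MVT2[of b a g g'] 2 assms by auto
    then show thesis using that[of z] 2 by (simp add: algebra_simps)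
  qed
qed

text \<open>Moving from \<open>p\<close> to \<open>q\<close> one coordinate at a time.\<close>

lemma increment_estimate:
  fixes p :: "nat \<Rightarrow> real"
  assumes V: "openin (Euclidean_space n) V" and h: "smooth_fun n V h" and p: "p \<in> V" and e: "e > 0"
  obtains d where "d > 0" "\<forall>q. (\<forall>i\<ge>n. q i = 0) \<longrightarrow> (\<forall>i<n. \<bar>q i - p i\<bar> < d) \<longrightarrow>
     \<bar>h q - h p - (\<Sum>i<n. pdiff i h p * (q i - p i))\<bar> \<le> e * (\<Sum>i<n. \<bar>q i - p i\<bar>)"
proof -
  have "\<exists>d>0. \<forall>u. (\<forall>j\<ge>n. u j = 0) \<longrightarrow> (\<forall>j<n. \<bar>u j - p j\<bar> < d) \<longrightarrow> u \<in> V \<and> (i < n \<longrightarrow> \<bar>pdiff i h u - pdiff i h p\<bar> < e)" for i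
  proof (cases "i < n")
    case True
    then show ?thesis using continuous_box[OF V p e smooth_funD(1)[OF smooth_funD(3)[OF h True]]] by metis
  next
    case False
    then show ?thesis using openin_box[OF V p] by metis
  qed
  then obtain D where D: "\<And>i. D i > 0" "\<And>i u. (\<forall>j\<ge>n. u j = 0) \<Longrightarrow> (\<forall>j<n. \<bar>u j - p j\<bar> < D i) \<Longrightarrow>
      u \<in> V \<and> (i < n \<longrightarrow> \<bar>pdiff i h u - pdiff i h p\<bar> < e)" by metis
  define d where "d = Min (insert 1 (D ` {..<n}))"
  have d: "d > 0" "\<And>i. i < n \<Longrightarrow> d \<le> D i"
    unfolding d_def by (auto simp: D)
  show thesis
  proof (rule that[OF d(1)], intro allI impI)
    fix q :: "nat \<Rightarrow> real"
    assume q: "\<forall>i\<ge>n. q i = 0" "\<forall>i<n. \<bar>q i - p i\<bar> < d"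
    have p0: "p i = 0" if "i \<ge> n" for i using open_zero[OF V p that] .
    \<comment> \<open>Intermediate points with the first \<open>k\<close> entries of
      \<open>q\<close> and the others of \<open>p\<close>. On each step the mean value theorem gives
      a partial derivative at a point of the cube, within \<open>e\<close> of that at
      \<open>p\<close>.\<close>
    define r where "r k i = (if i < k then q i else p i)" for k i :: nat
    have step: "\<bar>h (r (Suc k)) - h (r k) - pdiff k h p * (q k - p k)\<bar> \<le> e * \<bar>q k - p k\<bar>" if k: "k < n" for k
    proof -
      have u: "(r k)(k := t) \<in> V \<and> \<bar>pdiff k h ((r k)(k := t)) - pdiff k h p\<bar> < e"
        if t: "min (p k) (q k) \<le> t" "t \<le> max (p k) (q k)" for t
      proof -
        have "\<bar>t - p k\<bar> < D k" using t q(2) k d(2)[OF k] by (auto simp: abs_if min_def max_def split: if_splits)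
        moreover have "\<forall>i<n. \<bar>q i - p i\<bar> < D k" using q(2) d(2)[OF k] by (meson order_less_le_trans)
        ultimately have "\<forall>j<n. \<bar>((r k)(k := t)) j - p j\<bar> < D k" using D(1) by (auto simp: r_def)
        moreover have "\<forall>j\<ge>n. ((r k)(k := t)) j = 0" using k p0 by (auto simp: r_def)
        ultimately show ?thesis using D(2) k by blast
      qed
      have "((\<lambda>t. h ((r k)(k := t))) has_real_derivative pdiff k h ((r k)(k := t))) (at t)"
        if "min (p k) (q k) \<le> t" "t \<le> max (p k) (q k)" for t
        using DERIV_pdiff[OF smooth_funD(2)[OF h conjunct1[OF u[OF that]] k]]
        by (simp only: fun_upd_upd fun_upd_same)
      then obtain z where z: "min (p k) (q k) \<le> z" "z \<le> max (p k) (q k)"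
        "h ((r k)(k := q k)) - h ((r k)(k := p k)) = pdiff k h ((r k)(k := z)) * (q k - p k)"
        by (rule mvt_along)
      have "(r k)(k := q k) = r (Suc k)" "(r k)(k := p k) = r k"
        by (auto simp: r_def less_Suc_eq)
      then have "h (r (Suc k)) - h (r k) - pdiff k h p * (q k - p k) =
          (pdiff k h ((r k)(k := z)) - pdiff k h p) * (q k - p k)"
        using z(3) by (simp add: algebra_simps)
      then show ?thesis
        using u[OF z(1,2)] by (simp add: abs_mult mult_right_mono less_imp_le)
    qed
    have "h q - h p = (\<Sum>k<n. h (r (Suc k)) - h (r k))"
    proof -
      have "r n = q" "r 0 = p" using q(1) p0 by (auto simp: r_def)
      then show ?thesis using sum_lessThan_telescope[of "\<lambda>k. h (r k)" n] by simp
    qed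
    then have "\<bar>h q - h p - (\<Sum>i<n. pdiff i h p * (q i - p i))\<bar> =
       \<bar>\<Sum>k<n. h (r (Suc k)) - h (r k) - pdiff k h p * (q k - p k)\<bar>"
      by (simp add: sum_subtractf)
    also have "\<dots> \<le> (\<Sum>k<n. \<bar>h (r (Suc k)) - h (r k) - pdiff k h p * (q k - p k)\<bar>)" by (rule sum_abs)
    also have "\<dots> \<le> (\<Sum>k<n. e * \<bar>q k - p k\<bar>)" by (rule sum_mono) (simp add: step)
    finally show "\<bar>h q - h p - (\<Sum>i<n. pdiff i h p * (q i - p i))\<bar> \<le> e * (\<Sum>i<n. \<bar>q i - p i\<bar>)"
      by (simp add: sum_distrib_left)
  qed
qed

lemma chain_rule_curve:
  assumes V: "openin (Euclidean_space n) V" and h: "smooth_fun n V h" and p: "\<gamma> t0 \<in> V"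
    and z: "\<And>t i. i \<ge> n \<Longrightarrow> \<gamma> t i = 0"
    and d: "\<And>i. i < n \<Longrightarrow> ((\<lambda>t. \<gamma> t i) has_real_derivative \<gamma>' i) (at t0)"
  shows "((\<lambda>t. h (\<gamma> t)) has_real_derivative (\<Sum>i<n. pdiff i h (\<gamma> t0) * \<gamma>' i)) (at t0)"
proof -
  define Q where "Q i t = (\<gamma> t i - \<gamma> t0 i) / (t - t0)" for i t
  have Q: "(Q i \<longlongrightarrow> \<gamma>' i) (at t0)" if "i < n" for i
    using d[OF that] unfolding has_field_derivative_iff Q_def .
  define R where "R t = (h (\<gamma> t) - h (\<gamma> t0)) / (t - t0) - (\<Sum>i<n. pdiff i h (\<gamma> t0) * Q i t)" for t
  \<comment> \<open>The difference quotients satisfy \<open>\<Sum>i<n. \<bar>Q i t\<bar> < B\<close>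
    near \<open>t0\<close>, as \<open>B\<close> exceeds the limit by 1. The increment estimate is
    therefore used with \<open>e / B\<close>.\<close>
  define B where "B = 1 + (\<Sum>i<n. \<bar>\<gamma>' i\<bar>)"
  have B: "B > 0" unfolding B_def by (simp add: add_pos_nonneg sum_nonneg)
  have "((\<lambda>t. \<Sum>i<n. \<bar>Q i t\<bar>) \<longlongrightarrow> (\<Sum>i<n. \<bar>\<gamma>' i\<bar>)) (at t0)"
    using Q by (intro tendsto_sum tendsto_rabs) auto
  then have QB: "\<forall>\<^sub>F t in at t0. (\<Sum>i<n. \<bar>Q i t\<bar>) < B"
    by (rule order_tendstoD) (simp add: B_def)
  have "(R \<longlongrightarrow> 0) (at t0)"
  proof (rule tendstoI)
    fix e :: real assume e: "e > 0"
    then have "e / B > 0" using B by simp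
    then obtain D where D: "D > 0"
      "\<forall>q. (\<forall>i\<ge>n. q i = 0) \<longrightarrow> (\<forall>i<n. \<bar>q i - \<gamma> t0 i\<bar> < D) \<longrightarrow>
         \<bar>h q - h (\<gamma> t0) - (\<Sum>i<n. pdiff i h (\<gamma> t0) * (q i - \<gamma> t0 i))\<bar> \<le> e / B * (\<Sum>i<n. \<bar>q i - \<gamma> t0 i\<bar>)"
      by (rule increment_estimate[OF V h p])
    have "\<forall>\<^sub>F t in at t0. \<forall>i\<in>{..<n}. \<bar>\<gamma> t i - \<gamma> t0 i\<bar> < D"
    proof (rule eventually_ball_finite; clarsimp)
      fix i assume "i < n"
      have "((\<lambda>t. \<gamma> t i) \<longlongrightarrow> \<gamma> t0 i) (at t0)"
        using DERIV_isCont[OF d[OF \<open>i < n\<close>]] by (simp add: isCont_def)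
      from tendstoD[OF this D(1)] show "\<forall>\<^sub>F t in at t0. \<bar>\<gamma> t i - \<gamma> t0 i\<bar> < D"
        by (simp add: dist_real_def)
    qed
    with QB eventually_neq_at_within[of t0 t0 UNIV]
    show "\<forall>\<^sub>F t in at t0. dist (R t) 0 < e"
    proof eventually_elim
      case (elim t)
      then have nz: "t - t0 \<noteq> 0" by simp
      have "\<bar>h (\<gamma> t) - h (\<gamma> t0) - (\<Sum>i<n. pdiff i h (\<gamma> t0) * (\<gamma> t i - \<gamma> t0 i))\<bar> \<le> e / B * (\<Sum>i<n. \<bar>\<gamma> t i - \<gamma> t0 i\<bar>)"
        using elim z by (intro D(2)[rule_format]) auto
      moreover have "R t = (h (\<gamma> t) - h (\<gamma> t0) - (\<Sum>i<n. pdiff i h (\<gamma> t0) * (\<gamma> t i - \<gamma> t0 i))) / (t - t0)"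
        using nz by (simp add: R_def Q_def diff_divide_distrib[of "h (\<gamma> t) - h (\<gamma> t0)"] sum_divide_distrib)
      ultimately have "\<bar>R t\<bar> \<le> e / B * (\<Sum>i<n. \<bar>\<gamma> t i - \<gamma> t0 i\<bar>) / \<bar>t - t0\<bar>"
        by (simp only: abs_divide) (rule divide_right_mono, simp_all)
      also have "\<dots> = e / B * (\<Sum>i<n. \<bar>Q i t\<bar>)"
        by (simp add: Q_def abs_divide sum_divide_distrib[symmetric])
      also have "\<dots> < e / B * B"
        using elim \<open>e / B > 0\<close> by (intro mult_strict_left_mono) auto
      finally show ?case using B by simp
    qed
  qed
  moreover have "((\<lambda>t. \<Sum>i<n. pdiff i h (\<gamma> t0) * Q i t) \<longlongrightarrow> (\<Sum>i<n. pdiff i h (\<gamma> t0) * \<gamma>' i)) (at t0)"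
    using Q by (intro tendsto_sum tendsto_mult) auto
  ultimately have "((\<lambda>t. R t + (\<Sum>i<n. pdiff i h (\<gamma> t0) * Q i t)) \<longlongrightarrow> 0 + (\<Sum>i<n. pdiff i h (\<gamma> t0) * \<gamma>' i)) (at t0)"
    by (rule tendsto_add)
  then show ?thesis by (simp add: has_field_derivative_iff R_def)
qed

lemma chain_rule:
  assumes V: "openin (Euclidean_space n) V" and h: "smooth_fun n V h" and p: "\<phi> v \<in> V"
    and z: "\<And>u i. i \<ge> n \<Longrightarrow> \<phi> u i = 0"
    and d: "\<And>i. i < n \<Longrightarrow> differentiable_along j (\<lambda>u. \<phi> u i) v"
  shows "((\<lambda>t. h (\<phi> (v(j := t)))) has_real_derivative
     (\<Sum>i<n. pdiff i h (\<phi> v) * pdiff j (\<lambda>u. \<phi> u i) v)) (at (v j))"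
proof -
  have "((\<lambda>t. h (\<phi> (v(j := t)))) has_real_derivative
     (\<Sum>i<n. pdiff i h (\<phi> (v(j := v j))) * pdiff j (\<lambda>u. \<phi> u i) v)) (at (v j))"
  proof (rule chain_rule_curve[OF V h])
    show "\<phi> (v(j := v j)) \<in> V" using p by (simp only: fun_upd_triv)
    show "\<phi> (v(j := t)) i = 0" if "i \<ge> n" for t i using z[OF that] .
    show "((\<lambda>t. \<phi> (v(j := t)) i) has_real_derivative pdiff j (\<lambda>u. \<phi> u i) v) (at (v j))" if "i < n" for i
      using DERIV_pdiff[OF d[OF that]] .
  qed
  then show ?thesis by (simp only: fun_upd_triv)
qed

text \<open>Stable under partial derivatives, hence contained in the smooth functions by coinduction.\<close>

inductive smooth_closure :: "nat \<Rightarrow> (nat \<Rightarrow> real) set \<Rightarrow> ((nat \<Rightarrow> real) \<Rightarrow> real) \<Rightarrow> bool"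
  for n V where
  base: "smooth_fun n V h \<Longrightarrow> smooth_closure n V h"
| const: "smooth_closure n V (\<lambda>_. c)"
| add: "smooth_closure n V h \<Longrightarrow> smooth_closure n V k \<Longrightarrow> smooth_closure n V (\<lambda>v. h v + k v)"
| mult: "smooth_closure n V h \<Longrightarrow> smooth_closure n V k \<Longrightarrow> smooth_closure n V (\<lambda>v. h v * k v)"
| comp: "openin (Euclidean_space n) W \<Longrightarrow> smooth_fun n W h \<Longrightarrow> (\<And>v. v \<in> V \<Longrightarrow> \<phi> v \<in> W) \<Longrightarrow>
    (\<And>v i. i \<ge> n \<Longrightarrow> \<phi> v i = 0) \<Longrightarrow> (\<And>i. i < n \<Longrightarrow> smooth_fun n V (\<lambda>v. \<phi> v i)) \<Longrightarrow>
    smooth_closure n V (\<lambda>v. h (\<phi> v))"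

lemma smooth_closure_continuous:
  "smooth_closure n V h \<Longrightarrow> continuous_map (subtopology (Euclidean_space n) V) euclideanreal h"
proof (induction rule: smooth_closure.induct)
  case (comp W h \<phi>)
  have "continuous_map (subtopology (Euclidean_space n) V) (Euclidean_space n) (\<lambda>v i. if i < n then \<phi> v i else 0)"
    using comp(5) smooth_funD(1) by (auto simp: continuous_map_componentwise_Euclidean_space)
  then have "continuous_map (subtopology (Euclidean_space n) V) (Euclidean_space n) \<phi>"
    by (rule continuous_map_eq) (auto simp: fun_eq_iff comp(4) not_less)
  then have "continuous_map (subtopology (Euclidean_space n) V) (subtopology (Euclidean_space n) W) \<phi>"
    using comp(3) by (auto simp: continuous_map_in_subtopology)
  from continuous_map_compose[OF this smooth_funD(1)[OF comp(2)]] show ?case by (simp add: o_def)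
qed (auto intro: smooth_funD(1) continuous_map_add continuous_map_real_mult)

lemma smooth_closure_diff:
  "smooth_closure n V h \<Longrightarrow> v \<in> V \<Longrightarrow> i < n \<Longrightarrow> differentiable_along i h v"
proof (induction rule: smooth_closure.induct)
  case (comp W h \<phi>)
  have "((\<lambda>t. h (\<phi> (v(i := t)))) has_real_derivative
     (\<Sum>j<n. pdiff j h (\<phi> v) * pdiff i (\<lambda>u. \<phi> u j) v)) (at (v i))"
    by (rule chain_rule[OF comp(1,2)]) (use comp smooth_funD(2) in blast)+
  then show ?case unfolding real_differentiable_def by blast
qed (auto intro: smooth_funD(2))

lemma pdiff_add:
  "differentiable_along i h v \<Longrightarrow> differentiable_along i k v \<Longrightarrow>
    pdiff i (\<lambda>v. h v + k v) v = pdiff i h v + pdiff i k v"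
  by (rule pdiff_eqI) (auto intro!: DERIV_add dest: DERIV_pdiff)

lemma pdiff_mult:
  "differentiable_along i h v \<Longrightarrow> differentiable_along i k v \<Longrightarrow>
    pdiff i (\<lambda>v. h v * k v) v = pdiff i h v * k v + h v * pdiff i k v"
  by (rule pdiff_eqI) (use DERIV_mult[OF DERIV_pdiff[of h v i] DERIV_pdiff[of k v i]] in \<open>simp add: mult.commute\<close>)

lemma smooth_closure_sum:
  "(\<And>i. i \<in> I \<Longrightarrow> smooth_closure n V (h i)) \<Longrightarrow> smooth_closure n V (\<lambda>v. \<Sum>i\<in>I. h i v)"
  by (induction I rule: infinite_finite_induct) (auto intro: smooth_closure.intros)

lemma smooth_closure_pdiff:
  "smooth_closure n V h \<Longrightarrow> i < n \<Longrightarrow> \<exists>h'. smooth_closure n V h' \<and> (\<forall>v\<in>V. h' v = pdiff i h v)"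
proof (induction rule: smooth_closure.induct)
  case (base h)
  then show ?case using smooth_funD(3) smooth_closure.base by blast
next
  case (const c)
  then show ?case using smooth_closure.const[of n V 0] pdiff_const[of i c] by auto
next
  case (add h k)
  then obtain h' k' where *: "smooth_closure n V h'" "\<forall>v\<in>V. h' v = pdiff i h v"
    "smooth_closure n V k'" "\<forall>v\<in>V. k' v = pdiff i k v" by auto
  show ?case
    by (rule exI[of _ "\<lambda>v. h' v + k' v"])
      (use * add smooth_closure_diff in \<open>auto simp: pdiff_add intro: smooth_closure.intros\<close>)
next
  case (mult h k)
  then obtain h' k' where *: "smooth_closure n V h'" "\<forall>v\<in>V. h' v = pdiff i h v"
    "smooth_closure n V k'" "\<forall>v\<in>V. k' v = pdiff i k v" by auto
  show ?case
    by (rule exI[of _ "\<lambda>v. h' v * k v + h v * k' v"])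
      (use * mult smooth_closure_diff in \<open>auto simp: pdiff_mult intro!: smooth_closure.add smooth_closure.mult\<close>)
next
  case (comp W h \<phi>)
  have "smooth_closure n V (\<lambda>v. \<Sum>j<n. pdiff j h (\<phi> v) * pdiff i (\<lambda>u. \<phi> u j) v)"
  proof (rule smooth_closure_sum, rule smooth_closure.mult)
    fix j assume "j \<in> {..<n}"
    then have j: "j < n" by simp
    show "smooth_closure n V (\<lambda>v. pdiff j h (\<phi> v))"
      by (rule smooth_closure.comp[OF comp(1) smooth_funD(3)[OF comp(2) j] comp(3,4,5)])
    show "smooth_closure n V (pdiff i (\<lambda>u. \<phi> u j))"
      by (rule smooth_closure.base[OF smooth_funD(3)[OF comp(5)[OF j] comp(6)]])
  qed
  moreover have "(\<Sum>j<n. pdiff j h (\<phi> v) * pdiff i (\<lambda>u. \<phi> u j) v) = pdiff i (\<lambda>v. h (\<phi> v)) v" if "v \<in> V" for v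
    by (rule pdiff_eqI[symmetric], rule chain_rule[OF comp(1,2)])
      (use comp smooth_funD(2) that in blast)+
  ultimately show ?case by blast
qed

lemma smooth_closure_smooth:
  assumes "openin (Euclidean_space n) V" "smooth_closure n V h"
  shows "smooth_fun n V h"
  by (rule smooth_fun_coinduct[where P = "smooth_closure n V", OF assms])
    (auto intro: smooth_closure_continuous smooth_closure_diff smooth_closure_pdiff)

lemma smooth_fun_coord: "openin (Euclidean_space n) V \<Longrightarrow> smooth_fun n V (\<lambda>v. v i)"
proof (rule smooth_fun_coinduct[where P = "\<lambda>h. (\<exists>i. h = (\<lambda>v. v i)) \<or> (\<exists>c. h = (\<lambda>_. c))"])
  fix h :: "(nat \<Rightarrow> real) \<Rightarrow> real" and v :: "nat \<Rightarrow> real" and j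
  assume h: "(\<exists>i. h = (\<lambda>v. v i)) \<or> (\<exists>c. h = (\<lambda>_. c))"
  then show "continuous_map (subtopology (Euclidean_space n) V) euclideanreal h"
    by (auto simp: Euclidean_space_def intro!: continuous_map_from_subtopology continuous_map_product_projection)
  have "(\<lambda>t. (v(j := t)) i) differentiable (at (v j))" for i by (cases "i = j") auto
  then show "differentiable_along j h v" using h by auto
  have "pdiff j (\<lambda>v. v i) = (\<lambda>v. if i = j then 1 else 0)" for i
    by (rule ext, rule pdiff_eqI) (auto intro!: derivative_eq_intros)
  then show "\<exists>h'. ((\<exists>i. h' = (\<lambda>v. v i)) \<or> (\<exists>c. h' = (\<lambda>_. c))) \<and> (\<forall>v\<in>V. h' v = pdiff j h v)"
    using h by (auto simp: pdiff_const split: if_splits)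
qed auto

lemma pdiff_coord: "pdiff j (\<lambda>v. v i) = (\<lambda>v. if i = j then 1 else 0)"
  by (rule ext, rule pdiff_eqI) (auto intro!: derivative_eq_intros)

lemma pdiff_sum:
  "finite I \<Longrightarrow> (\<And>k. k \<in> I \<Longrightarrow> differentiable_along i (h k) v) \<Longrightarrow>
    pdiff i (\<lambda>v. \<Sum>k\<in>I. h k v) v = (\<Sum>k\<in>I. pdiff i (h k) v)"
  by (rule pdiff_eqI) (auto intro!: DERIV_sum dest: DERIV_pdiff)

subsection \<open>Symmetry of second partial derivatives\<close>

text \<open>The mean value theorem is applied first in direction \<open>a\<close>, to the difference
  of \<open>h\<close> across the square in direction \<open>b\<close>, and then in direction
  \<open>b\<close> to the derivative \<open>pdiff a h\<close>.\<close>

lemma second_difference: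
  assumes V: "openin (Euclidean_space n) V" and h: "smooth_fun n V h" and ab: "a < n" "b < n" "a \<noteq> b" and s: "s > 0"
    and box: "\<And>x y. 0 \<le> x \<Longrightarrow> x \<le> s \<Longrightarrow> 0 \<le> y \<Longrightarrow> y \<le> s \<Longrightarrow> p(a := p a + x, b := p b + y) \<in> V"
  shows "\<exists>x y. 0 \<le> x \<and> x \<le> s \<and> 0 \<le> y \<and> y \<le> s \<and>
    h (p(a := p a + s, b := p b + s)) - h (p(a := p a + s, b := p b)) - h (p(a := p a, b := p b + s)) + h (p(a := p a, b := p b))
      = pdiff b (pdiff a h) (p(a := p a + x, b := p b + y)) * s * s"
proof -
  let ?P = "\<lambda>x y. p(a := p a + x, b := p b + y)"
  have da: "((\<lambda>x. h (?P x y)) has_real_derivative pdiff a h (?P x y)) (at x)" if "0 \<le> x" "x \<le> s" "0 \<le> y" "y \<le> s" for x y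
  proof -
    have "((\<lambda>t. h ((?P x y)(a := t))) has_real_derivative pdiff a h (?P x y)) (at (?P x y a))"
      by (intro DERIV_pdiff smooth_funD(2)[OF h] box that ab)
    then have *: "((\<lambda>t. h ((?P x y)(a := t))) has_real_derivative pdiff a h (?P x y)) (at (p a + x))"
      using ab by simp
    have "((\<lambda>x'. h ((?P x y)(a := p a + x'))) has_real_derivative pdiff a h (?P x y)) (at x)"
      using * DERIV_shift[of "\<lambda>t. h ((?P x y)(a := t))" "pdiff a h (?P x y)" x "p a"]
      by (simp add: add.commute del: fun_upd_apply)
    moreover have "(?P x y)(a := p a + x') = ?P x' y" for x' using ab by (auto simp: fun_eq_iff)
    ultimately show ?thesis by (simp del: fun_upd_apply)
  qed
  have db: "((\<lambda>y. pdiff a h (?P x y)) has_real_derivative pdiff b (pdiff a h) (?P x y)) (at y)" if "0 \<le> x" "x \<le> s" "0 \<le> y" "y \<le> s" for x y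
  proof -
    have "((\<lambda>t. pdiff a h ((?P x y)(b := t))) has_real_derivative pdiff b (pdiff a h) (?P x y)) (at (?P x y b))"
      by (intro DERIV_pdiff smooth_funD(2)[OF smooth_funD(3)[OF h]] box that ab)
    then have *: "((\<lambda>t. pdiff a h ((?P x y)(b := t))) has_real_derivative pdiff b (pdiff a h) (?P x y)) (at (p b + y))"
      by simp
    have "((\<lambda>y'. pdiff a h ((?P x y)(b := p b + y'))) has_real_derivative pdiff b (pdiff a h) (?P x y)) (at y)"
      using * DERIV_shift[of "\<lambda>t. pdiff a h ((?P x y)(b := t))" "pdiff b (pdiff a h) (?P x y)" y "p b"]
      by (simp add: add.commute del: fun_upd_apply)
    moreover have "(?P x y)(b := p b + y') = ?P x y'" for y' by (simp only: fun_upd_upd)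
    ultimately show ?thesis by (simp del: fun_upd_apply)
  qed
  obtain x where x: "x > 0" "x < s" "(h (?P s s) - h (?P s 0)) - (h (?P 0 s) - h (?P 0 0)) =
      (s - 0) * (pdiff a h (?P x s) - pdiff a h (?P x 0))"
  proof -
    have "((\<lambda>x. h (?P x s) - h (?P x 0)) has_real_derivative pdiff a h (?P x s) - pdiff a h (?P x 0)) (at x)"
      if "0 \<le> x" "x \<le> s" for x
      using that s by (intro DERIV_diff da) auto
    from MVT2[OF s this] show thesis using that by blast
  qed
  obtain y where y: "y > 0" "y < s" "pdiff a h (?P x s) - pdiff a h (?P x 0) = (s - 0) * pdiff b (pdiff a h) (?P x y)"
    using MVT2[OF s, of "\<lambda>y. pdiff a h (?P x y)" "\<lambda>y. pdiff b (pdiff a h) (?P x y)"] db x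
    by (auto simp del: fun_upd_apply)
  have "(h (?P s s) - h (?P s 0)) - (h (?P 0 s) - h (?P 0 0)) = pdiff b (pdiff a h) (?P x y) * s * s"
    unfolding x(3) y(3) by simp
  then show ?thesis
    using x y by (intro exI[of _ x] exI[of _ y]) (simp add: algebra_simps del: fun_upd_apply)
qed

text \<open>The second difference is symmetric in \<open>a\<close> and \<open>b\<close>, so some
  value of one mixed derivative equals some value of the other on every small square. With
  \<open>e\<close> half of the supposed gap, continuity of both excludes this.\<close>

theorem pdiff_commute:
  assumes V: "openin (Euclidean_space n) V" and h: "smooth_fun n V h" and p: "p \<in> V" and ab: "a < n" "b < n"
  shows "pdiff a (pdiff b h) p = pdiff b (pdiff a h) p"
proof (cases "a = b")
  case False
  show ?thesis
  proof (rule ccontr)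
    assume ne: "pdiff a (pdiff b h) p \<noteq> pdiff b (pdiff a h) p"
    define e where "e = \<bar>pdiff a (pdiff b h) p - pdiff b (pdiff a h) p\<bar> / 2"
    have e: "e > 0" using ne by (simp add: e_def)
    have sm: "smooth_fun n V (pdiff a (pdiff b h))" "smooth_fun n V (pdiff b (pdiff a h))"
      using h ab by (auto intro: smooth_funD(3))
    obtain d where d: "d > 0" "\<And>u. (\<forall>i\<ge>n. u i = 0) \<Longrightarrow> (\<forall>i<n. \<bar>u i - p i\<bar> < d) \<Longrightarrow>
        u \<in> V \<and> \<bar>pdiff a (pdiff b h) u - pdiff a (pdiff b h) p\<bar> < e"
      using continuous_box[OF V p e smooth_funD(1)[OF sm(1)]] by metis
    obtain d' where d': "d' > 0" "\<And>u. (\<forall>i\<ge>n. u i = 0) \<Longrightarrow> (\<forall>i<n. \<bar>u i - p i\<bar> < d') \<Longrightarrow>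
        u \<in> V \<and> \<bar>pdiff b (pdiff a h) u - pdiff b (pdiff a h) p\<bar> < e"
      using continuous_box[OF V p e smooth_funD(1)[OF sm(2)]] by metis
    define s where "s = min d d' / 2"
    have s: "s > 0" "s < d" "s < d'" using d d' by (auto simp: s_def)
    have P: "(\<forall>i\<ge>n. (p(a := p a + x, b := p b + y)) i = 0)" "(\<forall>i<n. \<bar>(p(a := p a + x, b := p b + y)) i - p i\<bar> < min d d')"
      if "0 \<le> x" "x \<le> s" "0 \<le> y" "y \<le> s" for x y
      using that s ab open_zero[OF V p] by auto
    have box: "p(a := p a + x, b := p b + y) \<in> V" if "0 \<le> x" "x \<le> s" "0 \<le> y" "y \<le> s" for x y
      using P[OF that] d(2) by auto
    obtain x y where xy: "0 \<le> x" "x \<le> s" "0 \<le> y" "y \<le> s"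
      "h (p(a := p a + s, b := p b + s)) - h (p(a := p a + s, b := p b)) - h (p(a := p a, b := p b + s)) + h (p(a := p a, b := p b))
      = pdiff b (pdiff a h) (p(a := p a + x, b := p b + y)) * s * s"
      using second_difference[OF V h ab False s(1) box] by auto
    have tw: "p(b := u, a := t) = p(a := t, b := u)" for t u using False by (rule fun_upd_twist[symmetric])
    have box': "p(b := p b + x, a := p a + y) \<in> V" if "0 \<le> x" "x \<le> s" "0 \<le> y" "y \<le> s" for x y
      unfolding tw using that by (intro box)
    obtain x' y' where xy': "0 \<le> x'" "x' \<le> s" "0 \<le> y'" "y' \<le> s"
      "h (p(b := p b + s, a := p a + s)) - h (p(b := p b + s, a := p a)) - h (p(b := p b, a := p a + s)) + h (p(b := p b, a := p a))
      = pdiff a (pdiff b h) (p(b := p b + x', a := p a + y')) * s * s"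
      using second_difference[OF V h ab(2,1) False[symmetric] s(1) box'] by auto
    have "pdiff b (pdiff a h) (p(a := p a + x, b := p b + y)) * s * s =
        pdiff a (pdiff b h) (p(a := p a + y', b := p b + x')) * s * s"
      using xy(5) xy'(5) unfolding tw by linarith
    then have "pdiff b (pdiff a h) (p(a := p a + x, b := p b + y)) = pdiff a (pdiff b h) (p(a := p a + y', b := p b + x'))"
      using s(1) by simp
    moreover have "\<bar>pdiff b (pdiff a h) (p(a := p a + x, b := p b + y)) - pdiff b (pdiff a h) p\<bar> < e"
      by (rule conjunct2[OF d'(2)[OF P(1)[OF xy(1-4)]]]) (use P(2)[OF xy(1-4)] in \<open>simp del: fun_upd_apply\<close>)
    moreover have "\<bar>pdiff a (pdiff b h) (p(a := p a + y', b := p b + x')) - pdiff a (pdiff b h) p\<bar> < e"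
      by (rule conjunct2[OF d(2)[OF P(1)[OF xy'(3,4,1,2)]]]) (use P(2)[OF xy'(3,4,1,2)] in \<open>simp del: fun_upd_apply\<close>)
    ultimately show False unfolding e_def by (auto simp: abs_if split: if_splits)
  qed
qed simp

subsection \<open>Partial derivatives with respect to the coordinates of positive degree\<close>

lemma lpartial_base: "i < n \<Longrightarrow> lpartial n w i f = (\<lambda>\<mu>. pdiff i (f \<mu>))"
  by (simp add: lpartial_def)

lemma lpartial_fibre:
  "n \<le> i \<Longrightarrow> lpartial n w i f = (\<lambda>\<mu> v. gsign w i \<mu> * real (\<mu> i + 1) * f (\<mu>(i := \<mu> i + 1)) v)"
  by (simp add: lpartial_def gsign_def)

lemma lpartial_add: "n \<le> i \<Longrightarrow> lpartial n w i (f + g) = lpartial n w i f + lpartial n w i g"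
  by (simp add: lpartial_fibre fun_eq_iff plus_fun_apply algebra_simps)

lemma lpartial_zero [simp]: "lpartial n w i 0 = 0"
proof (cases "i < n")
  case True
  then show ?thesis
    by (simp add: lpartial_base fun_eq_iff zero_fun_apply) (simp add: zero_fun_def pdiff_const)
qed (simp add: lpartial_fibre fun_eq_iff zero_fun_apply)

lemma lpartial_scale: "n \<le> i \<Longrightarrow> lpartial n w i (lscale h f) = lscale h (lpartial n w i f)"
  by (simp add: lpartial_fibre lscale_def fun_eq_iff)

lemma lpartial_sum:
  fixes f :: "'i \<Rightarrow> lfun"
  assumes "n \<le> i"
  shows "lpartial n w i (sum f I) = (\<Sum>j\<in>I. lpartial n w i (f j))"
  using sum_comp_morphism[of "lpartial n w i" f I] by (simp add: lpartial_add[OF assms] o_def)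

lemma lpartial_lmono:
  assumes "n \<le> i"
  shows "lpartial n w i (lmono \<nu>) = lscale (\<lambda>_. gsign w i \<nu> * real (\<nu> i)) (lmono (\<nu>(i := \<nu> i - 1)))"
proof (intro ext)
  fix \<mu> v
  show "lpartial n w i (lmono \<nu>) \<mu> v = lscale (\<lambda>_. gsign w i \<nu> * real (\<nu> i)) (lmono (\<nu>(i := \<nu> i - 1))) \<mu> v"
  proof (cases "\<mu>(i := \<mu> i + 1) = \<nu>")
    case True
    then have m: "\<mu> = \<nu>(i := \<nu> i - 1)" "\<nu> i = \<mu> i + 1" by auto
    have S: "{j. j < i \<and> odd (w j) \<and> \<mu> j \<noteq> 0} = {j. j < i \<and> odd (w j) \<and> \<nu> j \<noteq> 0}"
      by (auto simp: m(1))
    have g: "gsign w i \<mu> = gsign w i \<nu>"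
      unfolding gsign_def S ..
    have "lpartial n w i (lmono \<nu>) \<mu> v = gsign w i \<nu> * real (\<nu> i)"
      unfolding lpartial_fibre[OF assms] lmono_def True g m(2) by simp
    moreover have "lmono (\<nu>(i := \<nu> i - 1)) \<mu> v = 1" unfolding lmono_def m(1)[symmetric] by simp
    ultimately show ?thesis by (simp only: lscale_def mult_1_right)
  next
    case False
    then have *: "\<nu> i = 0 \<or> \<mu> \<noteq> \<nu>(i := \<nu> i - 1)" by auto
    have "lpartial n w i (lmono \<nu>) \<mu> v = 0"
      unfolding lpartial_fibre[OF assms] lmono_def if_not_P[OF False] by simp
    moreover have "real (\<nu> i) = 0 \<or> lmono (\<nu>(i := \<nu> i - 1)) \<mu> v = 0" using * by (elim disjE) (simp_all add: lmono_def)
    ultimately show ?thesis by (auto simp only: lscale_def)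
  qed
qed

lemma lpartial_lone [simp]: "lpartial n w i lone = 0"
proof (cases "i < n")
  case True
  then show ?thesis
    by (auto simp: lpartial_base fun_eq_iff zero_fun_apply lone_def pdiff_const)
next
  case False
  then show ?thesis using lpartial_lmono[of n i w "\<lambda>_. 0"] by (simp add: lmono_zero)
qed

lemma lsupp_lpartial:
  assumes "lsupp P f" "\<And>\<mu>. n \<le> i \<Longrightarrow> P (\<mu>(i := \<mu> i + 1)) \<Longrightarrow> Q \<mu>" "\<And>\<mu>. i < n \<Longrightarrow> P \<mu> \<Longrightarrow> Q \<mu>"
  shows "lsupp Q (lpartial n w i f)"
  unfolding lsupp_def
proof (intro allI impI)
  fix \<mu> v assume nz: "lpartial n w i f \<mu> v \<noteq> 0"
  show "Q \<mu>"
  proof (cases "i < n")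
    case True
    \<comment> \<open>A nonzero base derivative at \<open>v\<close> forces the coefficient to be
      nonzero somewhere, though possibly not at \<open>v\<close>; the support condition does not
      mention the point.\<close>
    have "f \<mu> \<noteq> (\<lambda>_. 0)" using nz True by (auto simp: lpartial_base pdiff_const)
    then obtain u where "f \<mu> u \<noteq> 0" by auto
    then show ?thesis using assms(1,3) True by (auto simp: lsupp_def)
  next
    case False
    then show ?thesis using nz assms(1,2) by (auto simp: lpartial_fibre lsupp_def)
  qed
qed

lemma odd_ok_upd: "odd_ok w (\<mu>(i := \<mu> i + 1)) \<Longrightarrow> odd_ok w \<mu>"
  by (erule odd_ok_le) simp

lemma odd_ok_Suc: "odd_ok w (\<mu>(i := \<mu> i + 1)) \<longleftrightarrow> odd_ok w \<mu> \<and> (odd (w i) \<longrightarrow> \<mu> i = 0)"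
proof (intro iffI conjI impI)
  assume a: "odd_ok w (\<mu>(i := \<mu> i + 1))"
  show "odd_ok w \<mu>" by (rule odd_ok_upd[OF a])
  show "\<mu> i = 0" if "odd (w i)" using spec[OF a[unfolded odd_ok_def], of i] that by simp
next
  assume a: "odd_ok w \<mu> \<and> (odd (w i) \<longrightarrow> \<mu> i = 0)"
  show "odd_ok w (\<mu>(i := \<mu> i + 1))"
    unfolding odd_ok_def
  proof (intro allI impI)
    fix j assume "odd (w j)"
    then show "(\<mu>(i := \<mu> i + 1)) j \<le> 1"
      using a spec[OF conjunct1[OF a, unfolded odd_ok_def], of j] by (cases "j = i") simp_all
  qed
qed

lemma odd_okD: "odd_ok w \<mu> \<Longrightarrow> odd (w i) \<Longrightarrow> \<mu> i \<le> 1"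
  by (simp add: odd_ok_def)

lemma lok_lpartial: "lok w f \<Longrightarrow> lok w (lpartial n w i f)"
proof (erule lsupp_lpartial)
  fix \<mu> assume "fsupp (\<mu>(i := \<mu> i + 1)) \<and> odd_ok w (\<mu>(i := \<mu> i + 1))"
  then show "fsupp \<mu> \<and> odd_ok w \<mu>" using odd_ok_upd[of w \<mu> i] unfolding fsupp_upd by (elim conjE) (intro conjI)
qed

lemma mono_deg_upd:
  assumes "i < N"
  shows "mono_deg N w (\<mu>(i := \<mu> i + 1)) = mono_deg N w \<mu> + w i"
proof -
  have "(\<lambda>j. \<mu> j + ((\<lambda>_. 0)(i := 1)) j) = \<mu>(i := \<mu> i + 1)" by auto
  moreover have "mono_deg N w ((\<lambda>_. 0)(i := 1)) = w i"
    unfolding mono_deg_def using assms by (subst sum.mono_neutral_right[of _ "{i}"]) auto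
  ultimately show ?thesis using mono_deg_add[of N w \<mu> "(\<lambda>_. 0)(i := 1)"] by simp
qed

lemma mono_ok_upd: "mono_ok n N w (\<mu>(i := \<mu> i + 1)) \<Longrightarrow> n \<le> i \<and> i < N \<and> mono_ok n N w \<mu>"
  unfolding mono_ok_def by (metis Suc_eq_plus1 Suc_leD fun_upd_other fun_upd_same nat.simps(3))

text \<open>The subtraction does not truncate where it matters: a monomial of degree
  \<open>k\<close> that contains \<open>z_i\<close> has \<open>w i \<le> k\<close>.\<close>

lemma hdeg_lpartial:
  assumes "hdeg n N w k f" "i < n \<Longrightarrow> w i = 0"
  shows "hdeg n N w (k - w i) (lpartial n w i f)"
proof (rule lsupp_lpartial[OF assms(1)])
  fix \<mu> assume *: "mono_ok n N w (\<mu>(i := \<mu> i + 1)) \<and> mono_deg N w (\<mu>(i := \<mu> i + 1)) = k"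
  then show "mono_ok n N w \<mu> \<and> mono_deg N w \<mu> = k - w i"
    using mono_ok_upd[OF conjunct1[OF *]] mono_deg_upd[of i N w \<mu>] by simp
qed (use assms(2) in auto)

lemma gdeg_lpartial:
  assumes "gdeg n N w f"
  shows "gdeg n N w (lpartial n w i f)"
proof -
  obtain K where "bdeg n N w K f" using assms unfolding gdeg_def by (rule exE)
  then have "bdeg n N w K (lpartial n w i f)"
  proof (rule lsupp_lpartial)
    fix \<mu> assume *: "mono_ok n N w (\<mu>(i := \<mu> i + 1)) \<and> mono_deg N w (\<mu>(i := \<mu> i + 1)) \<le> K"
    then show "mono_ok n N w \<mu> \<and> mono_deg N w \<mu> \<le> K"
      using mono_ok_upd[OF conjunct1[OF *]] mono_deg_upd[of i N w \<mu>] by simp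
  qed
  then show ?thesis by (rule bdeg_gdeg)
qed

text \<open>Removing \<open>z_i\<close> lowers the degree by \<open>w i\<close>; for the parity this
  is the same as adding it, and the sum avoids truncated subtraction.\<close>

lemma lpar_lpartial:
  assumes "lpar w p f" "i < n \<Longrightarrow> even (w i)"
  shows "lpar w (p + w i) (lpartial n w i f)"
proof (rule lsupp_lpartial[OF assms(1)])
  fix \<mu>
  assume i: "n \<le> i" and *: "fsupp (\<mu>(i := \<mu> i + 1)) \<and> odd_ok w (\<mu>(i := \<mu> i + 1)) \<and>
    even (card (osupp w (\<mu>(i := \<mu> i + 1)))) = even p"
  have f: "fsupp \<mu>" "odd_ok w \<mu>" using conjunct1[OF *] odd_ok_upd[OF conjunct1[OF conjunct2[OF *]]] unfolding fsupp_upd by this+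
  show "fsupp \<mu> \<and> odd_ok w \<mu> \<and> even (card (osupp w \<mu>)) = even (p + w i)"
  proof (cases "odd (w i)")
    case True
    then have "\<mu> i = 0" using * unfolding odd_ok_Suc by blast
    then have "osupp w (\<mu>(i := \<mu> i + 1)) = insert i (osupp w \<mu>)" "i \<notin> osupp w \<mu>"
      using True by (auto simp: osupp_def)
    then show ?thesis using f * True finite_osupp[OF f(1)] by auto
  next
    case False
    then have "osupp w (\<mu>(i := \<mu> i + 1)) = osupp w \<mu>" by (auto simp: osupp_def)
    then show ?thesis using f * False by auto
  qed
qed (use assms(2) in auto)

lemma gsign_upd:
  "gsign w i (\<mu>(k := m)) =
    (if odd (w i) \<and> odd (w k) \<and> k < i \<and> (m = 0) \<noteq> (\<mu> k = 0) then - 1 else 1) * gsign w i \<mu>"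
proof -
  let ?S = "\<lambda>\<mu>. {j. j < i \<and> odd (w j) \<and> \<mu> j \<noteq> 0}"
  have fin: "finite (?S \<mu>)" for \<mu> :: "nat \<Rightarrow> nat" by auto
  show ?thesis
  proof (cases "odd (w k) \<and> k < i \<and> (m = 0) \<noteq> (\<mu> k = 0)")
    case True
    show ?thesis
    proof (cases "m = 0")
      case m: True
      then have i: "?S \<mu> = insert k (?S (\<mu>(k := m)))" "k \<notin> ?S (\<mu>(k := m))" using True by auto
      have "card (?S \<mu>) = Suc (card (?S (\<mu>(k := m))))"
        by (rule trans[OF arg_cong[OF i(1), of card] card_insert_disjoint[OF fin i(2)]])
      then show ?thesis unfolding gsign_def using True by (simp only: power_Suc if_True) simp
    next
      case m: False
      then have i: "?S (\<mu>(k := m)) = insert k (?S \<mu>)" "k \<notin> ?S \<mu>" using True by auto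
      have "card (?S (\<mu>(k := m))) = Suc (card (?S \<mu>))"
        by (rule trans[OF arg_cong[OF i(1), of card] card_insert_disjoint[OF fin i(2)]])
      then show ?thesis unfolding gsign_def using True by (simp only: power_Suc if_True) simp
    qed
  next
    case False
    then have "?S (\<mu>(k := m)) = ?S \<mu>" by auto
    then show ?thesis unfolding gsign_def using False by (simp only: if_False) auto
  qed
qed

lemma gsign_square: "gsign w i \<mu> * gsign w i \<mu> = 1"
  by (simp add: gsign_def flip: power_add)

text \<open>The graded Leibniz rule for a single coordinate, where both sides are explicit and only
  signs and multiplicities have to be compared.\<close>

lemma lpartial_lmult_lvar:
  assumes g: "lok w g" and i: "n \<le> i" "n \<le> k"
  shows "lpartial n w i (lmult w (lvar n k) g) =
    (if i = k then g else 0) + lscale (\<lambda>_. (- 1) ^ (w k * w i)) (lmult w (lvar n k) (lpartial n w i g))"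
proof (intro ext)
  fix \<mu> :: "nat \<Rightarrow> nat" and v
  let ?up = "\<mu>(i := \<mu> i + 1)"
  have L: "lpartial n w i (lmult w (lvar n k) g) \<mu> v = gsign w i \<mu> * real (\<mu> i + 1) *
     (if odd_ok w ?up \<and> ?up k \<noteq> 0 then gsign w k ?up * g (?up(k := ?up k - 1)) v else 0)"
    unfolding lpartial_fibre[OF i(1)] lmult_lvar[OF g i(2)] ..
  have R: "lmult w (lvar n k) (lpartial n w i g) \<mu> v =
     (if odd_ok w \<mu> \<and> \<mu> k \<noteq> 0 then gsign w k \<mu> * (gsign w i (\<mu>(k := \<mu> k - 1)) *
        real ((\<mu>(k := \<mu> k - 1)) i + 1) * g ((\<mu>(k := \<mu> k - 1))(i := (\<mu>(k := \<mu> k - 1)) i + 1)) v) else 0)"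
    unfolding lmult_lvar[OF lok_lpartial[OF g] i(2)] by (simp only: lpartial_fibre[OF i(1)])
  have E: "((if i = k then g else 0) + lscale (\<lambda>_. (- 1) ^ (w k * w i)) (lmult w (lvar n k) (lpartial n w i g))) \<mu> v
     = (if i = k then g \<mu> v else 0) + (- 1) ^ (w k * w i) * lmult w (lvar n k) (lpartial n w i g) \<mu> v"
    by (simp add: plus_fun_apply lscale_def zero_fun_apply)
  have ok: "g \<mu>' v \<noteq> 0 \<Longrightarrow> odd_ok w \<mu>'" for \<mu>' using lsuppD[OF g] by blast
  show "lpartial n w i (lmult w (lvar n k) g) \<mu> v = ((if i = k then g else 0) +
    lscale (\<lambda>_. (- 1) ^ (w k * w i)) (lmult w (lvar n k) (lpartial n w i g))) \<mu> v"
  proof (cases "i = k")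
    case True
    have G: "gsign w i \<mu> * gsign w i ?up = 1" "gsign w i \<mu> * gsign w i (\<mu>(i := \<mu> i - 1)) = 1"
      by (simp_all only: gsign_upd less_irrefl simp_thms if_False mult_1 gsign_square)
    have L': "lpartial n w i (lmult w (lvar n k) g) \<mu> v = (if odd_ok w ?up then real (\<mu> i + 1) * g \<mu> v else 0)"
      unfolding L using True G(1) by (auto simp: mult.assoc mult.left_commute[of _ "gsign w i \<mu>"] simp del: of_nat_add of_nat_Suc)
    have R': "lmult w (lvar n k) (lpartial n w i g) \<mu> v = (if odd_ok w \<mu> then real (\<mu> i) * g \<mu> v else 0)"
    proof (cases "\<mu> i = 0")
      case False
      then have "(\<mu>(k := \<mu> k - 1))(i := (\<mu>(k := \<mu> k - 1)) i + 1) = \<mu>" "(\<mu>(k := \<mu> k - 1)) i + 1 = \<mu> i"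
        using True by auto
      then show ?thesis unfolding R using True G(2) False
        by (simp add: mult.assoc[symmetric])
    next
      case m: True
      show ?thesis unfolding R using True m by simp
    qed
    note O = odd_ok_Suc[of w \<mu> i]
    show ?thesis
    proof (cases "g \<mu> v = 0")
      case False
      then have okm: "odd_ok w \<mu>" by (rule ok)
      show ?thesis
      proof (cases "odd (w i)")
        \<comment> \<open>If the odd \<open>z_i\<close> already has exponent 1, the left side
          vanishes and the two terms on the right cancel.\<close>
        case odd: True
        then have "\<mu> i = 0 \<or> \<mu> i = 1" using odd_okD[OF okm odd] by linarith
        then show ?thesis unfolding E L' R' O using True okm odd by (elim disjE) simp_all
      next
        case False
        then show ?thesis unfolding E L' R' O using True okm by (simp add: algebra_simps)
      qed
    qed (simp add: E L' R')
  next
    case False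
    have up: "?up(k := ?up k - 1) = (\<mu>(k := \<mu> k - 1))(i := (\<mu>(k := \<mu> k - 1)) i + 1)"
      "?up k = \<mu> k" "(\<mu>(k := \<mu> k - 1)) i = \<mu> i"
      using False by (auto simp: fun_eq_iff)
    let ?g = "g (?up(k := ?up k - 1)) v"
    show ?thesis
    proof (cases "?g = 0 \<or> \<mu> k = 0")
      case True
      then show ?thesis unfolding E L R using False up by auto
    next
      case nz: False
      then have "odd_ok w (?up(k := ?up k - 1))" using ok by blast
      then have oi: "odd (w i) \<Longrightarrow> \<mu> i = 0" using False odd_okD[of w "?up(k := ?up k - 1)" i] by simp
      then have O: "odd_ok w ?up \<longleftrightarrow> odd_ok w \<mu>" unfolding odd_ok_Suc by blast
      show ?thesis
      proof (cases "odd_ok w \<mu>")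
        case okm: True
        then have "odd (w k) \<Longrightarrow> \<mu> k = 1" using nz odd_okD[OF okm, of k] by (cases "\<mu> k") simp_all
        then have "gsign w i \<mu> * gsign w k ?up = (- 1) ^ (w k * w i) * (gsign w k \<mu> * gsign w i (\<mu>(k := \<mu> k - 1)))"
          using False oi nz by (cases "odd (w k)"; cases "odd (w i)"; cases "k < i") (auto simp: gsign_upd simp del: fun_upd_apply)
        from arg_cong[OF this, of "\<lambda>x. x * (real (\<mu> i + 1) * ?g)"]
        show ?thesis unfolding E L R O up using False okm nz by (simp add: algebra_simps fun_upd_twist[OF False])
      next
        case notok: False
        show ?thesis unfolding E L R O using False notok by simp
      qed
    qed
  qed
qed

text \<open>The rule as a property of the left factor alone, for all right factors: in this form it
  passes to products by associativity and reaches all monomials by induction.\<close>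

definition leibniz :: "nat \<Rightarrow> (nat \<Rightarrow> nat) \<Rightarrow> nat \<Rightarrow> nat \<Rightarrow> lfun \<Rightarrow> bool" where
  "leibniz n w i p f \<longleftrightarrow> (\<forall>g. lok w g \<longrightarrow> lpartial n w i (lmult w f g) =
     lmult w (lpartial n w i f) g + lscale (\<lambda>_. (- 1) ^ (p * w i)) (lmult w f (lpartial n w i g)))"

lemma leibnizD: "leibniz n w i p f \<Longrightarrow> lok w g \<Longrightarrow> lpartial n w i (lmult w f g) =
     lmult w (lpartial n w i f) g + lscale (\<lambda>_. (- 1) ^ (p * w i)) (lmult w f (lpartial n w i g))"
  by (simp add: leibniz_def)

lemma leibniz_lone: "leibniz n w i 0 lone"
  by (auto simp: leibniz_def lmult_lone_left lok_lpartial)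

lemma lok_lvar: "lok w (lvar n i)"
  by (auto simp: lsupp_def lvar_def odd_ok_def split: if_splits)

lemma lpartial_lvar:
  assumes "n \<le> i" "n \<le> k"
  shows "lpartial n w i (lvar n k) = (if i = k then lone else 0)"
  using lpartial_lmult_lvar[OF lok_lone[of w] assms]
  by (simp add: lmult_lone_right[OF lok_lvar] del: fun_upd_apply)

lemma leibniz_lvar: "n \<le> i \<Longrightarrow> n \<le> k \<Longrightarrow> leibniz n w i (w k) (lvar n k)"
  by (auto simp: leibniz_def lpartial_lmult_lvar lpartial_lvar lmult_lone_left)

lemma leibniz_lmult:
  assumes i: "n \<le> i" and f: "leibniz n w i p f" and g: "leibniz n w i q g" "lok w g"
  shows "leibniz n w i (p + q) (lmult w f g)"
  unfolding leibniz_def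
proof (intro allI impI)
  fix h assume h: "lok w h"
  have "lpartial n w i (lmult w (lmult w f g) h) =
      lmult w (lpartial n w i f) (lmult w g h) + lscale (\<lambda>_. (- 1) ^ (p * w i)) (lmult w f
        (lmult w (lpartial n w i g) h + lscale (\<lambda>_. (- 1) ^ (q * w i)) (lmult w g (lpartial n w i h))))"
    by (simp add: lmult_assoc leibnizD[OF f lmult_lok] leibnizD[OF g(1) h])
  also have "\<dots> = lmult w (lpartial n w i (lmult w f g)) h +
      lscale (\<lambda>_. (- 1) ^ ((p + q) * w i)) (lmult w (lmult w f g) (lpartial n w i h))"
    unfolding leibnizD[OF f g(2)]
    by (simp add: lmult_assoc lmult_add_left lmult_add_right lmult_scale_left lmult_scale_right
        lscale_add lscale_lscale add.assoc power_add distrib_right)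
  finally show "lpartial n w i (lmult w (lmult w f g) h) = lmult w (lpartial n w i (lmult w f g)) h +
      lscale (\<lambda>_. (- 1) ^ ((p + q) * w i)) (lmult w (lmult w f g) (lpartial n w i h))" .
qed

lemma leibniz_mpart:
  assumes i: "n \<le> i" and k: "k \<le> N" "n \<le> k"
  shows "leibniz n w i (\<Sum>j\<in>{k..<N}. w j * \<nu> j) (mpart w N (lvar n) k \<nu>)"
  using k
proof (induction rule: inc_induct)
  case base
  then show ?case by (simp add: mpart_end leibniz_lone)
next
  case (step k)
  have "leibniz n w i (m * w k + (\<Sum>j\<in>{Suc k..<N}. w j * \<nu> j))
     ((lmult w (lvar n k) ^^ m) (mpart w N (lvar n) (Suc k) \<nu>))" for m
  proof (induction m)
    case 0
    then show ?case using step by simp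
  next
    case (Suc m)
    have "lok w ((lmult w (lvar n k) ^^ m) (mpart w N (lvar n) (Suc k) \<nu>))"
      by (intro lok_power lok_mpart)
    from leibniz_lmult[OF i leibniz_lvar[OF i step.prems] Suc this] show ?case
      by (simp add: add.assoc)
  qed
  from this[of "\<nu> k"] show ?case
    using step(2) by (simp add: mpart_step sum.atLeast_Suc_lessThan mult.commute)
qed

lemma leibniz_lmono:
  assumes "n \<le> i" "mono_ok n N w \<nu>" "n \<le> N"
  shows "leibniz n w i (card (osupp w \<nu>)) (lmono \<nu>)"
proof -
  have "(\<Sum>j\<in>{n..<N}. w j * \<nu> j) = mono_deg N w \<nu>"
    unfolding mono_deg_def using assms(2) by (intro sum.mono_neutral_left) (auto simp: mono_ok_def not_le)
  then have "leibniz n w i (mono_deg N w \<nu>) (lmono \<nu>)"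
    using leibniz_mpart[OF assms(1,3) order.refl, of w \<nu>] mono_subst_lvar[OF assms(2,3)]
    by (simp add: mono_subst_mpart)
  moreover have "(- 1 :: real) ^ (card (osupp w \<nu>) * w i) = (- 1) ^ (mono_deg N w \<nu> * w i)"
    using mono_deg_parity[OF assms(2)] by (simp add: minus_one_power_iff)
  ultimately show ?thesis by (simp add: leibniz_def)
qed

theorem lpartial_lmult:
  assumes i: "n \<le> i" and f: "lpar w p f" "gdeg n N w f" and pos: "gpos n N w" "n \<le> N" and g: "lok w g"
  shows "lpartial n w i (lmult w f g) =
     lmult w (lpartial n w i f) g + lscale (\<lambda>_. (- 1) ^ (p * w i)) (lmult w f (lpartial n w i g))"
proof -
  obtain S where S: "finite S" "\<forall>\<nu> v. f \<nu> v \<noteq> 0 \<longrightarrow> \<nu> \<in> S" "\<forall>\<nu>\<in>S. mono_ok n N w \<nu>"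
    by (rule gdeg_finite[OF pos(1) f(2)])
  \<comment> \<open>Keeping only the exponents of parity \<open>p\<close> gives all monomials of the
    expansion the same sign in the Leibniz rule.\<close>
  define S' where "S' = {\<nu>\<in>S. even (card (osupp w \<nu>)) = even p}"
  have e: "f = (\<Sum>\<nu>\<in>S'. lscale (f \<nu>) (lmono \<nu>))"
  proof (rule lmono_expand)
    show "finite S'" using S by (simp add: S'_def)
    show "\<nu> \<in> S'" if "f \<nu> v \<noteq> 0" for \<nu> v
      using S(2) that lsuppD[OF f(1) that] by (auto simp: S'_def)
  qed
  have l: "lpartial n w i (lmult w (lmono \<nu>) g) = lmult w (lpartial n w i (lmono \<nu>)) g +
      lscale (\<lambda>_. (- 1) ^ (p * w i)) (lmult w (lmono \<nu>) (lpartial n w i g))" if "\<nu> \<in> S'" for \<nu>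
  proof -
    have "(- 1 :: real) ^ (card (osupp w \<nu>) * w i) = (- 1) ^ (p * w i)"
      using that by (simp add: S'_def minus_one_power_iff)
    then show ?thesis
      using leibnizD[OF leibniz_lmono[OF i _ pos(2)] g, of \<nu>] that S(3) by (simp add: S'_def)
  qed
  have "lpartial n w i (lmult w f g) = (\<Sum>\<nu>\<in>S'. lscale (f \<nu>) (lpartial n w i (lmult w (lmono \<nu>) g)))"
    by (subst e) (simp add: lmult_sum_left lmult_scale_left lpartial_sum[OF i] lpartial_scale[OF i])
  also have "\<dots> = (\<Sum>\<nu>\<in>S'. lscale (f \<nu>) (lmult w (lpartial n w i (lmono \<nu>)) g +
      lscale (\<lambda>_. (- 1) ^ (p * w i)) (lmult w (lmono \<nu>) (lpartial n w i g))))"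
    using l by (intro sum.cong) auto
  also have "\<dots> = lmult w (\<Sum>\<nu>\<in>S'. lscale (f \<nu>) (lpartial n w i (lmono \<nu>))) g +
      lscale (\<lambda>_. (- 1) ^ (p * w i)) (lmult w (\<Sum>\<nu>\<in>S'. lscale (f \<nu>) (lmono \<nu>)) (lpartial n w i g))"
    by (simp add: lmult_sum_left lmult_scale_left lscale_add sum.distrib lscale_sum lscale_lscale mult.commute)
  also have "(\<Sum>\<nu>\<in>S'. lscale (f \<nu>) (lpartial n w i (lmono \<nu>))) = lpartial n w i f"
    by (subst (2) e) (simp add: lpartial_sum[OF i] lpartial_scale[OF i])
  finally show ?thesis using e by simp
qed

subsection \<open>Vector fields and substitution\<close>

definition lsmooth :: "nat \<Rightarrow> (nat \<Rightarrow> real) set \<Rightarrow> lfun \<Rightarrow> bool" where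
  "lsmooth n V f \<longleftrightarrow> (\<forall>\<mu>. smooth_fun n V (f \<mu>))"

text \<open>Equality over a set of base points. Derivatives and transition functions are meaningful
  only over open domains and overlaps, so most identities hold in this sense and become equations
  after \<open>lrestrict\<close>.\<close>

definition eqon :: "(nat \<Rightarrow> real) set \<Rightarrow> lfun \<Rightarrow> lfun \<Rightarrow> bool" where
  "eqon V f g \<longleftrightarrow> (\<forall>v\<in>V. \<forall>\<mu>. f \<mu> v = g \<mu> v)"

lemma eqonI: "(\<And>v \<mu>. v \<in> V \<Longrightarrow> f \<mu> v = g \<mu> v) \<Longrightarrow> eqon V f g"
  by (simp add: eqon_def)

lemma eqonD: "eqon V f g \<Longrightarrow> v \<in> V \<Longrightarrow> f \<mu> v = g \<mu> v"
  by (simp add: eqon_def)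

lemma eqon_refl [simp, intro]: "eqon V f f"
  by (simp add: eqon_def)

lemma eqon_sym: "eqon V f g \<Longrightarrow> eqon V g f"
  by (simp add: eqon_def)

lemma eqon_trans [trans]: "eqon V f g \<Longrightarrow> eqon V g h \<Longrightarrow> eqon V f h"
  by (simp add: eqon_def)

lemma eqon_subset: "eqon V f g \<Longrightarrow> W \<subseteq> V \<Longrightarrow> eqon W f g"
  by (auto simp: eqon_def)

lemma eqon_add: "eqon V f f' \<Longrightarrow> eqon V g g' \<Longrightarrow> eqon V (f + g) (f' + g')"
  by (simp add: eqon_def plus_fun_apply)

lemma eqon_sum: "(\<And>i. i \<in> I \<Longrightarrow> eqon V (f i) (g i)) \<Longrightarrow> eqon V (sum f I) (sum g I)"
  for f g :: "'i \<Rightarrow> lfun"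
  by (auto simp: eqon_def sum_lfun_apply intro!: sum.cong)

lemma eqon_lmult: "eqon V f f' \<Longrightarrow> eqon V g g' \<Longrightarrow> eqon V (lmult w f g) (lmult w f' g')"
  by (auto simp: eqon_def intro!: lmult_cong_at)

lemma eqon_scale: "(\<And>v. v \<in> V \<Longrightarrow> h v = k v) \<Longrightarrow> eqon V f g \<Longrightarrow> eqon V (lscale h f) (lscale k g)"
  by (simp add: eqon_def lscale_def)

lemma eqon_power: "eqon V f g \<Longrightarrow> eqon V ((lmult w h ^^ m) f) ((lmult w h ^^ m) g)"
  by (induction m) (auto intro: eqon_lmult)

lemma eqon_lrestrict: "eqon V (lrestrict V f) f"
  by (simp add: eqon_def lrestrict_def)

lemma eqon_lrestrict_eq: "eqon V f g \<Longrightarrow> lrestrict V f = lrestrict V g"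
  by (auto simp: eqon_def lrestrict_def fun_eq_iff)

lemma smooth_const: "openin (Euclidean_space n) V \<Longrightarrow> smooth_fun n V (\<lambda>_. c)"
  by (rule smooth_closure_smooth, assumption, rule smooth_closure.const)

lemma smooth_add: "openin (Euclidean_space n) V \<Longrightarrow> smooth_fun n V h \<Longrightarrow> smooth_fun n V k \<Longrightarrow> smooth_fun n V (\<lambda>v. h v + k v)"
  by (rule smooth_closure_smooth, assumption, rule smooth_closure.add; rule smooth_closure.base)

lemma smooth_mult: "openin (Euclidean_space n) V \<Longrightarrow> smooth_fun n V h \<Longrightarrow> smooth_fun n V k \<Longrightarrow> smooth_fun n V (\<lambda>v. h v * k v)"
  by (rule smooth_closure_smooth, assumption, rule smooth_closure.mult; rule smooth_closure.base)

lemma smooth_sum: "openin (Euclidean_space n) V \<Longrightarrow> (\<And>i. i \<in> I \<Longrightarrow> smooth_fun n V (h i)) \<Longrightarrow> smooth_fun n V (\<lambda>v. \<Sum>i\<in>I. h i v)"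
  by (rule smooth_closure_smooth, assumption, rule smooth_closure_sum, rule smooth_closure.base, simp)

lemma smooth_comp:
  "openin (Euclidean_space n) V \<Longrightarrow> openin (Euclidean_space n) W \<Longrightarrow> smooth_fun n W h \<Longrightarrow> (\<And>v. v \<in> V \<Longrightarrow> \<phi> v \<in> W) \<Longrightarrow>
    (\<And>v i. i \<ge> n \<Longrightarrow> \<phi> v i = 0) \<Longrightarrow> (\<And>i. i < n \<Longrightarrow> smooth_fun n V (\<lambda>v. \<phi> v i)) \<Longrightarrow>
    smooth_fun n V (\<lambda>v. h (\<phi> v))"
  by (rule smooth_closure_smooth, assumption, rule smooth_closure.comp)

lemma smooth_cong:
  assumes V: "openin (Euclidean_space n) V" and h: "smooth_fun n V h" and eq: "\<And>v. v \<in> V \<Longrightarrow> k v = h v"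
  shows "smooth_fun n V k"
proof (rule smooth_fun_coinduct[where P = "\<lambda>k. \<exists>h. smooth_fun n V h \<and> (\<forall>v\<in>V. k v = h v)", OF V])
  fix k :: "(nat \<Rightarrow> real) \<Rightarrow> real" and i and v :: "nat \<Rightarrow> real"
  assume "\<exists>h. smooth_fun n V h \<and> (\<forall>v\<in>V. k v = h v)"
  then obtain h where h: "smooth_fun n V h" "\<And>v. v \<in> V \<Longrightarrow> k v = h v" by auto
  show "continuous_map (subtopology (Euclidean_space n) V) euclideanreal k"
    by (rule continuous_map_eq[OF smooth_funD(1)[OF h(1)]]) (use h in \<open>auto simp: topspace_subtopology\<close>)
  show "differentiable_along i k v" if "v \<in> V" "i < n"
    using h by (intro differentiable_along_cong[OF V that _ smooth_funD(2)[OF h(1) that]]) auto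
  show "\<exists>h'. (\<exists>h. smooth_fun n V h \<and> (\<forall>v\<in>V. h' v = h v)) \<and> (\<forall>v\<in>V. h' v = pdiff i k v)" if "i < n"
    by (intro exI[of _ "pdiff i h"] conjI ballI smooth_funD(3)[OF h(1) that] refl exI[of _ "pdiff i h"])
      (use h in \<open>auto intro!: pdiff_cong[OF V _ that]\<close>)
qed (use assms in auto)

lemma smooth_subset:
  assumes "openin (Euclidean_space n) W" "smooth_fun n V h" "W \<subseteq> V"
  shows "smooth_fun n W h"
  unfolding smooth_fun_def
proof (intro allI impI conjI ballI)
  fix js assume js: "set js \<subseteq> {..<n}"
  note * = assms(2)[unfolded smooth_fun_def, rule_format, OF js]
  show "continuous_map (subtopology (Euclidean_space n) W) euclideanreal (foldr pdiff js h)"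
    using * assms(3) continuous_map_from_subtopology_mono by blast
  fix v i assume "v \<in> W" "i < n"
  then show "differentiable_along i (foldr pdiff js h) v" using * assms(3) by blast
qed

lemma lsmooth_add: "openin (Euclidean_space n) V \<Longrightarrow> lsmooth n V f \<Longrightarrow> lsmooth n V g \<Longrightarrow> lsmooth n V (f + g)"
  by (simp add: lsmooth_def plus_fun_def smooth_add)

lemma lsmooth_lone: "openin (Euclidean_space n) V \<Longrightarrow> lsmooth n V lone"
  by (simp add: lsmooth_def lone_def smooth_const)

lemma lsmooth_lvar: "openin (Euclidean_space n) V \<Longrightarrow> lsmooth n V (lvar n i)"
proof -
  assume V: "openin (Euclidean_space n) V"
  have e: "lvar n i \<mu> = (if i < n then (if \<mu> = (\<lambda>_. 0) then (\<lambda>v. v i) else (\<lambda>_. 0))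
      else if \<mu> = (\<lambda>_. 0)(i := 1) then (\<lambda>_. 1) else (\<lambda>_. 0))" for \<mu>
    by (cases "i < n"; cases "\<mu> = (\<lambda>_. 0)(i := 1)") (simp_all add: lvar_def)
  show ?thesis
    unfolding lsmooth_def e using V by (simp add: smooth_const smooth_fun_coord)
qed

lemma lsmooth_scale: "openin (Euclidean_space n) V \<Longrightarrow> smooth_fun n V h \<Longrightarrow> lsmooth n V f \<Longrightarrow> lsmooth n V (lscale h f)"
  by (simp add: lsmooth_def lscale_def smooth_mult)

lemma lsmooth_sum:
  fixes f :: "'i \<Rightarrow> lfun"
  assumes "openin (Euclidean_space n) V" "\<And>i. i \<in> I \<Longrightarrow> lsmooth n V (f i)"
  shows "lsmooth n V (sum f I)"
proof -
  have "sum f I \<mu> = (\<lambda>v. \<Sum>i\<in>I. f i \<mu> v)" for \<mu> by (rule ext) (rule sum_lfun_apply)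
  then show ?thesis using assms by (auto simp: lsmooth_def intro!: smooth_sum)
qed

lemma lsmooth_lmult:
  assumes "openin (Euclidean_space n) V" "lsmooth n V f" "lsmooth n V g"
  shows "lsmooth n V (lmult w f g)"
  unfolding lsmooth_def
proof
  fix \<mu>
  have e: "lmult w f g \<mu> = (\<lambda>v. if fsupp \<mu> \<and> odd_ok w \<mu> then
     \<Sum>\<alpha> | \<forall>i. \<alpha> i \<le> \<mu> i. mono_sign w \<alpha> (\<lambda>i. \<mu> i - \<alpha> i) * f \<alpha> v * g (\<lambda>i. \<mu> i - \<alpha> i) v else 0)"
    by (rule ext) (rule lmult_eq)
  show "smooth_fun n V (lmult w f g \<mu>)"
  proof (cases "fsupp \<mu> \<and> odd_ok w \<mu>")
    case True
    show ?thesis unfolding e if_P[OF True]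
      using assms by (intro smooth_sum smooth_mult smooth_const) (auto simp: lsmooth_def)
  next
    case False
    show ?thesis unfolding e if_not_P[OF False] by (rule smooth_const[OF assms(1)])
  qed
qed

lemma lsmooth_subset: "openin (Euclidean_space n) W \<Longrightarrow> lsmooth n V f \<Longrightarrow> W \<subseteq> V \<Longrightarrow> lsmooth n W f"
  unfolding lsmooth_def using smooth_subset by blast

lemma lsmooth_cong: "openin (Euclidean_space n) V \<Longrightarrow> lsmooth n V f \<Longrightarrow> eqon V g f \<Longrightarrow> lsmooth n V g"
  unfolding lsmooth_def eqon_def by (metis smooth_cong)

lemma lsmooth_lrestrict: "openin (Euclidean_space n) V \<Longrightarrow> lsmooth n V f \<Longrightarrow> lsmooth n V (lrestrict V f)"
  by (erule (1) lsmooth_cong) (rule eqon_lrestrict)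

lemma lsmooth_lpartial:
  assumes "openin (Euclidean_space n) V" "lsmooth n V f"
  shows "lsmooth n V (lpartial n w i f)"
proof (cases "i < n")
  case True
  then show ?thesis using assms by (simp add: lpartial_base lsmooth_def smooth_funD(3))
next
  case False
  then show ?thesis using assms by (simp add: lpartial_fibre lsmooth_def smooth_mult smooth_const)
qed

lemma lsmooth_power:
  "openin (Euclidean_space n) V \<Longrightarrow> lsmooth n V g \<Longrightarrow> lsmooth n V f \<Longrightarrow> lsmooth n V ((lmult w g ^^ m) f)"
  by (induction m) (auto intro: lsmooth_lmult)

lemma lsmooth_mpart:
  assumes V: "openin (Euclidean_space n) V" and y: "\<And>i. k \<le> i \<Longrightarrow> i < N \<Longrightarrow> lsmooth n V (y i)"
  shows "lsmooth n V (mpart w N y k \<nu>)"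
proof (cases "k \<le> N")
  case True
  then show ?thesis using y
    by (induction rule: inc_induct) (auto simp: mpart_end mpart_step lsmooth_lone[OF V] intro!: lsmooth_power[OF V])
qed (simp add: mpart_end lsmooth_lone[OF V])

lemma lpartial_cong:
  assumes "openin (Euclidean_space n) V" "eqon V f g"
  shows "eqon V (lpartial n w i f) (lpartial n w i g)"
proof (cases "i < n")
  case True
  then show ?thesis using assms(2) by (auto simp: eqon_def lpartial_base intro!: pdiff_cong[OF assms(1)])
next
  case False
  then show ?thesis using assms(2) by (simp add: eqon_def lpartial_fibre)
qed

lemma lsmoothD: "lsmooth n V f \<Longrightarrow> v \<in> V \<Longrightarrow> i < n \<Longrightarrow> differentiable_along i (f \<mu>) v"
  unfolding lsmooth_def using smooth_funD(2) by blast

lemma lpartial_base_add: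
  assumes "lsmooth n V f" "lsmooth n V g" "i < n"
  shows "eqon V (lpartial n w i (f + g)) (lpartial n w i f + lpartial n w i g)"
proof (rule eqonI)
  fix v \<mu> assume v: "v \<in> V"
  have "(f + g) \<mu> = (\<lambda>v. f \<mu> v + g \<mu> v)" by (simp add: plus_fun_def)
  then show "lpartial n w i (f + g) \<mu> v = (lpartial n w i f + lpartial n w i g) \<mu> v"
    using pdiff_add[OF lsmoothD[OF assms(1) v assms(3)] lsmoothD[OF assms(2) v assms(3)]] assms(3)
    by (simp add: lpartial_base plus_fun_apply)
qed

lemma lpartial_base_scale:
  assumes "lsmooth n V f" "smooth_fun n V h" "i < n"
  shows "eqon V (lpartial n w i (lscale h f)) (lscale (pdiff i h) f + lscale h (lpartial n w i f))"
proof (rule eqonI)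
  fix v \<mu> assume v: "v \<in> V"
  show "lpartial n w i (lscale h f) \<mu> v = (lscale (pdiff i h) f + lscale h (lpartial n w i f)) \<mu> v"
    using pdiff_mult[OF smooth_funD(2)[OF assms(2) v assms(3)] lsmoothD[OF assms(1) v assms(3)]] assms(3)
    by (simp add: lpartial_base plus_fun_apply lscale_def)
qed

lemma lpartial_base_lmult:
  assumes f: "lsmooth n V f" and g: "lsmooth n V g" and i: "i < n"
  shows "eqon V (lpartial n w i (lmult w f g)) (lmult w (lpartial n w i f) g + lmult w f (lpartial n w i g))"
proof (rule eqonI)
  fix v \<mu> assume v: "v \<in> V"
  show "lpartial n w i (lmult w f g) \<mu> v = (lmult w (lpartial n w i f) g + lmult w f (lpartial n w i g)) \<mu> v"
  proof (cases "fsupp \<mu> \<and> odd_ok w \<mu>")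
    case True
    let ?m = "\<lambda>\<alpha> i. \<mu> i - \<alpha> i :: nat"
    let ?s = "\<lambda>\<alpha>. mono_sign w \<alpha> (?m \<alpha>)"
    have "((\<lambda>t. \<Sum>\<alpha> | \<forall>i. \<alpha> i \<le> \<mu> i. ?s \<alpha> * f \<alpha> (v(i := t)) * g (?m \<alpha>) (v(i := t)))
      has_real_derivative (\<Sum>\<alpha> | \<forall>i. \<alpha> i \<le> \<mu> i. ?s \<alpha> * pdiff i (f \<alpha>) v * g (?m \<alpha>) v +
         pdiff i (g (?m \<alpha>)) v * (?s \<alpha> * f \<alpha> v))) (at (v i))"
    proof (rule DERIV_sum)
      fix \<alpha>
      have "((\<lambda>t. (?s \<alpha> * f \<alpha> (v(i := t))) * g (?m \<alpha>) (v(i := t))) has_real_derivative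
        (?s \<alpha> * pdiff i (f \<alpha>) v) * g (?m \<alpha>) (v(i := v i)) + pdiff i (g (?m \<alpha>)) v * (?s \<alpha> * f \<alpha> (v(i := v i)))) (at (v i))"
        by (intro DERIV_mult DERIV_cmult DERIV_pdiff lsmoothD[OF f v i] lsmoothD[OF g v i])
      then show "((\<lambda>t. ?s \<alpha> * f \<alpha> (v(i := t)) * g (?m \<alpha>) (v(i := t))) has_real_derivative
        ?s \<alpha> * pdiff i (f \<alpha>) v * g (?m \<alpha>) v + pdiff i (g (?m \<alpha>)) v * (?s \<alpha> * f \<alpha> v)) (at (v i))"
        by (simp only: fun_upd_triv)
    qed
    then have "((\<lambda>t. lmult w f g \<mu> (v(i := t))) has_real_derivative (\<Sum>\<alpha> | \<forall>i. \<alpha> i \<le> \<mu> i. ?s \<alpha> * pdiff i (f \<alpha>) v * g (?m \<alpha>) v +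
         pdiff i (g (?m \<alpha>)) v * (?s \<alpha> * f \<alpha> v))) (at (v i))"
      unfolding lmult_eq if_P[OF True] .
    from pdiff_eqI[where h = "lmult w f g \<mu>", OF this] show ?thesis
      using i True by (simp add: lpartial_base lmult_eq plus_fun_apply sum.distrib mult_ac)
  next
    case False
    have "lmult w f g \<mu> = (\<lambda>_. 0)" by (rule ext) (rule lmult_notok[OF False])
    then show ?thesis
      using i by (simp add: lpartial_base plus_fun_apply pdiff_const lmult_notok[OF False])
  qed
qed

section \<open>Vector fields as graded derivations\<close>

definition vfield :: "nat \<Rightarrow> nat \<Rightarrow> (nat \<Rightarrow> nat) \<Rightarrow> (nat \<Rightarrow> lfun) \<Rightarrow> lfun \<Rightarrow> lfun" where
  "vfield n N w X f = (\<Sum>j<N. lmult w (X j) (lpartial n w j f))"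

lemma vfield_cong:
  "openin (Euclidean_space n) V \<Longrightarrow> eqon V f g \<Longrightarrow> eqon V (vfield n N w X f) (vfield n N w X g)"
  unfolding vfield_def by (intro eqon_sum eqon_lmult eqon_refl lpartial_cong)

lemma vfield_lone [simp]: "vfield n N w X lone = 0"
  by (simp add: vfield_def)

lemma vfield_zero [simp]: "vfield n N w X 0 = 0"
  by (simp add: vfield_def)

lemma vfield_add:
  assumes "lsmooth n V f" "lsmooth n V g"
  shows "eqon V (vfield n N w X (f + g)) (vfield n N w X f + vfield n N w X g)"
proof -
  have "eqon V (lpartial n w j (f + g)) (lpartial n w j f + lpartial n w j g)" for j
    using lpartial_base_add[OF assms, of j w] by (cases "j < n") (auto simp: lpartial_add)
  then have "eqon V (vfield n N w X (f + g)) (\<Sum>j<N. lmult w (X j) (lpartial n w j f + lpartial n w j g))"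
    unfolding vfield_def by (intro eqon_sum eqon_lmult eqon_refl)
  then show ?thesis by (simp add: vfield_def lmult_add_right sum.distrib)
qed

lemma vfield_sum:
  fixes f :: "'i \<Rightarrow> lfun"
  assumes V: "openin (Euclidean_space n) V" and "\<And>i. i \<in> I \<Longrightarrow> lsmooth n V (f i)"
  shows "eqon V (vfield n N w X (sum f I)) (\<Sum>i\<in>I. vfield n N w X (f i))"
  using assms(2)
proof (induction I rule: infinite_finite_induct)
  case (insert i I)
  have "eqon V (vfield n N w X (f i + sum f I)) (vfield n N w X (f i) + vfield n N w X (sum f I))"
    using insert.prems by (intro vfield_add lsmooth_sum[OF V]) auto
  also have "eqon V \<dots> (vfield n N w X (f i) + (\<Sum>i\<in>I. vfield n N w X (f i)))"
    using insert by (intro eqon_add eqon_refl) auto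
  finally show ?case using insert by simp
qed simp_all

text \<open>Only the base derivatives act on \<open>h\<close>; the second sum is the function
  \<open>X h\<close> multiplied by \<open>f\<close>, with the scalars pulled out.\<close>

lemma vfield_scale:
  assumes "lsmooth n V f" "smooth_fun n V h" "n \<le> N"
  shows "eqon V (vfield n N w X (lscale h f))
    (lscale h (vfield n N w X f) + (\<Sum>j<n. lscale (pdiff j h) (lmult w (X j) f)))"
proof -
  let ?c = "\<lambda>j. if j < n then lscale (pdiff j h) f else 0"
  have "eqon V (lpartial n w j (lscale h f)) (?c j + lscale h (lpartial n w j f))" for j
    using lpartial_base_scale[OF assms(1,2), of j w] by (cases "j < n") (auto simp: lpartial_scale)
  then have "eqon V (vfield n N w X (lscale h f)) (\<Sum>j<N. lmult w (X j) (?c j + lscale h (lpartial n w j f)))"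
    unfolding vfield_def by (intro eqon_sum eqon_lmult eqon_refl)
  also have "(\<Sum>j<N. lmult w (X j) (?c j + lscale h (lpartial n w j f))) =
    (\<Sum>j<N. lmult w (X j) (?c j)) + lscale h (vfield n N w X f)"
    by (simp add: vfield_def lmult_add_right sum.distrib lmult_scale_right lscale_sum)
  also have "(\<Sum>j<N. lmult w (X j) (?c j)) = (\<Sum>j<n. lmult w (X j) (?c j))"
    using assms(3) by (intro sum.mono_neutral_right) auto
  also have "\<dots> = (\<Sum>j<n. lscale (pdiff j h) (lmult w (X j) f))"
    by (intro sum.cong) (auto simp: lmult_scale_right)
  finally show ?thesis by (simp add: add.commute)
qed

text \<open>Here \<open>q\<close> is the parity of the vector field. Moving \<open>X j\<close> past
  \<open>f\<close> costs \<open>(w j + q) p\<close>, of which the sign \<open>p w_j\<close> of the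
  derivative cancels one part and leaves \<open>p q\<close>.\<close>

lemma vfield_lmult:
  assumes f: "lsmooth n V f" "lpar w p f" "gdeg n N w f" and g: "lsmooth n V g" "lok w g"
    and pos: "gpos n N w" "n \<le> N" "\<And>j. j < n \<Longrightarrow> even (w j)"
    and X: "\<And>j. j < N \<Longrightarrow> lpar w (w j + q) (X j)"
  shows "eqon V (vfield n N w X (lmult w f g))
    (lmult w (vfield n N w X f) g + lscale (\<lambda>_. (- 1) ^ (p * q)) (lmult w f (vfield n N w X g)))"
proof -
  have 1: "eqon V (lpartial n w j (lmult w f g)) (lmult w (lpartial n w j f) g +
      lscale (\<lambda>_. (- 1) ^ (p * w j)) (lmult w f (lpartial n w j g)))" for j
  proof (cases "j < n")
    case True
    then have "(- 1 :: real) ^ (p * w j) = 1" using pos(3) by (simp add: minus_one_power_iff)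
    then show ?thesis using lpartial_base_lmult[OF f(1) g(1) True, of w] by simp
  next
    case False
    then show ?thesis using lpartial_lmult[OF _ f(2,3) pos(1,2) g(2), of j] by simp
  qed
  have 2: "lmult w (X j) (lscale (\<lambda>_. (- 1) ^ (p * w j)) (lmult w f h)) =
      lscale (\<lambda>_. (- 1) ^ (p * q)) (lmult w f (lmult w (X j) h))" if "j < N" for j h
  proof -
    have "lmult w (X j) (lmult w f h) = lscale (\<lambda>_. (- 1) ^ ((w j + q) * p)) (lmult w f (lmult w (X j) h))"
      by (simp add: lmult_assoc[symmetric] lmult_commute[OF X[OF that] f(2)] lmult_scale_left)
    then show ?thesis
      by (simp add: lmult_scale_right lscale_lscale power_add[symmetric])
        (simp add: minus_one_power_iff algebra_simps)
  qed
  have "eqon V (vfield n N w X (lmult w f g)) (\<Sum>j<N. lmult w (X j) (lmult w (lpartial n w j f) g +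
      lscale (\<lambda>_. (- 1) ^ (p * w j)) (lmult w f (lpartial n w j g))))"
    unfolding vfield_def by (intro eqon_sum eqon_lmult eqon_refl 1)
  also have "\<dots> = lmult w (vfield n N w X f) g + lscale (\<lambda>_. (- 1) ^ (p * q)) (lmult w f (vfield n N w X g))"
    using 2 by (simp add: lmult_add_right sum.distrib vfield_def lmult_sum_left lmult_sum_right lscale_sum lmult_assoc)
  finally show ?thesis .
qed

lemma vfield_lpar:
  assumes "lpar w p f" "\<And>j. j < n \<Longrightarrow> even (w j)" "\<And>j. j < N \<Longrightarrow> lpar w (w j + q) (X j)"
  shows "lpar w (p + q) (vfield n N w X f)"
  unfolding vfield_def
proof (rule lsupp_sum)
  fix j assume "j \<in> {..<N}"
  then have "lpar w ((w j + q) + (p + w j)) (lmult w (X j) (lpartial n w j f))"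
    using assms by (intro lpar_lmult lpar_lpartial) auto
  then show "lpar w (p + q) (lmult w (X j) (lpartial n w j f))"
    by (rule lsupp_mono) auto
qed

text \<open>For a power with at least two factors \<open>y\<close> is even and commutes with
  everything, so the terms of the Leibniz rule coincide and give the factor
  \<open>m\<close>.\<close>

lemma vfield_power:
  assumes y: "lsmooth n V y" "lpar w p y" "gdeg n N w y" and R: "lsmooth n V R" "lok w R"
    and V: "openin (Euclidean_space n) V"
    and pos: "gpos n N w" "n \<le> N" "\<And>j. j < n \<Longrightarrow> even (w j)"
    and X: "\<And>j. j < N \<Longrightarrow> lpar w (w j + q) (X j)"
    and m: "odd p \<longrightarrow> m \<le> 1"
  shows "eqon V (vfield n N w X ((lmult w y ^^ m) R))
    (lscale (\<lambda>_. real m) (lmult w (vfield n N w X y) ((lmult w y ^^ (m - 1)) R)) +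
     lscale (\<lambda>_. (- 1) ^ (m * p * q)) ((lmult w y ^^ m) (vfield n N w X R)))"
  using m
proof (induction m)
  case (Suc m)
  let ?D = "vfield n N w X"
  have g1: "lsmooth n V ((lmult w y ^^ m) R)" by (rule lsmooth_power[OF V y(1) R(1)])
  have g2: "lok w ((lmult w y ^^ m) R)" by (rule lok_power[OF R(2)])
  have "eqon V (?D ((lmult w y ^^ Suc m) R)) (lmult w (?D y) ((lmult w y ^^ m) R) +
      lscale (\<lambda>_. (- 1) ^ (p * q)) (lmult w y (?D ((lmult w y ^^ m) R))))"
    using vfield_lmult[OF y g1 g2 pos X] by simp
  also have "eqon V \<dots> (lmult w (?D y) ((lmult w y ^^ m) R) +
      lscale (\<lambda>_. (- 1) ^ (p * q)) (lmult w y (lscale (\<lambda>_. real m) (lmult w (?D y) ((lmult w y ^^ (m - 1)) R)) +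
     lscale (\<lambda>_. (- 1) ^ (m * p * q)) ((lmult w y ^^ m) (?D R)))))"
    using Suc by (intro eqon_add eqon_scale eqon_lmult eqon_refl) auto
  also have "\<dots> = lscale (\<lambda>_. real (Suc m)) (lmult w (?D y) ((lmult w y ^^ (Suc m - 1)) R)) +
     lscale (\<lambda>_. (- 1) ^ (Suc m * p * q)) ((lmult w y ^^ Suc m) (?D R))"
  proof -
    have *: "lscale (\<lambda>_. (- 1) ^ (p * q)) (lmult w y (lscale (\<lambda>_. real m) (lmult w (?D y) ((lmult w y ^^ (m - 1)) R)))) =
      lscale (\<lambda>_. real m) (lmult w (?D y) ((lmult w y ^^ m) R))"
    proof (cases m)
      case (Suc k)
      then have p: "even p" using Suc.prems by auto
      have "lmult w y (lmult w (?D y) ((lmult w y ^^ k) R)) = lmult w (?D y) (lmult w y ((lmult w y ^^ k) R))"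
        using p by (simp add: lmult_assoc[symmetric] lmult_commute[OF y(2) vfield_lpar[OF y(2) pos(3) X]]
            lmult_scale_left minus_one_power_iff)
      then show ?thesis using Suc p by (simp add: lmult_scale_right minus_one_power_iff)
    qed simp
    have **: "lscale (\<lambda>_. 1 + real m) f = f + lscale (\<lambda>_. real m) f" for f
      by (simp add: lscale_def fun_eq_iff plus_fun_apply algebra_simps)
    show ?thesis
      unfolding lmult_add_right lscale_add * by (simp add: lmult_scale_right lscale_lscale ** power_add algebra_simps)
  qed
  finally show ?case .
qed simp

definition wgood :: "nat \<Rightarrow> nat \<Rightarrow> (nat \<Rightarrow> nat) \<Rightarrow> bool" where
  "wgood n N w \<longleftrightarrow> n \<le> N \<and> gpos n N w \<and> (\<forall>i<n. w i = 0)"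

text \<open>A smooth map over \<open>V\<close> that preserves degrees, from the graded domain with
  data \<open>N\<close>, \<open>w\<close> to the one with data \<open>N'\<close>, \<open>w'\<close>,
  given by the pullbacks of the target coordinates.\<close>

definition csub :: "nat \<Rightarrow> nat \<Rightarrow> (nat \<Rightarrow> nat) \<Rightarrow> nat \<Rightarrow> (nat \<Rightarrow> nat) \<Rightarrow> (nat \<Rightarrow> real) set \<Rightarrow> (nat \<Rightarrow> lfun) \<Rightarrow> bool" where
  "csub n N w N' w' V y \<longleftrightarrow> (\<forall>i<N'. lsmooth n V (y i) \<and> hdeg n N w (w' i) (y i))"

lemma wgoodD: "wgood n N w \<Longrightarrow> n \<le> N" "wgood n N w \<Longrightarrow> gpos n N w" "wgood n N w \<Longrightarrow> i < n \<Longrightarrow> w i = 0"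
  by (auto simp: wgood_def)

lemma csubD:
  assumes "csub n N w N' w' V y" "i < N'"
  shows "lsmooth n V (y i)" "hdeg n N w (w' i) (y i)" "gdeg n N w (y i)" "lpar w (w' i) (y i)"
  using assms hdeg_gdeg hdeg_lpar unfolding csub_def by blast+

lemma csub_good: "csub n N w N' w' V y \<Longrightarrow> wgood n N' w' \<Longrightarrow> good_subst n N' w' w y"
  unfolding good_subst_def using csubD(4) wgoodD(2) by blast

lemma power_sum:
  fixes f :: "'i \<Rightarrow> lfun"
  shows "(lmult w g ^^ m) (sum f I) = (\<Sum>i\<in>I. (lmult w g ^^ m) (f i))"
  by (induction m) (auto simp: lmult_sum_right)

lemma vfield_mpart:
  assumes V: "openin (Euclidean_space n) V" and w: "wgood n N w"
    and X: "\<And>j. j < N \<Longrightarrow> lpar w (w j + q) (X j)"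
    and y: "\<And>i. n \<le> i \<Longrightarrow> i < N' \<Longrightarrow> lsmooth n V (y i) \<and> lpar w (w' i) (y i) \<and> gdeg n N w (y i)"
    and \<nu>: "odd_ok w' \<nu>" and k: "k \<le> N'" "n \<le> k"
  shows "eqon V (vfield n N w X (mpart w N' y k \<nu>))
    (\<Sum>i\<in>{k..<N'}. lscale (\<lambda>_. gsign_from k w' i \<nu> * real (\<nu> i))
       (lmult w (vfield n N w X (y i)) (mpart w N' y k (\<nu>(i := \<nu> i - 1)))))"
  using k
proof (induction rule: inc_induct)
  case base
  then show ?case by (simp add: mpart_end)
next
  case (step k)
  let ?D = "vfield n N w X" and ?R = "mpart w N' y (Suc k) \<nu>"
  let ?R' = "\<lambda>i. mpart w N' y (Suc k) (\<nu>(i := \<nu> i - 1))"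
  note even = wgoodD(3)[OF w]
  have yk: "lsmooth n V (y k)" "lpar w (w' k) (y k)" "gdeg n N w (y k)" using y step by auto
  have "eqon V (?D ((lmult w (y k) ^^ \<nu> k) ?R))
    (lscale (\<lambda>_. real (\<nu> k)) (lmult w (?D (y k)) ((lmult w (y k) ^^ (\<nu> k - 1)) ?R)) +
     lscale (\<lambda>_. (- 1) ^ (\<nu> k * w' k * q)) ((lmult w (y k) ^^ \<nu> k) (?D ?R)))"
  proof (rule vfield_power[OF yk _ lok_mpart V wgoodD(2,1)[OF w] _ X])
    show "lsmooth n V ?R" using y step by (intro lsmooth_mpart[OF V]) auto
    show "odd (w' k) \<longrightarrow> \<nu> k \<le> 1" using odd_okD[OF \<nu>] by blast
  qed (auto simp: even)
  also have "eqon V \<dots> (lscale (\<lambda>_. real (\<nu> k)) (lmult w (?D (y k)) ((lmult w (y k) ^^ (\<nu> k - 1)) ?R)) +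
     lscale (\<lambda>_. (- 1) ^ (\<nu> k * w' k * q)) ((lmult w (y k) ^^ \<nu> k)
      (\<Sum>i\<in>{Suc k..<N'}. lscale (\<lambda>_. gsign_from (Suc k) w' i \<nu> * real (\<nu> i)) (lmult w (?D (y i)) (?R' i)))))"
    by (rule eqon_add[OF eqon_refl], rule eqon_scale[OF refl], rule eqon_power, rule step.IH)
      (use step in simp)
  also have "\<dots> = (\<Sum>i\<in>{k..<N'}. lscale (\<lambda>_. gsign_from k w' i \<nu> * real (\<nu> i))
       (lmult w (?D (y i)) (mpart w N' y k (\<nu>(i := \<nu> i - 1)))))"
  proof -
    have 1: "mpart w N' y k (\<nu>(k := \<nu> k - 1)) = (lmult w (y k) ^^ (\<nu> k - 1)) ?R"
    proof -
      have "mpart w N' y (Suc k) (\<nu>(k := \<nu> k - 1)) = ?R" by (rule mpart_cong) auto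
      then show ?thesis using step(2) by (simp add: mpart_step)
    qed
    have 2: "lscale (\<lambda>_. (- 1) ^ (\<nu> k * w' k * q)) ((lmult w (y k) ^^ \<nu> k)
        (lscale (\<lambda>_. gsign_from (Suc k) w' i \<nu> * real (\<nu> i)) (lmult w (?D (y i)) (?R' i)))) =
      lscale (\<lambda>_. gsign_from k w' i \<nu> * real (\<nu> i)) (lmult w (?D (y i)) (mpart w N' y k (\<nu>(i := \<nu> i - 1))))"
      if i: "i \<in> {Suc k..<N'}" for i
    proof -
      have p: "lpar w (w' i + q) (?D (y i))"
        using y[of i] i step even by (intro vfield_lpar X) auto
      have m: "mpart w N' y k (\<nu>(i := \<nu> i - 1)) = (lmult w (y k) ^^ \<nu> k) (?R' i)"
        using step(2) i by (simp add: mpart_step)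
      have s: "gsign_from k w' i \<nu> = (- 1) ^ (\<nu> k * (w' i * w' k)) * gsign_from (Suc k) w' i \<nu>"
        using i odd_okD[OF \<nu>] by (intro gsign_from_Suc) auto
      have "lmult w (?D (y i)) (mpart w N' y k (\<nu>(i := \<nu> i - 1))) =
        lscale (\<lambda>_. (- 1) ^ (\<nu> k * ((w' i + q) * w' k))) ((lmult w (y k) ^^ \<nu> k) (lmult w (?D (y i)) (?R' i)))"
        unfolding m by (rule lpar_swap_power[OF p yk(2)])
      \<comment> \<open>The field passes the powers of \<open>y_k\<close>, then its value on
        \<open>y_i\<close> is brought back in front of them. The dependence on \<open>q\<close>
        cancels and the Koszul sign of \<open>z_i\<close> and \<open>z_k\<close> remains.\<close>
      moreover have "(- 1 :: real) ^ (\<nu> k * w' k * q) = (- 1) ^ (\<nu> k * (w' i * w' k)) * (- 1) ^ (\<nu> k * ((w' i + q) * w' k))"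
        by (simp add: minus_one_power_iff)
      ultimately show ?thesis
        by (simp add: lscale_power lscale_lscale s mult_ac)
    qed
    have "(\<Sum>i\<in>{k..<N'}. lscale (\<lambda>_. gsign_from k w' i \<nu> * real (\<nu> i))
       (lmult w (?D (y i)) (mpart w N' y k (\<nu>(i := \<nu> i - 1))))) =
       lscale (\<lambda>_. gsign_from k w' k \<nu> * real (\<nu> k)) (lmult w (?D (y k)) (mpart w N' y k (\<nu>(k := \<nu> k - 1)))) +
       (\<Sum>i\<in>{Suc k..<N'}. lscale (\<lambda>_. gsign_from k w' i \<nu> * real (\<nu> i))
       (lmult w (?D (y i)) (mpart w N' y k (\<nu>(i := \<nu> i - 1)))))"
      using step(2) by (simp only: sum.atLeast_Suc_lessThan)
    also have "\<dots> = lscale (\<lambda>_. real (\<nu> k)) (lmult w (?D (y k)) ((lmult w (y k) ^^ (\<nu> k - 1)) ?R)) +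
     lscale (\<lambda>_. (- 1) ^ (\<nu> k * w' k * q)) ((lmult w (y k) ^^ \<nu> k)
      (\<Sum>i\<in>{Suc k..<N'}. lscale (\<lambda>_. gsign_from (Suc k) w' i \<nu> * real (\<nu> i)) (lmult w (?D (y i)) (?R' i))))"
      unfolding 1 gsign_from_self mult_1 power_sum lscale_sum
      by (rule arg_cong[of _ _ "\<lambda>x. _ + x"], rule sum.cong[OF refl], rule 2[symmetric])
    finally show ?thesis by (rule sym)
  qed
  finally have *: "eqon V (?D ((lmult w (y k) ^^ \<nu> k) ?R)) (\<Sum>i\<in>{k..<N'}. lscale (\<lambda>_. gsign_from k w' i \<nu> * real (\<nu> i))
       (lmult w (?D (y i)) (mpart w N' y k (\<nu>(i := \<nu> i - 1)))))" .
  show ?case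
    by (rule eqon_trans[OF _ *]) (simp only: mpart_step[OF step(2)] eqon_refl)
qed

lemma lsubst_nonzero:
  assumes "lsubst w n N y f \<mu> v \<noteq> 0"
  obtains \<nu> where "f \<nu> (base_subst n y v) \<noteq> 0" "mono_subst w n N y \<nu> \<mu> v \<noteq> 0"
proof -
  have "(\<Sum>\<nu> | f \<nu> (base_subst n y v) \<noteq> 0. f \<nu> (base_subst n y v) * mono_subst w n N y \<nu> \<mu> v) \<noteq> 0"
    using assms unfolding lsubst_def .
  then obtain \<nu> where "f \<nu> (base_subst n y v) * mono_subst w n N y \<nu> \<mu> v \<noteq> 0"
    by (rule sum.not_neutral_contains_not_neutral)
  then show thesis using that[of \<nu>] by simp
qed

lemma csub_subst_supp:
  assumes y: "csub n N w N' w' V y" and f: "lsupp (\<lambda>\<nu>. mono_ok n N' w' \<nu> \<and> P (mono_deg N' w' \<nu>)) f"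
  shows "lsupp (\<lambda>\<nu>. mono_ok n N w \<nu> \<and> P (mono_deg N w \<nu>)) (lsubst w n N' y f)"
  unfolding lsupp_def
proof (intro allI impI)
  fix \<mu> v assume "lsubst w n N' y f \<mu> v \<noteq> 0"
  then obtain \<nu> where \<nu>: "f \<nu> (base_subst n y v) \<noteq> 0" "mono_subst w n N' y \<nu> \<mu> v \<noteq> 0"
    by (rule lsubst_nonzero)
  have ok: "mono_ok n N' w' \<nu>" "P (mono_deg N' w' \<nu>)" using f \<nu>(1) unfolding lsupp_def by blast+
  have y': "\<And>i. n \<le> i \<Longrightarrow> i < N' \<Longrightarrow> hdeg n N w (w' i) (y i)" using csubD(2)[OF y] by simp
  have "hdeg n N w (mono_deg N' w' \<nu>) (mono_subst w n N' y \<nu>)"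
    using y' ok(1) by (intro hdeg_mono_subst[where w' = w']) simp_all
  then show "mono_ok n N w \<mu> \<and> P (mono_deg N w \<mu>)"
    using \<nu>(2) ok(2) unfolding lsupp_def by metis
qed

lemma csub_subst:
  assumes y: "csub n N w N' w' V y"
  shows "bdeg n N' w' K f \<Longrightarrow> bdeg n N w K (lsubst w n N' y f)"
    and "hdeg n N' w' K f \<Longrightarrow> hdeg n N w K (lsubst w n N' y f)"
    and "gdeg n N' w' f \<Longrightarrow> gdeg n N w (lsubst w n N' y f)"
proof -
  show b: "bdeg n N' w' K f \<Longrightarrow> bdeg n N w K (lsubst w n N' y f)" for K
    by (rule csub_subst_supp[OF y, where P = "\<lambda>d. d \<le> K"])
  show "hdeg n N' w' K f \<Longrightarrow> hdeg n N w K (lsubst w n N' y f)"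
    by (rule csub_subst_supp[OF y, where P = "\<lambda>d. d = K"])
  show "gdeg n N' w' f \<Longrightarrow> gdeg n N w (lsubst w n N' y f)"
    unfolding gdeg_def using b by blast
qed

lemma base_subst_zero: "i \<ge> n \<Longrightarrow> base_subst n y v i = 0"
  by (simp add: base_subst_def)

lemma smooth_base_subst:
  assumes V: "openin (Euclidean_space n) V" and W: "openin (Euclidean_space n) W"
    and y: "\<And>i. i < n \<Longrightarrow> lsmooth n V (y i)" and VW: "\<And>v. v \<in> V \<Longrightarrow> base_subst n y v \<in> W"
    and h: "smooth_fun n W h"
  shows "smooth_fun n V (\<lambda>v. h (base_subst n y v))"
  by (rule smooth_comp[OF V W h VW base_subst_zero])
    (use y in \<open>simp_all add: base_subst_def lsmooth_def\<close>)

lemma lsmooth_lsubst: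
  assumes V: "openin (Euclidean_space n) V" and W: "openin (Euclidean_space n) W"
    and y: "csub n N w N' w' V y" and w': "wgood n N' w'" and VW: "\<And>v. v \<in> V \<Longrightarrow> base_subst n y v \<in> W"
    and f: "lsmooth n W f" "gdeg n N' w' f"
  shows "lsmooth n V (lsubst w n N' y f)"
proof -
  obtain S where S: "finite S" "\<forall>\<nu> v. f \<nu> v \<noteq> 0 \<longrightarrow> \<nu> \<in> S" "\<forall>\<nu>\<in>S. mono_ok n N' w' \<nu>"
    by (rule gdeg_finite[OF wgoodD(2)[OF w'] f(2)])
  have "lsubst w n N' y f = (\<Sum>\<nu>\<in>S. lscale (\<lambda>v. f \<nu> (base_subst n y v)) (mono_subst w n N' y \<nu>))"
    by (rule lsubst_expand) (use S in auto)
  moreover have "lsmooth n V (mono_subst w n N' y \<nu>)" for \<nu>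
    unfolding mono_subst_mpart using csubD(1)[OF y] by (intro lsmooth_mpart[OF V])
  moreover have "smooth_fun n V (\<lambda>v. f \<nu> (base_subst n y v))" for \<nu>
    using f(1) csubD(1)[OF y] wgoodD(1)[OF w'] by (intro smooth_base_subst[OF V W _ VW]) (auto simp: lsmooth_def)
  ultimately show ?thesis by (simp add: lsmooth_sum[OF V] lsmooth_scale[OF V])
qed

text \<open>The chain rule. \<open>A\<close> is the ordinary chain rule for the coefficients and
  yields the terms \<open>k < n\<close>; \<open>B\<close> is the Leibniz rule for the monomials and
  yields the terms \<open>k \<ge> n\<close>. \<open>C1\<close> and \<open>C2\<close> expand the
  substituted derivatives of \<open>f\<close> over the same exponents for the comparison.\<close>

theorem vfield_lsubst:
  assumes V: "openin (Euclidean_space n) V" and W: "openin (Euclidean_space n) W"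
    and w: "wgood n N w" and w': "wgood n N' w'"
    and X: "\<And>j. j < N \<Longrightarrow> lpar w (w j + q) (X j)"
    and y: "csub n N w N' w' V y" and VW: "\<And>v. v \<in> V \<Longrightarrow> base_subst n y v \<in> W"
    and f: "lsmooth n W f" "gdeg n N' w' f"
  shows "eqon V (vfield n N w X (lsubst w n N' y f))
    (\<Sum>k<N'. lmult w (vfield n N w X (y k)) (lsubst w n N' y (lpartial n w' k f)))"
proof -
  let ?D = "vfield n N w X" and ?b = "base_subst n y" and ?Y = "mono_subst w n N' y"
  obtain S where S: "finite S" "\<forall>\<nu> v. f \<nu> v \<noteq> 0 \<longrightarrow> \<nu> \<in> S" "\<forall>\<nu>\<in>S. mono_ok n N' w' \<nu>"
    by (rule gdeg_finite[OF wgoodD(2)[OF w'] f(2)])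
  note nN = wgoodD(1)[OF w] and nN' = wgoodD(1)[OF w'] and pos' = wgoodD(2)[OF w']
  have f\<nu>: "smooth_fun n W (f \<nu>)" for \<nu> using f(1) by (simp add: lsmooth_def)
  have ys: "lsmooth n V (y i)" if "i < n" for i using csubD(1)[OF y] nN' that by auto
  have ex: "lsubst w n N' y f = (\<Sum>\<nu>\<in>S. lscale (\<lambda>v. f \<nu> (?b v)) (?Y \<nu>))"
    by (rule lsubst_expand) (use S in auto)
  have sY: "lsmooth n V (?Y \<nu>)" for \<nu>
    unfolding mono_subst_mpart using csubD(1)[OF y] by (intro lsmooth_mpart[OF V])
  have sf: "smooth_fun n V (\<lambda>v. f \<nu> (?b v))" for \<nu>
    by (rule smooth_base_subst[OF V W ys VW f\<nu>])
  have y0: "y i = lscale (y i (\<lambda>_. 0)) lone" if "i < n" for i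
    using hdeg_0_eq[of n N w "y i"] csubD(2)[OF y, of i] wgoodD(3)[OF w' that] wgoodD(2)[OF w] nN' that by simp
  have Dy0: "eqon V (?D (y i)) (\<Sum>j<n. lscale (pdiff j (y i (\<lambda>_. 0))) (lmult w (X j) lone))" if "i < n" for i
  proof -
    have "smooth_fun n V (y i (\<lambda>_. 0))" using ys[OF that] by (simp add: lsmooth_def)
    from vfield_scale[OF lsmooth_lone[OF V] this nN, of w X] show ?thesis
      by (simp add: y0[OF that, symmetric])
  qed
  have A: "eqon V (\<Sum>j<n. lscale (pdiff j (\<lambda>v. f \<nu> (?b v))) (lmult w (X j) (?Y \<nu>)))
      (\<Sum>i<n. lscale (\<lambda>v. pdiff i (f \<nu>) (?b v)) (lmult w (?D (y i)) (?Y \<nu>)))" for \<nu>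
  proof -
    have ch: "pdiff j (\<lambda>v. f \<nu> (?b v)) v = (\<Sum>i<n. pdiff i (f \<nu>) (?b v) * pdiff j (y i (\<lambda>_. 0)) v)"
      if "v \<in> V" "j < n" for v j
    proof -
      have e: "(\<lambda>u. ?b u i) = y i (\<lambda>_. 0)" if "i < n" for i using that by (simp add: base_subst_def)
      have "((\<lambda>t. f \<nu> (?b (v(j := t)))) has_real_derivative
        (\<Sum>i<n. pdiff i (f \<nu>) (?b v) * pdiff j (\<lambda>u. ?b u i) v)) (at (v j))"
      proof (rule chain_rule[OF W f\<nu>])
        show "?b v \<in> W" by (rule VW[OF that(1)])
        show "?b u i = 0" if "i \<ge> n" for u i by (rule base_subst_zero[OF that])
        show "differentiable_along j (\<lambda>u. ?b u i) v" if "i < n" for i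
          using lsmoothD[OF ys[OF that] \<open>v \<in> V\<close> \<open>j < n\<close>, of "\<lambda>_. 0"] that by (simp add: base_subst_def)
      qed
      from pdiff_eqI[where h = "\<lambda>v. f \<nu> (?b v)", OF this] show ?thesis using e by simp
    qed
    have "eqon V (\<Sum>j<n. lscale (pdiff j (\<lambda>v. f \<nu> (?b v))) (lmult w (X j) (?Y \<nu>)))
       (\<Sum>j<n. lscale (\<lambda>v. \<Sum>i<n. pdiff i (f \<nu>) (?b v) * pdiff j (y i (\<lambda>_. 0)) v) (lmult w (X j) (?Y \<nu>)))"
      using ch by (intro eqon_sum eqon_scale eqon_refl) auto
    also have "\<dots> = (\<Sum>i<n. lscale (\<lambda>v. pdiff i (f \<nu>) (?b v))
        (lmult w (\<Sum>j<n. lscale (pdiff j (y i (\<lambda>_. 0))) (lmult w (X j) lone)) (?Y \<nu>)))"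
      unfolding lscale_sum_left lmult_sum_left lscale_sum
      by (subst sum.swap) (simp add: lmult_scale_left lscale_lscale lmult_assoc lmult_lone_left[OF lok_mono_subst])
    also have "eqon V \<dots> (\<Sum>i<n. lscale (\<lambda>v. pdiff i (f \<nu>) (?b v)) (lmult w (?D (y i)) (?Y \<nu>)))"
      using eqon_sym[OF Dy0] by (intro eqon_sum eqon_scale eqon_lmult eqon_refl) auto
    finally show ?thesis .
  qed
  have B: "eqon V (?D (?Y \<nu>)) (\<Sum>i\<in>{n..<N'}. lscale (\<lambda>_. gsign w' i \<nu> * real (\<nu> i))
      (lmult w (?D (y i)) (?Y (\<nu>(i := \<nu> i - 1)))))" if "\<nu> \<in> S" for \<nu>
  proof -
    have ok: "mono_ok n N' w' \<nu>" using S(3) that by blast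
    show ?thesis
      using vfield_mpart[OF V w X _ mono_ok_odd_ok[OF ok] nN' order.refl, of y] csubD[OF y]
      by (simp add: mono_subst_mpart gsign_from_mono_ok[OF ok])
  qed
  have C1: "lsubst w n N' y (lpartial n w' k f) = (\<Sum>\<nu>\<in>S. lscale (\<lambda>v. pdiff k (f \<nu>) (?b v)) (?Y \<nu>))" if "k < n" for k
  proof -
    have "\<nu> \<in> S" if "lpartial n w' k f \<nu> v \<noteq> 0" for \<nu> v
    proof (rule ccontr)
      assume "\<nu> \<notin> S"
      then have "f \<nu> = (\<lambda>_. 0)" using S(2) by auto
      then show False using that \<open>k < n\<close> by (simp add: lpartial_base pdiff_const)
    qed
    then show ?thesis using S(1) by (subst lsubst_expand[of S]) (auto simp: lpartial_base[OF that])
  qed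
  have C2: "lsubst w n N' y (lpartial n w' k f) = (\<Sum>\<nu>\<in>S. lscale (\<lambda>v. f \<nu> (?b v) * (gsign w' k \<nu> * real (\<nu> k))) (?Y (\<nu>(k := \<nu> k - 1))))"
    if k: "n \<le> k" for k
  proof -
    have e: "f = (\<Sum>\<nu>\<in>S. lscale (f \<nu>) (lmono \<nu>))" by (rule lmono_expand) (use S in auto)
    have g: "gdeg n N' w' (lpartial n w' k (lmono \<nu>))" if "\<nu> \<in> S" for \<nu>
      using S(3) that by (intro gdeg_lpartial hdeg_gdeg[OF lmono_hdeg]) blast
    have "lpartial n w' k f = (\<Sum>\<nu>\<in>S. lscale (f \<nu>) (lpartial n w' k (lmono \<nu>)))"
      by (subst e) (simp add: lpartial_sum[OF k] lpartial_scale[OF k])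
    then have "lsubst w n N' y (lpartial n w' k f) = (\<Sum>\<nu>\<in>S. lsubst w n N' y (lscale (f \<nu>) (lpartial n w' k (lmono \<nu>))))"
      using g by (simp add: lsubst_sum[OF pos'] gdeg_scale)
    then show ?thesis
      by (simp add: lsubst_scale lpartial_lmono[OF k] lsubst_lmono lscale_lscale)
  qed
  have "eqon V (?D (lsubst w n N' y f)) (\<Sum>\<nu>\<in>S. ?D (lscale (\<lambda>v. f \<nu> (?b v)) (?Y \<nu>)))"
    unfolding ex by (intro vfield_sum[OF V] lsmooth_scale[OF V] sf sY)
  also have "eqon V \<dots> (\<Sum>\<nu>\<in>S. lscale (\<lambda>v. f \<nu> (?b v)) (?D (?Y \<nu>)) +
      (\<Sum>j<n. lscale (pdiff j (\<lambda>v. f \<nu> (?b v))) (lmult w (X j) (?Y \<nu>))))"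
    by (intro eqon_sum vfield_scale sf sY nN)
  also have "eqon V \<dots> (\<Sum>\<nu>\<in>S. lscale (\<lambda>v. f \<nu> (?b v)) (\<Sum>i\<in>{n..<N'}. lscale (\<lambda>_. gsign w' i \<nu> * real (\<nu> i))
      (lmult w (?D (y i)) (?Y (\<nu>(i := \<nu> i - 1))))) +
      (\<Sum>i<n. lscale (\<lambda>v. pdiff i (f \<nu>) (?b v)) (lmult w (?D (y i)) (?Y \<nu>))))"
    by (intro eqon_sum eqon_add eqon_scale refl A B)
  also have "\<dots> = (\<Sum>i\<in>{n..<N'}. lmult w (?D (y i)) (lsubst w n N' y (lpartial n w' i f))) +
      (\<Sum>i<n. lmult w (?D (y i)) (lsubst w n N' y (lpartial n w' i f)))"
  proof -
    have 1: "(\<Sum>\<nu>\<in>S. lscale (\<lambda>v. f \<nu> (?b v)) (\<Sum>i\<in>{n..<N'}. lscale (\<lambda>_. gsign w' i \<nu> * real (\<nu> i))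
      (lmult w (?D (y i)) (?Y (\<nu>(i := \<nu> i - 1)))))) =
      (\<Sum>i\<in>{n..<N'}. lmult w (?D (y i)) (lsubst w n N' y (lpartial n w' i f)))"
      unfolding lscale_sum by (subst sum.swap, rule sum.cong[OF refl])
        (simp add: C2 lmult_sum_right lmult_scale_right lscale_lscale)
    have 2: "(\<Sum>\<nu>\<in>S. \<Sum>i<n. lscale (\<lambda>v. pdiff i (f \<nu>) (?b v)) (lmult w (?D (y i)) (?Y \<nu>))) =
       (\<Sum>i<n. lmult w (?D (y i)) (lsubst w n N' y (lpartial n w' i f)))"
      by (subst sum.swap, rule sum.cong[OF refl]) (simp add: C1 lmult_sum_right lmult_scale_right)
    show ?thesis unfolding sum.distrib 1 2 ..
  qed
  also have "\<dots> = (\<Sum>k<N'. lmult w (?D (y k)) (lsubst w n N' y (lpartial n w' k f)))"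
  proof -
    have "{..<N'} = {n..<N'} \<union> {..<n}" "{n..<N'} \<inter> {..<n} = {}" using nN' by auto
    then show ?thesis by (simp add: sum.union_disjoint)
  qed
  finally show ?thesis .
qed

subsection \<open>Coordinate changes\<close>

text \<open>The differential of a function of the base coordinates, as a function of the coordinates
  \<open>\<xi>_j\<close>, which have index \<open>n + j\<close>.\<close>

definition dl :: "nat \<Rightarrow> ((nat \<Rightarrow> real) \<Rightarrow> real) \<Rightarrow> lfun" where
  "dl n h = (\<Sum>j<n. lscale (pdiff j h) (lvar n (n + j)))"

lemma dl_cong:
  assumes "openin (Euclidean_space n) V" "\<And>v. v \<in> V \<Longrightarrow> h v = k v"
  shows "eqon V (dl n h) (dl n k)"
  unfolding dl_def using assms by (intro eqon_sum eqon_scale eqon_refl) (auto intro: pdiff_cong)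

lemma dl_lsmooth: "openin (Euclidean_space n) V \<Longrightarrow> smooth_fun n V h \<Longrightarrow> lsmooth n V (dl n h)"
  unfolding dl_def by (intro lsmooth_sum lsmooth_scale lsmooth_lvar smooth_funD(3)) auto

lemma dl_hdeg: "2 * n \<le> N \<Longrightarrow> (\<And>j. j < n \<Longrightarrow> w (n + j) = 1) \<Longrightarrow> hdeg n N w 1 (dl n h)"
  unfolding dl_def
proof (intro lsupp_sum lsupp_scale)
  fix j assume "2 * n \<le> N" "\<And>j. j < n \<Longrightarrow> w (n + j) = 1" "j \<in> {..<n}"
  then show "hdeg n N w 1 (lvar n (n + j))" using hdeg_lvar[of n "n + j" N w] by simp
qed

lemma dl_sum:
  assumes V: "openin (Euclidean_space n) V" and I: "finite I" and h: "\<And>i. i \<in> I \<Longrightarrow> smooth_fun n V (h i)"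
  shows "eqon V (dl n (\<lambda>v. \<Sum>i\<in>I. h i v)) (\<Sum>i\<in>I. dl n (h i))"
proof -
  have "eqon V (dl n (\<lambda>v. \<Sum>i\<in>I. h i v)) (\<Sum>j<n. lscale (\<lambda>v. \<Sum>i\<in>I. pdiff j (h i) v) (lvar n (n + j)))"
    unfolding dl_def using smooth_funD(2)[OF h] I by (intro eqon_sum eqon_scale eqon_refl pdiff_sum) auto
  also have "\<dots> = (\<Sum>i\<in>I. dl n (h i))"
    unfolding dl_def lscale_sum_left by (rule sum.swap)
  finally show ?thesis .
qed

lemma dl_mult:
  assumes "smooth_fun n V h" "smooth_fun n V k"
  shows "eqon V (dl n (\<lambda>v. h v * k v)) (lscale k (dl n h) + lscale h (dl n k))"
proof -
  have "eqon V (dl n (\<lambda>v. h v * k v)) (\<Sum>j<n. lscale (\<lambda>v. k v * pdiff j h v + h v * pdiff j k v) (lvar n (n + j)))"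
    unfolding dl_def using smooth_funD(2)[OF assms(1)] smooth_funD(2)[OF assms(2)]
    by (intro eqon_sum eqon_scale eqon_refl) (simp add: pdiff_mult mult.commute)
  also have "\<dots> = lscale k (dl n h) + lscale h (dl n k)"
    by (simp add: dl_def lscale_add_left sum.distrib lscale_sum lscale_lscale)
  finally show ?thesis .
qed

lemma lpartial_base_lone: "i < n \<Longrightarrow> lpartial n w i (lscale h lone) = lscale (pdiff i h) lone"
proof (intro ext)
  fix \<mu> v assume i: "i < n"
  show "lpartial n w i (lscale h lone) \<mu> v = lscale (pdiff i h) lone \<mu> v"
  proof (cases "\<mu> = (\<lambda>_. 0)")
    case True
    then have "lscale h lone \<mu> = h" by (simp add: lscale_def lone_def)
    then show ?thesis using True by (simp add: lpartial_base[OF i]) (simp add: lscale_def lone_def)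
  next
    case False
    then have "lscale h lone \<mu> = (\<lambda>_. 0)" by (simp add: lscale_def lone_def)
    then show ?thesis using False by (simp add: lpartial_base[OF i] pdiff_const) (simp add: lscale_def lone_def)
  qed
qed

lemma lpartial_base_lvar: "i < n \<Longrightarrow> n \<le> k \<Longrightarrow> lpartial n w i (lvar n k) = 0"
proof -
  assume "i < n" "n \<le> k"
  then have "lvar n k \<mu> = (\<lambda>_. if \<mu> = (\<lambda>_. 0)(k := 1) then 1 else 0)" for \<mu>
    by (simp only: lvar_def linorder_not_less[symmetric] if_False)
  then show ?thesis using \<open>i < n\<close> by (simp add: lpartial_base pdiff_const zero_fun_def)
qed

lemma lpartial_base_sum:
  fixes f :: "'i \<Rightarrow> lfun"
  assumes V: "openin (Euclidean_space n) V" and f: "\<And>k. k \<in> I \<Longrightarrow> lsmooth n V (f k)" and i: "i < n"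
  shows "eqon V (lpartial n w i (sum f I)) (\<Sum>k\<in>I. lpartial n w i (f k))"
  using f
proof (induction I rule: infinite_finite_induct)
  case (insert k I)
  have "eqon V (lpartial n w i (f k + sum f I)) (lpartial n w i (f k) + lpartial n w i (sum f I))"
    using insert.prems i by (intro lpartial_base_add lsmooth_sum[OF V]) auto
  also have "eqon V \<dots> (lpartial n w i (f k) + (\<Sum>k\<in>I. lpartial n w i (f k)))"
    using insert by (intro eqon_add eqon_refl) auto
  finally show ?case using insert by simp
qed simp_all

text \<open>That \<open>d\<close> commutes with \<open>\<partial>_a\<close> is the symmetry of
  second derivatives.\<close>

lemma lpartial_base_dl:
  assumes V: "openin (Euclidean_space n) V" and h: "smooth_fun n V h" and a: "a < n"
  shows "eqon V (lpartial n w a (dl n h)) (dl n (pdiff a h))"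
proof -
  have "eqon V (lpartial n w a (dl n h)) (\<Sum>j<n. lpartial n w a (lscale (pdiff j h) (lvar n (n + j))))"
    unfolding dl_def using smooth_funD(3)[OF h] a
    by (intro lpartial_base_sum[OF V] lsmooth_scale[OF V] lsmooth_lvar[OF V]) auto
  also have "eqon V \<dots> (\<Sum>j<n. lscale (pdiff a (pdiff j h)) (lvar n (n + j)) + lscale (pdiff j h) (lpartial n w a (lvar n (n + j))))"
    using smooth_funD(3)[OF h] a
    by (intro eqon_sum lpartial_base_scale lsmooth_lvar[OF V]) auto
  also have "\<dots> = (\<Sum>j<n. lscale (pdiff a (pdiff j h)) (lvar n (n + j)))"
    using a by (simp add: lpartial_base_lvar)
  also have "eqon V \<dots> (\<Sum>j<n. lscale (pdiff j (pdiff a h)) (lvar n (n + j)))"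
    using a by (intro eqon_sum eqon_scale eqon_refl pdiff_commute[OF V h]) auto
  finally show ?thesis by (simp add: dl_def)
qed

text \<open>Naturality of \<open>d\<close>: pulling back \<open>dh\<close> along a base map together
  with its differential gives the differential of the pulled back function.\<close>

lemma lsubst_dl:
  assumes V: "openin (Euclidean_space n) V" and W: "openin (Euclidean_space n) W" and h: "smooth_fun n W h"
    and \<phi>: "\<And>v. v \<in> V \<Longrightarrow> \<phi> v \<in> W" "\<And>v i. v \<in> V \<Longrightarrow> i \<ge> n \<Longrightarrow> \<phi> v i = 0" "\<And>i. i < n \<Longrightarrow> smooth_fun n V (\<lambda>v. \<phi> v i)"
    and y: "\<And>i. i < n \<Longrightarrow> y i = lscale (\<lambda>v. \<phi> v i) lone" "\<And>i. i < n \<Longrightarrow> y (n + i) = dl n (\<lambda>v. \<phi> v i)"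
    and N: "wgood n N w'" "2 * n \<le> N" and w: "\<And>i. i < n \<Longrightarrow> lok w (y (n + i))"
  shows "eqon V (lsubst w n N y (dl n h)) (dl n (\<lambda>v. h (\<phi> v)))"
proof -
  have b: "base_subst n y v = \<phi> v" if "v \<in> V" for v
    using y(1) \<phi>(2)[OF that] by (auto simp: base_subst_def fun_eq_iff lscale_def lone_def)
  have g: "gdeg n N w' (lvar n (n + j))" if "j < n" for j
    using that N(2) by (intro hdeg_gdeg[OF hdeg_lvar]) auto
  have l: "lsubst w n N y (lvar n (n + j)) = y (n + j)" if "j < n" for j
    using that N(2) w by (intro lsubst_lvar) auto
  have ch: "pdiff k (\<lambda>v. h (\<phi> v)) v = (\<Sum>j<n. pdiff j h (\<phi> v) * pdiff k (\<lambda>v. \<phi> v j) v)" if v: "v \<in> V" and k: "k < n" for k v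
  proof -
    \<comment> \<open>\<open>chain_rule\<close> asks that the entries from \<open>n\<close> on
      vanish at all points, which is known of \<open>\<phi>\<close> on \<open>V\<close> only.
      Replacing \<open>\<phi>\<close> by 0 elsewhere does not affect derivatives on the open set
      \<open>V\<close>.\<close>
    let ?\<phi> = "\<lambda>u. if u \<in> V then \<phi> u else (\<lambda>_. 0)"
    have "((\<lambda>t. h (?\<phi> (v(k := t)))) has_real_derivative
      (\<Sum>j<n. pdiff j h (?\<phi> v) * pdiff k (\<lambda>u. ?\<phi> u j) v)) (at (v k))"
    proof (rule chain_rule[OF W h])
      show "?\<phi> v \<in> W" using \<phi>(1) v by simp
      show "?\<phi> u i = 0" if "i \<ge> n" for u i using \<phi>(2) that by simp
      show "differentiable_along k (\<lambda>u. ?\<phi> u i) v" if "i < n" for i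
        by (rule differentiable_along_cong[OF V v k _ smooth_funD(2)[OF \<phi>(3)[OF that] v k]]) simp
    qed
    from pdiff_eqI[where h = "\<lambda>v. h (?\<phi> v)", OF this]
    have "pdiff k (\<lambda>v. h (?\<phi> v)) v = (\<Sum>j<n. pdiff j h (\<phi> v) * pdiff k (\<lambda>u. ?\<phi> u j) v)" using v by simp
    moreover have "pdiff k (\<lambda>v. h (?\<phi> v)) v = pdiff k (\<lambda>v. h (\<phi> v)) v"
      by (rule pdiff_cong[OF V v k]) simp
    moreover have "pdiff k (\<lambda>u. ?\<phi> u j) v = pdiff k (\<lambda>u. \<phi> u j) v" for j
      by (rule pdiff_cong[OF V v k]) simp
    ultimately show ?thesis by simp
  qed
  have ex: "lsubst w n N y (dl n h) = (\<Sum>j<n. lscale (\<lambda>v. pdiff j h (base_subst n y v)) (dl n (\<lambda>v. \<phi> v j)))"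
    unfolding dl_def[of n h] using g l y(2)
    by (subst lsubst_sum[OF wgoodD(2)[OF N(1)]]) (simp_all add: lsubst_scale gdeg_scale)
  have "eqon V (lsubst w n N y (dl n h)) (\<Sum>j<n. lscale (\<lambda>v. pdiff j h (\<phi> v)) (dl n (\<lambda>v. \<phi> v j)))"
    unfolding ex using b by (intro eqon_sum eqon_scale eqon_refl) auto
  also have "\<dots> = (\<Sum>k<n. lscale (\<lambda>v. \<Sum>j<n. pdiff j h (\<phi> v) * pdiff k (\<lambda>v. \<phi> v j) v) (lvar n (n + k)))"
    unfolding dl_def lscale_sum lscale_sum_left by (subst sum.swap) (simp add: lscale_lscale)
  also have "eqon V \<dots> (dl n (\<lambda>v. h (\<phi> v)))"
    unfolding dl_def using ch by (intro eqon_sum eqon_scale eqon_refl) auto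
  finally show ?thesis .
qed

section \<open>Charts, Jacobians and their inverses\<close>

locale smooth_mfd =
  fixes T :: "'m topology" and n :: nat and A :: "'m chart set"
  assumes man: "smooth_manifold T n A"
begin

text \<open>The same set as \<open>cimage\<close>, shared by all bundles over the manifold since
  they have the same base charts.\<close>

definition ov :: "'m chart \<Rightarrow> 'm set \<Rightarrow> (nat \<Rightarrow> real) set" where
  "ov c W = snd c ` (fst c \<inter> W)"

abbreviation "\<tau> \<equiv> chart_trans"

text \<open>For coordinates \<open>x\<close> of \<open>c\<close> and \<open>x'\<close> of \<open>d\<close>, \<open>jac c d a b = \<partial>x'_a/\<partial>x_b\<close> and
  \<open>hinv c d b a = \<partial>x_b/\<partial>x'_a\<close>, both as functions of \<open>x\<close>.\<close>

definition jac :: "'m chart \<Rightarrow> 'm chart \<Rightarrow> nat \<Rightarrow> nat \<Rightarrow> (nat \<Rightarrow> real) \<Rightarrow> real" where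
  "jac c d a b = pdiff b (\<lambda>u. \<tau> c d u a)"

definition hinv :: "'m chart \<Rightarrow> 'm chart \<Rightarrow> nat \<Rightarrow> nat \<Rightarrow> (nat \<Rightarrow> real) \<Rightarrow> real" where
  "hinv c d b a = (\<lambda>v. jac d c b a (\<tau> c d v))"

lemma chart_open: "c \<in> A \<Longrightarrow> openin T (fst c)"
  and chart_image_open: "c \<in> A \<Longrightarrow> openin (Euclidean_space n) (snd c ` fst c)"
  and chart_homeo: "c \<in> A \<Longrightarrow> homeomorphic_map (subtopology T (fst c)) (subtopology (Euclidean_space n) (snd c ` fst c)) (snd c)"
  using man unfolding smooth_manifold_def by (auto dest!: bspec[of A _ c] simp: case_prod_beta)

lemma chart_smooth: "c \<in> A \<Longrightarrow> d \<in> A \<Longrightarrow> i < n \<Longrightarrow> smooth_fun n (ov c (fst d)) (\<lambda>v. \<tau> c d v i)"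
  using man unfolding smooth_manifold_def ov_def by (elim conjE) simp

lemma chart_inj: "c \<in> A \<Longrightarrow> inj_on (snd c) (fst c)"
proof -
  assume c: "c \<in> A"
  have "topspace (subtopology T (fst c)) = fst c"
    using openin_subset[OF chart_open[OF c]] by (auto simp: topspace_subtopology)
  then show ?thesis using chart_homeo[OF c] unfolding homeomorphic_map_def
    by (metis chart_homeo[OF c] homeomorphic_imp_injective_map)
qed

lemma ov_open:
  assumes c: "c \<in> A" and W: "openin T W"
  shows "openin (Euclidean_space n) (ov c W)"
proof -
  have "openin (subtopology T (fst c)) (fst c \<inter> W)"
    using W by (metis Int_commute openin_subtopology_Int)
  then have "openin (subtopology (Euclidean_space n) (snd c ` fst c)) (snd c ` (fst c \<inter> W))"
    using homeomorphic_imp_open_map[OF chart_homeo[OF c]] unfolding open_map_def by blast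
  then show ?thesis
    using openin_trans_full[OF _ chart_image_open[OF c]] unfolding ov_def by blast
qed

lemma ov_fst_open: "c \<in> A \<Longrightarrow> d \<in> A \<Longrightarrow> openin (Euclidean_space n) (ov c (fst d))"
  by (intro ov_open chart_open)

lemma ov_zero: "c \<in> A \<Longrightarrow> v \<in> ov c W \<Longrightarrow> i \<ge> n \<Longrightarrow> v i = 0"
  using open_zero[OF chart_image_open, of c v i] by (auto simp: ov_def)

lemma tau_eq: "c \<in> A \<Longrightarrow> x \<in> fst c \<Longrightarrow> \<tau> c d (snd c x) = snd d x"
  by (simp add: chart_trans_def inv_into_f_f[OF chart_inj])

lemma tau_ov': "c \<in> A \<Longrightarrow> v \<in> ov c (fst d) \<Longrightarrow> \<tau> c d v \<in> ov d (fst c)"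
  by (auto simp: ov_def tau_eq)

lemma tau_zero: "c \<in> A \<Longrightarrow> d \<in> A \<Longrightarrow> v \<in> ov c (fst d) \<Longrightarrow> i \<ge> n \<Longrightarrow> \<tau> c d v i = 0"
  using tau_ov' ov_zero by blast

lemma tau_comp: "c \<in> A \<Longrightarrow> d \<in> A \<Longrightarrow> v \<in> ov c (fst d) \<Longrightarrow> \<tau> d e (\<tau> c d v) = \<tau> c e v"
  by (auto simp: ov_def tau_eq)

lemma tau_id: "c \<in> A \<Longrightarrow> v \<in> ov c W \<Longrightarrow> \<tau> c c v = v"
  by (auto simp: ov_def tau_eq)

lemma ov_mono: "W \<subseteq> W' \<Longrightarrow> ov c W \<subseteq> ov c W'"
  by (auto simp: ov_def)

lemma jac_comp:
  assumes cde: "c \<in> A" "d \<in> A" "e \<in> A" and v: "v \<in> ov c (fst d \<inter> fst e)" and ab: "a < n" "b < n"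
  shows "jac c e a b v = (\<Sum>k<n. jac d e a k (\<tau> c d v) * jac c d k b v)"
proof -
  let ?V = "ov c (fst d \<inter> fst e)" and ?W = "ov d (fst e)"
  have V: "openin (Euclidean_space n) ?V" using cde by (intro ov_open openin_Int chart_open)
  have W: "openin (Euclidean_space n) ?W" using cde by (intro ov_fst_open)
  have vd: "u \<in> ov c (fst d)" if "u \<in> ?V" for u using that by (auto simp: ov_def)
  let ?\<phi> = "\<lambda>u. if u \<in> ?V then \<tau> c d u else (\<lambda>_. 0)"
  have "((\<lambda>t. \<tau> d e (?\<phi> (v(b := t))) a) has_real_derivative
      (\<Sum>k<n. pdiff k (\<lambda>u. \<tau> d e u a) (?\<phi> v) * pdiff b (\<lambda>u. ?\<phi> u k) v)) (at (v b))"
  proof (rule chain_rule[OF W chart_smooth[OF cde(2,3) ab(1)]])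
    show "?\<phi> v \<in> ?W" using v cde by (auto simp: ov_def tau_eq)
    show "?\<phi> u i = 0" if "i \<ge> n" for u i using tau_zero[OF cde(1,2) vd that] by simp
    show "differentiable_along b (\<lambda>u. ?\<phi> u i) v" if "i < n" for i
      by (rule differentiable_along_cong[OF V v ab(2) _ smooth_funD(2)[OF chart_smooth[OF cde(1,2) that] vd[OF v] ab(2)]]) simp
  qed
  from pdiff_eqI[where h = "\<lambda>u. \<tau> d e (?\<phi> u) a", OF this]
  have "pdiff b (\<lambda>u. \<tau> d e (?\<phi> u) a) v = (\<Sum>k<n. jac d e a k (\<tau> c d v) * pdiff b (\<lambda>u. ?\<phi> u k) v)"
    using v by (simp add: jac_def)
  moreover have "pdiff b (\<lambda>u. \<tau> d e (?\<phi> u) a) v = jac c e a b v"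
    unfolding jac_def by (rule pdiff_cong[OF V v ab(2)]) (use tau_comp[OF cde(1,2)] vd in simp)
  moreover have "pdiff b (\<lambda>u. ?\<phi> u k) v = jac c d k b v" for k
    unfolding jac_def by (rule pdiff_cong[OF V v ab(2)]) simp
  ultimately show ?thesis by simp
qed

lemma jac_id:
  assumes "c \<in> A" "v \<in> ov c (fst c)" "b < n"
  shows "jac c c a b v = (if a = b then 1 else 0)"
proof -
  have "jac c c a b v = pdiff b (\<lambda>u. u a) v"
    unfolding jac_def by (rule pdiff_cong[OF ov_fst_open[OF assms(1,1)] assms(2,3)]) (simp add: tau_id[OF assms(1)])
  then show ?thesis by (simp add: pdiff_coord)
qed

text \<open>The chain rule \<open>jac_comp\<close> for the inverse transitions from \<open>e\<close>
  over \<open>d\<close> to \<open>c\<close>, read in the coordinates of \<open>c\<close>.\<close>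

lemma hinv_comp:
  assumes cde: "c \<in> A" "d \<in> A" "e \<in> A" and v: "v \<in> ov c (fst d \<inter> fst e)" and ab: "a < n" "b < n"
  shows "hinv c e b a v = (\<Sum>k<n. hinv c d b k v * hinv d e k a (\<tau> c d v))"
proof -
  have v': "v \<in> ov c (fst d)" "v \<in> ov c (fst e)" using v by (auto simp: ov_def)
  have "\<tau> c e v \<in> ov e (fst d \<inter> fst c)" using v cde by (auto simp: ov_def tau_eq)
  from jac_comp[OF cde(3,2,1) this ab(2,1)] show ?thesis
    using tau_comp[OF cde(1,2) v'(1), of e] tau_comp[OF cde(1,3) v'(2), of d] by (simp add: hinv_def)
qed

lemma jac_hinv:
  assumes cd: "c \<in> A" "d \<in> A" and v: "v \<in> ov c (fst d)" and ab: "a < n" "b < n"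
  shows "(\<Sum>k<n. jac c d a k v * hinv c d k b v) = (if a = b then 1 else 0)"
    and "(\<Sum>k<n. hinv c d a k v * jac c d k b v) = (if a = b then 1 else 0)"
proof -
  have t: "\<tau> c d v \<in> ov d (fst c \<inter> fst d)" "\<tau> c d v \<in> ov d (fst d)" "v \<in> ov c (fst d \<inter> fst c)" "v \<in> ov c (fst c)"
    using v cd by (auto simp: ov_def tau_eq)
  have b: "\<tau> d c (\<tau> c d v) = v" using tau_comp[OF cd v, of c] tau_id[OF cd(1) t(4)] by simp
  show "(\<Sum>k<n. jac c d a k v * hinv c d k b v) = (if a = b then 1 else 0)"
    using jac_comp[OF cd(2,1,2) t(1) ab] jac_id[OF cd(2) t(2) ab(2), of a] by (simp add: hinv_def b)
  show "(\<Sum>k<n. hinv c d a k v * jac c d k b v) = (if a = b then 1 else 0)"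
    using jac_comp[OF cd(1,2,1) t(3) ab] jac_id[OF cd(1) t(4) ab(2), of a] by (simp add: hinv_def)
qed

lemma jac_smooth: "c \<in> A \<Longrightarrow> d \<in> A \<Longrightarrow> a < n \<Longrightarrow> b < n \<Longrightarrow> smooth_fun n (ov c (fst d)) (jac c d a b)"
  unfolding jac_def by (intro smooth_funD(3) chart_smooth)

lemma hinv_smooth:
  assumes cd: "c \<in> A" "d \<in> A" and ab: "a < n" "b < n"
  shows "smooth_fun n (ov c (fst d)) (hinv c d a b)"
proof -
  let ?V = "ov c (fst d)" and ?\<phi> = "\<lambda>u. if u \<in> ov c (fst d) then \<tau> c d u else (\<lambda>_. 0)"
  note V = ov_fst_open[OF cd]
  have "smooth_fun n ?V (\<lambda>v. jac d c a b (?\<phi> v))"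
  proof (rule smooth_comp[OF V ov_fst_open[OF cd(2,1)] jac_smooth[OF cd(2,1) ab]])
    show "?\<phi> v \<in> ov d (fst c)" if "v \<in> ?V" for v using tau_ov'[OF cd(1) that] that by simp
    show "?\<phi> v i = 0" if "i \<ge> n" for v i using tau_zero[OF cd _ that] by simp
    show "smooth_fun n ?V (\<lambda>v. ?\<phi> v i)" if "i < n" for i
      by (rule smooth_cong[OF V chart_smooth[OF cd that]]) simp
  qed
  then show ?thesis by (rule smooth_cong[OF V]) (simp add: hinv_def)
qed

end

subsection \<open>Changing the weights\<close>

abbreviation "lbelow L \<equiv> lsupp (\<lambda>\<mu>. \<forall>i\<ge>L. \<mu> i = 0)"

text \<open>A product sees the weights only through the parities of the coordinates that occur. This
  identifies computations on a bundle with those on a larger bundle over it.\<close>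

lemma lmult_wcong:
  assumes f: "lbelow L f" and g: "lbelow L g" and w: "\<And>i. i < L \<Longrightarrow> odd (w i) \<longleftrightarrow> odd (w' i)"
  shows "lmult w f g = lmult w' f g"
proof (intro ext)
  fix \<mu> v
  let ?s = "\<lambda>w. \<Sum>\<alpha> | \<forall>i. \<alpha> i \<le> \<mu> i. mono_sign w \<alpha> (\<lambda>i. \<mu> i - \<alpha> i) * f \<alpha> v * g (\<lambda>i. \<mu> i - \<alpha> i) v"
  show "lmult w f g \<mu> v = lmult w' f g \<mu> v"
  proof (cases "\<forall>i\<ge>L. \<mu> i = 0")
    case True
    have o: "odd (w i) \<and> \<alpha> i \<noteq> 0 \<longleftrightarrow> odd (w' i) \<and> \<alpha> i \<noteq> 0" if "\<alpha> i \<le> \<mu> i" for i and \<alpha> :: "nat \<Rightarrow> nat"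
      using w[of i] True that by (cases "i < L") auto
    have 1: "(\<forall>i. odd (w i) \<longrightarrow> \<mu> i \<le> 1) \<longleftrightarrow> (\<forall>i. odd (w' i) \<longrightarrow> \<mu> i \<le> 1)"
      using o[of \<mu>] by (metis le_refl zero_le)
    have "osupp w \<alpha> = osupp w' \<alpha>" if "\<forall>i. \<alpha> i \<le> \<mu> i" for \<alpha> :: "nat \<Rightarrow> nat"
      unfolding osupp_def using o that by blast
    then have "mono_sign w \<alpha> (\<lambda>i. \<mu> i - \<alpha> i) = mono_sign w' \<alpha> (\<lambda>i. \<mu> i - \<alpha> i)" if "\<forall>i. \<alpha> i \<le> \<mu> i" for \<alpha> :: "nat \<Rightarrow> nat"
      unfolding mono_sign_eq using that by simp
    then have 2: "?s w = ?s w'" by (intro sum.cong) auto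
    show ?thesis unfolding lmult_def 1 2 ..
  next
    case False
    then obtain i where i: "i \<ge> L" "\<mu> i \<noteq> 0" by auto
    have z: "f \<alpha> v * g (\<lambda>i. \<mu> i - \<alpha> i) v = 0" for \<alpha>
    proof (rule ccontr)
      assume "f \<alpha> v * g (\<lambda>i. \<mu> i - \<alpha> i) v \<noteq> 0"
      then have "\<alpha> i = 0" "\<mu> i - \<alpha> i = 0"
        using lsuppD[OF f, of \<alpha> v] lsuppD[OF g, of "\<lambda>i. \<mu> i - \<alpha> i" v] i by auto
      then show False using i by simp
    qed
    have "?s w = 0" for w by (rule sum.neutral) (simp add: mult.assoc z)
    then show ?thesis by (simp add: lmult_def)
  qed
qed

lemma lbelow_lmult: "lbelow L f \<Longrightarrow> lbelow L g \<Longrightarrow> lbelow L (lmult w f g)"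
  by (erule (1) lsupp_lmult) simp

lemma lbelow_lone: "lbelow L lone"
  by (simp add: lsupp_def lone_def)

lemma lbelow_lvar: "i < L \<Longrightarrow> lbelow L (lvar n i)"
  by (auto simp: lsupp_def lvar_def split: if_splits)

lemma mpart_wcong:
  assumes "\<And>i. k \<le> i \<Longrightarrow> i < N \<Longrightarrow> lbelow L (y i)" "\<And>i. i < L \<Longrightarrow> odd (w i) \<longleftrightarrow> odd (w' i)"
  shows "mpart w N y k \<nu> = mpart w' N y k \<nu> \<and> lbelow L (mpart w N y k \<nu>)"
proof (cases "k \<le> N")
  case True
  then show ?thesis using assms(1)
  proof (induction rule: inc_induct)
    case base
    then show ?case by (simp add: mpart_end lbelow_lone)
  next
    case (step k)
    have pw: "(lmult w (y k) ^^ m) f = (lmult w' (y k) ^^ m) f \<and> lbelow L ((lmult w (y k) ^^ m) f)" if "lbelow L f" for m f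
    proof (induction m)
      case (Suc m)
      have "lbelow L (y k)" using step by simp
      from lmult_wcong[OF this conjunct2[OF Suc] assms(2)] lbelow_lmult[OF this conjunct2[OF Suc], of w]
      show ?case using Suc by simp
    qed (use that in simp)
    have IH: "mpart w N y (Suc k) \<nu> = mpart w' N y (Suc k) \<nu>" "lbelow L (mpart w N y (Suc k) \<nu>)"
      using step by auto
    show ?case unfolding mpart_step[OF step(2)] IH(1)[symmetric] by (rule pw[OF IH(2)])
  qed
qed (simp add: mpart_end lbelow_lone)

lemma lsubst_wcong:
  assumes "\<And>i. n \<le> i \<Longrightarrow> i < N \<Longrightarrow> lbelow L (y i)" "\<And>i. i < L \<Longrightarrow> odd (w i) \<longleftrightarrow> odd (w' i)"
  shows "lsubst w n N y f = lsubst w' n N y f"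
  using mpart_wcong[OF assms] by (simp add: lsubst_def mono_subst_mpart)

text \<open>The sign of a left derivative involves the parities of \<open>z_i\<close> and of the
  coordinates before it only.\<close>

lemma lpartial_wcong:
  assumes "\<And>j. j \<le> i \<Longrightarrow> odd (w j) \<longleftrightarrow> odd (w' j)"
  shows "lpartial n w i f = lpartial n w' i f"
proof -
  have "{j. j < i \<and> odd (w j) \<and> \<mu> j \<noteq> 0} = {j. j < i \<and> odd (w' j) \<and> \<mu> j \<noteq> 0}" for \<mu> :: "nat \<Rightarrow> nat"
    using assms by (auto dest: less_imp_le)
  then have "gsign w i \<mu> = gsign w' i \<mu>" for \<mu>
    unfolding gsign_def using assms[of i] by (simp only: order_refl)
  then show ?thesis by (cases "i < n") (simp_all add: lpartial_base lpartial_fibre)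
qed

lemma vfield_lvar:
  assumes "k < N" "n \<le> N" "lok w (X k)"
  shows "vfield n N w X (lvar n k) = X k"
proof -
  have "lmult w (X j) (lpartial n w j (lvar n k)) = (if j = k then X k else 0)" if "j < N" for j
  proof (cases "k < n")
    case True
    have "lpartial n w j (lvar n k) = (if j = k then lone else 0)"
    proof (cases "j < n")
      case j: True
      show ?thesis
        unfolding lvar_base[OF True] lpartial_base_lone[OF j] pdiff_coord by simp
    next
      case False
      then show ?thesis unfolding lvar_base[OF True] using True by (simp add: lpartial_scale)
    qed
    then show ?thesis using lmult_lone_right[OF assms(3)] by simp
  next
    case False
    then have "lpartial n w j (lvar n k) = (if j = k then lone else 0)"
      by (cases "j < n") (auto simp: lpartial_base_lvar lpartial_lvar)
    then show ?thesis using lmult_lone_right[OF assms(3)] by simp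
  qed
  then have "vfield n N w X (lvar n k) = (\<Sum>j<N. if j = k then X k else 0)"
    unfolding vfield_def by (intro sum.cong) auto
  then show ?thesis using assms(1) by simp
qed

lemma lpartial_dl:
  assumes "a < n"
  shows "lpartial n w (n + a) (dl n h) = lscale (pdiff a h) lone"
proof -
  have "lpartial n w (n + a) (lscale (pdiff j h) (lvar n (n + j))) = (if j = a then lscale (pdiff a h) lone else 0)" for j
    by (simp add: lpartial_scale lpartial_lvar)
  then have "lpartial n w (n + a) (dl n h) = (\<Sum>j<n. if j = a then lscale (pdiff a h) lone else 0)"
    unfolding dl_def by (simp add: lpartial_sum)
  then show ?thesis using assms by simp
qed

subsection \<open>The transition functions of the bundles\<close>

text \<open>Degrees on \<open>T[1]M\<close> and \<open>T^*[1]M\<close>, and on \<open>T^*[2]T[1]M\<close>\<close>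

definition w1 :: "nat \<Rightarrow> nat \<Rightarrow> nat" where
  "w1 n i = (if i < n then 0 else 1)"

definition wC :: "nat \<Rightarrow> nat \<Rightarrow> nat" where
  "wC n i = (if i < n then 0 else if 2 * n \<le> i \<and> i < 3 * n then 2 else 1)"

lemma wgood_w1: "n \<le> N \<Longrightarrow> wgood n N (w1 n)" and wgood_wC: "n \<le> N \<Longrightarrow> wgood n N (wC n)"
  by (auto simp: wgood_def gpos_def w1_def wC_def)

context smooth_mfd
begin

abbreviation "M \<equiv> manifold T n A"
abbreviation "C \<equiv> courant_mfd M"

lemma M_simps [simp]:
  "space_of M = T" "bdim M = n" "ncoord M = n" "wt M = (\<lambda>_. 0)" "charts M = A" "cdom M = fst" "cmap M = snd"
  by (simp_all add: manifold_def)

lemma T1M_simps [simp]: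
  "space_of (T1 M) = T" "bdim (T1 M) = n" "ncoord (T1 M) = 2 * n" "wt (T1 M) = w1 n" "charts (T1 M) = A" "cdom (T1 M) = fst" "cmap (T1 M) = snd"
  by (simp_all add: T1_def T1_wt_def w1_def fun_eq_iff)

lemma TsM_simps [simp]:
  "space_of (Tstar (Suc 0) M) = T" "bdim (Tstar (Suc 0) M) = n" "ncoord (Tstar (Suc 0) M) = 2 * n" "wt (Tstar (Suc 0) M) = w1 n"
  "charts (Tstar (Suc 0) M) = A" "cdom (Tstar (Suc 0) M) = fst" "cmap (Tstar (Suc 0) M) = snd"
  by (simp_all add: Tstar_def Tstar_wt_def w1_def fun_eq_iff)

lemma C_simps [simp]:
  "space_of C = T" "bdim C = n" "ncoord C = 4 * n" "wt C = wC n" "charts C = A" "cdom C = fst" "cmap C = snd"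
  by (auto simp: courant_mfd_def Tstar_def Tstar_wt_def w1_def wC_def fun_eq_iff)

text \<open>Coordinate changes: \<open>et k\<close> for coordinates of covector type with indices from \<open>k\<close> on, \<open>pt\<close> for \<open>p_a\<close>,
  \<open>ct\<close> for all coordinates on \<open>T^*[2]T[1]M\<close>, and \<open>st\<close> for those on \<open>T^*[1]M\<close>\<close>

definition et :: "nat \<Rightarrow> 'm chart \<Rightarrow> 'm chart \<Rightarrow> nat \<Rightarrow> lfun" where
  "et k c d a = (\<Sum>b<n. lscale (hinv c d b a) (lvar n (k + b)))"

definition pt :: "'m chart \<Rightarrow> 'm chart \<Rightarrow> nat \<Rightarrow> lfun" where
  "pt c d a = (\<Sum>b<n. lscale (hinv c d b a) (lvar n (2 * n + b)) +
     lmult (wC n) (dl n (hinv c d b a)) (lvar n (3 * n + b)))"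

definition ct :: "'m chart \<Rightarrow> 'm chart \<Rightarrow> nat \<Rightarrow> lfun" where
  "ct c d i = (if i < n then lscale (\<lambda>v. \<tau> c d v i) lone
     else if i < 2 * n then dl n (\<lambda>v. \<tau> c d v (i - n))
     else if i < 3 * n then pt c d (i - 2 * n) else et (3 * n) c d (i - 3 * n))"

definition st :: "'m chart \<Rightarrow> 'm chart \<Rightarrow> nat \<Rightarrow> lfun" where
  "st c d i = (if i < n then lscale (\<lambda>v. \<tau> c d v i) lone else et n c d (i - n))"

lemma base_tau:
  assumes "c \<in> A" "d \<in> A" "v \<in> ov c (fst d)" "\<And>i. i < n \<Longrightarrow> y i = lscale (\<lambda>v. \<tau> c d v i) lone"
  shows "base_subst n y v = \<tau> c d v"
  using tau_zero[OF assms(1-3)] assms(4) by (auto simp: base_subst_def fun_eq_iff lscale_def lone_def)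

lemma ct_base: "i < n \<Longrightarrow> ct c d i = lscale (\<lambda>v. \<tau> c d v i) lone"
  and st_base: "i < n \<Longrightarrow> st c d i = lscale (\<lambda>v. \<tau> c d v i) lone"
  by (simp_all add: ct_def st_def)

lemma trans_M: "trans M c d i = lscale (\<lambda>v. \<tau> c d v i) lone"
  by (auto simp: manifold_def lscale_def lone_def fun_eq_iff)

lemma ldiff_base: "ldiff M (lscale h lone) = dl n h"
proof -
  have w: "T1_wt M = w1 n" by (simp add: T1_wt_def w1_def fun_eq_iff)
  show ?thesis
    unfolding ldiff_def lsum_eq w dl_def
    by (simp add: lpartial_base_lone lmult_scale_right lmult_lone_right lok_lvar)
qed

lemma trans_T1: "i < 2 * n \<Longrightarrow> trans (T1 M) c d i = ct c d i"
proof -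
  assume i: "i < 2 * n"
  have "trans (T1 M) c d i = (if i < n then trans M c d i else ldiff M (trans M c d (i - n)))"
    unfolding T1_def by simp
  then show ?thesis using i by (simp add: trans_M ldiff_base ct_def)
qed

lemma trans_Ts1:
  assumes cd: "c \<in> A" "d \<in> A" and i: "i < 2 * n"
  shows "eqon (ov c (fst d)) (trans (Tstar (Suc 0) M) c d i) (st c d i)"
proof (cases "i < n")
  case True
  have "trans (Tstar (Suc 0) M) c d i = trans M c d i"
    unfolding Tstar_def using True by simp
  then show ?thesis using True by (simp add: trans_M st_base)
next
  case False
  let ?a = "i - n" and ?w = "Tstar_wt (Suc 0) M"
  have b: "base_subst n (trans M c d) v = \<tau> c d v" if "v \<in> ov c (fst d)" for v
    by (rule base_tau[OF cd that trans_M])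
  have "trans (Tstar (Suc 0) M) c d i = (\<Sum>j<n. lmult ?w (lsubst (\<lambda>_. 0) n n (trans M c d)
      (lpartial n (\<lambda>_. 0) ?a (trans M d c j))) (lvar n (n + j)))"
    unfolding Tstar_def using False by (simp add: lsum_eq)
  also have "\<dots> = (\<Sum>j<n. lscale (\<lambda>v. jac d c j ?a (base_subst n (trans M c d) v)) (lvar n (n + j)))"
    using False i by (intro sum.cong refl)
      (simp add: trans_M[of d c] lpartial_base_lone lsubst_scale lmult_scale_left lmult_lone_left lok_lvar jac_def)
  finally have e: "trans (Tstar (Suc 0) M) c d i = (\<Sum>j<n. lscale (\<lambda>v. jac d c j ?a (base_subst n (trans M c d) v)) (lvar n (n + j)))" .
  show ?thesis
    unfolding e st_def et_def if_not_P[OF False]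
    by (intro eqon_sum eqon_scale eqon_refl) (simp add: hinv_def b)
qed

lemma lok_dl: "lok w (dl n h)"
  unfolding dl_def by (intro lsupp_sum lsupp_scale lok_lvar)

text \<open>Evaluation of the generic rule for momenta. As
  \<open>\<xi>_b = \<Sum>a. \<xi>'_a \<partial>x_b/\<partial>x'_a\<close> depends on
  \<open>x'\<close> as well as on \<open>\<xi>'\<close>, the new \<open>p_a\<close> acquires a term
  with the \<open>\<eta>_b\<close>, whose coefficient is the differential of the inverse
  Jacobian.\<close>

lemma trans_C:
  assumes cd: "c \<in> A" "d \<in> A" and i: "i < 4 * n"
  shows "eqon (ov c (fst d)) (trans C c d i) (ct c d i)"
proof (cases "i < 2 * n")
  case True
  have "trans C c d i = trans (T1 M) c d i"
    unfolding courant_mfd_def Tstar_def using True by simp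
  then show ?thesis using True by (simp add: trans_T1)
next
  case False
  let ?V = "ov c (fst d)" and ?t = "trans (T1 M) c d" and ?k = "i - 2 * n"
  note V = ov_fst_open[OF cd] and W = ov_fst_open[OF cd(2,1)]
  have b: "base_subst n ?t v = \<tau> c d v" if "v \<in> ov c (fst d)" for v
    by (rule base_tau[OF cd that]) (simp add: trans_T1 ct_base)
  have w: "Tstar_wt 2 (T1 M) = wC n"
    using C_simps(4) by (simp add: courant_mfd_def Tstar_def)
  \<comment> \<open>The derivative of the \<open>j\<close>-th coordinate of \<open>c\<close> along
    the coordinate of \<open>d\<close> with index \<open>?k\<close>, expressed in the coordinates of
    \<open>c\<close>.\<close>
  define G where "G j = lsubst (w1 n) n (2 * n) ?t (lpartial n (w1 n) ?k (trans (T1 M) d c j))" for j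
  have "trans C c d i = (\<Sum>j<2*n. lmult (wC n) (G j) (lvar n (2 * n + j)))"
    unfolding courant_mfd_def Tstar_def using False by (simp add: lsum_eq w[unfolded Tstar_def] G_def w)
  also have "{..<2*n} = {..<n} \<union> {n..<2*n}" by auto
  also have "(\<Sum>j\<in>{..<n} \<union> {n..<2*n}. lmult (wC n) (G j) (lvar n (2 * n + j))) =
    (\<Sum>j<n. lmult (wC n) (G j) (lvar n (2 * n + j))) + (\<Sum>j\<in>{n..<2*n}. lmult (wC n) (G j) (lvar n (2 * n + j)))"
    by (rule sum.union_disjoint) auto
  also have "(\<Sum>j\<in>{n..<2*n}. lmult (wC n) (G j) (lvar n (2 * n + j))) = (\<Sum>j<n. lmult (wC n) (G (n + j)) (lvar n (3 * n + j)))"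
    by (rule sum.reindex_bij_witness[of _ "\<lambda>j. n + j" "\<lambda>j. j - n"]) (auto intro!: arg_cong2[of _ _ _ _ "lmult (wC n)"] arg_cong[of _ _ "lvar n"])
  finally have e: "trans C c d i = (\<Sum>j<n. lmult (wC n) (G j) (lvar n (2 * n + j))) + (\<Sum>j<n. lmult (wC n) (G (n + j)) (lvar n (3 * n + j)))" .
  show ?thesis
  proof (cases "i < 3 * n")
    case True
    then have k: "?k < n" using False by simp
    have G1: "eqon ?V (G j) (lscale (hinv c d j ?k) lone)" if "j < n" for j
    proof -
      have "G j = lscale (\<lambda>v. jac d c j ?k (base_subst n ?t v)) lone"
        unfolding G_def using that k by (simp add: trans_T1 ct_base lpartial_base_lone lsubst_scale jac_def)
      then show ?thesis using b by (simp add: eqon_def lscale_def hinv_def)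
    qed
    \<comment> \<open>Differentiating \<open>\<xi>_j\<close> along \<open>x'\<close> gives the
      differential of an entry of the Jacobian in the coordinates of \<open>d\<close>;
      \<open>lsubst_dl\<close> transports it to those of \<open>c\<close>.\<close>
    have G2: "eqon ?V (G (n + j)) (dl n (hinv c d j ?k))" if "j < n" for j
    proof -
      have h: "smooth_fun n (ov d (fst c)) (\<lambda>v. \<tau> d c v j)" by (rule chart_smooth[OF cd(2,1) that])
      have "trans (T1 M) d c (n + j) = dl n (\<lambda>v. \<tau> d c v j)" using that by (simp add: trans_T1 ct_def)
      then have l: "eqon (ov d (fst c)) (lpartial n (w1 n) ?k (trans (T1 M) d c (n + j))) (dl n (jac d c j ?k))"
        using lpartial_base_dl[OF W h k, of "w1 n"] by (simp add: jac_def)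
      have "eqon ?V (G (n + j)) (lsubst (w1 n) n (2 * n) ?t (dl n (jac d c j ?k)))"
      proof (rule eqonI)
        fix v \<mu> assume v: "v \<in> ?V"
        then have "\<tau> c d v \<in> ov d (fst c)" by (rule tau_ov'[OF cd(1)])
        then show "G (n + j) \<mu> v = lsubst (w1 n) n (2 * n) ?t (dl n (jac d c j ?k)) \<mu> v"
          unfolding G_def by (intro lsubst_cong_at) (simp_all add: b[OF v] eqonD[OF l])
      qed
      also have "eqon ?V \<dots> (dl n (\<lambda>v. jac d c j ?k (\<tau> c d v)))"
      proof (rule lsubst_dl[OF V W jac_smooth[OF cd(2,1) that k]])
        show "\<tau> c d v \<in> ov d (fst c)" if "v \<in> ?V" for v using tau_ov'[OF cd(1) that] .
        show "\<tau> c d v i = 0" if "v \<in> ?V" "n \<le> i" for v i using tau_zero[OF cd that] .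
        show "smooth_fun n ?V (\<lambda>v. \<tau> c d v i)" if "i < n" for i using chart_smooth[OF cd that] .
        show "?t i = lscale (\<lambda>v. \<tau> c d v i) lone" if "i < n" for i using that by (simp add: trans_T1 ct_base)
        show "?t (n + i) = dl n (\<lambda>v. \<tau> c d v i)" if "i < n" for i using that by (simp add: trans_T1 ct_def)
        show "lok (w1 n) (?t (n + i))" if "i < n" for i using that by (simp add: trans_T1 ct_def lok_dl)
      qed (auto intro: wgood_w1)
      finally show ?thesis by (simp add: hinv_def)
    qed
    have "eqon ?V (trans C c d i) ((\<Sum>j<n. lmult (wC n) (lscale (hinv c d j ?k) lone) (lvar n (2 * n + j))) +
       (\<Sum>j<n. lmult (wC n) (dl n (hinv c d j ?k)) (lvar n (3 * n + j))))"
      unfolding e using G1 G2 by (intro eqon_add eqon_sum eqon_lmult eqon_refl) auto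
    also have "\<dots> = ct c d i"
      using False True by (simp add: ct_def pt_def sum.distrib lmult_scale_left lmult_lone_left lok_lvar)
    finally show ?thesis .
  next
    case f3: False
    let ?a = "i - 3 * n"
    have a: "?a < n" "?k = n + ?a" using f3 i by auto
    have G1: "G j = 0" if "j < n" for j
      unfolding G_def a(2) using that by (simp add: trans_T1 ct_base lpartial_scale)
    have G2: "eqon ?V (G (n + j)) (lscale (hinv c d j ?a) lone)" if "j < n" for j
    proof -
      have "trans (T1 M) d c (n + j) = dl n (\<lambda>v. \<tau> d c v j)" using that by (simp add: trans_T1 ct_def)
      then have "lpartial n (w1 n) ?k (trans (T1 M) d c (n + j)) = lscale (jac d c j ?a) lone"
        unfolding a(2) using lpartial_dl[OF a(1)] by (simp add: jac_def)
      then have "G (n + j) = lscale (\<lambda>v. jac d c j ?a (base_subst n ?t v)) lone"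
        unfolding G_def by (simp add: lsubst_scale)
      then show ?thesis using b by (simp add: eqon_def lscale_def hinv_def)
    qed
    have "eqon ?V (trans C c d i) ((\<Sum>j<n. lmult (wC n) 0 (lvar n (2 * n + j))) +
       (\<Sum>j<n. lmult (wC n) (lscale (hinv c d j ?a) lone) (lvar n (3 * n + j))))"
      unfolding e using G1 G2 by (intro eqon_add eqon_sum eqon_lmult eqon_refl) auto
    also have "\<dots> = ct c d i"
      using False f3 by (simp add: ct_def et_def lmult_scale_left lmult_lone_left lok_lvar)
    finally show ?thesis .
  qed
qed

end

section \<open>Cocycle conditions for the coordinate changes\<close>

lemma csub_subset: "openin (Euclidean_space n) W \<Longrightarrow> csub n N w N' w' V y \<Longrightarrow> W \<subseteq> V \<Longrightarrow> csub n N w N' w' W y"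
  unfolding csub_def using lsmooth_subset by blast

lemma mono_deg_0: "gpos n N w \<Longrightarrow> mono_ok n N w \<nu> \<Longrightarrow> mono_deg N w \<nu> = 0 \<Longrightarrow> \<nu> = (\<lambda>_. 0)"
proof (rule ext, rule ccontr)
  fix i assume *: "gpos n N w" "mono_ok n N w \<nu>" "mono_deg N w \<nu> = 0" "\<nu> i \<noteq> 0"
  then have i: "n \<le> i" "i < N" by (auto dest: mono_okD)
  have "w i * \<nu> i = 0" using *(3) i by (simp add: mono_deg_def)
  then show False using * i by (auto simp: gpos_def)
qed

text \<open>A monomial of positive degree is sent to a function of positive degree and does not
  contribute to the coefficient of 1. The locality condition for morphisms given in coordinates
  rests on this.\<close>

lemma lsubst_zero_coeff:
  assumes y: "csub n N w N' w' V y" and w': "wgood n N' w'" and f: "gdeg n N' w' f"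
  shows "lsubst w n N' y f (\<lambda>_. 0) v = f (\<lambda>_. 0) (base_subst n y v)"
proof -
  obtain S where S: "finite S" "\<forall>\<nu> v. f \<nu> v \<noteq> 0 \<longrightarrow> \<nu> \<in> S" "\<forall>\<nu>\<in>S. mono_ok n N' w' \<nu>"
    by (rule gdeg_finite[OF wgoodD(2)[OF w'] f])
  have z: "mono_subst w n N' y \<nu> (\<lambda>_. 0) v = (if \<nu> = (\<lambda>_. 0) then 1 else 0)" if "\<nu> \<in> S" for \<nu>
  proof (cases "\<nu> = (\<lambda>_. 0)")
    case True
    have "mono_subst w n N' y (\<lambda>_. 0) = lone"
      using lsubst_lmono[of w n N' y "\<lambda>_. 0"] by (simp add: lmono_zero)
    then show ?thesis using True by (simp add: lone_def)
  next
    case False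
    have ok: "mono_ok n N' w' \<nu>" using S(3) that by blast
    have y': "\<And>i. n \<le> i \<Longrightarrow> i < N' \<Longrightarrow> hdeg n N w (w' i) (y i)" using csubD(2)[OF y] by simp
    have h: "hdeg n N w (mono_deg N' w' \<nu>) (mono_subst w n N' y \<nu>)"
      using y' ok by (intro hdeg_mono_subst[where w' = w']) simp_all
    have "mono_deg N' w' \<nu> \<noteq> 0" using mono_deg_0[OF wgoodD(2)[OF w'] ok] False by blast
    moreover have "mono_deg N w (\<lambda>_. 0) = 0" by (simp add: mono_deg_def)
    ultimately have "mono_subst w n N' y \<nu> (\<lambda>_. 0) v = 0"
      using lsuppD[OF h, of "\<lambda>_. 0" v] by (metis (no_types))
    then show ?thesis using False by simp
  qed
  have "lsubst w n N' y f (\<lambda>_. 0) v = (\<Sum>\<nu>\<in>S. f \<nu> (base_subst n y v) * mono_subst w n N' y \<nu> (\<lambda>_. 0) v)"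
    by (rule lsubst_eq) (use S in auto)
  also have "\<dots> = (\<Sum>\<nu>\<in>S. if \<nu> = (\<lambda>_. 0) then f \<nu> (base_subst n y v) else 0)"
    using z by (intro sum.cong) auto
  also have "\<dots> = f (\<lambda>_. 0) (base_subst n y v)" using S(1,2) by (auto simp: sum.delta)
  finally show ?thesis .
qed

lemma lsubst_eqon_arg:
  assumes "\<And>v. v \<in> V \<Longrightarrow> base_subst n y v \<in> W" "eqon W f g"
  shows "eqon V (lsubst w n N y f) (lsubst w n N y g)"
proof (rule eqonI)
  fix v \<mu> assume "v \<in> V"
  then have "base_subst n y v \<in> W" by (rule assms(1))
  then show "lsubst w n N y f \<mu> v = lsubst w n N y g \<mu> v"
    using eqonD[OF assms(2)] by (intro lsubst_cong_at) simp_all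
qed

lemma lsubst_eqon_sub:
  assumes "\<And>i. i < n \<Longrightarrow> eqon V (y i) (y' i)" "\<And>i. i < N \<Longrightarrow> eqon V (y i) (y' i)"
  shows "eqon V (lsubst w n N y f) (lsubst w n N y' f)"
proof (rule eqonI)
  fix v \<mu> assume v: "v \<in> V"
  have "base_subst n y v = base_subst n y' v"
    using eqonD[OF assms(1) v] by (auto simp: base_subst_def)
  then show "lsubst w n N y f \<mu> v = lsubst w n N y' f \<mu> v"
    using eqonD[OF assms(1) v] eqonD[OF assms(2) v] by (intro lsubst_cong_at) simp_all
qed

lemma csub_comp:
  assumes y: "csub n N w N1 u1 V y" and z: "csub n N1 u1 N2 u2 V' z" and w: "wgood n N1 u1" "wgood n N2 u2"
    and f: "gdeg n N2 u2 f"
  shows "lsubst w n N1 y (lsubst u1 n N2 z f) = lsubst w n N2 (\<lambda>i. lsubst w n N1 y (z i)) f"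
proof (rule lsubst_lsubst[OF csub_good[OF y w(1)] wgoodD(1)[OF w(1)] _ _ f wgoodD(2)[OF w(2)]])
  show "gdeg n N1 u1 (z i)" if "n \<le> i" "i < N2" for i using csubD(3)[OF z that(2)] .
  show "hdeg n N1 u1 0 (z i)" if "i < n" for i
    using csubD(2)[OF z, of i] that wgoodD(1)[OF w(2)] wgoodD(3)[OF w(2) that] by simp
qed

context smooth_mfd
begin

lemma csub_ct:
  assumes cd: "c \<in> A" "d \<in> A"
  shows "csub n (4 * n) (wC n) (4 * n) (wC n) (ov c (fst d)) (ct c d)"
  unfolding csub_def
proof (intro allI impI)
  fix i assume i: "i < 4 * n"
  let ?V = "ov c (fst d)"
  note V = ov_fst_open[OF cd]
  have hd: "hdeg n (4 * n) (wC n) (wC n k) (lvar n k)" if "n \<le> k" "k < 4 * n" for k using hdeg_lvar[OF that] .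
  have dlh: "hdeg n (4 * n) (wC n) 1 (dl n h)" for h by (rule dl_hdeg) (auto simp: wC_def)
  consider "i < n" | "n \<le> i" "i < 2 * n" | "2 * n \<le> i" "i < 3 * n" | "3 * n \<le> i" using i by linarith
  then show "lsmooth n ?V (ct c d i) \<and> hdeg n (4 * n) (wC n) (wC n i) (ct c d i)"
  proof cases
    case 1
    have "hdeg n (4 * n) (wC n) 0 (lscale (\<lambda>v. \<tau> c d v i) lone)" by (intro lsupp_scale hdeg_lone)
    then show ?thesis
      using lsmooth_scale[OF V chart_smooth[OF cd 1] lsmooth_lone[OF V]] 1 by (simp add: ct_base wC_def)
  next
    case 2
    then show ?thesis
      using dl_lsmooth[OF V chart_smooth[OF cd, of "i - n"]] dlh by (simp add: ct_def wC_def)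
  next
    case 3
    have "lsmooth n ?V (pt c d (i - 2 * n))"
      unfolding pt_def using 3
      by (intro lsmooth_sum[OF V] lsmooth_add[OF V] lsmooth_scale[OF V] lsmooth_lmult[OF V] dl_lsmooth[OF V] lsmooth_lvar[OF V] hinv_smooth cd) auto
    moreover have "hdeg n (4 * n) (wC n) 2 (pt c d (i - 2 * n))"
      unfolding pt_def
    proof (intro lsupp_sum lsupp_add lsupp_scale)
      fix b assume b: "b \<in> {..<n}"
      show "hdeg n (4 * n) (wC n) 2 (lvar n (2 * n + b))" using hd[of "2 * n + b"] b by (simp add: wC_def)
      have "hdeg n (4 * n) (wC n) 1 (lvar n (3 * n + b))" using hd[of "3 * n + b"] b by (simp add: wC_def)
      from hdeg_lmult[OF dlh this, unfolded one_add_one]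
      show "hdeg n (4 * n) (wC n) 2 (lmult (wC n) (dl n (hinv c d b (i - 2 * n))) (lvar n (3 * n + b)))" .
    qed
    ultimately show ?thesis using 3 by (simp add: ct_def wC_def)
  next
    case 4
    have "lsmooth n ?V (et (3 * n) c d (i - 3 * n))"
      unfolding et_def using 4 i by (intro lsmooth_sum[OF V] lsmooth_scale[OF V] lsmooth_lvar[OF V] hinv_smooth cd) auto
    moreover have "hdeg n (4 * n) (wC n) 1 (et (3 * n) c d (i - 3 * n))"
      unfolding et_def
    proof (intro lsupp_sum lsupp_scale)
      fix b assume b: "b \<in> {..<n}"
      show "hdeg n (4 * n) (wC n) 1 (lvar n (3 * n + b))" using hd[of "3 * n + b"] b by (simp add: wC_def)
    qed
    ultimately show ?thesis using 4 by (simp add: ct_def wC_def)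
  qed
qed

lemma csub_st:
  assumes cd: "c \<in> A" "d \<in> A"
  shows "csub n (2 * n) (w1 n) (2 * n) (w1 n) (ov c (fst d)) (st c d)"
  unfolding csub_def
proof (intro allI impI)
  fix i assume i: "i < 2 * n"
  let ?V = "ov c (fst d)"
  note V = ov_fst_open[OF cd]
  show "lsmooth n ?V (st c d i) \<and> hdeg n (2 * n) (w1 n) (w1 n i) (st c d i)"
  proof (cases "i < n")
    case True
    have "hdeg n (2 * n) (w1 n) 0 (lscale (\<lambda>v. \<tau> c d v i) lone)" by (intro lsupp_scale hdeg_lone)
    then show ?thesis
      using lsmooth_scale[OF V chart_smooth[OF cd True] lsmooth_lone[OF V]] True by (simp add: st_base w1_def)
  next
    case False
    have "lsmooth n ?V (et n c d (i - n))"
      unfolding et_def using False i by (intro lsmooth_sum[OF V] lsmooth_scale[OF V] lsmooth_lvar[OF V] hinv_smooth cd) auto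
    moreover have "hdeg n (2 * n) (w1 n) 1 (et n c d (i - n))"
      unfolding et_def
    proof (intro lsupp_sum lsupp_scale)
      fix b assume b: "b \<in> {..<n}"
      show "hdeg n (2 * n) (w1 n) 1 (lvar n (n + b))" using hdeg_lvar[of n "n + b" "2 * n" "w1 n"] b by (simp add: w1_def)
    qed
    ultimately show ?thesis using False by (simp add: st_def w1_def)
  qed
qed

lemma et_comp:
  assumes cde: "c \<in> A" "d \<in> A" "e \<in> A" and a: "a < n" and N: "n \<le> k" "k + n \<le> N" and w: "wgood n N w"
    and y: "\<And>i. i < n \<Longrightarrow> y i = lscale (\<lambda>v. \<tau> c d v i) lone" "\<And>b. b < n \<Longrightarrow> y (k + b) = et k c d b"
  shows "eqon (ov c (fst d \<inter> fst e)) (lsubst w n N y (et k d e a)) (et k c e a)"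
proof -
  let ?V = "ov c (fst d \<inter> fst e)"
  have b: "base_subst n y v = \<tau> c d v" if "v \<in> ?V" for v
    using that by (intro base_tau[OF cde(1,2) _ y(1)]) (auto simp: ov_def)
  have g: "gdeg n N w (lvar n (k + b))" if "b < n" for b
    using that N by (intro hdeg_gdeg[OF hdeg_lvar]) auto
  have lk: "lok w (et k c d b)" for b unfolding et_def by (intro lsupp_sum lsupp_scale lok_lvar)
  have l: "lsubst w n N y (lvar n (k + b)) = et k c d b" if "b < n" for b
    using that N y(2) lk by (subst lsubst_lvar) auto
  have ex: "lsubst w n N y (et k d e a) = (\<Sum>b<n. lscale (\<lambda>v. hinv d e b a (base_subst n y v)) (et k c d b))"
    unfolding et_def[of k d e] using g l
    by (subst lsubst_sum[OF wgoodD(2)[OF w]]) (simp_all add: lsubst_scale gdeg_scale)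
  have "eqon ?V (lsubst w n N y (et k d e a)) (\<Sum>b<n. lscale (\<lambda>v. hinv d e b a (\<tau> c d v)) (et k c d b))"
    unfolding ex using b by (intro eqon_sum eqon_scale eqon_refl) auto
  also have "\<dots> = (\<Sum>j<n. lscale (\<lambda>v. \<Sum>b<n. hinv c d j b v * hinv d e b a (\<tau> c d v)) (lvar n (k + j)))"
    unfolding et_def lscale_sum lscale_sum_left by (subst sum.swap) (simp add: lscale_lscale mult.commute)
  also have "eqon ?V \<dots> (et k c e a)"
    unfolding et_def using hinv_comp[OF cde] a by (intro eqon_sum eqon_scale eqon_refl) auto
  finally show ?thesis .
qed

lemma base_comp_eqon:
  assumes cde: "c \<in> A" "d \<in> A" "e \<in> A" and i: "i < n"
    and y: "\<And>i. i < n \<Longrightarrow> y i = lscale (\<lambda>v. \<tau> c d v i) lone"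
  shows "eqon (ov c (fst d \<inter> fst e)) (lsubst w n N y (lscale (\<lambda>v. \<tau> d e v i) lone)) (lscale (\<lambda>v. \<tau> c e v i) lone)"
proof (rule eqonI)
  fix v \<mu> assume v: "v \<in> ov c (fst d \<inter> fst e)"
  then have v': "v \<in> ov c (fst d)" by (auto simp: ov_def)
  show "lsubst w n N y (lscale (\<lambda>v. \<tau> d e v i) lone) \<mu> v = lscale (\<lambda>v. \<tau> c e v i) lone \<mu> v"
    using base_tau[OF cde(1,2) v' y] tau_comp[OF cde(1,2) v', of e] by (simp add: lsubst_scale) (simp add: lscale_def)
qed

lemma dl_comp_eqon:
  assumes cd: "c \<in> A" "d \<in> A" and V: "openin (Euclidean_space n) V" "V \<subseteq> ov c (fst d)"
    and W: "openin (Euclidean_space n) W" "\<And>v. v \<in> V \<Longrightarrow> \<tau> c d v \<in> W" and h: "smooth_fun n W h"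
    and N: "wgood n N w" "2 * n \<le> N"
    and y: "\<And>i. i < n \<Longrightarrow> y i = lscale (\<lambda>v. \<tau> c d v i) lone" "\<And>i. i < n \<Longrightarrow> y (n + i) = dl n (\<lambda>v. \<tau> c d v i)"
  shows "eqon V (lsubst w n N y (dl n h)) (dl n (\<lambda>v. h (\<tau> c d v)))"
proof (rule lsubst_dl[OF V(1) W(1) h W(2) _ _ y N])
  show "\<tau> c d v i = 0" if "v \<in> V" "n \<le> i" for v i using tau_zero[OF cd _ that(2)] that(1) V(2) by blast
  show "smooth_fun n V (\<lambda>v. \<tau> c d v i)" if "i < n" for i using smooth_subset[OF V(1) chart_smooth[OF cd that] V(2)] .
  show "lok w (y (n + i))" if "i < n" for i using y(2)[OF that] lok_dl by simp
qed

text \<open>The terms with \<open>p\<close> compose by \<open>hinv_comp\<close>; the terms with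
  \<open>\<eta>\<close> require its differential, \<open>H dh + h dH = d(h H)\<close>.\<close>

lemma pt_comp:
  assumes cde: "c \<in> A" "d \<in> A" "e \<in> A" and a: "a < n"
  shows "eqon (ov c (fst d \<inter> fst e)) (lsubst (wC n) n (4 * n) (ct c d) (pt d e a)) (pt c e a)"
proof -
  let ?V = "ov c (fst d \<inter> fst e)" and ?S = "lsubst (wC n) n (4 * n) (ct c d)" and ?m = "lmult (wC n)"
  have V: "openin (Euclidean_space n) ?V" using cde by (intro ov_open openin_Int chart_open)
  have VV: "?V \<subseteq> ov c (fst d)" by (auto simp: ov_def)
  have W: "openin (Euclidean_space n) (ov d (fst e))" using cde by (intro ov_fst_open)
  have VW: "\<tau> c d v \<in> ov d (fst e)" if "v \<in> ?V" for v using that cde by (auto simp: ov_def tau_eq)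
  have wg: "wgood n (4 * n) (wC n)" by (rule wgood_wC) simp
  note good = csub_good[OF csub_ct[OF cde(1,2)] wg]
  have b: "base_subst n (ct c d) v = \<tau> c d v" if "v \<in> ?V" for v
    using that VV by (intro base_tau[OF cde(1,2)]) (auto simp: ct_base)
  have g: "gdeg n (4 * n) (wC n) (lvar n k)" if "n \<le> k" "k < 4 * n" for k
    using that by (intro hdeg_gdeg[OF hdeg_lvar]) auto
  have gdl: "gdeg n (4 * n) (wC n) (dl n h)" for h by (rule hdeg_gdeg, rule dl_hdeg) (auto simp: wC_def)
  have lp: "?S (lvar n (2 * n + b)) = pt c d b" "?S (lvar n (3 * n + b)) = et (3 * n) c d b" if "b < n" for b
  proof -
    have lk: "lok (wC n) (ct c d k)" if "k < 4 * n" for k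
      using csubD(3)[OF csub_ct[OF cde(1,2)] that] by (rule gdeg_lok)
    show "?S (lvar n (2 * n + b)) = pt c d b"
      using that lk[of "2 * n + b"] by (subst lsubst_lvar) (simp_all add: ct_def)
    show "?S (lvar n (3 * n + b)) = et (3 * n) c d b"
      using that lk[of "3 * n + b"] by (subst lsubst_lvar) (simp_all add: ct_def)
  qed
  define h where "h k b = hinv c d k b" for k b
  \<comment> \<open>The inverse Jacobian from \<open>d\<close> to \<open>e\<close> read in the
    coordinates of \<open>c\<close>; \<open>\<Sum>b<n. h k b v * H b v\<close> is then the one from
    \<open>c\<close> to \<open>e\<close>.\<close>
  define H where "H b v = hinv d e b a (\<tau> c d v)" for b v
  have hs: "smooth_fun n ?V (h k b)" if "k < n" "b < n" for k b
    unfolding h_def using smooth_subset[OF V hinv_smooth[OF cde(1,2) that] VV] .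
  have Hs: "smooth_fun n ?V (H b)" if "b < n" for b
  proof -
    let ?\<phi> = "\<lambda>u. if u \<in> ?V then \<tau> c d u else (\<lambda>_. 0)"
    have "smooth_fun n ?V (\<lambda>v. hinv d e b a (?\<phi> v))"
    proof (rule smooth_comp[OF V W hinv_smooth[OF cde(2,3) that a]])
      show "?\<phi> v \<in> ov d (fst e)" if "v \<in> ?V" for v using VW that by simp
      show "?\<phi> v i = 0" if "i \<ge> n" for v i using tau_zero[OF cde(1,2) _ that] VV by auto
      show "smooth_fun n ?V (\<lambda>v. ?\<phi> v i)" if "i < n" for i
        by (rule smooth_cong[OF V smooth_subset[OF V chart_smooth[OF cde(1,2) that] VV]]) simp
    qed
    then show ?thesis by (rule smooth_cong[OF V]) (simp add: H_def)
  qed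
  have dlS: "eqon ?V (?S (dl n (hinv d e b a))) (dl n (H b))" if "b < n" for b
    unfolding H_def using that a
    by (intro dl_comp_eqon[OF cde(1,2) V VV W VW hinv_smooth[OF cde(2,3)] wg]) (auto simp: ct_def)
  have ex: "?S (pt d e a) = (\<Sum>b<n. lscale (\<lambda>v. hinv d e b a (base_subst n (ct c d) v)) (pt c d b) +
      ?m (?S (dl n (hinv d e b a))) (et (3 * n) c d b))"
    unfolding pt_def[of d e] using wg
    by (subst lsubst_sum[OF wgoodD(2)[OF wg]])
      (auto intro!: gdeg_add gdeg_scale gdeg_lmult g gdl sum.cong
        simp: lsubst_add[OF wgoodD(2)[OF wg]] lsubst_scale lsubst_lmult[OF good] gdeg_scale gdeg_lmult g gdl lp)
  have "eqon ?V (?S (pt d e a)) (\<Sum>b<n. lscale (H b) (pt c d b) + ?m (dl n (H b)) (et (3 * n) c d b))"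
    unfolding ex using b dlS by (intro eqon_sum eqon_add eqon_scale eqon_lmult eqon_refl) (auto simp: H_def)
  also have "\<dots> = (\<Sum>k<n. lscale (\<lambda>v. \<Sum>b<n. h k b v * H b v) (lvar n (2 * n + k)) +
      ?m (\<Sum>b<n. lscale (H b) (dl n (h k b)) + lscale (h k b) (dl n (H b))) (lvar n (3 * n + k)))"
  proof -
    have 1: "(\<Sum>b<n. lscale (H b) (\<Sum>k<n. lscale (h k b) (lvar n (2 * n + k)))) = (\<Sum>k<n. lscale (\<lambda>v. \<Sum>b<n. h k b v * H b v) (lvar n (2 * n + k)))"
      unfolding lscale_sum lscale_sum_left by (subst sum.swap) (simp add: lscale_lscale mult.commute)
    have 2: "(\<Sum>b<n. lscale (H b) (\<Sum>k<n. ?m (dl n (h k b)) (lvar n (3 * n + k)))) = (\<Sum>k<n. ?m (\<Sum>b<n. lscale (H b) (dl n (h k b))) (lvar n (3 * n + k)))"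
      unfolding lscale_sum lmult_sum_left by (subst sum.swap) (simp add: lmult_scale_left)
    have 3: "(\<Sum>b<n. ?m (dl n (H b)) (\<Sum>k<n. lscale (h k b) (lvar n (3 * n + k)))) = (\<Sum>k<n. ?m (\<Sum>b<n. lscale (h k b) (dl n (H b))) (lvar n (3 * n + k)))"
      unfolding lmult_sum_right lmult_sum_left by (subst sum.swap) (simp add: lmult_scale_left lmult_scale_right)
    show ?thesis
      unfolding pt_def et_def h_def[symmetric] sum.distrib lscale_add 1 2 3 lmult_add_left by (simp add: add.assoc)
  qed
  also have "eqon ?V \<dots> (pt c e a)"
    unfolding pt_def
  proof (intro eqon_sum eqon_add eqon_lmult eqon_refl eqon_scale)
    fix k assume "k \<in> {..<n}"
    then have k: "k < n" by simp
    have e: "(\<Sum>b<n. h k b v * H b v) = hinv c e k a v" if "v \<in> ?V" for v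
      using hinv_comp[OF cde that a k] by (simp add: h_def H_def)
    show "(\<Sum>b<n. h k b v * H b v) = hinv c e k a v" if "v \<in> ?V" for v using e[OF that] .
    have "eqon ?V (\<Sum>b<n. lscale (H b) (dl n (h k b)) + lscale (h k b) (dl n (H b))) (\<Sum>b<n. dl n (\<lambda>v. h k b v * H b v))"
      using hs[OF k] Hs by (intro eqon_sum eqon_sym[OF dl_mult]) auto
    also have "eqon ?V \<dots> (dl n (\<lambda>v. \<Sum>b<n. h k b v * H b v))"
      using hs[OF k] Hs by (intro eqon_sym[OF dl_sum[OF V]] smooth_mult[OF V]) auto
    also have "eqon ?V \<dots> (dl n (hinv c e k a))" by (rule dl_cong[OF V e])
    finally show "eqon ?V (\<Sum>b<n. lscale (H b) (dl n (h k b)) + lscale (h k b) (dl n (H b))) (dl n (hinv c e k a))" .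
  qed
  finally show ?thesis .
qed

lemma ct_comp:
  assumes cde: "c \<in> A" "d \<in> A" "e \<in> A" and i: "i < 4 * n"
  shows "eqon (ov c (fst d \<inter> fst e)) (lsubst (wC n) n (4 * n) (ct c d) (ct d e i)) (ct c e i)"
proof -
  let ?V = "ov c (fst d \<inter> fst e)"
  have V: "openin (Euclidean_space n) ?V" using cde by (intro ov_open openin_Int chart_open)
  have VV: "?V \<subseteq> ov c (fst d)" by (auto simp: ov_def)
  have VW: "\<tau> c d v \<in> ov d (fst e)" if "v \<in> ?V" for v using that cde by (auto simp: ov_def tau_eq)
  have wg: "wgood n (4 * n) (wC n)" by (rule wgood_wC) simp
  consider "i < n" | "n \<le> i" "i < 2 * n" | "2 * n \<le> i" "i < 3 * n" | "3 * n \<le> i" using i by linarith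
  then show ?thesis
  proof cases
    case 1
    then show ?thesis using base_comp_eqon[OF cde 1, of "ct c d"] by (simp add: ct_base)
  next
    case 2
    then have "eqon ?V (lsubst (wC n) n (4 * n) (ct c d) (dl n (\<lambda>v. \<tau> d e v (i - n)))) (dl n (\<lambda>v. \<tau> d e (\<tau> c d v) (i - n)))"
      using cde by (intro dl_comp_eqon[OF cde(1,2) V VV ov_fst_open[OF cde(2,3)] VW chart_smooth[OF cde(2,3)] wg]) (auto simp: ct_def)
    also have "eqon ?V \<dots> (dl n (\<lambda>v. \<tau> c e v (i - n)))"
      using tau_comp[OF cde(1,2), of _ e] VV by (intro dl_cong[OF V]) (simp add: subset_iff)
    finally show ?thesis using 2 by (simp add: ct_def)
  next
    case 3
    then show ?thesis using pt_comp[OF cde, of "i - 2 * n"] by (simp add: ct_def)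
  next
    case 4
    have "eqon ?V (lsubst (wC n) n (4 * n) (ct c d) (et (3 * n) d e (i - 3 * n))) (et (3 * n) c e (i - 3 * n))"
      using 4 i by (intro et_comp[OF cde _ _ _ wg]) (auto simp: ct_def)
    then show ?thesis using 4 by (simp add: ct_def)
  qed
qed

lemma st_comp:
  assumes cde: "c \<in> A" "d \<in> A" "e \<in> A" and i: "i < 2 * n"
  shows "eqon (ov c (fst d \<inter> fst e)) (lsubst (w1 n) n (2 * n) (st c d) (st d e i)) (st c e i)"
proof (cases "i < n")
  case True
  then show ?thesis using base_comp_eqon[OF cde True, of "st c d"] by (simp add: st_base)
next
  case False
  have wg: "wgood n (2 * n) (w1 n)" by (rule wgood_w1) simp
  have "eqon (ov c (fst d \<inter> fst e)) (lsubst (w1 n) n (2 * n) (st c d) (et n d e (i - n))) (et n c e (i - n))"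
    using False i by (intro et_comp[OF cde _ _ _ wg]) (auto simp: st_def)
  then show ?thesis using False by (simp add: st_def)
qed

subsection \<open>Sections and their restrictions to a chart\<close>

text \<open>The coordinate changes \<open>t\<close> agree with \<open>trans X\<close> only over the overlaps, outside of which the latter
  take junk values.\<close>

definition good :: "('m, 'm chart) nmfd \<Rightarrow> ('m chart \<Rightarrow> 'm chart \<Rightarrow> nat \<Rightarrow> lfun) \<Rightarrow> bool" where
  "good X t \<longleftrightarrow> space_of X = T \<and> bdim X = n \<and> charts X = A \<and> cdom X = fst \<and> cmap X = snd \<and>
     wgood n (ncoord X) (wt X) \<and>
     (\<forall>c\<in>A. \<forall>d\<in>A. csub n (ncoord X) (wt X) (ncoord X) (wt X) (ov c (fst d)) (t c d) \<and>
        (\<forall>i<n. t c d i = lscale (\<lambda>v. \<tau> c d v i) lone) \<and>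
        (\<forall>i<ncoord X. eqon (ov c (fst d)) (trans X c d i) (t c d i))) \<and>
     (\<forall>c\<in>A. \<forall>d\<in>A. \<forall>e\<in>A. \<forall>i<ncoord X.
        eqon (ov c (fst d \<inter> fst e)) (lsubst (wt X) n (ncoord X) (t c d) (t d e i)) (t c e i))"

lemma goodD:
  assumes "good X t"
  shows "space_of X = T" "bdim X = n" "charts X = A" "cdom X = fst" "cmap X = snd"
    and "wgood n (ncoord X) (wt X)"
    and "c \<in> A \<Longrightarrow> d \<in> A \<Longrightarrow> csub n (ncoord X) (wt X) (ncoord X) (wt X) (ov c (fst d)) (t c d)"
    and "c \<in> A \<Longrightarrow> d \<in> A \<Longrightarrow> i < n \<Longrightarrow> t c d i = lscale (\<lambda>v. \<tau> c d v i) lone"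
    and "c \<in> A \<Longrightarrow> d \<in> A \<Longrightarrow> i < ncoord X \<Longrightarrow> eqon (ov c (fst d)) (trans X c d i) (t c d i)"
    and "c \<in> A \<Longrightarrow> d \<in> A \<Longrightarrow> e \<in> A \<Longrightarrow> i < ncoord X \<Longrightarrow>
      eqon (ov c (fst d \<inter> fst e)) (lsubst (wt X) n (ncoord X) (t c d) (t d e i)) (t c e i)"
  using assms unfolding good_def by (elim conjE, simp)+

lemma good_C: "good C ct"
  unfolding good_def by (simp add: wgood_wC csub_ct ct_base trans_C ct_comp)

lemma good_Ts1: "good (Tstar (Suc 0) M) st"
  unfolding good_def by (simp add: wgood_w1 csub_st st_base trans_Ts1 st_comp)

lemma cimage_ov: "good X t \<Longrightarrow> cimage X c W = ov c W"
  by (simp add: cimage_def ov_def goodD(4,5))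

lemma base_good:
  assumes g: "good X t" and cd: "c \<in> A" "d \<in> A" and v: "v \<in> ov c (fst d)"
  shows "base_subst n (t c d) v = \<tau> c d v"
  by (rule base_tau[OF cd v goodD(8)[OF g cd]])

definition supp_in :: "(nat \<Rightarrow> real) set \<Rightarrow> lfun \<Rightarrow> bool" where
  "supp_in V f \<longleftrightarrow> (\<forall>\<mu> v. f \<mu> v \<noteq> 0 \<longrightarrow> v \<in> V)"

lemma supp_in_lrestrict: "supp_in V (lrestrict V f)"
  by (auto simp: supp_in_def lrestrict_def)

lemma lrestrict_supp_in: "supp_in V f \<Longrightarrow> lrestrict V f = f"
  by (auto simp: supp_in_def lrestrict_def fun_eq_iff)

lemma supp_in_eqI: "supp_in V f \<Longrightarrow> supp_in V g \<Longrightarrow> eqon V f g \<Longrightarrow> f = g"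
  using eqon_lrestrict_eq lrestrict_supp_in by metis

lemma local_funs_iff:
  "(f \<in> local_funs n N w V \<and> (\<forall>\<mu> v. f \<mu> v \<noteq> 0 \<longrightarrow> mono_deg N w \<mu> \<le> K)) \<longleftrightarrow>
    bdeg n N w K f \<and> supp_in V f \<and> lsmooth n V f"
  unfolding local_funs_def lsupp_def supp_in_def lsmooth_def by blast

text \<open>The gluing condition evaluates transitions on overlaps only, so the explicit coordinate
  changes can replace \<open>trans X\<close>.\<close>

lemma sections_trans:
  assumes g: "good X t" and cd: "c \<in> A" "d \<in> A"
  shows "eqon (ov c (fst d \<inter> W)) (lsubst (wt X) n (ncoord X) (trans X c d) f) (lsubst (wt X) n (ncoord X) (t c d) f)"
proof (rule lsubst_eqon_sub)
  have V: "ov c (fst d \<inter> W) \<subseteq> ov c (fst d)" by (auto simp: ov_def)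
  show *: "eqon (ov c (fst d \<inter> W)) (trans X c d i) (t c d i)" if "i < ncoord X" for i
    using goodD(9)[OF g cd that] V by (rule eqon_subset)
  show "eqon (ov c (fst d \<inter> W)) (trans X c d i) (t c d i)" if "i < n" for i
    using * that wgoodD(1)[OF goodD(6)[OF g]] by simp
qed

lemma sections_iff:
  assumes g: "good X t"
  shows "f \<in> sections X W \<longleftrightarrow> (\<forall>c. c \<notin> A \<longrightarrow> f c = 0) \<and>
    (\<exists>K. \<forall>c\<in>A. bdeg n (ncoord X) (wt X) K (f c)) \<and>
    (\<forall>c\<in>A. supp_in (ov c W) (f c) \<and> lsmooth n (ov c W) (f c)) \<and>
    (\<forall>c\<in>A. \<forall>d\<in>A. eqon (ov c (fst d \<inter> W)) (f c) (lsubst (wt X) n (ncoord X) (t c d) (f d)))"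
    (is "_ \<longleftrightarrow> ?Z \<and> ?K \<and> ?L \<and> ?G")
proof -
  note c = cimage_ov[OF g] goodD(2-4)[OF g]
  have G: "(\<forall>c\<in>A. \<forall>d\<in>A. \<forall>\<mu>. \<forall>v\<in>ov c (fst d \<inter> W). f c \<mu> v = lsubst (wt X) n (ncoord X) (trans X c d) (f d) \<mu> v) \<longleftrightarrow> ?G"
    using sections_trans[OF g] by (simp add: eqon_def) metis
  have "f \<in> sections X W \<longleftrightarrow> ?Z \<and> (\<forall>c\<in>A. f c \<in> local_funs n (ncoord X) (wt X) (ov c W)) \<and> ?G \<and>
     (\<exists>K. \<forall>c \<mu> v. f c \<mu> v \<noteq> 0 \<longrightarrow> mono_deg (ncoord X) (wt X) \<mu> \<le> K)"
    unfolding sections_def mem_Collect_eq c G zero_lfun ..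
  also have "\<dots> \<longleftrightarrow> ?Z \<and> ?K \<and> ?L \<and> ?G"
  proof (intro iffI; elim conjE exE)
    fix K
    assume z: ?Z and l: "\<forall>c\<in>A. f c \<in> local_funs n (ncoord X) (wt X) (ov c W)" and gl: ?G
      and K: "\<forall>c \<mu> v. f c \<mu> v \<noteq> 0 \<longrightarrow> mono_deg (ncoord X) (wt X) \<mu> \<le> K"
    have "bdeg n (ncoord X) (wt X) K (f c) \<and> supp_in (ov c W) (f c) \<and> lsmooth n (ov c W) (f c)" if "c \<in> A" for c
      using local_funs_iff[of "f c"] l K that by blast
    then show "?Z \<and> ?K \<and> ?L \<and> ?G" using z gl by blast
  next
    fix K
    assume z: ?Z and K: "\<forall>c\<in>A. bdeg n (ncoord X) (wt X) K (f c)" and l: ?L and gl: ?G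
    have "f c \<in> local_funs n (ncoord X) (wt X) (ov c W) \<and> (\<forall>\<mu> v. f c \<mu> v \<noteq> 0 \<longrightarrow> mono_deg (ncoord X) (wt X) \<mu> \<le> K)" if "c \<in> A" for c
      using local_funs_iff[of "f c"] l K that by blast
    moreover have "f c \<mu> v = 0" if "c \<notin> A" for c \<mu> v
    proof -
      have "f c = 0" using z that by blast
      then show ?thesis by (simp add: zero_fun_apply)
    qed
    ultimately show "?Z \<and> (\<forall>c\<in>A. f c \<in> local_funs n (ncoord X) (wt X) (ov c W)) \<and> ?G \<and>
     (\<exists>K. \<forall>c \<mu> v. f c \<mu> v \<noteq> 0 \<longrightarrow> mono_deg (ncoord X) (wt X) \<mu> \<le> K)" using z gl by metis
  qed
  finally show ?thesis .
qed

lemma sectionsD: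
  assumes g: "good X t" and f: "f \<in> sections X W" and c: "c \<in> A"
  shows "gdeg n (ncoord X) (wt X) (f c)" "supp_in (ov c W) (f c)" "lsmooth n (ov c W) (f c)"
    and "d \<in> A \<Longrightarrow> eqon (ov c (fst d \<inter> W)) (f c) (lsubst (wt X) n (ncoord X) (t c d) (f d))"
  using f c unfolding sections_iff[OF g] gdeg_def by blast+

lemma sections_outside: "good X t \<Longrightarrow> f \<in> sections X W \<Longrightarrow> c \<notin> A \<Longrightarrow> f c = 0"
  using sections_iff by blast

lemma csub_good_subset:
  assumes g: "good X t" and cd: "c \<in> A" "d \<in> A" and W: "openin T W" "W \<subseteq> fst d"
  shows "csub n (ncoord X) (wt X) (ncoord X) (wt X) (ov c W) (t c d)"
  by (rule csub_subset[OF ov_open[OF cd(1) W(1)] goodD(7)[OF g cd] ov_mono[OF W(2)]])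

text \<open>The section over \<open>W\<close>, contained in the domain of the chart \<open>c\<close>, with the expression \<open>g\<close> in
  that chart.\<close>

definition ext :: "('m, 'm chart) nmfd \<Rightarrow> ('m chart \<Rightarrow> 'm chart \<Rightarrow> nat \<Rightarrow> lfun) \<Rightarrow> 'm chart \<Rightarrow> 'm set \<Rightarrow> lfun \<Rightarrow> 'm chart sec" where
  "ext X t c W g = (\<lambda>e. if e \<in> A then lrestrict (ov e W) (lsubst (wt X) n (ncoord X) (t e c) g) else 0)"

lemma tau_sub:
  assumes "e \<in> A" "v \<in> ov e W" "W \<subseteq> fst c"
  shows "\<tau> e c v \<in> ov c W" "v \<in> ov e (fst c)"
  using assms by (auto simp: ov_def tau_eq)

text \<open>That the expressions in two further charts match is the cocycle condition for the
  coordinate changes.\<close>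

lemma ext_section:
  assumes g: "good X t" and c: "c \<in> A" and W: "openin T W" "W \<subseteq> fst c"
    and f: "gdeg n (ncoord X) (wt X) f" "lsmooth n (ov c W) f"
  shows "ext X t c W f \<in> sections X W"
  unfolding sections_iff[OF g]
proof (intro conjI ballI allI impI)
  let ?N = "ncoord X" and ?w = "wt X"
  note wg = goodD(6)[OF g]
  show "ext X t c W f e = 0" if "e \<notin> A" for e using that by (simp add: ext_def)
  obtain K where K: "bdeg n ?N ?w K f" using f(1) by (auto simp: gdeg_def)
  show "\<exists>K. \<forall>e\<in>A. bdeg n ?N ?w K (ext X t c W f e)"
    by (intro exI[of _ K] ballI) (auto simp: ext_def intro!: lsupp_lrestrict csub_subst(1)[OF goodD(7)[OF g _ c] K])
  fix e assume e: "e \<in> A"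
  note V = ov_open[OF e W(1)]
  have b: "base_subst n (t e c) v \<in> ov c W" if "v \<in> ov e W" for v
    using tau_sub[OF e that W(2)] base_good[OF g e c] by simp
  show "supp_in (ov e W) (ext X t c W f e)" using e by (simp add: ext_def supp_in_lrestrict)
  show "lsmooth n (ov e W) (ext X t c W f e)"
    using e lsmooth_lsubst[OF V ov_open[OF c W(1)] csub_good_subset[OF g e c W] wg b f(2,1)]
    by (simp add: ext_def lsmooth_lrestrict[OF V])
  fix d assume d: "d \<in> A"
  let ?V = "ov e (fst d \<inter> W)"
  have V': "?V \<subseteq> ov e W" "?V \<subseteq> ov e (fst d \<inter> fst c)" "?V \<subseteq> ov e (fst d)" using W(2) by (auto simp: ov_def)
  have bd: "base_subst n (t e d) v \<in> ov d W" if "v \<in> ?V" for v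
    using that base_good[OF g e d, of v] V'(3) e by (auto simp: ov_def tau_eq)
  have "eqon ?V (ext X t c W f e) (lsubst ?w n ?N (t e c) f)"
    using e V'(1) by (simp add: ext_def eqon_subset[OF eqon_lrestrict])
  also have "eqon ?V \<dots> (lsubst ?w n ?N (\<lambda>i. lsubst ?w n ?N (t e d) (t d c i)) f)"
  proof (rule eqon_sym, rule lsubst_eqon_sub)
    show *: "eqon ?V (lsubst ?w n ?N (t e d) (t d c i)) (t e c i)" if "i < ?N" for i
      using goodD(10)[OF g e d c that] V'(2) by (rule eqon_subset)
    show "eqon ?V (lsubst ?w n ?N (t e d) (t d c i)) (t e c i)" if "i < n" for i
      using * that wgoodD(1)[OF wg] by simp
  qed
  also have "lsubst ?w n ?N (\<lambda>i. lsubst ?w n ?N (t e d) (t d c i)) f = lsubst ?w n ?N (t e d) (lsubst ?w n ?N (t d c) f)"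
    by (rule csub_comp[OF goodD(7)[OF g e d] goodD(7)[OF g d c] wg wg f(1), symmetric])
  also have "eqon ?V \<dots> (lsubst ?w n ?N (t e d) (ext X t c W f d))"
    using d by (intro lsubst_eqon_arg[OF bd]) (simp_all add: ext_def eqon_sym[OF eqon_lrestrict])
  finally show "eqon ?V (ext X t c W f e) (lsubst ?w n ?N (t e d) (ext X t c W f d))" .
qed

text \<open>Over a part of one chart domain the gluing condition recovers all expressions of a
  section from the one in that chart.\<close>

lemma section_ext:
  assumes g: "good X t" and c: "c \<in> A" and W: "W' \<subseteq> fst c" "W' \<subseteq> W" and f: "f \<in> sections X W"
  shows "sec_restrict X W' f = ext X t c W' (f c)"
proof
  fix e
  show "sec_restrict X W' f e = ext X t c W' (f c) e"
  proof (cases "e \<in> A")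
    case True
    have "ov e W' \<subseteq> ov e (fst c \<inter> W)" using W by (auto simp: ov_def)
    then have "eqon (ov e W') (f e) (lsubst (wt X) n (ncoord X) (t e c) (f c))"
      using sectionsD(4)[OF g f True c] eqon_subset by blast
    then show ?thesis using True
      by (simp add: sec_restrict_def ext_def cimage_ov[OF g] eqon_lrestrict_eq)
  next
    case False
    then show ?thesis
      using sections_outside[OF g f False] by (simp add: sec_restrict_def ext_def)
        (simp add: lrestrict_def zero_fun_def)
  qed
qed

lemma ext_add:
  assumes g: "good X t" and f: "gdeg n (ncoord X) (wt X) f" "gdeg n (ncoord X) (wt X) h"
  shows "sec_add (ext X t c W f) (ext X t c W h) = ext X t c W (f + h)"
  unfolding sec_add_def ladd_eq ext_def using lsubst_add[OF wgoodD(2)[OF goodD(6)[OF g]] f]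
  by (auto simp: fun_eq_iff lrestrict_def plus_fun_apply zero_fun_apply)

lemma ext_mult:
  assumes g: "good X t" and c: "c \<in> A" and f: "gdeg n (ncoord X) (wt X) f" "gdeg n (ncoord X) (wt X) h"
  shows "sec_mult X (ext X t c W f) (ext X t c W h) = ext X t c W (lmult (wt X) f h)"
proof
  fix e
  show "sec_mult X (ext X t c W f) (ext X t c W h) e = ext X t c W (lmult (wt X) f h) e"
  proof (cases "e \<in> A")
    case True
    show ?thesis
      using lsubst_lmult[OF csub_good[OF goodD(7)[OF g True c] goodD(6)[OF g]] f wgoodD(1)[OF goodD(6)[OF g]]] True
      by (simp add: sec_mult_def ext_def lmult_restrict)
  qed (simp add: sec_mult_def ext_def)
qed

subsection \<open>Morphisms given by coordinate expressions\<close>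

lemma preim_id: "space_of X = T \<Longrightarrow> openin T W \<Longrightarrow> base \<psi> = (\<lambda>m. m) \<Longrightarrow> preim X \<psi> W = W"
  using openin_subset by (fastforce simp: preim_def)

text \<open>The square formed by the substitutions \<open>y\<close> and the coordinate changes
  commutes on overlaps. Fixing the base coordinates makes the base map the identity, as
  \<open>coord_morphism\<close> assumes.\<close>

definition compatible :: "('m, 'm chart) nmfd \<Rightarrow> ('m chart \<Rightarrow> 'm chart \<Rightarrow> nat \<Rightarrow> lfun) \<Rightarrow> ('m chart \<Rightarrow> nat \<Rightarrow> lfun) \<Rightarrow> bool" where
  "compatible X t y \<longleftrightarrow> (\<forall>c\<in>A. csub n (ncoord X) (wt X) (ncoord X) (wt X) (ov c (fst c)) (y c) \<and>
     (\<forall>i<n. y c i = lvar n i) \<and>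
     (\<forall>d\<in>A. \<forall>i<ncoord X. eqon (ov c (fst d)) (lsubst (wt X) n (ncoord X) (y c) (t c d i))
        (lsubst (wt X) n (ncoord X) (t c d) (y d i))))"

lemma base_lvar: "(\<And>i. i < n \<Longrightarrow> y i = lvar n i) \<Longrightarrow> c \<in> A \<Longrightarrow> v \<in> ov c W \<Longrightarrow> base_subst n y v = v"
  using ov_zero by (auto simp: base_subst_def fun_eq_iff lvar_def)

text \<open>In each chart the algebra laws and the degrees are those of \<open>lsubst\<close>;
  compatibility makes the local pullbacks agree on overlaps, and \<open>lsubst_zero_coeff\<close>
  gives locality.\<close>

theorem coord_morphism_n_morphism:
  assumes g: "good X t" and y: "compatible X t y"
  shows "n_morphism X X (coord_morphism X X y)"
proof -
  let ?N = "ncoord X" and ?w = "wt X" and ?P = "coord_morphism X X y"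
  let ?S = "\<lambda>c. lsubst ?w n ?N (y c)"
  note wg = goodD(6)[OF g] and nN = wgoodD(1)[OF goodD(6)[OF g]] and pos = wgoodD(2)[OF goodD(6)[OF g]]
  have yc: "csub n ?N ?w ?N ?w (ov c (fst c)) (y c)" if "c \<in> A" for c using y that by (auto simp: compatible_def)
  have y0: "y c i = lvar n i" if "c \<in> A" "i < n" for c i using y that by (auto simp: compatible_def)
  have yt: "eqon (ov c (fst d)) (?S c (t c d i)) (lsubst ?w n ?N (t c d) (y d i))" if "c \<in> A" "d \<in> A" "i < ?N" for c d i
    using y that by (auto simp: compatible_def)
  have b: "base_subst n (y c) v = v" if "c \<in> A" "v \<in> ov c W" for c v W
    by (rule base_lvar[of "y c", OF y0[OF that(1)] that])
  have pull: "pull ?P W f c = (if c \<in> A then lrestrict (ov c W) (?S c (f c)) else 0)" for W f c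
    by (simp add: coord_morphism_def cimage_ov[OF g] goodD(2,3)[OF g] zero_lfun)
  have pre: "preim X ?P W = W" if "openin T W" for W
    by (rule preim_id[OF goodD(1)[OF g] that]) (simp add: coord_morphism_def)
  have ovc: "ov c W = ov c (fst c \<inter> W)" for c W by (auto simp: ov_def)
  have sec: "pull ?P W f \<in> sections X W" if W: "openin T W" and f: "f \<in> sections X W" for W f
    unfolding sections_iff[OF g]
  proof (intro conjI ballI allI impI)
    show "pull ?P W f c = 0" if "c \<notin> A" for c using that by (simp add: pull)
    obtain K where "\<forall>c\<in>A. bdeg n ?N ?w K (f c)" using f sections_iff[OF g] by blast
    then show "\<exists>K. \<forall>c\<in>A. bdeg n ?N ?w K (pull ?P W f c)"
      by (intro exI[of _ K]) (auto simp: pull intro!: lsupp_lrestrict csub_subst(1)[OF yc])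
    fix c assume c: "c \<in> A"
    note V = ov_open[OF c W]
    have sub: "ov c W \<subseteq> ov c (fst c)" by (auto simp: ov_def)
    show "supp_in (ov c W) (pull ?P W f c)" using c by (simp add: pull supp_in_lrestrict)
    have "lsmooth n (ov c W) (?S c (f c))"
      using b[OF c] by (intro lsmooth_lsubst[OF V V csub_subset[OF V yc[OF c] sub] wg _ sectionsD(3,1)[OF g f c]]) auto
    then show "lsmooth n (ov c W) (pull ?P W f c)" using c by (simp add: pull lsmooth_lrestrict[OF V])
    fix d assume d: "d \<in> A"
    let ?V = "ov c (fst d \<inter> W)"
    have V': "?V \<subseteq> ov c W" "?V \<subseteq> ov c (fst d)" by (auto simp: ov_def)
    have bt: "base_subst n (t c d) v \<in> ov d W" if "v \<in> ?V" for v
      using that base_good[OF g c d, of v] V'(2) c by (auto simp: ov_def tau_eq)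
    have "eqon ?V (pull ?P W f c) (?S c (f c))" using c V'(1) by (simp add: pull eqon_subset[OF eqon_lrestrict])
    also have "eqon ?V \<dots> (?S c (lsubst ?w n ?N (t c d) (f d)))"
      using b[OF c] by (intro lsubst_eqon_arg[OF _ sectionsD(4)[OF g f c d]]) simp
    also have "?S c (lsubst ?w n ?N (t c d) (f d)) = lsubst ?w n ?N (\<lambda>i. ?S c (t c d i)) (f d)"
      by (rule csub_comp[OF yc[OF c] goodD(7)[OF g c d] wg wg sectionsD(1)[OF g f d]])
    also have "eqon ?V \<dots> (lsubst ?w n ?N (\<lambda>i. lsubst ?w n ?N (t c d) (y d i)) (f d))"
    proof (rule lsubst_eqon_sub)
      show *: "eqon ?V (?S c (t c d i)) (lsubst ?w n ?N (t c d) (y d i))" if "i < ?N" for i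
        using yt[OF c d that] V'(2) by (rule eqon_subset)
      show "eqon ?V (?S c (t c d i)) (lsubst ?w n ?N (t c d) (y d i))" if "i < n" for i
        using * that nN by simp
    qed
    also have "lsubst ?w n ?N (\<lambda>i. lsubst ?w n ?N (t c d) (y d i)) (f d) = lsubst ?w n ?N (t c d) (?S d (f d))"
      by (rule csub_comp[OF goodD(7)[OF g c d] yc[OF d] wg wg sectionsD(1)[OF g f d], symmetric])
    also have "eqon ?V \<dots> (lsubst ?w n ?N (t c d) (pull ?P W f d))"
      using d by (intro lsubst_eqon_arg[OF bt]) (simp_all add: pull eqon_sym[OF eqon_lrestrict])
    finally show "eqon ?V (pull ?P W f c) (lsubst ?w n ?N (t c d) (pull ?P W f d))" .
  qed
  show ?thesis
    unfolding n_morphism_def goodD(1)[OF g]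
  proof (intro conjI allI impI ballI)
    show "continuous_map T T (base ?P)" by (simp add: coord_morphism_def)
    fix W assume W: "openin T W"
    show "pull ?P W f \<in> sections X (preim X ?P W)" if "f \<in> sections X W" for f
      using sec[OF W that] pre[OF W] by simp
    show "pull ?P W (sec_one X W) = sec_one X (preim X ?P W)"
    proof
      fix c
      have "eqon (ov c W) (?S c (lrestrict (ov c W) lone)) (?S c lone)" if "c \<in> A"
        using b[OF that] by (intro lsubst_eqon_arg[OF _ eqon_lrestrict]) simp
      then show "pull ?P W (sec_one X W) c = sec_one X (preim X ?P W) c"
        by (simp add: pull sec_one_def cimage_ov[OF g] goodD(3)[OF g] pre[OF W] zero_lfun eqon_lrestrict_eq)
    qed
    fix f assume f: "f \<in> sections X W"
    show "pull ?P W (sec_add f h) = sec_add (pull ?P W f) (pull ?P W h)" if h: "h \<in> sections X W" for h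
    proof
      fix c
      have "?S c (f c + h c) = ?S c (f c) + ?S c (h c)" if "c \<in> A"
        by (rule lsubst_add[OF pos sectionsD(1)[OF g f that] sectionsD(1)[OF g h that]])
      then show "pull ?P W (sec_add f h) c = sec_add (pull ?P W f) (pull ?P W h) c"
        by (simp add: pull sec_add_def ladd_eq) (simp add: lrestrict_def fun_eq_iff plus_fun_apply)
    qed
    show "pull ?P W (sec_mult X f h) = sec_mult X (pull ?P W f) (pull ?P W h)" if h: "h \<in> sections X W" for h
    proof
      fix c
      have "?S c (lmult ?w (f c) (h c)) = lmult ?w (?S c (f c)) (?S c (h c))" if "c \<in> A"
        by (rule lsubst_lmult[OF csub_good[OF yc[OF that] wg] sectionsD(1)[OF g f that] sectionsD(1)[OF g h that] nN])
      then show "pull ?P W (sec_mult X f h) c = sec_mult X (pull ?P W f) (pull ?P W h) c"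
        by (simp add: pull sec_mult_def lmult_restrict)
    qed
    show "pull ?P W (sec_scale r f) = sec_scale r (pull ?P W f)" for r
    proof
      fix c
      have s: "sec_scale r h c = lscale (\<lambda>_. r) (h c)" for h :: "'m chart sec" by (simp add: sec_scale_def lscale_def)
      have l: "lrestrict V (lscale (\<lambda>_. r) h) = lscale (\<lambda>_. r) (lrestrict V h)" for V h
        by (simp add: lscale_def lrestrict_def fun_eq_iff)
      show "pull ?P W (sec_scale r f) c = sec_scale r (pull ?P W f) c"
        unfolding s pull by (simp add: lsubst_scale l)
    qed
    show "homogeneous X k (pull ?P W f)" if h: "homogeneous X k f" for k
      unfolding homogeneous_def
    proof (intro allI impI)
      fix c \<mu> v assume nz: "pull ?P W f c \<mu> v \<noteq> 0"
      then have c: "c \<in> A" and nz': "?S c (f c) \<mu> v \<noteq> 0"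
        by (auto simp: pull lrestrict_def zero_fun_apply split: if_splits)
      obtain K where "bdeg n ?N ?w K (f c)" using sectionsD(1)[OF g f c] by (auto simp: gdeg_def)
      moreover have "f c \<mu> v \<noteq> 0 \<Longrightarrow> mono_deg ?N ?w \<mu> = k" for \<mu> v using h unfolding homogeneous_def by blast
      ultimately have "hdeg n ?N ?w k (f c)" unfolding lsupp_def by blast
      from csub_subst(2)[OF yc[OF c] this] nz' show "mono_deg ?N ?w \<mu> = k" by (auto simp: lsupp_def)
    qed
    show "pull ?P W' (sec_restrict X W' f) = sec_restrict X (preim X ?P W') (pull ?P W f)" if W': "openin T W' \<and> W' \<subseteq> W" for W'
    proof
      fix c
      have r: "lrestrict (ov c W') (lrestrict (ov c W) h) = lrestrict (ov c W') h" for h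
        using ov_mono[OF conjunct2[OF W'], of c] by (auto simp: lrestrict_def fun_eq_iff)
      have "eqon (ov c W') (?S c (lrestrict (ov c W') (f c))) (?S c (f c))" if "c \<in> A"
        using b[OF that] by (intro lsubst_eqon_arg[OF _ eqon_lrestrict]) simp
      moreover have "lrestrict (ov c W') 0 = 0" by (simp add: lrestrict_def fun_eq_iff zero_fun_apply)
      ultimately show "pull ?P W' (sec_restrict X W' f) c = sec_restrict X (preim X ?P W') (pull ?P W f) c"
        using W' by (simp add: pull sec_restrict_def cimage_ov[OF g] pre r eqon_lrestrict_eq)
    qed
    fix m c d assume m: "m \<in> preim X ?P W" and c: "c \<in> charts X" and d: "d \<in> charts X"
      and md: "m \<in> cdom X c \<and> base ?P m \<in> cdom X d"
    have c: "c \<in> A" and d: "d \<in> A" using c d goodD(3)[OF g] by auto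
    have m: "m \<in> W" "m \<in> fst c" "m \<in> fst d"
      using m md pre[OF W] by (auto simp: goodD(4)[OF g] coord_morphism_def)
    let ?v = "snd c m"
    have v: "?v \<in> ov c W" "?v \<in> ov c (fst d \<inter> W)" "?v \<in> ov c (fst d)" using m by (auto simp: ov_def)
    have "pull ?P W f c (\<lambda>_. 0) ?v = f c (\<lambda>_. 0) ?v"
      using c v(1) lsubst_zero_coeff[OF yc[OF c] wg sectionsD(1)[OF g f c]] b[OF c v(1)]
      by (simp add: pull lrestrict_def)
    also have "\<dots> = lsubst ?w n ?N (t c d) (f d) (\<lambda>_. 0) ?v"
      by (rule eqonD[OF sectionsD(4)[OF g f c d] v(2)])
    also have "\<dots> = f d (\<lambda>_. 0) (snd d m)"
      using lsubst_zero_coeff[OF goodD(7)[OF g c d] wg sectionsD(1)[OF g f d]] base_good[OF g c d v(3)] tau_eq[OF c m(2)]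
      by simp
    finally show "pull ?P W f c (\<lambda>_. 0) (cmap X c m) = f d (\<lambda>_. 0) (cmap X d (base ?P m))"
      by (simp add: goodD(5)[OF g] coord_morphism_def)
  qed
qed

end

lemma hdeg_wext:
  assumes "hdeg n N w k f" "N \<le> N'" "\<And>i. i < N \<Longrightarrow> w' i = w i"
  shows "hdeg n N' w' k f"
  using assms(1)
proof (rule lsupp_mono)
  fix \<mu> assume \<mu>: "mono_ok n N w \<mu> \<and> mono_deg N w \<mu> = k"
  have z: "\<mu> i = 0" if "N \<le> i" for i
  proof (rule ccontr)
    assume "\<mu> i \<noteq> 0"
    then have "i < N" using mono_okD[of n N w \<mu> i] \<mu> by simp
    then show False using that by simp
  qed
  have ok: "mono_ok n N' w' \<mu>"
    unfolding mono_ok_def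
  proof (intro conjI allI impI)
    fix i
    show "n \<le> i" "i < N'" if "\<mu> i \<noteq> 0" using mono_okD[OF conjunct1[OF \<mu>] that] assms(2) by auto
    show "\<mu> i \<le> 1" if "odd (w' i)"
    proof (cases "i < N")
      case True
      then show ?thesis using \<mu> that assms(3) by (auto simp: mono_ok_def)
    qed (simp add: z)
  qed
  have "mono_deg N' w' \<mu> = (\<Sum>i<N. w' i * \<mu> i)"
    unfolding mono_deg_def using assms(2) by (intro sum.mono_neutral_right) (auto simp: z)
  also have "\<dots> = k" using \<mu> assms(3) by (simp add: mono_deg_def)
  finally show "mono_ok n N' w' \<mu> \<and> mono_deg N' w' \<mu> = k" using ok by simp
qed

lemma mono_ok_below: "mono_ok n N w \<mu> \<Longrightarrow> \<forall>i\<ge>N. \<mu> i = 0"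
  using mono_okD by (metis not_le)

lemma hdeg_below: "hdeg n N w k f \<Longrightarrow> lbelow N f"
  by (erule lsupp_mono) (blast dest: mono_ok_below)

context smooth_mfd
begin

lemma w1_wC: "i < 2 * n \<Longrightarrow> wC n i = w1 n i"
  by (simp add: w1_def wC_def)

lemma lbelow_ct: "i < 2 * n \<Longrightarrow> lbelow (2 * n) (ct c d i)"
  unfolding ct_def dl_def by (auto intro!: lsupp_scale lsupp_sum lbelow_lone lbelow_lvar)

text \<open>Functions pulled back from \<open>T[1]M\<close> involve the first \<open>2 * n\<close>
  coordinates only, for which \<open>wC\<close> and \<open>w1\<close> agree.\<close>

lemma lsubst_ct_low:
  assumes "gdeg n (2 * n) (w1 n) f"
  shows "lsubst (wC n) n (4 * n) (ct c d) f = lsubst (w1 n) n (2 * n) (ct c d) f"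
proof -
  have "lsubst (wC n) n (4 * n) (ct c d) f = lsubst (wC n) n (2 * n) (ct c d) f"
    by (rule lsubst_trunc[OF assms]) auto
  also have "\<dots> = lsubst (w1 n) n (2 * n) (ct c d) f"
    by (rule lsubst_wcong[of n "2 * n" "2 * n"]) (simp_all add: lbelow_ct w1_wC)
  finally show ?thesis .
qed

lemma csub_ct1:
  assumes cd: "c \<in> A" "d \<in> A"
  shows "csub n (2 * n) (w1 n) (2 * n) (w1 n) (ov c (fst d)) (ct c d)"
  unfolding csub_def
proof (intro allI impI conjI)
  fix i assume i: "i < 2 * n"
  show "lsmooth n (ov c (fst d)) (ct c d i)" using csubD(1)[OF csub_ct[OF cd], of i] i by simp
  have "hdeg n (2 * n) (w1 n) 0 (lscale (\<lambda>v. \<tau> c d v i) lone)" by (intro lsupp_scale hdeg_lone)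
  moreover have "hdeg n (2 * n) (w1 n) 1 (dl n h)" for h by (rule dl_hdeg) (auto simp: w1_def)
  ultimately show "hdeg n (2 * n) (w1 n) (w1 n i) (ct c d i)" using i by (simp add: ct_def w1_def)
qed

lemma good_T1: "good (T1 M) ct"
  unfolding good_def
proof (intro conjI ballI allI impI)
  show "wgood n (ncoord (T1 M)) (wt (T1 M))" by (simp add: wgood_w1)
  fix c assume c: "c \<in> A"
  fix d assume d: "d \<in> A"
  show "csub n (ncoord (T1 M)) (wt (T1 M)) (ncoord (T1 M)) (wt (T1 M)) (ov c (fst d)) (ct c d)"
    using csub_ct1[OF c d] by simp
  show "ct c d i = lscale (\<lambda>v. \<tau> c d v i) lone" if "i < n" for i using ct_base[OF that] .
  show "eqon (ov c (fst d)) (trans (T1 M) c d i) (ct c d i)" if "i < ncoord (T1 M)" for i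
    using that by (simp add: trans_T1)
  fix e i assume e: "e \<in> A" and i: "i < ncoord (T1 M)"
  have "lsubst (w1 n) n (2 * n) (ct c d) (ct d e i) = lsubst (wC n) n (4 * n) (ct c d) (ct d e i)"
    using csubD(3)[OF csub_ct1[OF d e]] i by (simp add: lsubst_ct_low)
  then show "eqon (ov c (fst d \<inter> fst e)) (lsubst (wt (T1 M)) n (ncoord (T1 M)) (ct c d) (ct d e i)) (ct c e i)"
    using ct_comp[OF c d e, of i] i by simp
qed simp_all

subsection \<open>Homogeneous 3-forms\<close>

text \<open>All fibre coordinates of \<open>T[1]M\<close> have weight 1, so degree 3 already means
  that each monomial has three factors \<open>dx\<close>.\<close>

definition form3 :: "'m chart sec \<Rightarrow> bool" where
  "form3 \<kappa> \<longleftrightarrow> (\<forall>c\<in>A. hdeg n (2 * n) (w1 n) 3 (\<kappa> c) \<and> lsmooth n (ov c (fst c)) (\<kappa> c) \<and> supp_in (ov c (fst c)) (\<kappa> c) \<and>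
     (\<forall>d\<in>A. eqon (ov c (fst d)) (\<kappa> c) (lsubst (w1 n) n (2 * n) (ct c d) (\<kappa> d))))"

lemma form3D:
  assumes "form3 \<kappa>" "c \<in> A"
  shows "hdeg n (2 * n) (w1 n) 3 (\<kappa> c)" "lsmooth n (ov c (fst c)) (\<kappa> c)" "supp_in (ov c (fst c)) (\<kappa> c)"
    and "d \<in> A \<Longrightarrow> eqon (ov c (fst d)) (\<kappa> c) (lsubst (w1 n) n (2 * n) (ct c d) (\<kappa> d))"
  using assms unfolding form3_def by blast+

lemma ov_topspace: "c \<in> A \<Longrightarrow> ov c (topspace T) = ov c (fst c)"
  using openin_subset[OF chart_open, of c] by (auto simp: ov_def)

lemma form3_diff_forms:
  assumes "\<kappa> \<in> diff_forms M 3 0"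
  shows "form3 \<kappa>"
proof -
  have s: "\<kappa> \<in> sections (T1 M) (topspace T)" using assms by (simp add: diff_forms_def)
  have h: "homogeneous (T1 M) 3 \<kappa>" using assms by (simp add: diff_forms_def)
  show "form3 \<kappa>"
    unfolding form3_def
  proof (intro ballI conjI)
    fix c assume c: "c \<in> A"
    note S = sectionsD[OF good_T1 s c]
    obtain K where K: "bdeg n (2 * n) (w1 n) K (\<kappa> c)" using S(1) by (auto simp: gdeg_def)
    have "\<kappa> c \<mu> v \<noteq> 0 \<Longrightarrow> mono_deg (2 * n) (w1 n) \<mu> = 3" for \<mu> v
      using h unfolding homogeneous_def T1M_simps by blast
    with K show "hdeg n (2 * n) (w1 n) 3 (\<kappa> c)" unfolding lsupp_def by blast
    show "lsmooth n (ov c (fst c)) (\<kappa> c)" "supp_in (ov c (fst c)) (\<kappa> c)" using S(2,3) c by (simp_all add: ov_topspace)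
    fix d assume d: "d \<in> A"
    have "fst d \<inter> topspace T = fst d" using openin_subset[OF chart_open[OF d]] by blast
    then show "eqon (ov c (fst d)) (\<kappa> c) (lsubst (w1 n) n (2 * n) (ct c d) (\<kappa> d))" using S(4)[OF d] by simp
  qed
qed

lemma form3_uminus: "form3 \<kappa> \<Longrightarrow> form3 (\<lambda>c. lscale (\<lambda>_. - 1) (\<kappa> c))"
  unfolding form3_def
proof (intro ballI conjI)
  fix c assume k: "\<forall>c\<in>A. hdeg n (2 * n) (w1 n) 3 (\<kappa> c) \<and> lsmooth n (ov c (fst c)) (\<kappa> c) \<and> supp_in (ov c (fst c)) (\<kappa> c) \<and>
     (\<forall>d\<in>A. eqon (ov c (fst d)) (\<kappa> c) (lsubst (w1 n) n (2 * n) (ct c d) (\<kappa> d)))" and c: "c \<in> A"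
  then have *: "hdeg n (2 * n) (w1 n) 3 (\<kappa> c)" "lsmooth n (ov c (fst c)) (\<kappa> c)" "supp_in (ov c (fst c)) (\<kappa> c)"
    "\<And>d. d \<in> A \<Longrightarrow> eqon (ov c (fst d)) (\<kappa> c) (lsubst (w1 n) n (2 * n) (ct c d) (\<kappa> d))"
    by blast+
  note V = ov_fst_open[OF c c]
  show "hdeg n (2 * n) (w1 n) 3 (lscale (\<lambda>_. - 1) (\<kappa> c))" by (intro lsupp_scale *)
  show "lsmooth n (ov c (fst c)) (lscale (\<lambda>_. - 1) (\<kappa> c))" by (intro lsmooth_scale[OF V] smooth_const[OF V] *)
  show "supp_in (ov c (fst c)) (lscale (\<lambda>_. - 1) (\<kappa> c))" using *(3) by (simp add: supp_in_def lscale_def)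
  show "eqon (ov c (fst d)) (lscale (\<lambda>_. - 1) (\<kappa> c)) (lsubst (w1 n) n (2 * n) (ct c d) (lscale (\<lambda>_. - 1) (\<kappa> d)))"
    if "d \<in> A" for d
    unfolding lsubst_scale by (intro eqon_scale refl *(4) that)
qed

text \<open>\<open>\<partial>\<kappa>/\<partial>\<xi>_a\<close>\<close>

definition kd :: "'m chart sec \<Rightarrow> 'm chart \<Rightarrow> nat \<Rightarrow> lfun" where
  "kd \<kappa> c a = lpartial n (w1 n) (n + a) (\<kappa> c)"

lemma kd_props:
  assumes k: "form3 \<kappa>" and c: "c \<in> A" and a: "a < n"
  shows "hdeg n (2 * n) (w1 n) 2 (kd \<kappa> c a)" "lsmooth n (ov c (fst c)) (kd \<kappa> c a)" "supp_in (ov c (fst c)) (kd \<kappa> c a)"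
proof -
  have "hdeg n (2 * n) (w1 n) (3 - w1 n (n + a)) (kd \<kappa> c a)"
    unfolding kd_def by (rule hdeg_lpartial[OF form3D(1)[OF k c]]) simp
  then show "hdeg n (2 * n) (w1 n) 2 (kd \<kappa> c a)" by (simp add: w1_def)
  show "lsmooth n (ov c (fst c)) (kd \<kappa> c a)"
    unfolding kd_def by (rule lsmooth_lpartial[OF ov_fst_open[OF c c] form3D(2)[OF k c]])
  show "supp_in (ov c (fst c)) (kd \<kappa> c a)"
    using form3D(3)[OF k c] unfolding kd_def by (auto simp: supp_in_def lpartial_fibre)
qed

lemma vfield_single:
  assumes "k < N" "lok w f"
  shows "vfield n N w (\<lambda>j. if j = k then lone else 0) f = lpartial n w k f"
proof -
  have "vfield n N w (\<lambda>j. if j = k then lone else 0) f = (\<Sum>j<N. if j = k then lpartial n w k f else 0)"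
    unfolding vfield_def by (rule sum.cong) (auto simp: lmult_lone_left lok_lpartial[OF assms(2)])
  then show ?thesis using assms(1) by simp
qed

text \<open>Differentiating the gluing condition of \<open>\<kappa>\<close> along
  \<open>\<xi>_b\<close> by the chain rule brings in
  \<open>\<partial>\<xi>'_a/\<partial>\<xi>_b\<close>, an entry of the Jacobian (\<open>D\<close>).
  Multiplying by the inverse matrix gives the claim: the transformation law of the
  \<open>p_a\<close> without the \<open>\<eta>\<close> term.\<close>

lemma kd_change:
  assumes k: "form3 \<kappa>" and cd: "c \<in> A" "d \<in> A" and a: "a < n"
  shows "eqon (ov c (fst d)) (lsubst (w1 n) n (2 * n) (ct c d) (kd \<kappa> d a)) (\<Sum>b<n. lscale (hinv c d b a) (kd \<kappa> c b))"
proof -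
  let ?V = "ov c (fst d)" and ?w = "w1 n" and ?S = "lsubst (w1 n) n (2 * n) (ct c d)"
  note V = ov_fst_open[OF cd] and W = ov_fst_open[OF cd(2,1)]
  have wg: "wgood n (2 * n) ?w" by (rule wgood_w1) simp
  have sub: "ov d (fst c) \<subseteq> ov d (fst d)" by (auto simp: ov_def)
  have b0: "base_subst n (ct c d) v = \<tau> c d v" if "v \<in> ?V" for v by (rule base_tau[OF cd that ct_base])
  have D: "eqon ?V (kd \<kappa> c b) (\<Sum>a<n. lscale (jac c d a b) (?S (kd \<kappa> d a)))" if b: "b < n" for b
  proof -
    \<comment> \<open>The odd vector field \<open>\<partial>/\<partial>\<xi>_b\<close>, written with
      components so that \<open>vfield_lsubst\<close> applies.\<close>
    let ?X = "\<lambda>j. if j = n + b then lone else 0"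
    have vs: "vfield n (2 * n) ?w ?X f = lpartial n ?w (n + b) f" if "lok ?w f" for f
      using b by (intro vfield_single that) simp
    have "eqon ?V (kd \<kappa> c b) (lpartial n ?w (n + b) (?S (\<kappa> d)))"
      unfolding kd_def by (rule lpartial_cong[OF V form3D(4)[OF k cd]])
    also have "lpartial n ?w (n + b) (?S (\<kappa> d)) = vfield n (2 * n) ?w ?X (?S (\<kappa> d))"
      by (simp add: vs lok_lsubst)
    also have "eqon ?V \<dots> (\<Sum>i<2*n. lmult ?w (vfield n (2 * n) ?w ?X (ct c d i)) (?S (lpartial n ?w i (\<kappa> d))))"
    proof (rule vfield_lsubst[OF V W wg wg])
      show "lpar ?w (?w j + 1) (?X j)" if "j < 2 * n" for j
        using lone_lpar[of ?w] by (auto simp: w1_def)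
      show "csub n (2 * n) ?w (2 * n) ?w ?V (ct c d)" by (rule csub_ct1[OF cd])
      show "base_subst n (ct c d) v \<in> ov d (fst c)" if "v \<in> ?V" for v using tau_ov'[OF cd(1) that] b0[OF that] by simp
      show "lsmooth n (ov d (fst c)) (\<kappa> d)" by (rule lsmooth_subset[OF W form3D(2)[OF k cd(2)] sub])
      show "gdeg n (2 * n) ?w (\<kappa> d)" by (rule hdeg_gdeg[OF form3D(1)[OF k cd(2)]])
    qed
    also have "(\<Sum>i<2*n. lmult ?w (vfield n (2 * n) ?w ?X (ct c d i)) (?S (lpartial n ?w i (\<kappa> d)))) =
      (\<Sum>i\<in>{n..<2*n}. lmult ?w (vfield n (2 * n) ?w ?X (ct c d i)) (?S (lpartial n ?w i (\<kappa> d))))"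
    proof (rule sum.mono_neutral_right)
      show "\<forall>i\<in>{..<2*n} - {n..<2*n}. lmult ?w (vfield n (2 * n) ?w ?X (ct c d i)) (?S (lpartial n ?w i (\<kappa> d))) = 0"
      proof
        fix i assume "i \<in> {..<2*n} - {n..<2*n}"
        then have "i < n" by auto
        then have "vfield n (2 * n) ?w ?X (ct c d i) = 0"
          by (simp only: ct_base vs[OF lsupp_scale[OF lok_lone]]) (simp add: lpartial_scale)
        then show "lmult ?w (vfield n (2 * n) ?w ?X (ct c d i)) (?S (lpartial n ?w i (\<kappa> d))) = 0" by simp
      qed
    qed auto
    also have "\<dots> = (\<Sum>a<n. lmult ?w (vfield n (2 * n) ?w ?X (ct c d (n + a))) (?S (kd \<kappa> d a)))"
      by (rule sum.reindex_bij_witness[of _ "\<lambda>j. n + j" "\<lambda>j. j - n"]) (auto simp: kd_def)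
    also have "\<dots> = (\<Sum>a<n. lscale (jac c d a b) (?S (kd \<kappa> d a)))"
    proof (rule sum.cong[OF refl])
      fix a assume "a \<in> {..<n}"
      then have "ct c d (n + a) = dl n (\<lambda>v. \<tau> c d v a)" by (simp add: ct_def)
      then have "vfield n (2 * n) ?w ?X (ct c d (n + a)) = lscale (jac c d a b) lone"
        using lpartial_dl[OF b, of ?w] by (simp add: vs lok_dl jac_def)
      then show "lmult ?w (vfield n (2 * n) ?w ?X (ct c d (n + a))) (?S (kd \<kappa> d a)) = lscale (jac c d a b) (?S (kd \<kappa> d a))"
        by (simp add: lmult_scale_left lmult_lone_left lok_lsubst)
    qed
    finally show ?thesis .
  qed
  have "eqon ?V (\<Sum>b<n. lscale (hinv c d b a) (kd \<kappa> c b)) (\<Sum>b<n. lscale (hinv c d b a) (\<Sum>a'<n. lscale (jac c d a' b) (?S (kd \<kappa> d a'))))"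
    by (intro eqon_sum eqon_scale refl D) simp
  also have "(\<Sum>b<n. lscale (hinv c d b a) (\<Sum>a'<n. lscale (jac c d a' b) (?S (kd \<kappa> d a')))) =
    (\<Sum>a'<n. lscale (\<lambda>v. \<Sum>b<n. jac c d a' b v * hinv c d b a v) (?S (kd \<kappa> d a')))"
    unfolding lscale_sum by (subst sum.swap) (simp add: lscale_lscale lscale_sum_left mult.commute)
  also have "eqon ?V \<dots> (\<Sum>a'<n. lscale (\<lambda>_. if a' = a then 1 else 0) (?S (kd \<kappa> d a')))"
    using jac_hinv(1)[OF cd _ _ a] by (intro eqon_sum eqon_scale eqon_refl) auto
  also have "(\<Sum>a'<n. lscale (\<lambda>_. if a' = a then 1 else 0) (?S (kd \<kappa> d a'))) = (\<Sum>a'<n. if a' = a then ?S (kd \<kappa> d a) else 0)"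
    by (intro sum.cong refl) auto
  also have "\<dots> = ?S (kd \<kappa> d a)" using a by simp
  finally show ?thesis by (rule eqon_sym)
qed

subsection \<open>The translation of the momenta\<close>

definition yk :: "'m chart sec \<Rightarrow> 'm chart \<Rightarrow> nat \<Rightarrow> lfun" where
  "yk \<kappa> c i = (if 2 * n \<le> i \<and> i < 3 * n then lvar n i + kd \<kappa> c (i - 2 * n) else lvar n i)"

lemma csub_lvar: "openin (Euclidean_space n) V \<Longrightarrow> wgood n N w \<Longrightarrow> csub n N w N w V (lvar n)"
  unfolding csub_def
proof (intro allI impI conjI)
  fix i assume V: "openin (Euclidean_space n) V" and w: "wgood n N w" and i: "i < N"
  show "lsmooth n V (lvar n i)" by (rule lsmooth_lvar[OF V])
  show "hdeg n N w (w i) (lvar n i)"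
  proof (cases "i < n")
    case True
    then show ?thesis using hdeg_lvar0[OF True, of N w] wgoodD(3)[OF w True] by simp
  next
    case False
    then show ?thesis using i by (intro hdeg_lvar) auto
  qed
qed

lemma csub_yk:
  assumes k: "form3 \<kappa>" and c: "c \<in> A"
  shows "csub n (4 * n) (wC n) (4 * n) (wC n) (ov c (fst c)) (yk \<kappa> c)"
  unfolding csub_def
proof (intro allI impI)
  fix i assume i: "i < 4 * n"
  note V = ov_fst_open[OF c c]
  have wg: "wgood n (4 * n) (wC n)" by (rule wgood_wC) simp
  note l = csub_lvar[OF V wg]
  have "lsmooth n (ov c (fst c)) (lvar n i + kd \<kappa> c a) \<and> hdeg n (4 * n) (wC n) 2 (lvar n i + kd \<kappa> c a)"
    if "2 * n \<le> i" "i < 3 * n" "a < n" for a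
  proof
    show "lsmooth n (ov c (fst c)) (lvar n i + kd \<kappa> c a)"
      by (intro lsmooth_add[OF V] csubD(1)[OF l i] kd_props(2)[OF k c that(3)])
    have "hdeg n (4 * n) (wC n) 2 (kd \<kappa> c a)"
      by (rule hdeg_wext[OF kd_props(1)[OF k c that(3)]]) (auto simp: w1_wC)
    then show "hdeg n (4 * n) (wC n) 2 (lvar n i + kd \<kappa> c a)"
      using csubD(2)[OF l i] that by (intro lsupp_add) (auto simp: wC_def)
  qed
  from this[of "i - 2 * n"] show "lsmooth n (ov c (fst c)) (yk \<kappa> c i) \<and> hdeg n (4 * n) (wC n) (wC n i) (yk \<kappa> c i)"
    using csubD(1,2)[OF l i] by (cases "2 * n \<le> i \<and> i < 3 * n") (auto simp: yk_def wC_def)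
qed

lemma base_yk: "c \<in> A \<Longrightarrow> v \<in> ov c W \<Longrightarrow> base_subst n (yk \<kappa> c) v = v"
  by (rule base_lvar) (simp_all add: yk_def)

text \<open>The substitution moves the \<open>p_a\<close> only, which occupy the excluded
  indices.\<close>

lemma lsubst_yk_id:
  assumes c: "c \<in> A" and f: "gdeg n (4 * n) (wC n) f" "lsupp (\<lambda>\<nu>. \<forall>i. 2 * n \<le> i \<and> i < 3 * n \<longrightarrow> \<nu> i = 0) f"
  shows "eqon (ov c W) (lsubst (wC n) n (4 * n) (yk \<kappa> c) f) f"
proof (rule eqonI)
  fix v \<mu> assume v: "v \<in> ov c W"
  have wg: "wgood n (4 * n) (wC n)" by (rule wgood_wC) simp
  have "lsubst (wC n) n (4 * n) (yk \<kappa> c) f \<mu> v = lsubst (wC n) n (4 * n) (lvar n) f \<mu> v"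
  proof (rule lsubst_cong_at)
    fix i \<nu> assume "f \<nu> (base_subst n (yk \<kappa> c) v) \<noteq> 0" "\<nu> i \<noteq> 0"
    then have "\<not> (2 * n \<le> i \<and> i < 3 * n)" using lsuppD[OF f(2), of \<nu> "base_subst n (yk \<kappa> c) v"] by (metis neq0_conv)
    then show "\<forall>\<mu>. yk \<kappa> c i \<mu> v = lvar n i \<mu> v" unfolding yk_def by (simp only: if_False) simp
  qed (simp_all add: yk_def)
  also have "\<dots> = f \<mu> v" by (rule lsubst_lvar_id[OF f(1) wgoodD(2,1)[OF wg] order.refl ov_zero[OF c v]])
  finally show "lsubst (wC n) n (4 * n) (yk \<kappa> c) f \<mu> v = f \<mu> v" .
qed

lemma gdeg_low: "hdeg n (2 * n) (w1 n) k f \<Longrightarrow> gdeg n (4 * n) (wC n) f"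
proof -
  assume f: "hdeg n (2 * n) (w1 n) k f"
  have "hdeg n (4 * n) (wC n) k f" by (rule hdeg_wext[OF f]) (simp_all add: w1_wC)
  then show ?thesis by (rule hdeg_gdeg)
qed

lemma lsubst_yk_low:
  assumes c: "c \<in> A" and f: "hdeg n (2 * n) (w1 n) k f"
  shows "eqon (ov c W) (lsubst (wC n) n (4 * n) (yk \<kappa> c) f) f"
  by (rule lsubst_yk_id[OF c gdeg_low[OF f] lsupp_mono[OF hdeg_below[OF f]]]) simp

text \<open>The transformed \<open>x\<close>, \<open>\<xi>\<close> and \<open>\<eta>\<close> contain
  no \<open>p\<close>, so the translation fixes them. The transformed \<open>p_a\<close> are affine
  in the \<open>p_b\<close> and pick up
  \<open>\<Sum>b. hinv c d b a * \<partial>\<kappa>/\<partial>\<xi>_b\<close>, which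
  \<open>kd_change\<close> identifies with the shift in the other chart.\<close>

lemma compatible_yk:
  assumes k: "form3 \<kappa>"
  shows "compatible C ct (yk \<kappa>)"
  unfolding compatible_def C_simps
proof (intro ballI conjI allI impI)
  let ?w = "wC n" and ?N = "4 * n"
  fix c assume c: "c \<in> A"
  show cs: "csub n ?N ?w ?N ?w (ov c (fst c)) (yk \<kappa> c)" by (rule csub_yk[OF k c])
  show "yk \<kappa> c i = lvar n i" if "i < n" for i using that by (simp add: yk_def)
  fix d i assume d: "d \<in> A" and i: "i < ?N"
  let ?V = "ov c (fst d)" and ?S = "lsubst ?w n ?N (yk \<kappa> c)" and ?R = "lsubst ?w n ?N (ct c d)"
  have wg: "wgood n ?N ?w" by (rule wgood_wC) simp
  note pos = wgoodD(2)[OF wg]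
  have ctg: "gdeg n ?N ?w (ct c d i)" by (rule csubD(3)[OF csub_ct[OF c d] i])
  have lv: "?R (lvar n i) = ct c d i"
  proof (cases "i < n")
    case True
    then show ?thesis by (simp add: lsubst_lvar_base ct_base) (simp add: lscale_def lone_def)
  next
    case False
    then show ?thesis using i by (intro lsubst_lvar) (auto intro: lpar_lok csubD(4)[OF csub_ct[OF c d] i])
  qed
  show "eqon ?V (?S (ct c d i)) (?R (yk \<kappa> d i))"
  proof (cases "2 * n \<le> i \<and> i < 3 * n")
    case False
    have l: "lsupp (\<lambda>\<nu>. \<forall>i. 2 * n \<le> i \<and> i < 3 * n \<longrightarrow> \<nu> i = 0) (ct c d i)"
    proof (cases "i < 2 * n")
      case True
      show ?thesis by (rule lsupp_mono[OF lbelow_ct[OF True]]) simp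
    next
      case f: False
      have "lsupp (\<lambda>\<nu>. \<forall>i. 2 * n \<le> i \<and> i < 3 * n \<longrightarrow> \<nu> i = 0) (lvar n (3 * n + b))" for b
        by (auto simp: lsupp_def lvar_def split: if_splits)
      then show ?thesis using False f by (auto simp: ct_def et_def intro!: lsupp_sum lsupp_scale)
    qed
    have "yk \<kappa> d i = lvar n i" using False by (auto simp: yk_def)
    then show ?thesis using lsubst_yk_id[OF c ctg l] lv by simp
  next
    case True
    let ?a = "i - 2 * n"
    have a: "?a < n" using True by arith
    have g1: "gdeg n ?N ?w (lvar n j)" if "n \<le> j" "j < ?N" for j by (rule hdeg_gdeg[OF hdeg_lvar[OF that]])
    have dlh: "hdeg n ?N ?w 1 (dl n h)" for h by (rule dl_hdeg) (auto simp: wC_def)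
    \<comment> \<open>The summands with \<open>\<eta>\<close> in the transformed momentum, which
      contain no \<open>p\<close>.\<close>
    define E where "E b = lmult ?w (dl n (hinv c d b ?a)) (lvar n (3 * n + b))" for b
    have Eg: "gdeg n ?N ?w (E b)" if "b < n" for b
      unfolding E_def by (rule gdeg_lmult[OF hdeg_gdeg[OF dlh] g1]) (use that in auto)
    have El: "lsupp (\<lambda>\<nu>. \<forall>i. 2 * n \<le> i \<and> i < 3 * n \<longrightarrow> \<nu> i = 0) (E b)" for b
      unfolding E_def
    proof (rule lsupp_lmult)
      show "lbelow (2 * n) (dl n (hinv c d b ?a))" unfolding dl_def by (auto intro!: lsupp_scale lsupp_sum lbelow_lvar)
      show "lsupp (\<lambda>\<nu>. \<forall>i. 2 * n \<le> i \<and> i < 3 * n \<longrightarrow> \<nu> i = 0) (lvar n (3 * n + b))"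
        by (auto simp: lsupp_def lvar_def split: if_splits)
    qed simp
    have p: "ct c d i = (\<Sum>b<n. lscale (hinv c d b ?a) (lvar n (2 * n + b)) + E b)"
      using True by (simp add: ct_def pt_def E_def)
    have y2: "?S (lvar n (2 * n + b)) = lvar n (2 * n + b) + kd \<kappa> c b" if "b < n" for b
    proof -
      have "?S (lvar n (2 * n + b)) = yk \<kappa> c (2 * n + b)"
        using that by (intro lsubst_lvar lpar_lok[OF csubD(4)[OF cs]]) auto
      then show ?thesis using that by (simp add: yk_def)
    qed
    have "?S (ct c d i) = (\<Sum>b<n. ?S (lscale (hinv c d b ?a) (lvar n (2 * n + b)) + E b))"
      unfolding p by (intro lsubst_sum[OF pos] gdeg_add gdeg_scale g1 Eg) auto
    also have "\<dots> = (\<Sum>b<n. ?S (lscale (hinv c d b ?a) (lvar n (2 * n + b))) + ?S (E b))"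
      by (intro sum.cong refl lsubst_add[OF pos] gdeg_scale g1 Eg) auto
    also have "\<dots> = (\<Sum>b<n. lscale (\<lambda>v. hinv c d b ?a (base_subst n (yk \<kappa> c) v)) (lvar n (2 * n + b) + kd \<kappa> c b) + ?S (E b))"
      by (intro sum.cong refl) (simp add: lsubst_scale y2)
    finally have "?S (ct c d i) = (\<Sum>b<n. lscale (\<lambda>v. hinv c d b ?a (base_subst n (yk \<kappa> c) v)) (lvar n (2 * n + b) + kd \<kappa> c b) + ?S (E b))" .
    moreover have "eqon ?V (\<Sum>b<n. lscale (\<lambda>v. hinv c d b ?a (base_subst n (yk \<kappa> c) v)) (lvar n (2 * n + b) + kd \<kappa> c b) + ?S (E b))
      (\<Sum>b<n. lscale (hinv c d b ?a) (lvar n (2 * n + b) + kd \<kappa> c b) + E b)"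
      using base_yk[OF c] by (intro eqon_sum eqon_add eqon_scale eqon_refl lsubst_yk_id[OF c Eg El]) auto
    moreover have "(\<Sum>b<n. lscale (hinv c d b ?a) (lvar n (2 * n + b) + kd \<kappa> c b) + E b) =
        ct c d i + (\<Sum>b<n. lscale (hinv c d b ?a) (kd \<kappa> c b))"
      unfolding p by (simp add: lscale_add sum.distrib algebra_simps)
    ultimately have 1: "eqon ?V (?S (ct c d i)) (ct c d i + (\<Sum>b<n. lscale (hinv c d b ?a) (kd \<kappa> c b)))" by simp
    have "?R (yk \<kappa> d i) = ?R (lvar n i) + ?R (kd \<kappa> d ?a)"
      using True g1[of i] gdeg_low[OF kd_props(1)[OF k d a]] lsubst_add[OF pos] i by (simp add: yk_def)
    also have "?R (kd \<kappa> d ?a) = lsubst (w1 n) n (2 * n) (ct c d) (kd \<kappa> d ?a)"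
      by (rule lsubst_ct_low[OF hdeg_gdeg[OF kd_props(1)[OF k d a]]])
    finally have 2: "?R (yk \<kappa> d i) = ct c d i + lsubst (w1 n) n (2 * n) (ct c d) (kd \<kappa> d ?a)" unfolding lv .
    show ?thesis
      unfolding 2 by (rule eqon_trans[OF 1]) (intro eqon_add eqon_refl eqon_sym[OF kd_change[OF k c d a]])
  qed
qed

end

lemma lsubst_cong_coords:
  assumes "\<And>i. i < N \<Longrightarrow> y i = y' i" "n \<le> N"
  shows "lsubst w n N y f = lsubst w n N y' f"
proof (intro ext)
  fix \<mu> v
  have "base_subst n y v = base_subst n y' v" using assms by (auto simp: base_subst_def)
  then show "lsubst w n N y f \<mu> v = lsubst w n N y' f \<mu> v"
    using assms by (intro lsubst_cong_at) simp_all
qed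

lemma lpartial_below: "lbelow L f \<Longrightarrow> n \<le> i \<Longrightarrow> L \<le> i \<Longrightarrow> lpartial n w i f = 0"
proof (intro ext, rule ccontr)
  fix \<mu> v assume f: "lbelow L f" and i: "n \<le> i" "L \<le> i" and nz: "lpartial n w i f \<mu> v \<noteq> (0 :: lfun) \<mu> v"
  have "f (\<mu>(i := \<mu> i + 1)) v \<noteq> 0"
    using nz unfolding lpartial_fibre[OF i(1)] zero_fun_apply by (metis mult_zero_right)
  then have "\<forall>j\<ge>L. (\<mu>(i := \<mu> i + 1)) j = 0" by (rule lsuppD[OF f])
  from this[rule_format, OF i(2)] show False by simp
qed

subsection \<open>Double contraction of a 3-form with the de Rham field\<close>

text \<open>The derivation \<open>\<Sum>j. z_{p+j} \<partial>/\<partial>z_{q+j}\<close>; it gives the contraction with the de Rham field for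
  \<open>z_{p+j} = \<xi>_j\<close>, \<open>z_{q+j} = dx_j\<close>, and the result of the double contraction after exchanging the two.\<close>

definition dshift :: "nat \<Rightarrow> (nat \<Rightarrow> nat) \<Rightarrow> nat \<Rightarrow> nat \<Rightarrow> lfun \<Rightarrow> lfun" where
  "dshift n w p q f = (\<Sum>j<n. lmult w (lvar n (p + j)) (lpartial n w (q + j) f))"

lemma dshift_add: "n \<le> q \<Longrightarrow> dshift n w p q (f + g) = dshift n w p q f + dshift n w p q g"
  by (simp add: dshift_def lpartial_add lmult_add_right sum.distrib)

lemma dshift_scale: "n \<le> q \<Longrightarrow> dshift n w p q (lscale h f) = lscale h (dshift n w p q f)"
  by (simp add: dshift_def lpartial_scale lmult_scale_right lscale_sum)

lemma dshift_sum:
  fixes f :: "'i \<Rightarrow> lfun"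
  shows "n \<le> q \<Longrightarrow> dshift n w p q (sum f I) = (\<Sum>i\<in>I. dshift n w p q (f i))"
  unfolding dshift_def by (simp add: lpartial_sum lmult_sum_right sum.swap[of _ I])

lemma dshift_lone [simp]: "dshift n w p q lone = 0"
  by (simp add: dshift_def)

lemma lmult_lvar_swap:
  assumes "n \<le> i" "n \<le> k" "odd (w i)" "odd (w k)"
  shows "lmult w (lvar n i) (lmult w (lvar n k) g) = lscale (\<lambda>_. - 1) (lmult w (lvar n k) (lmult w (lvar n i) g))"
proof -
  have h: "lpar w (w j) (lvar n j)" if "n \<le> j" for j using hdeg_lpar[OF hdeg_lvar[OF that lessI]] .
  have "lmult w (lvar n i) (lvar n k) = lscale (\<lambda>_. (- 1) ^ (w i * w k)) (lmult w (lvar n k) (lvar n i))"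
    by (rule lmult_commute[OF h h]) fact+
  then show ?thesis
    using assms by (simp flip: lmult_assoc add: lmult_scale_left)
qed

text \<open>The operator is an odd derivative followed by multiplication with an odd coordinate. The
  two signs cancel, so it acts as an even derivation.\<close>

lemma dshift_lmult_lvar:
  assumes g: "lok w g" and k: "n \<le> k" and w: "odd (w k)" "\<And>j. j < n \<Longrightarrow> odd (w (p + j))" "\<And>j. j < n \<Longrightarrow> odd (w (q + j))"
    and pq: "n \<le> p" "n \<le> q"
  shows "dshift n w p q (lmult w (lvar n k) g) =
    (if q \<le> k \<and> k < q + n then lmult w (lvar n (p + (k - q))) g else 0) + lmult w (lvar n k) (dshift n w p q g)"
proof -
  have "lmult w (lvar n (p + j)) (lpartial n w (q + j) (lmult w (lvar n k) g)) =
      (if q + j = k then lmult w (lvar n (p + j)) g else 0) + lmult w (lvar n k) (lmult w (lvar n (p + j)) (lpartial n w (q + j) g))"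
    if j: "j < n" for j
  proof -
    have "lpartial n w (q + j) (lmult w (lvar n k) g) =
        (if q + j = k then g else 0) + lscale (\<lambda>_. - 1) (lmult w (lvar n k) (lpartial n w (q + j) g))"
      using lpartial_lmult_lvar[OF g _ k, of "q + j"] pq w(1) w(3)[OF j] by simp
    moreover have "lmult w (lvar n (p + j)) (lmult w (lvar n k) h) =
        lscale (\<lambda>_. - 1) (lmult w (lvar n k) (lmult w (lvar n (p + j)) h))" for h
      using pq k w(1) w(2)[OF j] by (intro lmult_lvar_swap) auto
    ultimately show ?thesis by (simp add: lmult_add_right lmult_scale_right lscale_lscale)
  qed
  then have "dshift n w p q (lmult w (lvar n k) g) = (\<Sum>j<n. if q + j = k then lmult w (lvar n (p + j)) g else 0) +
      lmult w (lvar n k) (dshift n w p q g)"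
    by (simp add: dshift_def sum.distrib lmult_sum_right)
  moreover have "(\<Sum>j<n. if q + j = k then lmult w (lvar n (p + j)) g else 0) =
      (if q \<le> k \<and> k < q + n then lmult w (lvar n (p + (k - q))) g else 0)"
  proof (cases "q \<le> k \<and> k < q + n")
    case True
    then have "(\<Sum>j<n. if q + j = k then lmult w (lvar n (p + j)) g else 0) =
        (\<Sum>j<n. if j = k - q then lmult w (lvar n (p + (k - q))) g else 0)" by (intro sum.cong refl) auto
    then show ?thesis using True by auto
  next
    case False
    then have "q + j \<noteq> k" if "j < n" for j using that by auto
    then show ?thesis by (subst if_not_P[OF False]) (simp add: sum.neutral)
  qed
  ultimately show ?thesis by simp
qed

text \<open>Degrees on \<open>T[1]T[1]M\<close> and \<open>T[1]T^*[1]M\<close>\<close>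

definition w2 :: "nat \<Rightarrow> nat \<Rightarrow> nat" where
  "w2 n i = (if i < n then 0 else if i < 3 * n then 1 else 2)"

lemma wgood_w2: "n \<le> N \<Longrightarrow> wgood n N (w2 n)"
  by (auto simp: wgood_def gpos_def w2_def)

lemma w1_w2: "i < 2 * n \<Longrightarrow> w2 n i = w1 n i"
  by (simp add: w1_def w2_def)

text \<open>Splitting off the coordinate of least index costs no sign. The factorisation is stated
  for all \<open>w\<close> extending \<open>w1 n\<close> because it is used in the algebras of
  \<open>w1 n\<close> and of \<open>w2 n\<close>.\<close>

lemma lmono_peel:
  assumes \<nu>: "mono_ok n (2 * n) (w1 n) \<nu>" "mono_deg (2 * n) (w1 n) \<nu> = Suc k"
  shows "\<exists>a \<nu>'. a < n \<and> mono_ok n (2 * n) (w1 n) \<nu>' \<and> mono_deg (2 * n) (w1 n) \<nu>' = k \<and>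
    (\<forall>w. (\<forall>i<2 * n. w i = w1 n i) \<longrightarrow> lmono \<nu> = lmult w (lvar n (n + a)) (lmono \<nu>'))"
proof -
  have "\<exists>i. \<nu> i \<noteq> 0"
  proof (rule ccontr)
    assume "\<not> ?thesis"
    then have "mono_deg (2 * n) (w1 n) \<nu> = 0" by (simp add: mono_deg_def)
    then show False using \<nu>(2) by simp
  qed
  define i where "i = (LEAST i. \<nu> i \<noteq> 0)"
  have i: "\<nu> i \<noteq> 0" unfolding i_def by (rule LeastI_ex) fact
  have least: "\<nu> j = 0" if "j < i" for j using not_less_Least[of j "\<lambda>i. \<nu> i \<noteq> 0"] that by (simp add: i_def)
  have r: "n \<le> i" "i < 2 * n" using mono_okD[OF \<nu>(1) i] by auto
  define \<nu>' where "\<nu>' = \<nu>(i := 0)"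
  have one: "\<nu> i = 1"
  proof -
    have "\<nu> i \<le> 1" using r by (intro odd_okD[OF mono_ok_odd_ok[OF \<nu>(1)]]) (simp add: w1_def)
    then show ?thesis using i by simp
  qed
  have up: "\<nu>'(i := \<nu>' i + 1) = \<nu>" using one by (auto simp: \<nu>'_def)
  have ok: "mono_ok n (2 * n) (w1 n) \<nu>'" using \<nu>(1) by (auto simp: mono_ok_def \<nu>'_def)
  have "mono_deg (2 * n) (w1 n) \<nu> = mono_deg (2 * n) (w1 n) \<nu>' + w1 n i"
    using mono_deg_upd[OF r(2), of "w1 n" \<nu>'] unfolding up .
  then have deg: "mono_deg (2 * n) (w1 n) \<nu>' = k" using \<nu>(2) r by (simp add: w1_def)
  have "lmono \<nu> = lmult w (lvar n (n + (i - n))) (lmono \<nu>')" if w: "\<forall>i<2 * n. w i = w1 n i" for w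
  proof -
    have ok': "mono_ok n (2 * n) w \<nu>'"
      using ok w unfolding mono_ok_def by (metis le0 le_eq_less_or_eq not_le zero_le_one)
    have e: "{j. j < i \<and> odd (w j) \<and> \<nu>' j \<noteq> 0} = {}" using least by (auto simp: \<nu>'_def)
    have "gsign w i \<nu>' = 1" unfolding gsign_def e by simp
    moreover have "\<nu>' i = 0" by (simp add: \<nu>'_def)
    ultimately show ?thesis
      using lmult_lvar_lmono[OF r(1) ok'] r up by simp
  qed
  moreover have "i - n < n" using r by simp
  ultimately show ?thesis using ok deg by blast
qed

lemma lmono_peel3:
  assumes "mono_ok n (2 * n) (w1 n) \<nu>" "mono_deg (2 * n) (w1 n) \<nu> = 3"
  shows "\<exists>a b c. a < n \<and> b < n \<and> c < n \<and> (\<forall>w. (\<forall>i<2 * n. w i = w1 n i) \<longrightarrow>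
    lmono \<nu> = lmult w (lvar n (n + a)) (lmult w (lvar n (n + b)) (lmult w (lvar n (n + c)) lone)))"
proof -
  have "mono_deg (2 * n) (w1 n) \<nu> = Suc 2" using assms(2) by simp
  from lmono_peel[OF assms(1) this] obtain a \<nu>1 where a: "a < n" "mono_ok n (2 * n) (w1 n) \<nu>1"
    "mono_deg (2 * n) (w1 n) \<nu>1 = Suc 1"
    "\<forall>w. (\<forall>i<2 * n. w i = w1 n i) \<longrightarrow> lmono \<nu> = lmult w (lvar n (n + a)) (lmono \<nu>1)" by auto
  from lmono_peel[OF a(2,3)] obtain b \<nu>2 where b: "b < n" "mono_ok n (2 * n) (w1 n) \<nu>2"
    "mono_deg (2 * n) (w1 n) \<nu>2 = Suc 0"
    "\<forall>w. (\<forall>i<2 * n. w i = w1 n i) \<longrightarrow> lmono \<nu>1 = lmult w (lvar n (n + b)) (lmono \<nu>2)" by auto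
  from lmono_peel[OF b(2,3)] obtain c \<nu>3 where c: "c < n" "mono_ok n (2 * n) (w1 n) \<nu>3"
    "mono_deg (2 * n) (w1 n) \<nu>3 = 0"
    "\<forall>w. (\<forall>i<2 * n. w i = w1 n i) \<longrightarrow> lmono \<nu>2 = lmult w (lvar n (n + c)) (lmono \<nu>3)" by auto
  have "\<nu>3 = (\<lambda>_. 0)"
    by (rule mono_deg_0[OF wgoodD(2)[OF wgood_w1] c(2,3)]) simp
  then have "lmono \<nu>3 = lone" by (simp add: lmono_zero)
  then show ?thesis using a(1,4) b(1,4) c(1,4) by metis
qed

text \<open>\<open>q_M^*\<close> leaves the coefficients of a form unchanged; \<open>dx_a\<close> has index \<open>n + a\<close> on \<open>T[1]M\<close> and \<open>2 n + a\<close>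
  on \<open>T[1]T[1]M\<close>.\<close>

definition yF :: "nat \<Rightarrow> nat \<Rightarrow> lfun" where
  "yF n i = (if i < n then lvar n i else lvar n (n + i))"

lemma dshift_dshift_lmono:
  assumes \<nu>: "mono_ok n (2 * n) (w1 n) \<nu>" "mono_deg (2 * n) (w1 n) \<nu> = 3"
  shows "dshift n (w2 n) n (2 * n) (dshift n (w2 n) n (2 * n) (mono_subst (w2 n) n (2 * n) (yF n) \<nu>)) =
    lscale (\<lambda>_. 2) (dshift n (w2 n) (2 * n) n (lmono \<nu>))"
proof -
  let ?w = "w2 n" and ?z = "\<lambda>i. lvar n (n + i)" and ?d = "\<lambda>i. lvar n (2 * n + i)"
  let ?m = "lmult ?w" and ?I = "dshift n ?w n (2 * n)" and ?E = "dshift n ?w (2 * n) n"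
  obtain a b c where abc: "a < n" "b < n" "c < n"
    and l: "\<forall>w. (\<forall>i<2 * n. w i = w1 n i) \<longrightarrow> lmono \<nu> = lmult w (?z a) (lmult w (?z b) (lmult w (?z c) lone))"
    using lmono_peel3[OF \<nu>] by blast
  have l2: "lmono \<nu> = ?m (?z a) (?m (?z b) (?m (?z c) lone))" using l by (simp add: w1_w2)
  have l1: "lmono \<nu> = lmult (w1 n) (?z a) (lmult (w1 n) (?z b) (lmult (w1 n) (?z c) lone))" using l by simp
  have gs: "good_subst n (2 * n) (w1 n) ?w (yF n)"
    unfolding good_subst_def
  proof (intro conjI allI impI)
    show "gpos n (2 * n) (w1 n)" by (rule wgoodD(2)[OF wgood_w1]) simp
    fix i assume i: "n \<le> i \<and> i < 2 * n"
    have "hdeg n (4 * n) ?w (?w (n + i)) (lvar n (n + i))" using i by (intro hdeg_lvar) auto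
    from hdeg_lpar[OF this] show "lpar ?w (w1 n i) (yF n i)" using i by (simp add: yF_def w1_def w2_def)
  qed
  have g: "gdeg n (2 * n) (w1 n) (?z i)" if "i < n" for i using that by (intro hdeg_gdeg[OF hdeg_lvar]) auto
  have g0: "gdeg n (2 * n) (w1 n) lone" by (rule hdeg_gdeg[OF hdeg_lone])
  have y: "yF n (n + i) = ?d i" for i by (simp add: yF_def mult_2 add.assoc)
  have s: "lsubst ?w n (2 * n) (yF n) (lmult (w1 n) (?z i) f) = ?m (?d i) (lsubst ?w n (2 * n) (yF n) f)"
    if "i < n" "gdeg n (2 * n) (w1 n) f" for i f
    using lsubst_lmult_lvar[OF gs that(2), of "n + i"] that(1) y by simp
  have e: "mono_subst ?w n (2 * n) (yF n) \<nu> = ?m (?d a) (?m (?d b) (?m (?d c) lone))"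
    using abc g g0 by (simp add: lsubst_lmono[symmetric] l1 s gdeg_lmult)
  \<comment> \<open>On a single factor \<open>?I\<close> sends \<open>dx_i\<close> to
    \<open>\<xi>_i\<close> and kills \<open>\<xi>_i\<close>, while \<open>?E\<close> sends
    \<open>\<xi>_i\<close> to \<open>dx_i\<close>. As even derivations they are evaluated factor by
    factor.\<close>
  have I1: "?I (?m (?d i) f) = ?m (?z i) f + ?m (?d i) (?I f)" if "i < n" "lok ?w f" for i f
    using dshift_lmult_lvar[OF that(2), of n "2 * n + i" n "2 * n"] that(1) by (simp add: w2_def)
  have I2: "?I (?m (?z i) f) = ?m (?z i) (?I f)" if "i < n" "lok ?w f" for i f
    using dshift_lmult_lvar[OF that(2), of n "n + i" n "2 * n"] that(1) by (simp add: w2_def)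
  have E1: "?E (?m (?z i) f) = ?m (?d i) f + ?m (?z i) (?E f)" if "i < n" "lok ?w f" for i f
    using dshift_lmult_lvar[OF that(2), of n "n + i" "2 * n" n] that(1) by (simp add: w2_def)
  note simps = lmult_lok lok_lone lmult_add_right dshift_add
  have E: "?E (?m (?z a) (?m (?z b) (?m (?z c) lone))) =
    ?m (?d a) (?m (?z b) (?m (?z c) lone)) + (?m (?z a) (?m (?d b) (?m (?z c) lone)) + ?m (?z a) (?m (?z b) (?m (?d c) lone)))"
    using abc by (simp add: E1 simps)
  have I: "?I (?I (?m (?d a) (?m (?d b) (?m (?d c) lone)))) =
    (?m (?z a) (?m (?z b) (?m (?d c) lone)) + ?m (?z a) (?m (?d b) (?m (?z c) lone))) +
    ((?m (?z a) (?m (?z b) (?m (?d c) lone)) + ?m (?d a) (?m (?z b) (?m (?z c) lone))) +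
     (?m (?z a) (?m (?d b) (?m (?z c) lone)) + ?m (?d a) (?m (?z b) (?m (?z c) lone))))"
    using abc by (simp add: I1 I2 simps)
  have two: "(x + y) + ((x + z) + (y + z)) = lscale (\<lambda>_. 2) (z + (y + x))" for x y z
    by (simp add: lscale_def fun_eq_iff plus_fun_apply)
  have "?I (?I (?m (?d a) (?m (?d b) (?m (?d c) lone)))) = lscale (\<lambda>_. 2) (?E (?m (?z a) (?m (?z b) (?m (?z c) lone))))"
    unfolding I E by (rule two)
  then show ?thesis unfolding e l2 .
qed

context smooth_mfd
begin

lemma TT_simps [simp]:
  "space_of (T1 (T1 M)) = T" "bdim (T1 (T1 M)) = n" "ncoord (T1 (T1 M)) = 4 * n" "wt (T1 (T1 M)) = w2 n"
  "charts (T1 (T1 M)) = A" "cdom (T1 (T1 M)) = fst" "cmap (T1 (T1 M)) = snd" "T1_wt (T1 M) = w2 n"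
proof -
  show w: "T1_wt (T1 M) = w2 n" by (auto simp: T1_wt_def w1_def w2_def fun_eq_iff)
  show "wt (T1 (T1 M)) = w2 n" using w by (simp add: T1_def)
  show "space_of (T1 (T1 M)) = T" "bdim (T1 (T1 M)) = n" "charts (T1 (T1 M)) = A" "cdom (T1 (T1 M)) = fst" "cmap (T1 (T1 M)) = snd"
    using T1M_simps by (simp_all add: T1_def)
  have "ncoord (T1 X) = 2 * ncoord X" for X :: "('m, 'm chart) nmfd" by (simp add: T1_def)
  from this[of "T1 M"] show "ncoord (T1 (T1 M)) = 4 * n" by simp
qed

lemma ldiff_T1: "ldiff (T1 M) f = vfield n (2 * n) (w2 n) (\<lambda>j. lvar n (2 * n + j)) f"
proof -
  have "lpartial n (w1 n) j f = lpartial n (w2 n) j f" if "j < 2 * n" for j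
    using that by (intro lpartial_wcong) (simp add: w1_w2)
  then show ?thesis by (simp add: ldiff_def lsum_eq vfield_def)
qed

text \<open>The 1-form \<open>\<Sum>j. dx_j \<partial>\<kappa>/\<partial>\<xi>_j\<close> on
  \<open>T[1]M\<close>, as a function on \<open>T[1]T[1]M\<close>.\<close>

definition alpha :: "'m chart sec \<Rightarrow> 'm chart \<Rightarrow> lfun" where
  "alpha \<kappa> c = (\<Sum>j<n. lmult (w2 n) (lvar n (2 * n + j)) (kd \<kappa> c j))"

lemma kd_w2: "j < n \<Longrightarrow> lpartial n (w2 n) (n + j) (\<kappa> c) = kd \<kappa> c j"
  unfolding kd_def by (rule lpartial_wcong) (simp add: w1_w2)

lemma alpha_dshift: "alpha \<kappa> c = dshift n (w2 n) (2 * n) n (\<kappa> c)"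
  by (simp add: alpha_def dshift_def kd_w2)

lemma pullback_form:
  "form_pullback (T1 M) M (proj_coords M) \<kappa> c =
    (if c \<in> A then lrestrict (ov c T') (lsubst (w2 n) n (2 * n) (yF n) (\<kappa> c)) else 0)"
  if "T' = topspace T"
proof -
  have "lsubst (w2 n) n (2 * n) (\<lambda>i. if i < n then lvar n i else ldiff (T1 M) (lvar n (i - n))) (\<kappa> c) =
      lsubst (w2 n) n (2 * n) (yF n) (\<kappa> c)"
  proof (rule lsubst_cong_coords)
    fix i assume i: "i < 2 * n"
    have "ldiff (T1 M) (lvar n (i - n)) = lvar n (2 * n + (i - n))" if "n \<le> i"
      unfolding ldiff_T1 using i that by (intro vfield_lvar lok_lvar) auto
    then show "(if i < n then lvar n i else ldiff (T1 M) (lvar n (i - n))) = yF n i" by (simp add: yF_def)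
  qed simp
  then show ?thesis
    by (simp add: that form_pullback_def coord_morphism_def proj_coords_def cimage_def ov_def zero_lfun cong: if_cong)
qed

lemma contract_dshift: "contract (T1 M) (deRham_vf M) \<alpha> c = dshift n (w2 n) n (2 * n) (\<alpha> c)"
proof -
  let ?F = "\<lambda>j. lmult (w2 n) (deRham_vf M c j) (lpartial n (w2 n) (2 * n + j) (\<alpha> c))"
  have "contract (T1 M) (deRham_vf M) \<alpha> c = (\<Sum>j<2 * n. ?F j)" by (simp add: contract_def lsum_eq)
  also have "\<dots> = (\<Sum>j<n. ?F j)"
    by (rule sum.mono_neutral_right) (auto simp: deRham_vf_def zero_lfun)
  also have "\<dots> = dshift n (w2 n) n (2 * n) (\<alpha> c)" by (simp add: dshift_def deRham_vf_def)
  finally show ?thesis .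
qed

lemma shift_form_eq:
  assumes k: "form3 \<kappa>"
  shows "shift_form M \<kappa> = (\<lambda>c. if c \<in> A then alpha \<kappa> c else 0)"
proof
  fix c
  let ?I = "dshift n (w2 n) n (2 * n)"
  have s: "sec_scale (1/2) h c = lscale (\<lambda>_. 1/2) (h c)" for h :: "'m chart sec" by (simp add: sec_scale_def lscale_def)
  have e: "shift_form M \<kappa> c = lscale (\<lambda>_. 1/2) (?I (?I (form_pullback (T1 M) M (proj_coords M) \<kappa> c)))"
    unfolding shift_form_def s contract_dshift ..
  show "shift_form M \<kappa> c = (if c \<in> A then alpha \<kappa> c else 0)"
  proof (cases "c \<in> A")
    case False
    have "?I 0 = 0" by (simp add: dshift_def)
    then show ?thesis using False by (simp add: e pullback_form[OF refl])
  next
    case c: True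
    note h = form3D(1)[OF k c]
    define S where "S = {\<nu>. bmono n (2 * n) (w1 n) 3 \<nu> \<and> mono_deg (2 * n) (w1 n) \<nu> = 3}"
    have "gpos n (2 * n) (w1 n)" by (rule wgoodD(2)[OF wgood_w1]) simp
    from finite_bmono[OF this, of 3] have fin: "finite S" unfolding S_def by (rule finite_subset[rotated]) auto
    have inS: "\<nu> \<in> S" if nz: "\<kappa> c \<nu> v \<noteq> 0" for \<nu> v
    proof -
      have "mono_ok n (2 * n) (w1 n) \<nu> \<and> mono_deg (2 * n) (w1 n) \<nu> = 3" by (rule lsuppD[OF h nz])
      then show ?thesis by (simp add: S_def)
    qed
    have ex: "\<kappa> c = (\<Sum>\<nu>\<in>S. lscale (\<kappa> c \<nu>) (lmono \<nu>))" by (rule lmono_expand[OF fin inS])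
    have "lrestrict (ov c (topspace T)) (lsubst (w2 n) n (2 * n) (yF n) (\<kappa> c)) =
        (\<Sum>\<nu>\<in>S. lscale (\<kappa> c \<nu>) (mono_subst (w2 n) n (2 * n) (yF n) \<nu>))"
    proof (rule supp_in_eqI[OF supp_in_lrestrict])
      have "\<kappa> c \<nu> v = 0" if "v \<notin> ov c (topspace T)" for \<nu> v
        using form3D(3)[OF k c] that c by (auto simp: supp_in_def ov_topspace)
      then show "supp_in (ov c (topspace T)) (\<Sum>\<nu>\<in>S. lscale (\<kappa> c \<nu>) (mono_subst (w2 n) n (2 * n) (yF n) \<nu>))"
        unfolding supp_in_def sum_lfun_apply lscale_def by (metis (no_types, lifting) mult_zero_left sum.neutral)
      have b: "base_subst n (yF n) v = v" if "v \<in> ov c (topspace T)" for v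
        by (rule base_lvar[OF _ c that]) (simp add: yF_def)
      have "eqon (ov c (topspace T)) (lsubst (w2 n) n (2 * n) (yF n) (\<kappa> c))
          (\<Sum>\<nu>\<in>S. lscale (\<kappa> c \<nu>) (mono_subst (w2 n) n (2 * n) (yF n) \<nu>))"
      proof -
        have "lsubst (w2 n) n (2 * n) (yF n) (\<kappa> c) =
            (\<Sum>\<nu>\<in>S. lscale (\<lambda>v. \<kappa> c \<nu> (base_subst n (yF n) v)) (mono_subst (w2 n) n (2 * n) (yF n) \<nu>))"
          by (rule lsubst_expand[OF fin inS])
        moreover have "eqon (ov c (topspace T)) (\<Sum>\<nu>\<in>S. lscale (\<lambda>v. \<kappa> c \<nu> (base_subst n (yF n) v)) (mono_subst (w2 n) n (2 * n) (yF n) \<nu>))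
            (\<Sum>\<nu>\<in>S. lscale (\<kappa> c \<nu>) (mono_subst (w2 n) n (2 * n) (yF n) \<nu>))"
          using b by (intro eqon_sum eqon_scale eqon_refl) simp
        ultimately show ?thesis by simp
      qed
      then show "eqon (ov c (topspace T)) (lrestrict (ov c (topspace T)) (lsubst (w2 n) n (2 * n) (yF n) (\<kappa> c)))
          (\<Sum>\<nu>\<in>S. lscale (\<kappa> c \<nu>) (mono_subst (w2 n) n (2 * n) (yF n) \<nu>))"
        by (rule eqon_trans[OF eqon_lrestrict])
    qed
    then have "shift_form M \<kappa> c = (\<Sum>\<nu>\<in>S. lscale (\<lambda>_. 1/2) (lscale (\<kappa> c \<nu>) (?I (?I (mono_subst (w2 n) n (2 * n) (yF n) \<nu>)))))"
      using c by (simp add: e pullback_form[OF refl] dshift_sum dshift_scale lscale_sum)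
    also have "\<dots> = (\<Sum>\<nu>\<in>S. lscale (\<kappa> c \<nu>) (dshift n (w2 n) (2 * n) n (lmono \<nu>)))"
    proof (rule sum.cong[OF refl])
      fix \<nu> assume "\<nu> \<in> S"
      then have "?I (?I (mono_subst (w2 n) n (2 * n) (yF n) \<nu>)) = lscale (\<lambda>_. 2) (dshift n (w2 n) (2 * n) n (lmono \<nu>))"
        by (intro dshift_dshift_lmono) (auto simp: S_def)
      then show "lscale (\<lambda>_. 1/2) (lscale (\<kappa> c \<nu>) (?I (?I (mono_subst (w2 n) n (2 * n) (yF n) \<nu>)))) =
          lscale (\<kappa> c \<nu>) (dshift n (w2 n) (2 * n) n (lmono \<nu>))"
        by (simp add: lscale_lscale)
    qed
    also have "\<dots> = dshift n (w2 n) (2 * n) n (\<kappa> c)"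
      by (subst (2) ex) (simp add: dshift_sum dshift_scale)
    finally show ?thesis using c by (simp add: alpha_dshift)
  qed
qed

section \<open>The shift form as a global 1-form, and the translation by it\<close>

lemma kd_below: "form3 \<kappa> \<Longrightarrow> c \<in> A \<Longrightarrow> a < n \<Longrightarrow> lbelow (2 * n) (kd \<kappa> c a)"
  by (rule hdeg_below[OF kd_props(1)])

text \<open>\<open>\<partial>\<kappa>/\<partial>\<xi>_j\<close> contains no differentials, so the
  component along \<open>dx_j\<close> is read off directly; there is none along
  \<open>d\<xi>_j\<close>, and the translation fixes the \<open>\<eta>_j\<close>.\<close>

lemma lpartial_alpha:
  assumes k: "form3 \<kappa>" and c: "c \<in> A" and i: "2 * n \<le> i"
  shows "lpartial n (w2 n) i (alpha \<kappa> c) = (if i < 3 * n then kd \<kappa> c (i - 2 * n) else 0)"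
proof -
  have ni: "n \<le> i" using i by simp
  have "lpartial n (w2 n) i (lmult (w2 n) (lvar n (2 * n + j)) (kd \<kappa> c j)) = (if j = i - 2 * n then kd \<kappa> c (i - 2 * n) else 0)"
    if j: "j < n" for j
  proof -
    have l: "lok (w2 n) (kd \<kappa> c j)"
      using hdeg_wext[OF kd_props(1)[OF k c j], of "2 * n" "w2 n"] w1_w2
      by (intro bdeg_lok[OF hdeg_bdeg]) auto
    have "lpartial n (w2 n) i (kd \<kappa> c j) = 0" by (rule lpartial_below[OF kd_below[OF k c j] ni i])
    then show ?thesis using lpartial_lmult_lvar[OF l ni, of "2 * n + j"] i by auto
  qed
  then have "lpartial n (w2 n) i (alpha \<kappa> c) = (\<Sum>j<n. if j = i - 2 * n then kd \<kappa> c (i - 2 * n) else 0)"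
    unfolding alpha_def lpartial_sum[OF ni] by (intro sum.cong refl) simp
  then show ?thesis using i by auto
qed

lemma translation_eq:
  assumes k: "form3 \<kappa>"
  shows "translation 2 (T1 M) (shift_form M \<kappa>) = coord_morphism C C (yk \<kappa>)"
proof -
  let ?y = "\<lambda>c i. if i < ncoord (T1 M) then lvar (bdim (T1 M)) i
            else ladd (lvar (bdim (T1 M)) i) (lpartial (bdim (T1 M)) (T1_wt (T1 M)) i (shift_form M \<kappa> c))"
  have "?y c i = yk \<kappa> c i" if "c \<in> A" for c i
    using that lpartial_alpha[OF k that, of i] by (auto simp: shift_form_eq[OF k] ladd_eq yk_def not_less)
  then have "lsubst (wC n) n (4 * n) (?y c) f = lsubst (wC n) n (4 * n) (yk \<kappa> c) f" if "c \<in> A" for c f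
    using that by (intro lsubst_cong_coords) auto
  then have "coord_morphism C C ?y = coord_morphism C C (yk \<kappa>)"
    by (simp add: coord_morphism_def cong: if_cong)
  then show ?thesis unfolding translation_def courant_mfd_def .
qed

lemma trans_TT:
  shows "i < 2 * n \<Longrightarrow> trans (T1 (T1 M)) c d i = ct c d i"
    and "a < n \<Longrightarrow> trans (T1 (T1 M)) c d (2 * n + a) = (\<Sum>l<n. lscale (jac c d a l) (lvar n (2 * n + l)))"
proof -
  have t: "trans (T1 (T1 M)) c d i = (if i < 2 * n then trans (T1 M) c d i else ldiff (T1 M) (trans (T1 M) c d (i - 2 * n)))" for i
    using T1M_simps(3) by (simp add: T1_def[of "T1 M"])
  show "i < 2 * n \<Longrightarrow> trans (T1 (T1 M)) c d i = ct c d i" by (simp add: t trans_T1)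
  assume a: "a < n"
  have l: "lmult (w2 n) (lvar n (2 * n + j)) (lpartial n (w2 n) j (lscale (\<lambda>v. \<tau> c d v a) lone)) =
      (if j < n then lscale (jac c d a j) (lvar n (2 * n + j)) else 0)" for j
    by (simp add: lpartial_base_lone lpartial_scale jac_def lmult_scale_right lmult_lone_right lok_lvar)
  have "trans (T1 (T1 M)) c d (2 * n + a) = vfield n (2 * n) (w2 n) (\<lambda>j. lvar n (2 * n + j)) (lscale (\<lambda>v. \<tau> c d v a) lone)"
    using a by (simp add: t trans_T1 ct_base ldiff_T1)
  also have "\<dots> = (\<Sum>j<2 * n. if j < n then lscale (jac c d a j) (lvar n (2 * n + j)) else 0)"
    unfolding vfield_def l ..
  also have "\<dots> = (\<Sum>l<n. lscale (jac c d a l) (lvar n (2 * n + l)))"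
    by (rule sum.mono_neutral_cong_right) auto
  finally show "trans (T1 (T1 M)) c d (2 * n + a) = (\<Sum>l<n. lscale (jac c d a l) (lvar n (2 * n + l)))" .
qed

lemma hdeg_kd_w2: "form3 \<kappa> \<Longrightarrow> c \<in> A \<Longrightarrow> j < n \<Longrightarrow> 2 * n \<le> N \<Longrightarrow> hdeg n N (w2 n) 2 (kd \<kappa> c j)"
  by (rule hdeg_wext[OF kd_props(1)]) (simp_all add: w1_w2)

lemma hdeg_alpha:
  assumes "form3 \<kappa>" "c \<in> A" "3 * n \<le> N"
  shows "hdeg n N (w2 n) 3 (alpha \<kappa> c)"
  unfolding alpha_def
proof (rule lsupp_sum)
  fix j assume j: "j \<in> {..<n}"
  have "hdeg n N (w2 n) (w2 n (2 * n + j)) (lvar n (2 * n + j))" using j assms(3) by (intro hdeg_lvar) auto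
  then have 1: "hdeg n N (w2 n) 1 (lvar n (2 * n + j))" using j by (simp add: w2_def)
  have 2: "hdeg n N (w2 n) 2 (kd \<kappa> c j)" by (rule hdeg_kd_w2) (use assms j in auto)
  show "hdeg n N (w2 n) 3 (lmult (w2 n) (lvar n (2 * n + j)) (kd \<kappa> c j))"
    using hdeg_lmult[OF 1 2] by (simp add: numeral_3_eq_3)
qed

text \<open>The differentials \<open>dx_j\<close> transform by the Jacobian and the
  \<open>\<partial>\<kappa>/\<partial>\<xi>_j\<close> by its inverse, so the two matrices
  cancel.\<close>

lemma alpha_change:
  assumes k: "form3 \<kappa>" and cd: "c \<in> A" "d \<in> A"
  shows "eqon (ov c (fst d)) (lsubst (w2 n) n (4 * n) (trans (T1 (T1 M)) c d) (alpha \<kappa> d)) (alpha \<kappa> c)"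
proof -
  let ?V = "ov c (fst d)" and ?t = "trans (T1 (T1 M)) c d" and ?w = "w2 n"
  \<comment> \<open>The form involves \<open>x\<close>, \<open>\<xi>\<close> and \<open>dx\<close>
    only. Truncating to \<open>3 * n\<close> coordinates avoids the transitions of the
    \<open>d\<xi>_a\<close>.\<close>
  let ?S = "lsubst (w2 n) n (3 * n) (trans (T1 (T1 M)) c d)"
  let ?d = "\<lambda>l. lvar n (2 * n + l)"
  have wg: "wgood n (3 * n) ?w" by (rule wgood_w2) simp
  have t2: "?t i = (\<Sum>l<n. lscale (jac c d (i - 2 * n) l) (?d l))" if "2 * n \<le> i" "i < 3 * n" for i
    using trans_TT(2)[of "i - 2 * n" c d] that by simp
  have gs: "good_subst n (3 * n) ?w ?w ?t"
    unfolding good_subst_def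
  proof (intro conjI allI impI)
    show "gpos n (3 * n) ?w" by (rule wgoodD(2)[OF wg])
    fix i assume i: "n \<le> i \<and> i < 3 * n"
    have "hdeg n (3 * n) ?w 1 (?t i)"
    proof (cases "i < 2 * n")
      case True
      then have "?t i = dl n (\<lambda>v. \<tau> c d v (i - n))" using i by (simp add: trans_TT(1) ct_def)
      moreover have "hdeg n (3 * n) ?w 1 (dl n h)" for h by (rule dl_hdeg) (auto simp: w2_def)
      ultimately show ?thesis by simp
    next
      case False
      have "hdeg n (3 * n) ?w 1 (?d l)" if "l < n" for l
        using hdeg_lvar[of n "2 * n + l" "3 * n" ?w] that by (simp add: w2_def)
      then show ?thesis using False i by (auto simp: t2 intro!: lsupp_sum lsupp_scale)
    qed
    from hdeg_lpar[OF this] show "lpar ?w (?w i) (?t i)" using i by (simp add: w2_def)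
  qed
  have kg: "gdeg n (3 * n) ?w (kd \<kappa> d j)" if "j < n" for j
    using hdeg_kd_w2[OF k cd(2) that, of "3 * n"] by (intro hdeg_gdeg) simp
  have dg: "gdeg n (3 * n) ?w (?d j)" if "j < n" for j using that by (intro hdeg_gdeg[OF hdeg_lvar]) auto
  have Sk: "eqon ?V (?S (kd \<kappa> d j)) (\<Sum>b<n. lscale (hinv c d b j) (kd \<kappa> c b))" if j: "j < n" for j
  proof -
    have "?S (kd \<kappa> d j) = lsubst ?w n (2 * n) ?t (kd \<kappa> d j)"
      by (rule lsubst_trunc[OF hdeg_gdeg[OF hdeg_kd_w2[OF k cd(2) j order.refl]]]) auto
    also have "\<dots> = lsubst ?w n (2 * n) (ct c d) (kd \<kappa> d j)" by (rule lsubst_cong_coords) (auto simp: trans_TT(1))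
    also have "\<dots> = lsubst (w1 n) n (2 * n) (ct c d) (kd \<kappa> d j)"
      by (rule lsubst_wcong[of n "2 * n" "2 * n"]) (simp_all add: lbelow_ct w1_w2)
    finally show ?thesis using kd_change[OF k cd j] by simp
  qed
  have "lsubst ?w n (4 * n) ?t (alpha \<kappa> d) = ?S (alpha \<kappa> d)"
    by (rule lsubst_trunc[OF hdeg_gdeg[OF hdeg_alpha[OF k cd(2) order.refl]]]) auto
  also have "\<dots> = (\<Sum>j<n. ?S (lmult ?w (?d j) (kd \<kappa> d j)))"
    unfolding alpha_def by (intro lsubst_sum[OF wgoodD(2)[OF wg]] gdeg_lmult dg kg) auto
  also have "\<dots> = (\<Sum>j<n. lmult ?w (?t (2 * n + j)) (?S (kd \<kappa> d j)))"
    by (intro sum.cong refl lsubst_lmult_lvar[OF gs] kg) auto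
  finally have "eqon ?V (lsubst ?w n (4 * n) ?t (alpha \<kappa> d))
      (\<Sum>j<n. lmult ?w (?t (2 * n + j)) (\<Sum>b<n. lscale (hinv c d b j) (kd \<kappa> c b)))"
    using Sk by (auto intro!: eqon_sum eqon_lmult)
  also have "(\<Sum>j<n. lmult ?w (?t (2 * n + j)) (\<Sum>b<n. lscale (hinv c d b j) (kd \<kappa> c b))) =
      (\<Sum>j<n. \<Sum>l<n. \<Sum>b<n. lscale (\<lambda>v. hinv c d b j v * jac c d j l v) (lmult ?w (?d l) (kd \<kappa> c b)))"
  proof (rule sum.cong[OF refl])
    fix j assume j: "j \<in> {..<n}"
    have "lmult ?w (?t (2 * n + j)) g = (\<Sum>l<n. lscale (jac c d j l) (lmult ?w (?d l) g))" for g
      using j by (simp add: trans_TT(2) lmult_sum_left lmult_scale_left)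
    moreover have "lmult ?w (?d l) (\<Sum>b<n. lscale (hinv c d b j) (kd \<kappa> c b)) =
        (\<Sum>b<n. lscale (hinv c d b j) (lmult ?w (?d l) (kd \<kappa> c b)))" for l
      by (simp add: lmult_sum_right lmult_scale_right)
    moreover have "jac c d j l v * hinv c d b j v = hinv c d b j v * jac c d j l v" for l b v by (rule mult.commute)
    ultimately show "lmult ?w (?t (2 * n + j)) (\<Sum>b<n. lscale (hinv c d b j) (kd \<kappa> c b)) =
        (\<Sum>l<n. \<Sum>b<n. lscale (\<lambda>v. hinv c d b j v * jac c d j l v) (lmult ?w (?d l) (kd \<kappa> c b)))"
      by (simp only: lscale_sum lscale_lscale)
  qed
  also have "\<dots> = (\<Sum>l<n. \<Sum>j<n. \<Sum>b<n. lscale (\<lambda>v. hinv c d b j v * jac c d j l v) (lmult ?w (?d l) (kd \<kappa> c b)))"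
    by (rule sum.swap)
  also have "\<dots> = (\<Sum>l<n. \<Sum>b<n. \<Sum>j<n. lscale (\<lambda>v. hinv c d b j v * jac c d j l v) (lmult ?w (?d l) (kd \<kappa> c b)))"
    by (intro sum.cong refl sum.swap)
  also have "\<dots> = (\<Sum>l<n. \<Sum>b<n. lscale (\<lambda>v. \<Sum>j<n. hinv c d b j v * jac c d j l v) (lmult ?w (?d l) (kd \<kappa> c b)))"
    by (simp only: lscale_sum_left)
  also have "eqon ?V \<dots> (\<Sum>l<n. \<Sum>b<n. lscale (\<lambda>v. if b = l then 1 else 0) (lmult ?w (?d l) (kd \<kappa> c b)))"
    using jac_hinv(2)[OF cd] by (intro eqon_sum eqon_scale eqon_refl) auto
  also have "(\<Sum>l<n. \<Sum>b<n. lscale (\<lambda>v. if b = l then 1 else 0) (lmult ?w (?d l) (kd \<kappa> c b))) = alpha \<kappa> c"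
    unfolding alpha_def
  proof (rule sum.cong[OF refl])
    fix l assume l: "l \<in> {..<n}"
    have "(\<Sum>b<n. lscale (\<lambda>v. if b = l then 1 else 0) (lmult ?w (?d l) (kd \<kappa> c b))) =
      (\<Sum>b<n. if b = l then lmult ?w (?d l) (kd \<kappa> c l) else 0)" by (intro sum.cong refl) auto
    then show "(\<Sum>b<n. lscale (\<lambda>v. if b = l then 1 else 0) (lmult ?w (?d l) (kd \<kappa> c b))) = lmult ?w (?d l) (kd \<kappa> c l)"
      using l by simp
  qed
  finally show ?thesis .
qed

lemma shift_form_diff_forms:
  assumes k: "form3 \<kappa>"
  shows "shift_form M \<kappa> \<in> diff_forms (T1 M) 1 2"
proof -
  let ?a = "shift_form M \<kappa>"
  have a: "?a c = alpha \<kappa> c" if "c \<in> A" for c using that by (simp add: shift_form_eq[OF k])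
  have a0: "?a c \<mu> v = 0" if "c \<notin> A" for c \<mu> v using that by (simp add: shift_form_eq[OF k] zero_fun_apply)
  have h: "hdeg n (4 * n) (w2 n) 3 (alpha \<kappa> c)" if "c \<in> A" for c by (rule hdeg_alpha[OF k that]) simp
  have deg: "mono_deg (4 * n) (w2 n) \<mu> = 3" if "?a c \<mu> v \<noteq> 0" for c \<mu> v
  proof -
    have c: "c \<in> A" using a0 that by blast
    then show ?thesis using lsuppD[OF h[OF c], of \<mu> v] that by (simp add: a)
  qed
  have sec: "?a \<in> sections (T1 (T1 M)) (topspace T)"
    \<comment> \<open>The definition is used directly instead of \<open>sections_iff\<close>, which
      would presuppose the full coordinate changes of \<open>T[1]T[1]M\<close> including those of
      \<open>d\<xi>_a\<close>.\<close>
    unfolding sections_def mem_Collect_eq TT_simps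
  proof (intro conjI allI impI ballI)
    show "?a c = (\<lambda>_ _. 0)" if "c \<notin> A" for c using a0[OF that] by auto
    show "\<exists>K. \<forall>c \<mu> v. ?a c \<mu> v \<noteq> 0 \<longrightarrow> mono_deg (4 * n) (w2 n) \<mu> \<le> K" using deg by (intro exI[of _ 3]) simp
    fix c assume c: "c \<in> A"
    have im: "cimage (T1 (T1 M)) c W = ov c W" for W by (simp add: cimage_def ov_def)
    note V = ov_fst_open[OF c c]
    have "lsmooth n (ov c (fst c)) (alpha \<kappa> c)"
      unfolding alpha_def by (intro lsmooth_sum[OF V] lsmooth_lmult[OF V] lsmooth_lvar[OF V] kd_props(2)[OF k c]) simp
    moreover have "supp_in (ov c (fst c)) (alpha \<kappa> c)"
    proof -
      have "lrestrict (ov c (fst c)) (kd \<kappa> c j) = kd \<kappa> c j" if "j < n" for j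
        by (rule lrestrict_supp_in[OF kd_props(3)[OF k c that]])
      moreover have "lmult (w2 n) f g \<mu> v = 0" if "v \<notin> V" "lrestrict V g = g" for f g V \<mu> v
      proof -
        have "g \<alpha> v = 0" for \<alpha> using that by (metis lrestrict_def)
        then show ?thesis by (simp add: lmult_def)
      qed
      ultimately show ?thesis
        unfolding supp_in_def alpha_def sum_lfun_apply by (metis (no_types, lifting) lessThan_iff sum.neutral)
    qed
    ultimately show "?a c \<in> local_funs n (4 * n) (w2 n) (cimage (T1 (T1 M)) c (topspace T))"
      using local_funs_iff[of "alpha \<kappa> c" "4 * n" "w2 n" "ov c (fst c)" 3] hdeg_bdeg[OF h[OF c]] c by (simp add: a im ov_topspace)
    fix d \<mu> v assume d: "d \<in> A" and v: "v \<in> cimage (T1 (T1 M)) c (fst d \<inter> topspace T)"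
    have "v \<in> ov c (fst d)" using v by (auto simp: im ov_def)
    then show "?a c \<mu> v = lsubst (w2 n) n (4 * n) (trans (T1 (T1 M)) c d) (?a d) \<mu> v"
      unfolding a[OF c] a[OF d] by (rule eqonD[OF eqon_sym[OF alpha_change[OF k c d]]])
  qed
  have cnt: "(\<Sum>i\<in>{2 * n..<4 * n}. \<mu> i) = 1" if "?a c \<mu> v \<noteq> 0" for c \<mu> v
  proof -
    have c: "c \<in> A" using a0 that by blast
    have "lsupp (\<lambda>\<mu>. (\<Sum>i\<in>{2 * n..<4 * n}. \<mu> i) = 1) (alpha \<kappa> c)"
      unfolding alpha_def
    proof (rule lsupp_sum)
      fix j assume j: "j \<in> {..<n}"
      have "(\<Sum>i\<in>{2 * n..<4 * n}. ((\<lambda>_. 0)(2 * n + j := Suc 0)) i) = (1 :: nat)"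
      proof -
        have "(\<Sum>i\<in>{2 * n..<4 * n}. ((\<lambda>_. 0)(2 * n + j := Suc 0)) i) = (\<Sum>i\<in>{2 * n..<4 * n}. if i = 2 * n + j then 1 else 0)"
          by (intro sum.cong refl) simp
        then show ?thesis using j by simp
      qed
      then have "lsupp (\<lambda>\<mu>. (\<Sum>i\<in>{2 * n..<4 * n}. \<mu> i) = 1) (lvar n (2 * n + j))"
        by (auto simp: lsupp_def lvar_def split: if_splits)
      then show "lsupp (\<lambda>\<mu>. (\<Sum>i\<in>{2 * n..<4 * n}. \<mu> i) = 1) (lmult (w2 n) (lvar n (2 * n + j)) (kd \<kappa> c j))"
        by (rule lsupp_lmult[OF _ kd_below[OF k c]]) (use j in \<open>auto simp: sum.distrib\<close>)
    qed
    from lsuppD[OF this] show ?thesis using that by (simp add: a[OF c])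
  qed
  show ?thesis
    unfolding diff_forms_def mem_Collect_eq
  proof (intro conjI allI impI)
    show "?a \<in> sections (T1 (T1 M)) (topspace (space_of (T1 M)))" using sec by simp
    show "homogeneous (T1 (T1 M)) (1 + 2) ?a" unfolding homogeneous_def using deg by simp
    fix c \<mu> v assume "?a c \<mu> v \<noteq> 0"
    from cnt[OF this] show "(\<Sum>i\<in>{ncoord (T1 M)..<2 * ncoord (T1 M)}. \<mu> i) = 1" by simp
  qed
qed

end

section \<open>The vector fields in a chart and their intertwining\<close>

lemma lpartial_swap:
  assumes V: "openin (Euclidean_space n) V" and f: "lsmooth n V f" and i: "n \<le> i" and b: "b < n"
  shows "eqon V (lpartial n w i (lpartial n w b f)) (lpartial n w b (lpartial n w i f))"
proof (rule eqonI)
  fix v \<mu> assume v: "v \<in> V"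
  let ?c = "gsign w i \<mu> * real (\<mu> i + 1)" and ?h = "f (\<mu>(i := \<mu> i + 1))"
  have "differentiable_along b (\<lambda>_. ?c) v" by (rule smooth_funD(2)[OF smooth_const[OF V] v b])
  from pdiff_mult[OF this lsmoothD[OF f v b]]
  have "pdiff b (\<lambda>v. ?c * ?h v) v = ?c * pdiff b ?h v" by (simp add: pdiff_const)
  then show "lpartial n w i (lpartial n w b f) \<mu> v = lpartial n w b (lpartial n w i f) \<mu> v"
    by (simp only: lpartial_fibre[OF i] lpartial_base[OF b])
qed

lemma lrestrict_zero_eqon: "lrestrict V f = 0 \<Longrightarrow> eqon V f 0"
proof (rule eqonI)
  fix v \<mu> assume "lrestrict V f = 0" "v \<in> V"
  then show "f \<mu> v = (0 :: lfun) \<mu> v" by (simp add: lrestrict_def fun_eq_iff split: if_splits)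
qed

context smooth_mfd
begin

text \<open>The components of \<open>Q\<close> and \<open>Q_\<kappa>\<close>\<close>

definition Xs :: "nat \<Rightarrow> lfun" where
  "Xs i = (if i < n then lvar n (n + i) else if 3 * n \<le> i \<and> i < 4 * n then lvar n (i - n) else 0)"

definition Xk :: "'m chart sec \<Rightarrow> 'm chart \<Rightarrow> nat \<Rightarrow> lfun" where
  "Xk \<kappa> c i = (if i < n then lvar n (n + i) else if i < 2 * n then 0
     else if i < 3 * n then lscale (\<lambda>_. - 1) (lpartial n (wC n) (i - 2 * n) (\<kappa> c))
     else lvar n (i - n) + kd \<kappa> c (i - 3 * n))"

lemma Q_std_eq: "Q_std M W f c = (if c \<in> A then lrestrict (ov c W) (vfield n (4 * n) (wC n) Xs (f c)) else 0)"
  by (simp add: Q_std_def vf_apply_def lsum_eq zero_lfun cimage_def ov_def vfield_def Xs_def cong: if_cong)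

lemma rpartial_base: "i < n \<Longrightarrow> rpartial n w i f = lpartial n w i f"
  by (simp add: rpartial_def lpartial_base)

text \<open>In degree 3 the left and the right derivatives along an odd coordinate agree: of the two other
  factors of a monomial, an even number is passed on both sides or an odd number on both sides.\<close>

lemma rpartial_kd:
  assumes k: "form3 \<kappa>" and c: "c \<in> A" and a: "a < n"
  shows "rpartial n (wC n) (n + a) (\<kappa> c) = kd \<kappa> c a"
proof (intro ext)
  fix \<mu> :: "nat \<Rightarrow> nat" and v
  let ?i = "n + a" and ?w = "wC n" and ?\<mu> = "\<mu>(n + a := \<mu> (n + a) + 1)"
  have kd: "kd \<kappa> c a = lpartial n ?w ?i (\<kappa> c)"
    unfolding kd_def by (rule lpartial_wcong) (use a in \<open>simp add: w1_wC\<close>)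
  show "rpartial n ?w ?i (\<kappa> c) \<mu> v = kd \<kappa> c a \<mu> v"
  proof (cases "\<kappa> c ?\<mu> v = 0")
    case True
    then show ?thesis by (simp add: kd rpartial_def lpartial_def)
  next
    case False
    have h: "hdeg n (4 * n) ?w 3 (\<kappa> c)" by (rule hdeg_wext[OF form3D(1)[OF k c]]) (simp_all add: w1_wC)
    have "\<forall>\<mu> v. \<kappa> c \<mu> v \<noteq> 0 \<longrightarrow> mono_ok n (4 * n) ?w \<mu> \<and> mono_deg (4 * n) ?w \<mu> = 3" using h unfolding lsupp_def .
    note this[rule_format, OF False]
    then have m: "mono_ok n (4 * n) ?w ?\<mu> \<and> mono_deg (4 * n) ?w ?\<mu> = 3" .
    have w: "odd (?w ?i)" using a by (simp add: wC_def)
    have z: "\<mu> ?i = 0" using odd_okD[OF mono_ok_odd_ok[OF conjunct1[OF m]] w] by simp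
    let ?L = "{j. j < ?i \<and> odd (?w j) \<and> \<mu> j \<noteq> 0}" and ?R = "{j. ?i < j \<and> odd (?w j) \<and> \<mu> j \<noteq> 0}"
    have fin: "finite (osupp ?w ?\<mu>)" by (rule finite_osupp[OF mono_ok_fsupp[OF conjunct1[OF m]]])
    have e: "osupp ?w ?\<mu> = insert ?i (?L \<union> ?R)"
    proof (rule set_eqI)
      fix j
      consider "j < ?i" | "j = ?i" | "?i < j" by linarith
      then show "j \<in> osupp ?w ?\<mu> \<longleftrightarrow> j \<in> insert ?i (?L \<union> ?R)"
        unfolding osupp_def using w by cases simp_all
    qed
    then have f: "finite ?L" "finite ?R" using fin by auto
    have "odd (card (osupp ?w ?\<mu>))" using mono_deg_parity[OF conjunct1[OF m]] m by simp
    moreover have "card (osupp ?w ?\<mu>) = Suc (card ?L + card ?R)"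
      unfolding e using f by (subst card_insert_disjoint) (auto intro!: card_Un_disjoint)
    ultimately have "even (card ?L + card ?R)" by simp
    moreover have "(- 1) ^ p = ((- 1) ^ q :: real)" if "even (p + q)" for p q
      using that by (cases "even p") auto
    ultimately have "(- 1) ^ card ?L = ((- 1) ^ card ?R :: real)" by blast
    then show ?thesis by (simp add: kd rpartial_def lpartial_def)
  qed
qed

lemma rpartial_momentum:
  assumes k: "form3 \<kappa>" and c: "c \<in> A" and i: "2 * n \<le> i"
  shows "rpartial n w i (\<kappa> c) = 0"
proof (intro ext)
  fix \<mu> :: "nat \<Rightarrow> nat" and v
  have "\<kappa> c (\<mu>(i := \<mu> i + 1)) v = 0"
  proof (rule ccontr)
    assume "\<kappa> c (\<mu>(i := \<mu> i + 1)) v \<noteq> 0"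
    then have "\<forall>j\<ge>2 * n. (\<mu>(i := \<mu> i + 1)) j = 0" by (rule lsuppD[OF hdeg_below[OF form3D(1)[OF k c]]])
    from this[rule_format, OF i] show False by simp
  qed
  then show "rpartial n w i (\<kappa> c) \<mu> v = (0 :: lfun) \<mu> v" using i by (simp add: rpartial_def zero_fun_apply)
qed

lemma pull_Tstar_proj:
  assumes k: "form3 \<kappa>" and c: "c \<in> A"
  shows "pull (Tstar_proj 2 (T1 M)) (topspace T) \<kappa> c = \<kappa> c"
proof -
  have h: "hdeg n (2 * n) (wC n) 3 (\<kappa> c)" by (rule hdeg_wext[OF form3D(1)[OF k c]]) (simp_all add: w1_wC)
  have wg: "wgood n (2 * n) (wC n)" by (rule wgood_wC) simp
  have C: "Tstar 2 (T1 M) = C" by (simp add: courant_mfd_def)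
  have "pull (Tstar_proj 2 (T1 M)) (topspace T) \<kappa> c =
      lrestrict (ov c (topspace T)) (lsubst (wC n) n (2 * n) (lvar n) (\<kappa> c))"
    using c by (simp add: Tstar_proj_def coord_morphism_def C proj_coords_def cimage_def ov_def)
  also have "\<dots> = lrestrict (ov c (topspace T)) (\<kappa> c)"
    using lsubst_lvar_id[OF hdeg_gdeg[OF h] wgoodD(2,1)[OF wg] order.refl] ov_zero[OF c]
    by (intro eqon_lrestrict_eq eqonI) blast
  also have "\<dots> = \<kappa> c" using form3D(3)[OF k c] c by (simp add: ov_topspace lrestrict_supp_in)
  finally show ?thesis .
qed

lemma Q_twisted_eq:
  assumes k: "form3 \<kappa>"
  shows "Q_twisted M \<kappa> W f c = (if c \<in> A then lrestrict (ov c W) (vfield n (4 * n) (wC n) (Xk \<kappa> c) (f c)) else 0)"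
proof (cases "c \<in> A")
  case False
  then show ?thesis by (simp add: Q_twisted_def sec_add_def ladd_eq Q_std_eq poisson_def zero_lfun)
next
  case c: True
  let ?w = "wC n" and ?m = "lmult (wC n)"
  let ?p = "\<lambda>i. lpartial n (wC n) i (f c)" and ?k = "\<lambda>i. rpartial n (wC n) i (\<kappa> c)"
  have w: "Tstar_wt 2 (T1 M) = ?w"
    using C_simps(4) by (simp add: courant_mfd_def Tstar_def)
  have "poisson (T1 M) W (pull (Tstar_proj 2 (T1 M)) (topspace T) \<kappa>) f c =
     lrestrict (ov c W) (\<lambda>\<mu> x. \<Sum>j<2 * n. ?m (?k (2 * n + j)) (?p j) \<mu> x - (- 1) ^ w1 n j * ?m (?k j) (?p (2 * n + j)) \<mu> x)"
    using c by (simp add: poisson_def Let_def w lsum_def cimage_def ov_def pull_Tstar_proj[OF k])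
  \<comment> \<open>The first half of the bracket differentiates \<open>\<kappa>\<close> along
    momenta and vanishes. In the second the sign is -1 for \<open>x_a\<close> and +1 for the odd
    \<open>\<xi>_a\<close>, which gives the components along \<open>p_a\<close> and
    \<open>\<eta>_a\<close>.\<close>
  also have "(\<lambda>\<mu> x. \<Sum>j<2 * n. ?m (?k (2 * n + j)) (?p j) \<mu> x - (- 1) ^ w1 n j * ?m (?k j) (?p (2 * n + j)) \<mu> x) =
     (\<Sum>j<2 * n. lscale (\<lambda>_. - ((- 1) ^ w1 n j)) (?m (?k j) (?p (2 * n + j))))"
  proof -
    have "?m (?k (2 * n + j)) g = 0" for j g using rpartial_momentum[OF k c, of "2 * n + j"] by simp
    then show ?thesis by (simp add: fun_eq_iff sum_lfun_apply lscale_def zero_fun_apply)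
  qed
  also have "\<dots> = (\<Sum>j<4 * n. ?m (if 2 * n \<le> j then lscale (\<lambda>_. - ((- 1) ^ w1 n (j - 2 * n))) (?k (j - 2 * n)) else 0) (?p j))"
  proof -
    have "(\<Sum>j<2 * n. lscale (\<lambda>_. - ((- 1) ^ w1 n j)) (?m (?k j) (?p (2 * n + j)))) =
      (\<Sum>j\<in>{2 * n..<4 * n}. ?m (if 2 * n \<le> j then lscale (\<lambda>_. - ((- 1) ^ w1 n (j - 2 * n))) (?k (j - 2 * n)) else 0) (?p j))"
      by (rule sum.reindex_bij_witness[of _ "\<lambda>j. j - 2 * n" "\<lambda>j. 2 * n + j"]) (auto simp: lmult_scale_left)
    also have "\<dots> = (\<Sum>j<4 * n. ?m (if 2 * n \<le> j then lscale (\<lambda>_. - ((- 1) ^ w1 n (j - 2 * n))) (?k (j - 2 * n)) else 0) (?p j))"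
      by (rule sum.mono_neutral_left) auto
    finally show ?thesis .
  qed
  finally have P: "poisson (T1 M) W (pull (Tstar_proj 2 (T1 M)) (topspace T) \<kappa>) f c =
    lrestrict (ov c W) (\<Sum>j<4 * n. ?m (if 2 * n \<le> j then lscale (\<lambda>_. - ((- 1) ^ w1 n (j - 2 * n))) (?k (j - 2 * n)) else 0) (?p j))" .
  have X: "Xs j + (if 2 * n \<le> j then lscale (\<lambda>_. - ((- 1) ^ w1 n (j - 2 * n))) (?k (j - 2 * n)) else 0) = Xk \<kappa> c j" if j: "j < 4 * n" for j
  proof -
    consider "j < n" | "n \<le> j" "j < 2 * n" | "2 * n \<le> j" "j < 3 * n" | "3 * n \<le> j" using j by linarith
    then show ?thesis
    proof cases
      case 3
      then have "j - 2 * n < n" by arith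
      then show ?thesis using 3 by (simp add: Xs_def Xk_def rpartial_base w1_def)
    next
      case 4
      have a: "j - 3 * n < n" "n + (j - 3 * n) = j - 2 * n" using 4 j by arith+
      have "?k (j - 2 * n) = kd \<kappa> c (j - 3 * n)" using rpartial_kd[OF k c a(1)] unfolding a(2) .
      then show ?thesis using 4 j by (simp add: Xs_def Xk_def w1_def)
    qed (simp_all add: Xs_def Xk_def)
  qed
  have "lrestrict V g + lrestrict V h = lrestrict V (g + h)" for V g h
    by (simp add: lrestrict_def fun_eq_iff plus_fun_apply)
  then have "Q_twisted M \<kappa> W f c = lrestrict (ov c W) (\<Sum>j<4 * n. ?m (Xs j) (?p j) +
      ?m (if 2 * n \<le> j then lscale (\<lambda>_. - ((- 1) ^ w1 n (j - 2 * n))) (?k (j - 2 * n)) else 0) (?p j))"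
    using c by (simp add: Q_twisted_def sec_add_def ladd_eq Q_std_eq P vfield_def sum.distrib)
  also have "\<dots> = lrestrict (ov c W) (vfield n (4 * n) ?w (Xk \<kappa> c) (f c))"
    unfolding vfield_def using X by (simp flip: lmult_add_left)
  finally show ?thesis using c by simp
qed

text \<open>In a chart \<open>d\<kappa> = \<Sum>b. \<xi>_b \<partial>\<kappa>/\<partial>x_b =
  0\<close>. Differentiating along the odd \<open>\<xi>_a\<close> gives
  \<open>\<partial>\<kappa>/\<partial>x_a - \<Sum>b. \<xi>_b \<partial>/\<partial>\<xi>_a
  (\<partial>\<kappa>/\<partial>x_b) = 0\<close>, and the derivatives commute.\<close>

lemma closed_kd:
  assumes k: "form3 \<kappa>" and cl: "closed_form M \<kappa>" and c: "c \<in> A" and a: "a < n"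
  shows "eqon (ov c (fst c)) (\<Sum>b<n. lmult (wC n) (lvar n (n + b)) (lpartial n (wC n) b (kd \<kappa> c a)))
    (lpartial n (wC n) a (\<kappa> c))"
proof -
  let ?V = "ov c (fst c)" and ?w = "wC n" and ?p = "\<lambda>i. lpartial n (wC n) i"
  note V = ov_fst_open[OF c c]
  have h: "hdeg n (4 * n) ?w 3 (\<kappa> c)" by (rule hdeg_wext[OF form3D(1)[OF k c]]) (simp_all add: w1_wC)
  have l: "lok ?w (?p b (\<kappa> c))" for b by (rule lok_lpartial[OF bdeg_lok[OF hdeg_bdeg[OF h]]])
  have kd: "kd \<kappa> c a = ?p (n + a) (\<kappa> c)"
    unfolding kd_def by (rule lpartial_wcong) (use a in \<open>simp add: w1_wC\<close>)
  have "vf_apply (T1 M) (deRham_vf M) (topspace T) \<kappa> c = 0" using cl by (simp add: closed_form_def zero_lfun)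
  then have z: "lrestrict ?V (\<Sum>i<2 * n. lmult (w1 n) (deRham_vf M c i) (lpartial n (w1 n) i (\<kappa> c))) = 0"
  proof -
    have "cimage (T1 M) c (topspace T) = ?V" using ov_topspace[OF c] by (simp add: cimage_def ov_def)
    then show ?thesis using c \<open>vf_apply _ _ _ _ _ = 0\<close> by (simp add: vf_apply_def lsum_eq)
  qed
  have "(\<Sum>i<2 * n. lmult (w1 n) (deRham_vf M c i) (lpartial n (w1 n) i (\<kappa> c))) =
    (\<Sum>b<n. lmult (w1 n) (lvar n (n + b)) (lpartial n (w1 n) b (\<kappa> c)))"
    by (rule sum.mono_neutral_cong_right) (auto simp: deRham_vf_def zero_lfun)
  also have "\<dots> = (\<Sum>b<n. lmult ?w (lvar n (n + b)) (?p b (\<kappa> c)))"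
  proof (rule sum.cong[OF refl])
    fix b assume b: "b \<in> {..<n}"
    have "lbelow (2 * n) (lpartial n (w1 n) b (\<kappa> c))"
      by (rule lsupp_lpartial[OF hdeg_below[OF form3D(1)[OF k c]]]) (use b in auto)
    moreover have "lpartial n (w1 n) b (\<kappa> c) = ?p b (\<kappa> c)" using b by (simp add: lpartial_base)
    ultimately show "lmult (w1 n) (lvar n (n + b)) (lpartial n (w1 n) b (\<kappa> c)) = lmult ?w (lvar n (n + b)) (?p b (\<kappa> c))"
      using b lmult_wcong[of "2 * n" "lvar n (n + b)" "?p b (\<kappa> c)" "w1 n" ?w] by (simp add: lbelow_lvar w1_wC)
  qed
  finally have s: "(\<Sum>i<2 * n. lmult (w1 n) (deRham_vf M c i) (lpartial n (w1 n) i (\<kappa> c))) =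
    (\<Sum>b<n. lmult ?w (lvar n (n + b)) (?p b (\<kappa> c)))" .
  have "eqon ?V (\<Sum>b<n. lmult ?w (lvar n (n + b)) (?p b (\<kappa> c))) 0"
    by (rule lrestrict_zero_eqon[OF z[unfolded s]])
  from lpartial_cong[OF V this, of ?w "n + a"]
  have "eqon ?V (\<Sum>b<n. ?p (n + a) (lmult ?w (lvar n (n + b)) (?p b (\<kappa> c)))) 0"
    by (simp add: lpartial_sum)
  also have "(\<Sum>b<n. ?p (n + a) (lmult ?w (lvar n (n + b)) (?p b (\<kappa> c)))) =
      (\<Sum>b<n. (if b = a then ?p a (\<kappa> c) else 0) + lscale (\<lambda>_. - 1) (lmult ?w (lvar n (n + b)) (?p (n + a) (?p b (\<kappa> c)))))"
    using a by (intro sum.cong refl) (auto simp: lpartial_lmult_lvar[OF l] wC_def)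
  also have "\<dots> = ?p a (\<kappa> c) + lscale (\<lambda>_. - 1) (\<Sum>b<n. lmult ?w (lvar n (n + b)) (?p (n + a) (?p b (\<kappa> c))))"
    using a by (simp add: sum.distrib lscale_sum)
  finally have 1: "eqon ?V (?p a (\<kappa> c) + lscale (\<lambda>_. - 1) (\<Sum>b<n. lmult ?w (lvar n (n + b)) (?p (n + a) (?p b (\<kappa> c))))) 0" .
  have "eqon ?V (\<Sum>b<n. lmult ?w (lvar n (n + b)) (?p b (kd \<kappa> c a))) (\<Sum>b<n. lmult ?w (lvar n (n + b)) (?p (n + a) (?p b (\<kappa> c))))"
    unfolding kd by (intro eqon_sum eqon_lmult eqon_refl eqon_sym[OF lpartial_swap[OF V form3D(2)[OF k c]]]) auto
  then show ?thesis using 1 by (simp add: eqon_def lscale_def plus_fun_apply zero_fun_apply)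
qed

lemma wgood_C: "wgood n (4 * n) (wC n)"
  by (rule wgood_wC) simp

text \<open>The field has degree 1, so its component along \<open>z_j\<close> has degree
  \<open>w_j + 1\<close>; this supplies the parity \<open>q = 1\<close> for the chain rule.\<close>

lemma Xk_lpar:
  assumes k: "form3 \<kappa>" and c: "c \<in> A" and j: "j < 4 * n"
  shows "lpar (wC n) (wC n j + 1) (Xk \<kappa> c j)"
proof -
  have h: "hdeg n (4 * n) (wC n) 3 (\<kappa> c)" by (rule hdeg_wext[OF form3D(1)[OF k c]]) (simp_all add: w1_wC)
  have kd: "hdeg n (4 * n) (wC n) 2 (kd \<kappa> c a)" if "a < n" for a
    by (rule hdeg_wext[OF kd_props(1)[OF k c that]]) (simp_all add: w1_wC)
  have lv: "hdeg n (4 * n) (wC n) (wC n i) (lvar n i)" if "n \<le> i" "i < 4 * n" for i by (rule hdeg_lvar[OF that])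
  consider "j < n" | "n \<le> j" "j < 2 * n" | "2 * n \<le> j" "j < 3 * n" | "3 * n \<le> j" using j by linarith
  then have "hdeg n (4 * n) (wC n) (wC n j + 1) (Xk \<kappa> c j)"
  proof cases
    case 1
    then show ?thesis using lv[of "n + j"] by (simp add: Xk_def wC_def)
  next
    case 2
    then show ?thesis by (simp add: Xk_def)
  next
    case 3
    then have a: "j - 2 * n < n" by arith
    have "hdeg n (4 * n) (wC n) (3 - wC n (j - 2 * n)) (lpartial n (wC n) (j - 2 * n) (\<kappa> c))"
      by (rule hdeg_lpartial[OF h]) (simp add: wC_def)
    then have "hdeg n (4 * n) (wC n) 3 (Xk \<kappa> c j)" using 3 a by (auto simp: Xk_def wC_def intro!: lsupp_scale)
    then show ?thesis using 3 by (simp add: wC_def numeral_3_eq_3)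
  next
    case 4
    then have a: "j - 3 * n < n" "n \<le> j - n" "j - n < 4 * n" "2 * n \<le> j - n" "j - n < 3 * n" using j by arith+
    have "hdeg n (4 * n) (wC n) 2 (lvar n (j - n))" using lv[OF a(2,3)] a by (simp add: wC_def)
    then have "hdeg n (4 * n) (wC n) 2 (lvar n (j - n) + kd \<kappa> c (j - 3 * n))" using kd[OF a(1)] by (rule lsupp_add)
    then show ?thesis using 4 by (simp add: Xk_def wC_def numeral_2_eq_2)
  qed
  then show ?thesis by (rule hdeg_lpar)
qed

lemma lsubst_yk_lvar:
  assumes k: "form3 \<kappa>" and c: "c \<in> A" and i: "i < 4 * n"
  shows "eqon (ov c W) (lsubst (wC n) n (4 * n) (yk \<kappa> c) (lvar n i)) (yk \<kappa> c i)"
proof (cases "i < n")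
  case True
  have "lscale (lvar n i (\<lambda>_. 0)) lone = lvar n i" using True by (simp add: lvar_base) (simp add: lscale_def lone_def)
  then show ?thesis using True by (simp add: lsubst_lvar_base yk_def)
next
  case False
  have "lsubst (wC n) n (4 * n) (yk \<kappa> c) (lvar n i) = yk \<kappa> c i"
    by (rule lsubst_lvar) (use False i lpar_lok[OF csubD(4)[OF csub_yk[OF k c] i]] in auto)
  then show ?thesis by simp
qed

text \<open>The check on coordinates. Only \<open>p_a\<close> uses that the form is closed: the term
  \<open>- \<partial>\<kappa>/\<partial>x_a\<close> from \<open>p_a\<close> cancels against the
  derivative of the shift, matching \<open>Q p_a = 0\<close>.\<close>

lemma yk_intertwines:
  assumes k: "form3 \<kappa>" and cl: "closed_form M \<kappa>" and c: "c \<in> A" and i: "i < 4 * n"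
  shows "eqon (ov c (fst c)) (vfield n (4 * n) (wC n) (Xk \<kappa> c) (yk \<kappa> c i)) (lsubst (wC n) n (4 * n) (yk \<kappa> c) (Xs i))"
proof -
  let ?V = "ov c (fst c)" and ?w = "wC n"
  note V = ov_fst_open[OF c c]
  have X: "vfield n (4 * n) ?w (Xk \<kappa> c) (lvar n i) = Xk \<kappa> c i"
    by (rule vfield_lvar) (use i lpar_lok[OF Xk_lpar[OF k c i]] in auto)
  consider "i < n" | "n \<le> i" "i < 2 * n" | "2 * n \<le> i" "i < 3 * n" | "3 * n \<le> i" using i by linarith
  then show ?thesis
  proof cases
    case 1
    then have "eqon ?V (lsubst ?w n (4 * n) (yk \<kappa> c) (Xs i)) (yk \<kappa> c (n + i))"
      using lsubst_yk_lvar[OF k c, of "n + i" "fst c"] by (simp add: Xs_def)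
    then show ?thesis using 1 X by (simp add: yk_def Xk_def eqon_sym)
  next
    case 2
    then show ?thesis using X by (simp add: yk_def Xk_def Xs_def)
  next
    case 4
    then have a: "i - n < 4 * n" "2 * n \<le> i - n" "i - n < 3 * n" "i - n - 2 * n = i - 3 * n" using i by arith+
    have "eqon ?V (lsubst ?w n (4 * n) (yk \<kappa> c) (Xs i)) (yk \<kappa> c (i - n))"
      using lsubst_yk_lvar[OF k c a(1), of "fst c"] 4 i by (simp add: Xs_def)
    moreover have "yk \<kappa> c (i - n) = Xk \<kappa> c i" using 4 a by (simp add: yk_def Xk_def)
    moreover have "yk \<kappa> c i = lvar n i" using 4 by (simp add: yk_def)
    ultimately show ?thesis using X by (simp add: eqon_sym)
  next
    case 3
    then have a: "i - 2 * n < n" by arith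
    let ?a = "i - 2 * n"
    let ?p = "\<lambda>j. lpartial n ?w j (kd \<kappa> c ?a)"
    \<comment> \<open>The shift depends on \<open>x\<close> and \<open>\<xi>\<close> only, and the
      component of the field along \<open>\<xi>\<close> is 0, so the base derivatives alone
      remain.\<close>
    have "vfield n (4 * n) ?w (Xk \<kappa> c) (kd \<kappa> c ?a) = (\<Sum>b<n. lmult ?w (lvar n (n + b)) (?p b))"
      unfolding vfield_def
    proof (rule sum.mono_neutral_cong_right)
      show "\<forall>j\<in>{..<4 * n} - {..<n}. lmult ?w (Xk \<kappa> c j) (?p j) = 0"
      proof
        fix j assume "j \<in> {..<4 * n} - {..<n}"
        then have j: "n \<le> j" by simp
        show "lmult ?w (Xk \<kappa> c j) (?p j) = 0"
        proof (cases "j < 2 * n")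
          case True
          then show ?thesis using j by (simp add: Xk_def)
        next
          case False
          then show ?thesis using lpartial_below[OF kd_below[OF k c a] j, of ?w] by simp
        qed
      qed
    qed (simp_all add: Xk_def)
    with closed_kd[OF k cl c a]
    have "eqon ?V (vfield n (4 * n) ?w (Xk \<kappa> c) (kd \<kappa> c ?a)) (lpartial n ?w ?a (\<kappa> c))" by simp
    then have "eqon ?V (Xk \<kappa> c i + vfield n (4 * n) ?w (Xk \<kappa> c) (kd \<kappa> c ?a)) (Xk \<kappa> c i + lpartial n ?w ?a (\<kappa> c))"
      by (intro eqon_add eqon_refl)
    moreover have "Xk \<kappa> c i + lpartial n ?w ?a (\<kappa> c) = 0"
      using 3 by (simp add: Xk_def) (simp add: lscale_def fun_eq_iff plus_fun_apply zero_fun_apply)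
    moreover have "eqon ?V (vfield n (4 * n) ?w (Xk \<kappa> c) (lvar n i + kd \<kappa> c ?a))
        (vfield n (4 * n) ?w (Xk \<kappa> c) (lvar n i) + vfield n (4 * n) ?w (Xk \<kappa> c) (kd \<kappa> c ?a))"
      by (rule vfield_add[OF lsmooth_lvar[OF V] kd_props(2)[OF k c a]])
    ultimately have "eqon ?V (vfield n (4 * n) ?w (Xk \<kappa> c) (lvar n i + kd \<kappa> c ?a)) 0"
      unfolding X by (simp add: eqon_def)
    then show ?thesis using 3 by (simp add: yk_def Xs_def)
  qed
qed

lemma ov_sub: "ov c W \<subseteq> ov c (fst c)"
  by (auto simp: ov_def)

lemma Xs_gdeg: "i < 4 * n \<Longrightarrow> gdeg n (4 * n) (wC n) (Xs i)"
  unfolding Xs_def by (auto intro!: hdeg_gdeg[OF hdeg_lvar])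

text \<open>By the chain rule and multiplicativity both sides are sums over the coordinates with the
  same substituted derivatives of \<open>f\<close>, so agreement on the coordinates
  suffices.\<close>

lemma vfield_yk:
  assumes k: "form3 \<kappa>" and cl: "closed_form M \<kappa>" and c: "c \<in> A" and W: "openin T W"
    and f: "gdeg n (4 * n) (wC n) f" "lsmooth n (ov c W) f"
  shows "eqon (ov c W) (vfield n (4 * n) (wC n) (Xk \<kappa> c) (lsubst (wC n) n (4 * n) (yk \<kappa> c) f))
    (lsubst (wC n) n (4 * n) (yk \<kappa> c) (vfield n (4 * n) (wC n) Xs f))"
proof -
  let ?w = "wC n" and ?V = "ov c W" and ?S = "lsubst (wC n) n (4 * n) (yk \<kappa> c)"
  note V = ov_open[OF c W]
  have cs: "csub n (4 * n) ?w (4 * n) ?w ?V (yk \<kappa> c)" by (rule csub_subset[OF V csub_yk[OF k c] ov_sub])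
  have g: "gdeg n (4 * n) ?w (lmult ?w (Xs i) (lpartial n ?w i f))" if "i < 4 * n" for i
    by (rule gdeg_lmult[OF Xs_gdeg[OF that] gdeg_lpartial[OF f(1)]])
  have "eqon ?V (vfield n (4 * n) ?w (Xk \<kappa> c) (?S f))
      (\<Sum>i<4 * n. lmult ?w (vfield n (4 * n) ?w (Xk \<kappa> c) (yk \<kappa> c i)) (?S (lpartial n ?w i f)))"
  proof (rule vfield_lsubst[OF V V wgood_C wgood_C])
    show "lpar ?w (?w j + 1) (Xk \<kappa> c j)" if "j < 4 * n" for j by (rule Xk_lpar[OF k c that])
    show "csub n (4 * n) ?w (4 * n) ?w ?V (yk \<kappa> c)" by (rule cs)
    show "base_subst n (yk \<kappa> c) v \<in> ?V" if "v \<in> ?V" for v using base_yk[OF c that] that by simp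
  qed (rule f)+
  also have "eqon ?V \<dots> (\<Sum>i<4 * n. lmult ?w (?S (Xs i)) (?S (lpartial n ?w i f)))"
    by (intro eqon_sum eqon_lmult eqon_refl eqon_subset[OF yk_intertwines[OF k cl c] ov_sub]) simp
  also have "(\<Sum>i<4 * n. lmult ?w (?S (Xs i)) (?S (lpartial n ?w i f))) = (\<Sum>i<4 * n. ?S (lmult ?w (Xs i) (lpartial n ?w i f)))"
  proof (rule sum.cong[OF refl])
    fix i assume "i \<in> {..<4 * n}"
    then show "lmult ?w (?S (Xs i)) (?S (lpartial n ?w i f)) = ?S (lmult ?w (Xs i) (lpartial n ?w i f))"
      by (intro lsubst_lmult[OF csub_good[OF cs wgood_C] Xs_gdeg gdeg_lpartial[OF f(1)], symmetric]) auto
  qed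
  also have "\<dots> = ?S (\<Sum>i<4 * n. lmult ?w (Xs i) (lpartial n ?w i f))"
    by (rule lsubst_sum[OF wgoodD(2)[OF wgood_C] g, symmetric]) simp
  finally show ?thesis by (simp add: vfield_def)
qed

lemma pull_yk:
  "pull (coord_morphism C C (yk \<kappa>)) W f c =
    (if c \<in> A then lrestrict (ov c W) (lsubst (wC n) n (4 * n) (yk \<kappa> c) (f c)) else 0)"
  by (simp add: coord_morphism_def cimage_def ov_def zero_lfun)

lemma preim_coord: "openin T W \<Longrightarrow> space_of X = T \<Longrightarrow> preim X (coord_morphism Y Z y) W = W"
  by (rule preim_id) (simp_all add: coord_morphism_def)

lemma nq_morphism_yk:
  assumes k: "form3 \<kappa>" and cl: "closed_form M \<kappa>"
  shows "nq_morphism C (Q_twisted M \<kappa>) C (Q_std M) (coord_morphism C C (yk \<kappa>))"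
  unfolding nq_morphism_def
proof (intro conjI allI impI ballI)
  let ?P = "coord_morphism C C (yk \<kappa>)" and ?S = "\<lambda>c. lsubst (wC n) n (4 * n) (yk \<kappa> c)"
  show "n_morphism C C ?P" by (rule coord_morphism_n_morphism[OF good_C compatible_yk[OF k]])
  fix W f assume W: "openin (space_of C) W" and f: "f \<in> sections C W"
  have W: "openin T W" using W by simp
  show "pull ?P W (Q_std M W f) = Q_twisted M \<kappa> (preim C ?P W) (pull ?P W f)"
  proof
    fix c
    show "pull ?P W (Q_std M W f) c = Q_twisted M \<kappa> (preim C ?P W) (pull ?P W f) c"
    proof (cases "c \<in> A")
      case c: True
      note V = ov_open[OF c W]
      note F = sectionsD[OF good_C f c, unfolded C_simps]
      have b: "base_subst n (yk \<kappa> c) v \<in> ov c W" if "v \<in> ov c W" for v using base_yk[OF c that] that by simp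
      have "eqon (ov c W) (?S c (Q_std M W f c)) (?S c (vfield n (4 * n) (wC n) Xs (f c)))"
      proof (rule lsubst_eqon_arg[OF b])
        show "eqon (ov c W) (Q_std M W f c) (vfield n (4 * n) (wC n) Xs (f c))"
          unfolding Q_std_eq if_P[OF c] by (rule eqon_lrestrict)
      qed
      also have "eqon (ov c W) \<dots> (vfield n (4 * n) (wC n) (Xk \<kappa> c) (?S c (f c)))"
        by (rule eqon_sym[OF vfield_yk[OF k cl c W F(1,3)]])
      also have "eqon (ov c W) \<dots> (vfield n (4 * n) (wC n) (Xk \<kappa> c) (pull ?P W f c))"
        by (rule vfield_cong[OF V]) (simp add: pull_yk c eqon_sym[OF eqon_lrestrict])
      finally show ?thesis
        using c W by (simp add: pull_yk[of _ _ "Q_std M W f"] Q_twisted_eq[OF k] preim_coord eqon_lrestrict_eq)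
    qed (simp add: pull_yk Q_twisted_eq[OF k])
  qed
qed

subsection \<open>The projection to the shifted cotangent bundle\<close>

text \<open>The pullback of \<open>x_a, \<eta>_a\<close> along \<open>s \<circ> \<omega> \<circ> L\<close>\<close>

definition yl :: "nat \<Rightarrow> lfun" where
  "yl i = (if i < n then lvar n i else lvar n (2 * n + i))"

lemma bundle_simps:
  assumes "Z = T1 (Tstar (Suc 0) M) \<or> Z = Tstar 2 (Tstar (Suc 0) M)"
  shows "space_of Z = T" "bdim Z = n" "ncoord Z = 4 * n" "charts Z = A" "cdom Z = fst" "cmap Z = snd"
proof -
  have t: "space_of (T1 X) = space_of X" "bdim (T1 X) = bdim X" "ncoord (T1 X) = 2 * ncoord X" "charts (T1 X) = charts X"
    "cdom (T1 X) = cdom X" "cmap (T1 X) = cmap X" for X :: "('m, 'm chart) nmfd" by (simp_all add: T1_def)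
  have s: "space_of (Tstar 2 X) = space_of X" "bdim (Tstar 2 X) = bdim X" "ncoord (Tstar 2 X) = 2 * ncoord X" "charts (Tstar 2 X) = charts X"
    "cdom (Tstar 2 X) = cdom X" "cmap (Tstar 2 X) = cmap X" for X :: "('m, 'm chart) nmfd" by (simp_all add: Tstar_def)
  show "space_of Z = T" "bdim Z = n" "ncoord Z = 4 * n" "charts Z = A" "cdom Z = fst" "cmap Z = snd"
    using assms by (auto simp: t s)
qed

lemma bundle_wt: "wt (T1 (Tstar (Suc 0) M)) = w2 n" "wt (Tstar 2 (Tstar (Suc 0) M)) = wC n"
proof -
  have "wt (T1 X) = T1_wt X" "wt (Tstar 2 X) = Tstar_wt 2 X" for X :: "('m, 'm chart) nmfd" by (simp_all add: T1_def Tstar_def)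
  then show "wt (T1 (Tstar (Suc 0) M)) = w2 n" "wt (Tstar 2 (Tstar (Suc 0) M)) = wC n"
    by (auto simp: T1_wt_def Tstar_wt_def w1_def w2_def wC_def fun_eq_iff)
qed

lemma gdeg_wext:
  assumes "gdeg n (2 * n) (w1 n) f" "\<And>i. i < 2 * n \<Longrightarrow> w i = w1 n i" "2 * n \<le> N"
  shows "gdeg n N w f"
proof -
  obtain K where "bdeg n (2 * n) (w1 n) K f" using assms(1) by (auto simp: gdeg_def)
  then have "bdeg n N w K f"
  proof (rule lsupp_mono)
    fix \<mu> assume \<mu>: "bmono n (2 * n) (w1 n) K \<mu>"
    have "hdeg n (2 * n) (w1 n) (mono_deg (2 * n) (w1 n) \<mu>) (lmono \<mu>)" by (rule lmono_hdeg) (use \<mu> in simp)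
    from hdeg_wext[OF this assms(3,2)] have "hdeg n N w (mono_deg (2 * n) (w1 n) \<mu>) (lmono \<mu>)" by simp
    from lsuppD[OF this, of \<mu> "\<lambda>_. 0"] \<mu> show "bmono n N w K \<mu>" by (simp add: lmono_def)
  qed
  then show ?thesis by (rule bdeg_gdeg)
qed

text \<open>\<open>T1_proj\<close> and \<open>omega_flat\<close> fix the coordinates
  \<open>x_a\<close> and \<open>\<eta>_a\<close>, hence do not change the expression of a function
  on \<open>T^*[1]M\<close>.\<close>

lemma pull_low:
  assumes c: "c \<in> A" and f: "gdeg n (2 * n) (w1 n) f" "supp_in (ov c W) f"
    and w: "\<And>i. i < 2 * n \<Longrightarrow> w i = w1 n i" and N: "2 * n \<le> N" and y: "\<And>i. i < 2 * n \<Longrightarrow> y i = lvar n i"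
  shows "lrestrict (ov c W) (lsubst w n N y f) = f"
proof -
  have wg: "wgood n (2 * n) w"
    using wgood_w1[of n "2 * n"] w by (auto simp: wgood_def gpos_def)
  have "lsubst w n N y f = lsubst w n (2 * n) y f" by (rule lsubst_trunc[OF f(1) _ N]) simp
  also have "\<dots> = lsubst w n (2 * n) (lvar n) f" by (rule lsubst_cong_coords[OF y]) auto
  finally have "lsubst w n N y f = lsubst w n (2 * n) (lvar n) f" .
  moreover have "lrestrict (ov c W) (lsubst w n (2 * n) (lvar n) f) = lrestrict (ov c W) f"
    using lsubst_lvar_id[OF gdeg_wext[OF f(1) w order.refl] wgoodD(2,1)[OF wg] order.refl] ov_zero[OF c]
    by (intro eqon_lrestrict_eq eqonI) blast
  ultimately show ?thesis using f(2) by (simp add: lrestrict_supp_in)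
qed

lemma base_s: "base (s_omega_L M) = (\<lambda>m. m)"
  by (simp add: s_omega_L_def mor_comp_def T1_proj_def omega_flat_def legendre_def coord_morphism_def Let_def comp_def)

text \<open>Of the three factors only the Legendre transform moves an index that occurs: it takes
  \<open>\<eta>_a\<close> from \<open>n + a\<close> to \<open>3 * n + a\<close>.\<close>

lemma pull_s:
  assumes W: "openin T W" and f: "f \<in> sections (Tstar (Suc 0) M) W"
  shows "pull (s_omega_L M) W f = (\<lambda>c. if c \<in> A then lrestrict (ov c W) (lsubst (wC n) n (2 * n) yl (f c)) else 0)"
proof -
  let ?Y = "Tstar (Suc 0) M" and ?Z = "T1 (Tstar (Suc 0) M)" and ?Z' = "Tstar 2 (Tstar (Suc 0) M)"
  note F = sectionsD[OF good_Ts1 f, unfolded TsM_simps]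
  note Z = bundle_simps[of ?Z, simplified] and Z' = bundle_simps[of ?Z', simplified]
  have f0: "f c = 0" if "c \<notin> A" for c using sections_outside[OF good_Ts1 f that] .
  have 1: "pull (T1_proj ?Y) W f = f"
  proof
    fix c
    show "pull (T1_proj ?Y) W f c = f c"
      using pull_low[OF _ F(1,2), of c "w2 n" "2 * n" "lvar n"] f0[of c]
      by (simp add: T1_proj_def coord_morphism_def Z bundle_wt cimage_def proj_coords_def w1_w2 zero_lfun flip: ov_def)
  qed
  have 2: "pull (omega_flat M) W f = f"
  proof
    fix c
    show "pull (omega_flat M) W f c = f c"
      using pull_low[OF _ F(1,2), of c "wC n" "4 * n" "\<lambda>i. if i < 2 * n then lvar n i else if i < 3 * n then lvar n (n + i) else lvar n (i - n)"] f0[of c]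
      by (simp add: omega_flat_def coord_morphism_def Z Z' bundle_wt cimage_def w1_wC zero_lfun flip: ov_def)
  qed
  have 3: "pull (legendre M) W f = (\<lambda>c. if c \<in> A then lrestrict (ov c W) (lsubst (wC n) n (2 * n) yl (f c)) else 0)"
  proof
    fix c
    let ?y = "\<lambda>i. if i < n then lvar n i else if i < 2 * n then lvar n (2 * n + i) else if i < 3 * n then lvar n i else lvar n (i - 2 * n)"
    have "lsubst (wC n) n (4 * n) ?y (f c) = lsubst (wC n) n (2 * n) yl (f c)" if "c \<in> A"
    proof -
      have "lsubst (wC n) n (4 * n) ?y (f c) = lsubst (wC n) n (2 * n) ?y (f c)" by (rule lsubst_trunc[OF F(1)[OF that]]) auto
      also have "\<dots> = lsubst (wC n) n (2 * n) yl (f c)" by (rule lsubst_cong_coords) (auto simp: yl_def)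
      finally show ?thesis .
    qed
    then show "pull (legendre M) W f c = (if c \<in> A then lrestrict (ov c W) (lsubst (wC n) n (2 * n) yl (f c)) else 0)"
      by (simp add: legendre_def coord_morphism_def Z' cimage_def zero_lfun flip: ov_def)
  qed
  have "pull (s_omega_L M) W f = pull (legendre M) (preim ?Z' (omega_flat M) (preim ?Z (T1_proj ?Y) W))
      (pull (omega_flat M) (preim ?Z (T1_proj ?Y) W) (pull (T1_proj ?Y) W f))"
    by (simp add: s_omega_L_def mor_comp_def)
  moreover have "preim ?Z (T1_proj ?Y) W = W" unfolding T1_proj_def by (rule preim_coord[OF W Z(1)])
  moreover have "preim ?Z' (omega_flat M) W = W" unfolding omega_flat_def Let_def by (rule preim_coord[OF W Z'(1)])
  ultimately show ?thesis by (simp add: 1 2 3)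
qed

lemma csub_yl: "openin (Euclidean_space n) V \<Longrightarrow> csub n (4 * n) (wC n) (2 * n) (w1 n) V yl"
  unfolding csub_def
proof (intro allI impI conjI)
  fix i assume V: "openin (Euclidean_space n) V" and i: "i < 2 * n"
  show "lsmooth n V (yl i)" by (simp add: yl_def lsmooth_lvar[OF V])
  show "hdeg n (4 * n) (wC n) (w1 n i) (yl i)"
    using hdeg_lvar0[of i n "4 * n" "wC n"] hdeg_lvar[of n "2 * n + i" "4 * n" "wC n"] i
    by (cases "i < n") (simp_all add: yl_def w1_def wC_def)
qed

lemma is_psi_yk:
  assumes k: "form3 \<kappa>" and cl: "closed_form M \<kappa>"
  shows "is_psi M \<kappa> (coord_morphism C C (yk \<kappa>))"
  unfolding is_psi_def
proof
  let ?P = "coord_morphism C C (yk \<kappa>)"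
  show "nq_morphism C (Q_twisted M \<kappa>) C (Q_std M) ?P" by (rule nq_morphism_yk[OF k cl])
  show "mor_eq C (Tstar 1 M) (mor_comp C (s_omega_L M) ?P) (s_omega_L M)"
    unfolding mor_eq_def
  proof (intro conjI allI impI ballI)
    show "base (mor_comp C (s_omega_L M) ?P) m = base (s_omega_L M) m" for m
      by (simp add: mor_comp_def coord_morphism_def)
    fix W f assume "openin (space_of (Tstar 1 M)) W" and "f \<in> sections (Tstar 1 M) W"
    then have W: "openin T W" and f: "f \<in> sections (Tstar (Suc 0) M) W" by simp_all
    note F = sectionsD[OF good_Ts1 f, unfolded TsM_simps]
    have pre: "preim C (s_omega_L M) W = W" by (rule preim_id[OF _ W base_s]) simp
    have "pull ?P W (pull (s_omega_L M) W f) c = pull (s_omega_L M) W f c" for c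
    proof (cases "c \<in> A")
      case c: True
      note V = ov_open[OF c W]
      let ?S = "lsubst (wC n) n (4 * n) (yk \<kappa> c)" and ?L = "\<lambda>y. lsubst (wC n) n (2 * n) y (f c)"
      have b: "base_subst n (yk \<kappa> c) v \<in> ov c W" if "v \<in> ov c W" for v using base_yk[OF c that] that by simp
      have "eqon (ov c W) (?S (lrestrict (ov c W) (?L yl))) (?S (?L yl))"
        by (rule lsubst_eqon_arg[OF b eqon_lrestrict])
      also have "?S (?L yl) = ?L (\<lambda>i. ?S (yl i))"
        by (rule csub_comp[OF csub_yk[OF k c] csub_yl[OF V] wgood_C wgood_w1 F(1)[OF c]]) simp
      also have "eqon (ov c W) \<dots> (?L yl)"
      proof (rule lsubst_eqon_sub)
        show *: "eqon (ov c W) (?S (yl i)) (yl i)" if "i < 2 * n" for i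
          using lsubst_yk_lvar[OF k c, of i W] lsubst_yk_lvar[OF k c, of "2 * n + i" W] that
          by (cases "i < n") (simp_all add: yl_def yk_def)
        show "eqon (ov c W) (?S (yl i)) (yl i)" if "i < n" for i using * that by simp
      qed
      finally show ?thesis using c by (simp add: pull_yk pull_s[OF W f] eqon_lrestrict_eq)
    qed (simp add: pull_yk pull_s[OF W f])
    then show "pull (mor_comp C (s_omega_L M) ?P) W f = pull (s_omega_L M) W f"
      by (simp add: mor_comp_def pre fun_eq_iff)
  qed
qed

subsection \<open>Uniqueness\<close>

text \<open>In degree 0 only the coefficient of the empty monomial is left, and that is an ordinary
  function. This turns the locality of a morphism into a statement about pullbacks.\<close>

lemma sections_degree0_eqI:
  assumes s: "f \<in> sections C W" "g \<in> sections C W" "homogeneous C 0 f" "homogeneous C 0 g"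
    and eq: "\<And>e m. e \<in> A \<Longrightarrow> m \<in> fst e \<Longrightarrow> m \<in> W \<Longrightarrow> f e (\<lambda>_. 0) (snd e m) = g e (\<lambda>_. 0) (snd e m)"
  shows "f = g"
proof (intro ext)
  fix e \<mu> v
  have z: "h e \<mu> v = 0" if h: "h \<in> sections C W" "homogeneous C 0 h" and e: "e \<in> A" and *: "v \<notin> ov e W \<or> \<mu> \<noteq> (\<lambda>_. 0)" for h
  proof (rule ccontr)
    assume nz: "h e \<mu> v \<noteq> 0"
    note H = sectionsD[OF good_C h(1) e, unfolded C_simps]
    have "v \<in> ov e W" using H(2) nz unfolding supp_in_def by blast
    obtain K where "bdeg n (4 * n) (wC n) K (h e)" using H(1) by (auto simp: gdeg_def)
    from lsuppD[OF this nz] have "mono_ok n (4 * n) (wC n) \<mu>" by simp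
    moreover have "mono_deg (4 * n) (wC n) \<mu> = 0" using h(2) nz unfolding homogeneous_def C_simps by blast
    ultimately have "\<mu> = (\<lambda>_. 0)" by (rule mono_deg_0[OF wgoodD(2)[OF wgood_C]])
    with \<open>v \<in> ov e W\<close> * show False by blast
  qed
  consider "e \<notin> A" | "e \<in> A" "v \<notin> ov e W \<or> \<mu> \<noteq> (\<lambda>_. 0)" | m where "e \<in> A" "\<mu> = (\<lambda>_. 0)" "v = snd e m" "m \<in> fst e" "m \<in> W"
    by (auto simp: ov_def)
  then show "f e \<mu> v = g e \<mu> v"
  proof cases
    case 1
    then show ?thesis using sections_outside[OF good_C s(1)] sections_outside[OF good_C s(2)] by simp
  next
    case 2
    then show ?thesis using z[OF s(1,3)] z[OF s(2,4)] by simp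
  next
    case 3
    then show ?thesis using eq by simp
  qed
qed

lemma vfield_Xs_lvar: "i < 4 * n \<Longrightarrow> vfield n (4 * n) (wC n) Xs (lvar n i) = Xs i"
  by (rule vfield_lvar) (auto simp: Xs_def intro!: lok_lvar)

lemma vfield_Xs_base:
  "vfield n (4 * n) (wC n) Xs (lscale h lone) = dl n h"
proof -
  have "vfield n (4 * n) (wC n) Xs (lscale h lone) = (\<Sum>j<n. lscale (pdiff j h) (lvar n (n + j)))"
    unfolding vfield_def
    by (rule sum.mono_neutral_cong_right)
      (auto simp: lpartial_base_lone lpartial_scale Xs_def lmult_scale_right lmult_lone_right lok_lvar)
  then show ?thesis by (simp add: dl_def)
qed

text \<open>Applied to \<open>\<Sum>b. hinv c d b a * \<eta>_b\<close>, \<open>Q\<close> acts on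
  both factors: on \<open>\<eta>_b\<close> it gives \<open>p_b\<close>, on the coefficient its
  differential. This is the transformation law of \<open>p_a\<close>.\<close>

lemma vfield_Xs_et:
  assumes cd: "c \<in> A" "d \<in> A" and a: "a < n"
  shows "eqon (ov c (fst d)) (vfield n (4 * n) (wC n) Xs (et (3 * n) c d a)) (pt c d a)"
proof -
  let ?V = "ov c (fst d)" and ?X = "vfield n (4 * n) (wC n) Xs" and ?h = "\<lambda>b. hinv c d b a"
  note V = ov_fst_open[OF cd]
  have hs: "smooth_fun n ?V (?h b)" if "b < n" for b by (rule hinv_smooth[OF cd that a])
  have "eqon ?V (?X (et (3 * n) c d a)) (\<Sum>b<n. ?X (lscale (?h b) (lvar n (3 * n + b))))"
    unfolding et_def using hs by (intro vfield_sum[OF V] lsmooth_scale[OF V] lsmooth_lvar[OF V]) auto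
  also have "eqon ?V \<dots> (\<Sum>b<n. lscale (?h b) (?X (lvar n (3 * n + b))) +
      (\<Sum>j<n. lscale (pdiff j (?h b)) (lmult (wC n) (Xs j) (lvar n (3 * n + b)))))"
    using hs by (intro eqon_sum vfield_scale lsmooth_lvar[OF V]) auto
  also have "(\<Sum>b<n. lscale (?h b) (?X (lvar n (3 * n + b))) +
      (\<Sum>j<n. lscale (pdiff j (?h b)) (lmult (wC n) (Xs j) (lvar n (3 * n + b))))) = pt c d a"
    unfolding pt_def
  proof (rule sum.cong[OF refl])
    fix b assume b: "b \<in> {..<n}"
    have "Xs (3 * n + b) = lvar n (2 * n + b)" using b by (simp add: Xs_def)
    moreover have "lmult (wC n) (dl n (?h b)) (lvar n (3 * n + b)) =
        (\<Sum>j<n. lscale (pdiff j (?h b)) (lmult (wC n) (Xs j) (lvar n (3 * n + b))))"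
      unfolding dl_def lmult_sum_left by (rule sum.cong) (auto simp: lmult_scale_left Xs_def)
    ultimately show "lscale (?h b) (?X (lvar n (3 * n + b))) +
      (\<Sum>j<n. lscale (pdiff j (?h b)) (lmult (wC n) (Xs j) (lvar n (3 * n + b)))) =
      lscale (?h b) (lvar n (2 * n + b)) + lmult (wC n) (dl n (?h b)) (lvar n (3 * n + b))"
      using b by (simp add: vfield_Xs_lvar)
  qed
  finally show ?thesis .
qed

lemma lsubst_ct_lvar:
  assumes "c \<in> A" "d \<in> A" "i < 4 * n"
  shows "lsubst (wC n) n (4 * n) (ct c d) (lvar n i) = ct c d i"
proof (cases "i < n")
  case True
  then show ?thesis by (simp add: lsubst_lvar_base ct_base) (simp add: lscale_def lone_def)
next
  case False
  show ?thesis
    by (rule lsubst_lvar) (use False assms(3) lpar_lok[OF csubD(4)[OF csub_ct[OF assms(1,2)] assms(3)]] in auto)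
qed

lemma ext_lvar:
  "i < 4 * n \<Longrightarrow> c \<in> A \<Longrightarrow> e \<in> A \<Longrightarrow> ext C ct c W (lvar n i) e = lrestrict (ov e W) (ct e c i)"
  by (simp add: ext_def lsubst_ct_lvar)

text \<open>A coordinate of the chart \<open>c\<close> is a section with expressions in all charts,
  so \<open>Q x_a = \<xi>_a\<close> and \<open>Q \<eta>_a = p_a\<close> have to be verified after
  every coordinate change.\<close>

lemma Q_std_ext:
  assumes c: "c \<in> A" and W: "openin T W" "W \<subseteq> fst c" and i: "i < n \<or> 3 * n \<le> i \<and> i < 4 * n"
    and j: "j = (if i < n then n + i else i - n)"
  shows "Q_std M W (ext C ct c W (lvar n i)) = ext C ct c W (lvar n j)"
proof
  fix e
  show "Q_std M W (ext C ct c W (lvar n i)) e = ext C ct c W (lvar n j) e"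
  proof (cases "e \<in> A")
    case e: True
    note V = ov_open[OF e W(1)]
    have j4: "i < 4 * n" "j < 4 * n" using i j by auto
    have "eqon (ov e W) (vfield n (4 * n) (wC n) Xs (ext C ct c W (lvar n i) e)) (vfield n (4 * n) (wC n) Xs (ct e c i))"
      unfolding ext_lvar[OF j4(1) c e] by (rule vfield_cong[OF V eqon_lrestrict])
    also have "eqon (ov e W) \<dots> (ct e c j)"
    proof (cases "i < n")
      case True
      then show ?thesis using j by (simp add: ct_base vfield_Xs_base) (simp add: ct_def)
    next
      case False
      then have a: "i - 3 * n < n" "2 * n \<le> j" "j < 3 * n" "j - 2 * n = i - 3 * n" "3 * n \<le> i" using i j by auto
      have "ct e c i = et (3 * n) e c (i - 3 * n)" "ct e c j = pt e c (i - 3 * n)" using a by (simp_all add: ct_def)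
      then show ?thesis using eqon_subset[OF vfield_Xs_et[OF e c a(1)] ov_mono[OF W(2)]] by simp
    qed
    finally show ?thesis using e by (simp add: Q_std_eq ext_lvar[OF j4(2) c e] eqon_lrestrict_eq)
  qed (simp add: Q_std_eq ext_def)
qed

lemma pull_s_ext:
  assumes c: "c \<in> A" and W: "openin T W" "W \<subseteq> fst c" and a: "a < n"
  shows "ext (Tstar (Suc 0) M) st c W (lvar n (n + a)) \<in> sections (Tstar (Suc 0) M) W"
    and "pull (s_omega_L M) W (ext (Tstar (Suc 0) M) st c W (lvar n (n + a))) = ext C ct c W (lvar n (3 * n + a))"
proof -
  let ?g = "ext (Tstar (Suc 0) M) st c W (lvar n (n + a))"
  have gl: "gdeg n (2 * n) (w1 n) (lvar n (n + b))" if "b < n" for b using that by (intro hdeg_gdeg[OF hdeg_lvar]) auto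
  show s: "?g \<in> sections (Tstar (Suc 0) M) W"
    by (rule ext_section[OF good_Ts1 c W]) (simp_all add: gl a lsmooth_lvar[OF ov_open[OF c W(1)]])
  show "pull (s_omega_L M) W ?g = ext C ct c W (lvar n (3 * n + a))"
  proof
    fix e
    show "pull (s_omega_L M) W ?g e = ext C ct c W (lvar n (3 * n + a)) e"
    proof (cases "e \<in> A")
      case e: True
      let ?L = "lsubst (wC n) n (2 * n) yl"
      have b: "base_subst n yl v = v" if "v \<in> ov e W" for v by (rule base_lvar[OF _ e that]) (simp add: yl_def)
      then have b': "base_subst n yl v \<in> ov e W" if "v \<in> ov e W" for v using that by simp
      have "lsubst (w1 n) n (2 * n) (st e c) (lvar n (n + a)) = st e c (n + a)"
        by (rule lsubst_lvar) (use a lpar_lok[OF csubD(4)[OF csub_st[OF e c], of "n + a"]] in auto)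
      then have g: "?g e = lrestrict (ov e W) (et n e c a)" using e by (simp add: ext_def st_def)
      have "eqon (ov e W) (?L (?g e)) (?L (et n e c a))" unfolding g by (rule lsubst_eqon_arg[OF b' eqon_lrestrict])
      also have "?L (et n e c a) = (\<Sum>b<n. ?L (lscale (hinv e c b a) (lvar n (n + b))))"
        unfolding et_def by (intro lsubst_sum[OF wgoodD(2)[OF wgood_w1[of n "2 * n"]]] gdeg_scale gl) auto
      also have "\<dots> = (\<Sum>b<n. lscale (\<lambda>v. hinv e c b a (base_subst n yl v)) (lvar n (3 * n + b)))"
      proof (rule sum.cong[OF refl])
        fix b assume "b \<in> {..<n}"
        then have b: "b < n" by simp
        have "?L (lvar n (n + b)) = yl (n + b)" by (rule lsubst_lvar) (use b in \<open>auto simp: yl_def intro!: lok_lvar\<close>)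
        moreover have "yl (n + b) = lvar n (3 * n + b)" using b by (simp add: yl_def)
        ultimately show "?L (lscale (hinv e c b a) (lvar n (n + b))) =
            lscale (\<lambda>v. hinv e c b a (base_subst n yl v)) (lvar n (3 * n + b))" by (simp add: lsubst_scale)
      qed
      also have "eqon (ov e W) \<dots> (et (3 * n) e c a)"
        unfolding et_def using b by (intro eqon_sum eqon_scale eqon_refl) simp
      also have "et (3 * n) e c a = ct e c (3 * n + a)" using a by (simp add: ct_def)
      finally show ?thesis
        using e a ext_lvar[of "3 * n + a" c e W] c by (simp add: pull_s[OF W(1) s] eqon_lrestrict_eq)
    next
      case False
      have "pull (s_omega_L M) W ?g e = 0" unfolding pull_s[OF W(1) s] if_not_P[OF False] ..
      then show ?thesis using False by (simp add: ext_def)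
    qed
  qed
qed

lemma is_psi_base:
  assumes "is_psi M \<kappa> \<psi>" "m \<in> topspace T"
  shows "base \<psi> m = m"
  using assms by (simp add: is_psi_def mor_eq_def mor_comp_def base_s)

lemma is_psi_preim: "is_psi M \<kappa> \<psi> \<Longrightarrow> openin T W \<Longrightarrow> preim C \<psi> W = W"
  using is_psi_base openin_subset by (fastforce simp: preim_def)

lemma is_psi_morphism: "is_psi M \<kappa> \<psi> \<Longrightarrow> n_morphism C C \<psi>"
  by (simp add: is_psi_def nq_morphism_def)

lemma n_morphismD:
  assumes \<psi>: "n_morphism C C \<psi>" and W: "openin T W" and f: "f \<in> sections C W"
  shows "pull \<psi> W f \<in> sections C (preim C \<psi> W)"
    and "g \<in> sections C W \<Longrightarrow> pull \<psi> W (sec_add f g) = sec_add (pull \<psi> W f) (pull \<psi> W g)"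
    and "g \<in> sections C W \<Longrightarrow> pull \<psi> W (sec_mult C f g) = sec_mult C (pull \<psi> W f) (pull \<psi> W g)"
    and "homogeneous C k f \<Longrightarrow> homogeneous C k (pull \<psi> W f)"
    and "openin T W' \<Longrightarrow> W' \<subseteq> W \<Longrightarrow> pull \<psi> W' (sec_restrict C W' f) = sec_restrict C (preim C \<psi> W') (pull \<psi> W f)"
    and "m \<in> preim C \<psi> W \<Longrightarrow> c \<in> A \<Longrightarrow> d \<in> A \<Longrightarrow> m \<in> fst c \<Longrightarrow> base \<psi> m \<in> fst d \<Longrightarrow>
      pull \<psi> W f c (\<lambda>_. 0) (snd c m) = f d (\<lambda>_. 0) (snd d (base \<psi> m))"
proof -
  note D = mp[OF spec[OF conjunct2[OF \<psi>[unfolded n_morphism_def C_simps]]] W]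
  note D1 = D[THEN conjunct1] and D2 = D[THEN conjunct2, THEN conjunct2]
  note D3 = D2[THEN conjunct1, rule_format] and D4 = D2[THEN conjunct2, THEN conjunct2]
  note D5 = D4[THEN conjunct1, rule_format] and D6 = D4[THEN conjunct2, THEN conjunct1, rule_format]
    and D7 = D4[THEN conjunct2, THEN conjunct2, rule_format]
  show "pull \<psi> W f \<in> sections C (preim C \<psi> W)" using D1 f by simp
  show "g \<in> sections C W \<Longrightarrow> pull \<psi> W (sec_add f g) = sec_add (pull \<psi> W f) (pull \<psi> W g)"
    and "g \<in> sections C W \<Longrightarrow> pull \<psi> W (sec_mult C f g) = sec_mult C (pull \<psi> W f) (pull \<psi> W g)"
    using D3[OF f, of g] by simp_all
  show "homogeneous C k f \<Longrightarrow> homogeneous C k (pull \<psi> W f)" by (rule D5[OF f])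
  show "openin T W' \<Longrightarrow> W' \<subseteq> W \<Longrightarrow> pull \<psi> W' (sec_restrict C W' f) = sec_restrict C (preim C \<psi> W') (pull \<psi> W f)"
    by (rule D6[OF _ f]) simp
  show "m \<in> preim C \<psi> W \<Longrightarrow> c \<in> A \<Longrightarrow> d \<in> A \<Longrightarrow> m \<in> fst c \<Longrightarrow> base \<psi> m \<in> fst d \<Longrightarrow>
      pull \<psi> W f c (\<lambda>_. 0) (snd c m) = f d (\<lambda>_. 0) (snd d (base \<psi> m))"
    by (rule D7[OF f]) simp_all
qed

text \<open>A morphism that satisfies the condition is determined on \<open>x_a\<close> by locality, on \<open>\<eta>_a\<close> by the
  projection to \<open>T^*[1]M\<close>, and on \<open>\<xi>_a = Q x_a\<close> and \<open>p_a = Q \<eta>_a\<close> by equivariance.\<close>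

lemma is_psi_unique_chart:
  assumes \<psi>: "is_psi M \<kappa> \<psi>" and \<phi>: "is_psi M \<kappa> \<phi>" and c: "c \<in> A" and W: "openin T W" "W \<subseteq> fst c"
    and f: "gdeg n (4 * n) (wC n) f" "lsmooth n (ov c W) f"
  shows "pull \<psi> W (ext C ct c W f) = pull \<phi> W (ext C ct c W f)"
proof -
  let ?V = "ov c W" and ?e = "ext C ct c W" and ?w = "wC n"
  \<comment> \<open>The local expressions on which the two pullbacks agree form a subalgebra. It is
    shown to contain the base functions and the coordinates, hence every expression of bounded
    degree.\<close>
  define P where "P g \<longleftrightarrow> gdeg n (4 * n) ?w g \<and> lsmooth n ?V g \<and> pull \<psi> W (?e g) = pull \<phi> W (?e g)" for g
  note V = ov_open[OF c W(1)]
  note m\<psi> = is_psi_morphism[OF \<psi>] and m\<phi> = is_psi_morphism[OF \<phi>]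
  note p\<psi> = is_psi_preim[OF \<psi> W(1)] and p\<phi> = is_psi_preim[OF \<phi> W(1)]
  have sec: "?e g \<in> sections C W" if "gdeg n (4 * n) ?w g" "lsmooth n ?V g" for g
    by (rule ext_section[OF good_C c W]) (use that in simp_all)
  have add: "P (g + h)" if "P g" "P h" for g h
  proof -
    have "pull x W (?e (g + h)) = sec_add (pull x W (?e g)) (pull x W (?e h))" if x: "n_morphism C C x" for x
      using n_morphismD(2)[OF x W(1) sec sec, of g h] ext_add[OF good_C, of g h c W] \<open>P g\<close> \<open>P h\<close> by (simp add: P_def)
    then show ?thesis
      using that m\<psi> m\<phi> by (simp add: P_def gdeg_add lsmooth_add[OF V])
  qed
  have mult: "P (lmult ?w g h)" if "P g" "P h" for g h
  proof -
    have "pull x W (?e (lmult ?w g h)) = sec_mult C (pull x W (?e g)) (pull x W (?e h))" if x: "n_morphism C C x" for x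
      using n_morphismD(3)[OF x W(1) sec sec, of g h] ext_mult[OF good_C c, of g h W] \<open>P g\<close> \<open>P h\<close> by (simp add: P_def)
    then show ?thesis
      using that m\<psi> m\<phi> by (simp add: P_def gdeg_lmult lsmooth_lmult[OF V])
  qed
  \<comment> \<open>Pullbacks of a degree 0 section have degree 0, and locality fixes their values
    at points, where both base maps are the identity. This reaches arbitrary smooth \<open>h\<close>
    and not only polynomials in the \<open>x_a\<close>.\<close>
  have base: "P (lscale h lone)" if h: "smooth_fun n ?V h" for h
  proof -
    have g: "gdeg n (4 * n) ?w (lscale h lone)" by (rule hdeg_gdeg[OF lsupp_scale[OF hdeg_lone]])
    have s: "lsmooth n ?V (lscale h lone)" by (intro lsmooth_scale[OF V h] lsmooth_lone[OF V])
    have h0: "homogeneous C 0 (?e (lscale h lone))"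
      unfolding homogeneous_def
    proof (intro allI impI)
      fix e \<mu> v assume "?e (lscale h lone) e \<mu> v \<noteq> 0"
      then have "lscale (\<lambda>v. h (base_subst n (ct e c) v)) lone \<mu> v \<noteq> 0"
        by (auto simp: ext_def lsubst_scale lrestrict_def zero_fun_apply split: if_splits)
      then have "\<mu> = (\<lambda>_. 0)" by (simp add: lscale_def lone_def split: if_splits)
      then show "mono_deg (ncoord C) (wt C) \<mu> = 0" by (simp add: mono_deg_def)
    qed
    have "pull \<psi> W (?e (lscale h lone)) = pull \<phi> W (?e (lscale h lone))"
    proof (rule sections_degree0_eqI)
      show "pull \<psi> W (?e (lscale h lone)) \<in> sections C W" using n_morphismD(1)[OF m\<psi> W(1) sec[OF g s]] p\<psi> by simp
      show "pull \<phi> W (?e (lscale h lone)) \<in> sections C W" using n_morphismD(1)[OF m\<phi> W(1) sec[OF g s]] p\<phi> by simp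
      show "homogeneous C 0 (pull \<psi> W (?e (lscale h lone)))" by (rule n_morphismD(4)[OF m\<psi> W(1) sec[OF g s] h0])
      show "homogeneous C 0 (pull \<phi> W (?e (lscale h lone)))" by (rule n_morphismD(4)[OF m\<phi> W(1) sec[OF g s] h0])
      fix e m assume e: "e \<in> A" "m \<in> fst e" "m \<in> W"
      have m: "m \<in> topspace T" using openin_subset[OF W(1)] e by blast
      have "pull x W (?e (lscale h lone)) e (\<lambda>_. 0) (snd e m) = ?e (lscale h lone) e (\<lambda>_. 0) (snd e m)"
        if x: "is_psi M \<kappa> x" for x
        using n_morphismD(6)[OF is_psi_morphism[OF x] W(1) sec[OF g s], of m e e] e
          is_psi_base[OF x m] is_psi_preim[OF x W(1)] by simp
      then show "pull \<psi> W (?e (lscale h lone)) e (\<lambda>_. 0) (snd e m) = pull \<phi> W (?e (lscale h lone)) e (\<lambda>_. 0) (snd e m)"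
        using \<psi> \<phi> by simp
    qed
    then show ?thesis using g s by (simp add: P_def)
  qed
  have lv: "gdeg n (4 * n) ?w (lvar n i)" "lsmooth n ?V (lvar n i)" if "i < 4 * n" for i
    using csubD(1,3)[OF csub_lvar[OF V wgood_C] that] by auto
  have Q: "P (lvar n j)" if P: "P (lvar n i)" and i: "i < n \<or> 3 * n \<le> i \<and> i < 4 * n" and j: "j = (if i < n then n + i else i - n)" for i j
  proof -
    have ij: "i < 4 * n" "j < 4 * n" using i j by auto
    have e: "?e (lvar n i) \<in> sections C W" using sec lv[OF ij(1)] by blast
    have "pull x W (?e (lvar n j)) = Q_twisted M \<kappa> W (pull x W (?e (lvar n i)))" if x: "is_psi M \<kappa> x" for x
    proof -
      have "pull x W (Q_std M W (?e (lvar n i))) = Q_twisted M \<kappa> (preim C x W) (pull x W (?e (lvar n i)))"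
        using x W(1) e by (simp add: is_psi_def nq_morphism_def)
      then show ?thesis using Q_std_ext[OF c W i j] is_psi_preim[OF x W(1)] by simp
    qed
    then show ?thesis using P \<psi> \<phi> lv[OF ij(2)] by (simp add: P_def)
  qed
  have x: "P (lvar n i)" if "i < n" for i
    unfolding lvar_base[OF that] by (rule base[OF smooth_fun_coord[OF V]])
  have \<xi>: "P (lvar n (n + a))" if "a < n" for a
    by (rule Q[OF x[OF that]]) (use that in auto)
  \<comment> \<open>The section \<open>\<eta>_a\<close> is itself a pullback from
    \<open>T^*[1]M\<close>, so the condition on the composition with the projection says that it is
    fixed.\<close>
  have \<eta>: "P (lvar n (3 * n + a))" if a: "a < n" for a
  proof -
    have "pull x W (?e (lvar n (3 * n + a))) = ?e (lvar n (3 * n + a))" if x: "is_psi M \<kappa> x" for x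
    proof -
      let ?g = "ext (Tstar (Suc 0) M) st c W (lvar n (n + a))"
      have pre: "preim C (s_omega_L M) W = W" by (rule preim_id[OF _ W(1) base_s]) simp
      have "\<forall>W. openin T W \<longrightarrow> (\<forall>f\<in>sections (Tstar (Suc 0) M) W.
          pull x (preim C (s_omega_L M) W) (pull (s_omega_L M) W f) = pull (s_omega_L M) W f)"
        using x by (simp add: is_psi_def mor_eq_def mor_comp_def)
      from bspec[OF mp[OF spec[OF this] W(1)] pull_s_ext(1)[OF c W a]]
      have "pull x W (pull (s_omega_L M) W ?g) = pull (s_omega_L M) W ?g" unfolding pre .
      then show ?thesis by (simp add: pull_s_ext(2)[OF c W a])
    qed
    then have "pull \<psi> W (?e (lvar n (3 * n + a))) = pull \<phi> W (?e (lvar n (3 * n + a)))"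
      by (simp only: \<psi> \<phi>)
    moreover have "3 * n + a < 4 * n" using a by simp
    ultimately show ?thesis using lv[of "3 * n + a"] unfolding P_def by blast
  qed
  have p: "P (lvar n (2 * n + a))" if "a < n" for a
    by (rule Q[OF \<eta>[OF that]]) (use that in auto)
  have var: "P (lvar n i)" if i: "n \<le> i" "i < 4 * n" for i
  proof -
    have "(\<exists>a<n. i = n + a) \<or> (\<exists>a<n. i = 2 * n + a) \<or> (\<exists>a<n. i = 3 * n + a)"
    proof -
      have "i = n + (i - n)" "i - n < n" if "i < 2 * n" using that i by arith+
      moreover have "i = 2 * n + (i - 2 * n)" "i - 2 * n < n" if "2 * n \<le> i" "i < 3 * n" using that by arith+
      moreover have "i = 3 * n + (i - 3 * n)" "i - 3 * n < n" if "3 * n \<le> i" using that i by arith+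
      ultimately show ?thesis by (meson not_le)
    qed
    then show ?thesis using \<xi> p \<eta> by blast
  qed
  have one: "P lone" using base[OF smooth_const[OF V], of 1] by simp
  have zero: "P 0" using base[OF smooth_const[OF V], of 0] by simp
  have power: "P ((lmult ?w (lvar n i) ^^ m) g)" if "P g" "n \<le> i" "i < 4 * n" for g i m
    by (induction m) (simp_all add: that mult var)
  have part: "P (mpart ?w (4 * n) (lvar n) k \<nu>)" if "n \<le> k" for k \<nu>
  proof (cases "k \<le> 4 * n")
    case True
    then show ?thesis using that
    proof (induction rule: inc_induct)
      case base
      show ?case unfolding mpart_end[OF order.refl] by (rule one)
    next
      case (step k)
      have "P (mpart ?w (4 * n) (lvar n) (Suc k) \<nu>)" using step by simp
      then show ?case unfolding mpart_step[OF step(2)] using step by (intro power) auto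
    qed
  next
    case False
    then show ?thesis using mpart_end[of "4 * n" k] one by simp
  qed
  have sum: "P (\<Sum>\<nu>\<in>S. g \<nu>)" if "finite S" "\<And>\<nu>. \<nu> \<in> S \<Longrightarrow> P (g \<nu>)" for S and g :: "(nat \<Rightarrow> nat) \<Rightarrow> lfun"
    using that by (induction S rule: finite_induct) (simp_all add: zero add)
  obtain S where S: "finite S" "\<forall>\<nu> v. f \<nu> v \<noteq> 0 \<longrightarrow> \<nu> \<in> S" "\<forall>\<nu>\<in>S. mono_ok n (4 * n) ?w \<nu>"
    by (rule gdeg_finite[OF wgoodD(2)[OF wgood_C] f(1)])
  have ex: "f = (\<Sum>\<nu>\<in>S. lscale (f \<nu>) (lmono \<nu>))" by (rule lmono_expand) (use S in auto)
  have "P (\<Sum>\<nu>\<in>S. lscale (f \<nu>) (lmono \<nu>))"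
  proof (rule sum[OF S(1)])
    fix \<nu> assume "\<nu> \<in> S"
    then have ok: "mono_ok n (4 * n) ?w \<nu>" using S(3) by blast
    have l: "lmono \<nu> = mpart ?w (4 * n) (lvar n) n \<nu>"
      using mono_subst_lvar[OF ok] by (simp add: mono_subst_mpart)
    have "smooth_fun n ?V (f \<nu>)" using f(2) by (simp add: lsmooth_def)
    then have "P (lmult ?w (lscale (f \<nu>) lone) (mpart ?w (4 * n) (lvar n) n \<nu>))" by (intro mult base part) simp_all
    then show "P (lscale (f \<nu>) (lmono \<nu>))"
      by (simp add: l lmult_scale_left lmult_lone_left lok_mpart)
  qed
  then show ?thesis unfolding ex[symmetric] by (simp add: P_def)
qed

text \<open>Pullbacks commute with restriction, so the expression in a chart can be computed over
  the part of \<open>W\<close> in its domain, where the section is an \<open>ext\<close>.\<close>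

lemma is_psi_unique:
  assumes \<psi>: "is_psi M \<kappa> \<psi>" and \<phi>: "is_psi M \<kappa> \<phi>" and W: "openin T W" and f: "f \<in> sections C W"
  shows "pull \<psi> W f = pull \<phi> W f"
proof
  fix c
  have sec: "pull x W f \<in> sections C W" if x: "is_psi M \<kappa> x" for x
    using n_morphismD(1)[OF is_psi_morphism[OF x] W f] is_psi_preim[OF x W] by simp
  show "pull \<psi> W f c = pull \<phi> W f c"
  proof (cases "c \<in> A")
    case False
    then show ?thesis using sections_outside[OF good_C sec[OF \<psi>] False] sections_outside[OF good_C sec[OF \<phi>] False] by simp
  next
    case c: True
    let ?W = "W \<inter> fst c"
    have W': "openin T ?W" "?W \<subseteq> fst c" "?W \<subseteq> W" using W chart_open[OF c] by auto
    have e: "sec_restrict C ?W f = ext C ct c ?W (f c)" by (rule section_ext[OF good_C c W'(2,3) f])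
    have o: "ov c ?W = ov c W" by (auto simp: ov_def)
    note F = sectionsD[OF good_C f c, unfolded C_simps]
    have r: "pull x W f c = pull x ?W (ext C ct c ?W (f c)) c" if x: "is_psi M \<kappa> x" for x
    proof -
      have "pull x ?W (ext C ct c ?W (f c)) c = sec_restrict C ?W (pull x W f) c"
        using n_morphismD(5)[OF is_psi_morphism[OF x] W f W'(1,3)] is_psi_preim[OF x W'(1)] by (simp add: e)
      also have "\<dots> = lrestrict (ov c W) (pull x W f c)" by (simp add: sec_restrict_def cimage_ov[OF good_C] o)
      also have "\<dots> = pull x W f c" by (rule lrestrict_supp_in[OF sectionsD(2)[OF good_C sec[OF x] c]])
      finally show ?thesis by simp
    qed
    have "lsmooth n (ov c ?W) (f c)" using F(3) by (simp add: o)
    then show ?thesis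
      using is_psi_unique_chart[OF \<psi> \<phi> c W'(1,2) F(1)] by (simp add: r[OF \<psi>] r[OF \<phi>])
  qed
qed

subsection \<open>The inverse translation\<close>

text \<open>The shifts contain no \<open>p\<close> and are unaffected by a further translation, so
  composing translations adds the shifts.\<close>

lemma pull_yk_inverse:
  assumes k: "form3 \<kappa>" "form3 \<kappa>'" and inv: "\<And>c a. c \<in> A \<Longrightarrow> a < n \<Longrightarrow> kd \<kappa>' c a + kd \<kappa> c a = 0"
    and W: "openin T W" and f: "f \<in> sections C W"
  shows "pull (coord_morphism C C (yk \<kappa>')) W (pull (coord_morphism C C (yk \<kappa>)) W f) = f"
proof
  fix c
  show "pull (coord_morphism C C (yk \<kappa>')) W (pull (coord_morphism C C (yk \<kappa>)) W f) c = f c"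
  proof (cases "c \<in> A")
    case c: True
    let ?S = "\<lambda>\<kappa>. lsubst (wC n) n (4 * n) (yk \<kappa> c)"
    note F = sectionsD[OF good_C f c, unfolded C_simps]
    have b: "base_subst n (yk \<kappa>' c) v \<in> ov c W" if "v \<in> ov c W" for v using base_yk[OF c that] that by simp
    have y: "eqon (ov c W) (?S \<kappa>' (yk \<kappa> c i)) (lvar n i)" if i: "i < 4 * n" for i
    proof (cases "2 * n \<le> i \<and> i < 3 * n")
      case False
      then have "yk x c i = lvar n i" for x by (auto simp: yk_def)
      then show ?thesis using lsubst_yk_lvar[OF k(2) c i, of W] by simp
    next
      case True
      let ?a = "i - 2 * n"
      have a: "?a < n" using True by arith
      have "gdeg n (4 * n) (wC n) (lvar n i)" using True i by (intro hdeg_gdeg[OF hdeg_lvar]) auto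
      then have "?S \<kappa>' (yk \<kappa> c i) = ?S \<kappa>' (lvar n i) + ?S \<kappa>' (kd \<kappa> c ?a)"
        using True lsubst_add[OF wgoodD(2)[OF wgood_C] _ gdeg_low[OF kd_props(1)[OF k(1) c a]]] by (simp add: yk_def)
      moreover have "eqon (ov c W) (?S \<kappa>' (lvar n i) + ?S \<kappa>' (kd \<kappa> c ?a)) (yk \<kappa>' c i + kd \<kappa> c ?a)"
        by (intro eqon_add lsubst_yk_lvar[OF k(2) c i] lsubst_yk_low[OF c kd_props(1)[OF k(1) c a]])
      moreover have "yk \<kappa>' c i + kd \<kappa> c ?a = lvar n i"
        using True inv[OF c a] by (simp add: yk_def add.assoc)
      ultimately show ?thesis by simp
    qed
    have "eqon (ov c W) (?S \<kappa>' (lrestrict (ov c W) (?S \<kappa> (f c)))) (?S \<kappa>' (?S \<kappa> (f c)))"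
      by (rule lsubst_eqon_arg[OF b eqon_lrestrict])
    also have "?S \<kappa>' (?S \<kappa> (f c)) = lsubst (wC n) n (4 * n) (\<lambda>i. ?S \<kappa>' (yk \<kappa> c i)) (f c)"
      by (rule csub_comp[OF csub_yk[OF k(2) c] csub_yk[OF k(1) c] wgood_C wgood_C F(1)])
    also have "eqon (ov c W) \<dots> (lsubst (wC n) n (4 * n) (lvar n) (f c))"
    proof (rule lsubst_eqon_sub)
      show "eqon (ov c W) (?S \<kappa>' (yk \<kappa> c i)) (lvar n i)" if "i < 4 * n" for i by (rule y[OF that])
      show "eqon (ov c W) (?S \<kappa>' (yk \<kappa> c i)) (lvar n i)" if "i < n" for i by (rule y) (use that in simp)
    qed
    also have "eqon (ov c W) \<dots> (f c)"
      using lsubst_lvar_id[OF F(1) wgoodD(2,1)[OF wgood_C] order.refl] ov_zero[OF c] by (intro eqonI) blast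
    finally show ?thesis using c F(2) by (simp add: pull_yk eqon_lrestrict_eq lrestrict_supp_in)
  qed (simp add: pull_yk sections_outside[OF good_C f])
qed

lemma is_psi_diffeomorphism:
  assumes k: "form3 \<kappa>" and cl: "closed_form M \<kappa>" and \<psi>: "is_psi M \<kappa> \<psi>"
  shows "n_diffeomorphism C C \<psi>"
proof -
  define \<kappa>' where "\<kappa>' = (\<lambda>c. lscale (\<lambda>_. - 1) (\<kappa> c))"
  have k': "form3 \<kappa>'" unfolding \<kappa>'_def by (rule form3_uminus[OF k])
  let ?P = "coord_morphism C C (yk \<kappa>)" and ?R = "coord_morphism C C (yk \<kappa>')"
  have inv: "kd \<kappa>' c a + kd \<kappa> c a = 0" "kd \<kappa> c a + kd \<kappa>' c a = 0" if "c \<in> A" "a < n" for c a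
    unfolding kd_def \<kappa>'_def
    by (simp_all add: lpartial_scale) (simp_all add: lscale_def fun_eq_iff plus_fun_apply zero_fun_apply)
  \<comment> \<open>By uniqueness \<open>\<psi>\<close> acts as the explicit translation, so the
    translation for \<open>- \<kappa>\<close> inverts it too.\<close>
  have u: "pull \<psi> W f = pull ?P W f" if "openin T W" "f \<in> sections C W" for W f
    by (rule is_psi_unique[OF \<psi> is_psi_yk[OF k cl] that])
  have nR: "n_morphism C C ?R" by (rule coord_morphism_n_morphism[OF good_C compatible_yk[OF k']])
  have preR: "preim C ?R W = W" if "openin T W" for W by (rule preim_coord[OF that]) simp
  have baseR: "base ?R = (\<lambda>m. m)" by (simp add: coord_morphism_def)
  have "mor_eq C C (mor_comp C ?R \<psi>) mor_id"
    unfolding mor_eq_def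
  proof (intro conjI allI impI ballI)
    show "base (mor_comp C ?R \<psi>) m = base mor_id m" if "m \<in> topspace (space_of C)" for m
      using is_psi_base[OF \<psi>] that by (simp add: mor_comp_def mor_id_def baseR)
    fix W f assume "openin (space_of C) W" and f: "f \<in> sections C W"
    then have W: "openin T W" by simp
    have "pull ?R W f \<in> sections C W" using n_morphismD(1)[OF nR W f] preR[OF W] by simp
    then show "pull (mor_comp C ?R \<psi>) W f = pull mor_id W f"
      using pull_yk_inverse[OF k' k inv(2) W f] by (simp add: mor_comp_def mor_id_def preR[OF W] u[OF W])
  qed
  moreover have "mor_eq C C (mor_comp C \<psi> ?R) mor_id"
    unfolding mor_eq_def
  proof (intro conjI allI impI ballI)
    show "base (mor_comp C \<psi> ?R) m = base mor_id m" if "m \<in> topspace (space_of C)" for m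
      using is_psi_base[OF \<psi>] that by (simp add: mor_comp_def mor_id_def baseR)
    fix W f assume "openin (space_of C) W" and f: "f \<in> sections C W"
    then have W: "openin T W" by simp
    show "pull (mor_comp C \<psi> ?R) W f = pull mor_id W f"
      using pull_yk_inverse[OF k k' inv(1) W f] by (simp add: mor_comp_def mor_id_def is_psi_preim[OF \<psi> W] u[OF W f])
  qed
  ultimately show ?thesis
    using is_psi_morphism[OF \<psi>] nR unfolding n_diffeomorphism_def by blast
qed

end

theorem proposition2:
  fixes T :: "'m topology" and n :: nat and A :: "'m chart set" and \<kappa> :: "'m chart sec"
    and M :: "('m, 'm chart) nmfd"
  assumes "smooth_manifold T n A" and "M = manifold T n A"
    and "\<kappa> \<in> diff_forms M 3 0" and "closed_form M \<kappa>"
  shows "shift_form M \<kappa> \<in> diff_forms (T1 M) 1 2 \<and>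
    (\<exists>\<psi>. is_psi M \<kappa> \<psi>) \<and>
    (\<forall>\<psi>. is_psi M \<kappa> \<psi> \<longrightarrow>
       mor_eq (courant_mfd M) (courant_mfd M) \<psi> (translation 2 (T1 M) (shift_form M \<kappa>)) \<and>
       n_diffeomorphism (courant_mfd M) (courant_mfd M) \<psi>)"
proof -
  interpret smooth_mfd T n A by unfold_locales (rule assms(1))
  have k: "form3 \<kappa>" using assms(2,3) by (intro form3_diff_forms) simp
  have cl: "closed_form (manifold T n A) \<kappa>" using assms(2,4) by simp
  have "mor_eq C C \<psi> (translation 2 (T1 (manifold T n A)) (shift_form (manifold T n A) \<kappa>))"
    if \<psi>: "is_psi (manifold T n A) \<kappa> \<psi>" for \<psi>
    unfolding translation_eq[OF k] mor_eq_def
    using is_psi_base[OF \<psi>] is_psi_unique[OF \<psi> is_psi_yk[OF k cl]]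
    \<comment> \<open>Only the \<open>base\<close> component is unfolded, so that the pullback keeps
      the form in which \<open>is_psi_unique\<close> states it.\<close>
    by (simp add: coord_morphism_def[of _ _ "yk \<kappa>", THEN arg_cong[of _ _ base]])
  then show ?thesis
    unfolding assms(2) using shift_form_diff_forms[OF k] is_psi_yk[OF k cl] is_psi_diffeomorphism[OF k cl] by blast
qed

end
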